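(* Let $k$ be a nonzero integer and let $b:\mathbb R\to\mathbb R$ satisfy: (i) there is $0<c_m<1$ with $c_m\le b'(y)\le c_m^{-1}$ for all $y\in\mathbb R$; (ii) $b''\in H^4(\mathbb R)$; (iii) the Rayleigh operator $\mathcal R_{b,k}$ has a single embedded eigenvalue and has no other eigenvalues. If, in addition, the embedded eigenvalue is a multiple eigenvalue, then there exist $\omega_{\rm in}\in L^\infty(\mathbb R)\cap L^2(\mathbb R)$ and $C>0$ such that the solution $\omega(t,y)$ of $$\partial_t\omega(t,y)+ik\,\mathcal R_{b,k}\omega(t,y)=0,\qquad \omega(0,y)=\omega_{\rm in}(y),$$ satisfies $$\|\omega(t,\cdot)\|_{L^\infty(\mathbb R)}\ge Ct,\qquad \|\omega(t,\cdot)\|_{L^2(\mathbb R)}\ge Ct,\qquad \text{for all } t\ge 0.$$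
   Context: The Rayleigh operator is $\mathcal R_{b,k}\omega=b\,\omega-b''\,(\partial_y^2-k^2)^{-1}\omega$, acting on complex-valued functions on $\mathbb R$ (in $L^2(\mathbb R)$, where $(\partial_y^2-k^2)^{-1}\omega$ denotes the solution $\psi\in H^2(\mathbb R)$ of $\psi''-k^2\psi=\omega$). Its continuous spectrum is $\mathrm{Ran}\,b=\mathbb R$. A number $c\in\mathbb C$ is an eigenvalue if $\mathcal R_{b,k}\omega=c\,\omega$ for some nonzero $\omega\in L^2(\mathbb R)$, equivalently if $(b-c)(\psi''-k^2\psi)-b''\psi=0$ for some nonzero $\psi\in H^2(\mathbb R)$; an eigenvalue $c\in\mathbb R$ is called an embedded eigenvalue. The solution of the evolution equation is $\omega(t)=e^{-ikt\mathcal R_{b,k}}\omega_{\rm in}$. Multiplicity. For $c_r\in\mathbb R$ put $y_c=b^{-1}(c_r)$ and let $\phi_1(y,c_r)$ be the real solution of $\partial_y\big((b(y)-c_r)^2\phi_1'\big)=k^2(b(y)-c_r)^2\phi_1$ with $\phi_1(y_c,c_r)=1$, $\phi_1'(y_c,c_r)=0$. Define $$\mathcal J_1(c_r)=\frac{1}{b'(y_c)}\,\mathrm{P.V.}\!\int_{\mathbb R}\frac{b'(y_c)-b'(y)}{(b(y)-c_r)^2}\,dy+\int_{\mathbb R}\frac{1}{(b(y)-c_r)^2}\Big(\frac{1}{\phi_1(y,c_r)^2}-1\Big)dy,\qquad \mathcal J_2(c_r)=\pi\,\frac{b''(y_c)}{b'(y_c)^3}.$$ The functions $\mathcal J_1(c_r)\mp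 i\mathcal J_2(c_r)$ are the boundary values on the real line (from $\pm\mathrm{Im}\,c>0$) of the Wronskian; a real number $c_*$ is an embedded eigenvalue if and only if $\mathcal J_1(c_* )=\mathcal J_2(c_* )=0$. The algebraic multiplicity of $c_*$ is the order of the zero of this Wronskian at $c_*$, and $c_*$ is a multiple eigenvalue if its algebraic multiplicity is greater than $1$, i.e. $\mathcal J_1(c_* )=\mathcal J_2(c_* )=\partial_{c_r}\mathcal J_1(c_* )=\partial_{c_r}\mathcal J_2(c_* )=0$. *)

theory Defs
  imports "HOL-Analysis.Analysis" "HOL-Probability.Essential_Supremum"
begin

text \<open>
  Elements of the spaces \<open>L\<^sup>2\<close>, \<open>L\<^sup>\<infinity>\<close>, \<open>H\<^sup>n\<close> over the real line are represented by functions, and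
  equality of classes by equality almost everywhere.
\<close>

definition L2 :: "(real \<Rightarrow> 'a::euclidean_space) \<Rightarrow> bool" where
  "L2 f \<longleftrightarrow> f \<in> borel_measurable lborel \<and> integrable lborel (\<lambda>y. (norm (f y))\<^sup>2)"

definition L2_norm :: "(real \<Rightarrow> 'a::euclidean_space) \<Rightarrow> real" where
  "L2_norm f = sqrt (LINT y|lborel. (norm (f y))\<^sup>2)"

definition Linf_norm :: "(real \<Rightarrow> 'a::euclidean_space) \<Rightarrow> ereal" where
  "Linf_norm f = esssup lborel (\<lambda>y. ereal (norm (f y)))"

definition Linf :: "(real \<Rightarrow> 'a::euclidean_space) \<Rightarrow> bool" where
  "Linf f \<longleftrightarrow> f \<in> borel_measurable lborel \<and> Linf_norm f < \<infinity>"

text \<open>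
  Sobolev spaces on the line, following Brezis (Functional Analysis, Sobolev Spaces and Partial
  Differential Equations, Chapter 8): \<open>g\<close> is the weak derivative of \<open>f\<close> when integration by parts
  holds against all compactly supported \<open>C\<^sup>1\<close> functions, and \<open>H\<^sup>n\<^sup>+\<^sup>1\<close> consists of the \<open>L\<^sup>2\<close> functions
  that have a weak derivative in \<open>H\<^sup>n\<close>.
\<close>

definition test_function :: "(real \<Rightarrow> real) \<Rightarrow> bool" where
  "test_function \<phi> \<longleftrightarrow> \<phi> C1_differentiable_on UNIV \<and> compact (closure {y. \<phi> y \<noteq> 0})"

definition L2_weak_deriv :: "(real \<Rightarrow> 'a::euclidean_space) \<Rightarrow> (real \<Rightarrow> 'a) \<Rightarrow> bool" where
  "L2_weak_deriv f g \<longleftrightarrow> L2 f \<and> L2 g \<and>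
     (\<forall>\<phi>. test_function \<phi> \<longrightarrow>
        (LINT y|lborel. deriv \<phi> y *\<^sub>R f y) = - (LINT y|lborel. \<phi> y *\<^sub>R g y))"

primrec Sobolev_H :: "nat \<Rightarrow> (real \<Rightarrow> 'a::euclidean_space) \<Rightarrow> bool" where
  "Sobolev_H 0 f \<longleftrightarrow> L2 f"
| "Sobolev_H (Suc n) f \<longleftrightarrow> (\<exists>g. L2_weak_deriv f g \<and> Sobolev_H n g)"

text \<open>\<open>\<psi> = (\<partial>\<^sub>y\<^sup>2 - k\<^sup>2)\<^sup>-\<^sup>1 \<omega>\<close>; for \<open>k \<noteq> 0\<close> such a \<open>\<psi>\<close> is unique up to null sets.\<close>

definition helmholtz_inverse :: "int \<Rightarrow> (real \<Rightarrow> complex) \<Rightarrow> (real \<Rightarrow> complex) \<Rightarrow> bool" where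
  "helmholtz_inverse k \<omega> \<psi> \<longleftrightarrow> Sobolev_H 2 \<psi> \<and>
     (\<exists>\<psi>1 \<psi>2. L2_weak_deriv \<psi> \<psi>1 \<and> L2_weak_deriv \<psi>1 \<psi>2 \<and>
        (AE y in lborel. \<psi>2 y - (of_int k)\<^sup>2 * \<psi> y = \<omega> y))"

text \<open>
  The graph of the Rayleigh operator. As \<open>b\<close> is unbounded, so is the operator; its domain in \<open>L\<^sup>2\<close>
  consists of the \<open>\<omega>\<close> for which \<open>b \<omega> - b'' \<psi>\<close> lies in \<open>L\<^sup>2\<close>.
\<close>

definition rayleigh :: "(real \<Rightarrow> real) \<Rightarrow> int \<Rightarrow> (real \<Rightarrow> complex) \<Rightarrow> (real \<Rightarrow> complex) \<Rightarrow> bool" where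
  "rayleigh b k \<omega> \<eta> \<longleftrightarrow> L2 \<omega> \<and> L2 \<eta> \<and>
     (\<exists>\<psi>. helmholtz_inverse k \<omega> \<psi> \<and>
        (AE y in lborel. \<eta> y = of_real (b y) * \<omega> y - of_real (deriv (deriv b) y) * \<psi> y))"

definition rayleigh_eigenvalue :: "(real \<Rightarrow> real) \<Rightarrow> int \<Rightarrow> complex \<Rightarrow> bool" where
  "rayleigh_eigenvalue b k c \<longleftrightarrow>
     (\<exists>\<omega>. L2 \<omega> \<and> \<not> (AE y in lborel. \<omega> y = 0) \<and> rayleigh b k \<omega> (\<lambda>y. c * \<omega> y))"

definition pv_integral :: "real \<Rightarrow> (real \<Rightarrow> real) \<Rightarrow> real" where
  "pv_integral a f = Lim (at_right 0) (\<lambda>\<epsilon>. LINT y:{y. \<epsilon> < \<bar>y - a\<bar>}|lborel. f y)"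

definition is_phi1 :: "(real \<Rightarrow> real) \<Rightarrow> int \<Rightarrow> real \<Rightarrow> (real \<Rightarrow> real) \<Rightarrow> bool" where
  "is_phi1 b k c \<phi> \<longleftrightarrow>
     (\<exists>\<phi>'. (\<forall>y. (\<phi> has_real_derivative \<phi>' y) (at y)) \<and>
        (\<forall>y. ((\<lambda>z. (b z - c)\<^sup>2 * \<phi>' z) has_real_derivative (of_int k)\<^sup>2 * (b y - c)\<^sup>2 * \<phi> y) (at y)) \<and>
        \<phi> (inv b c) = 1 \<and> \<phi>' (inv b c) = 0)"

text \<open>
  The equation is singular at \<open>y\<^sub>c = inv b c\<close>, but it is equivalent to the Volterra equation obtained
  by integrating from \<open>y\<^sub>c\<close>, so the solution is unique.
\<close>

definition phi1 :: "(real \<Rightarrow> real) \<Rightarrow> int \<Rightarrow> real \<Rightarrow> real \<Rightarrow> real" where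
  "phi1 b k c = (THE \<phi>. is_phi1 b k c \<phi>)"

definition J1 :: "(real \<Rightarrow> real) \<Rightarrow> int \<Rightarrow> real \<Rightarrow> real" where
  "J1 b k c = (let yc = inv b c in
     1 / deriv b yc * pv_integral yc (\<lambda>y. (deriv b yc - deriv b y) / (b y - c)\<^sup>2) +
     (LINT y|lborel. 1 / (b y - c)\<^sup>2 * (1 / (phi1 b k c y)\<^sup>2 - 1)))"

definition J2 :: "(real \<Rightarrow> real) \<Rightarrow> real \<Rightarrow> real" where
  "J2 b c = (let yc = inv b c in pi * deriv (deriv b) yc / (deriv b yc) ^ 3)"

text \<open>The boundary values \<open>J\<^sub>1 \<minusplus> i J\<^sub>2\<close> of the Wronskian have a zero of order greater than one.\<close>

definition multiple_embedded_eigenvalue :: "(real \<Rightarrow> real) \<Rightarrow> int \<Rightarrow> real \<Rightarrow> bool" where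
  "multiple_embedded_eigenvalue b k c \<longleftrightarrow>
     rayleigh_eigenvalue b k (of_real c) \<and>
     J1 b k c = 0 \<and> J2 b c = 0 \<and>
     (J1 b k has_real_derivative 0) (at c) \<and> (J2 b has_real_derivative 0) (at c)"

definition L2_continuous :: "(real \<Rightarrow> real \<Rightarrow> complex) \<Rightarrow> bool" where
  "L2_continuous u \<longleftrightarrow> (\<forall>t\<ge>0. L2 (u t)) \<and>
     (\<forall>t\<ge>0. ((\<lambda>s. L2_norm (\<lambda>y. u s y - u t y)) \<longlongrightarrow> 0) (at t within {0..}))"

definition L2_has_time_derivative ::
    "(real \<Rightarrow> real \<Rightarrow> complex) \<Rightarrow> (real \<Rightarrow> real \<Rightarrow> complex) \<Rightarrow> bool" where
  "L2_has_time_derivative U u \<longleftrightarrow> (\<forall>t\<ge>0. L2 (U t)) \<and> (\<forall>t\<ge>0. L2 (u t)) \<and>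
     (\<forall>t\<ge>0. ((\<lambda>s. L2_norm (\<lambda>y. (U s y - U t y) / of_real (s - t) - u t y)) \<longlongrightarrow> 0)
        (at t within {0..}))"

text \<open>
  The solution \<open>\<omega>(t) = exp (- i k t R) \<omega>\<^sub>i\<^sub>n\<close> of \<open>\<partial>\<^sub>t\<omega> + i k R \<omega> = 0\<close> for arbitrary \<open>L\<^sup>2\<close> data, which need
  not lie in the domain of the unbounded operator \<open>R\<close>. The orbits of the semigroup are the mild
  solutions: \<open>\<omega>\<close> is continuous with values in \<open>L\<^sup>2\<close>, its integral \<open>W(t)\<close> over \<open>[0, t]\<close> lies in the domain
  of \<open>R\<close>, and \<open>\<omega>(t) = \<omega>\<^sub>i\<^sub>n - i k R W(t)\<close>. The \<open>L\<^sup>2\<close>-valued integral is expressed as the antiderivative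
  of \<open>\<omega>\<close> that vanishes at time 0.
\<close>

definition rayleigh_solution ::
    "(real \<Rightarrow> real) \<Rightarrow> int \<Rightarrow> (real \<Rightarrow> complex) \<Rightarrow> (real \<Rightarrow> real \<Rightarrow> complex) \<Rightarrow> bool" where
  "rayleigh_solution b k \<omega>in \<omega> \<longleftrightarrow> L2_continuous \<omega> \<and>
     (\<exists>W. (AE y in lborel. W 0 y = 0) \<and> L2_has_time_derivative W \<omega> \<and>
        (\<forall>t\<ge>0. \<exists>\<eta>. rayleigh b k (W t) \<eta> \<and>
           (AE y in lborel. \<omega> t y = \<omega>in y - \<i> * of_int k * \<eta> y)))"

end

theory Submission
  imports Defs "HOL-Probability.Sinc_Integral" "HOL-Real_Asymp.Real_Asymp"
begin

text \<open>
  Write \<open>c\<^sub>*\<close> for the embedded eigenvalue, \<open>y\<^sub>*\<close> for its critical point, \<open>\<omega>\<^sub>0\<close> for a real eigenfunction and \<open>\<psi>\<close> for its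
  stream function. If \<open>(R - c\<^sub>*) \<omega>\<^sub>1 = \<omega>\<^sub>0\<close> has a real solution \<open>\<omega>\<^sub>1\<close>, then
  \<open>exp (- i k c\<^sub>* t) (\<omega>\<^sub>1 - i k t \<omega>\<^sub>0)\<close> solves the evolution equation and dominates \<open>|k| t |\<omega>\<^sub>0|\<close> pointwise; an energy
  estimate shows that it is the only mild solution with data \<open>\<omega>\<^sub>1\<close>.

  Since \<open>J\<^sub>2\<close> vanishes to second order, \<open>b'' = r (b - c\<^sub>*)\<^sup>2\<close> with a bounded, locally Lipschitz \<open>r\<close>. So the equation for \<open>\<omega>\<^sub>1\<close>
  amounts to \<open>\<psi>\<^sub>1'' - (k\<^sup>2 + r (b - c\<^sub>*)) \<psi>\<^sub>1 = r \<psi>\<close>, which reduction of order solves (\<open>\<psi>\<close> has no zeros and decays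
  exponentially) as soon as \<open>H = \<integral> r \<psi>\<^sup>2 = 0\<close>.

  To see that \<open>H = 0\<close>, no differentiation of \<open>\<phi>\<^sub>1\<close> in \<open>c\<close> is needed: \<open>J\<^sub>1(c)\<close> is an extremal value of a quadratic form at speed \<open>c\<close>,
  and the fixed trial function \<open>\<psi>\<close> gives \<open>0 \<le> (c - c\<^sub>*) H + O((c - c\<^sub>*)\<^sup>2) + const J\<^sub>1(c)\<close> by Picone's identity. As
  \<open>J\<^sub>1(c) = o(c - c\<^sub>*)\<close>, dividing by \<open>c - c\<^sub>*\<close> from both sides yields \<open>H = 0\<close>.
\<close>

section \<open>Weak derivatives on the line\<close>

text \<open>The obstacle is a singularity that moves with the speed. At speed \<open>b a\<close> the
  comparison solution in Picone's identity is \<open>(b - b a) * \<phi>\<close>. As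
  \<open>\<phi> \<ge> 1\<close>, it vanishes only at \<open>a\<close>, but this zero is a pole of
  the identity, and \<open>J1\<close> itself is only a principal value. Two cancellations remove the
  pole. Adding the constant \<open>b' a * \<psi> a\<close> to the Wronskian of \<open>\<psi>\<close>
  and the comparison solution makes it vanish at \<open>a\<close>; the square of this constant is
  the factor in front of \<open>J1\<close>. The boundary term then has the same limit on both sides
  of \<open>a\<close> and drops out of symmetric truncations. The quadratic error contains a
  principal value with density \<open>r \<psi>\<^sup>2\<close>, to be bounded uniformly for speeds
  near the eigenvalue. This is why \<open>r\<close> has to be Lipschitz near the critical point,
  which uses three classical derivatives of \<open>b''\<close>. A second difficulty is that the
  eigenfunction and the derivatives of \<open>b''\<close> are given only weakly, up to null sets,
  whereas Picone's identity and uniqueness for the differential equation are classical. Hence the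
  preparation on continuous representatives.\<close>

lemma ex_primitive:
  fixes h :: "real \<Rightarrow> real"
  assumes "continuous_on UNIV h"
  obtains H where "\<And>y. (H has_real_derivative h y) (at y)" "H a = 0"
proof -
  have "\<exists>F. \<forall>x::real. (-\<infinity>::ereal) < ereal x \<longrightarrow> ereal x < \<infinity> \<longrightarrow> (F has_vector_derivative h x) (at x)"
    using assms by (intro einterval_antiderivative) (auto simp: continuous_on_eq_continuous_at)
  then obtain F where F: "\<And>x. (F has_real_derivative h x) (at x)"
    by (auto simp: has_real_derivative_iff_has_vector_derivative)
  show thesis
    by (rule that[of "\<lambda>y. F y - F a"]) (auto intro!: derivative_eq_intros F)
qed

lemma integrable_bdd_interval:
  fixes f :: "real \<Rightarrow> 'a::euclidean_space"
  assumes "L2 f"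
  shows "set_integrable lborel {a..b} f"
  unfolding set_integrable_def
proof (rule Bochner_Integration.integrable_bound)
  show "integrable lborel (\<lambda>y. indicator {a..b} y + (norm (f y))\<^sup>2)"
    using assms by (intro Bochner_Integration.integrable_add) (auto simp: L2_def integrable_indicator_iff emeasure_lborel_Icc_eq)
  show "(\<lambda>x. indicat_real {a..b} x *\<^sub>R f x) \<in> borel_measurable lborel"
    using assms by (auto simp: L2_def)
  have "norm (f x) \<le> 1 + (norm (f x))\<^sup>2" for x
    using zero_le_power2[of "norm (f x) - 1"] norm_ge_zero[of "f x"]
    by (simp add: power2_eq_square algebra_simps del: norm_ge_zero)
  then show "AE x in lborel. norm (indicat_real {a..b} x *\<^sub>R f x) \<le> norm (indicat_real {a..b} x + (norm (f x))\<^sup>2)"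
    by (auto simp: indicator_def)
qed

lemma L2_mult_integrable:
  fixes f g :: "real \<Rightarrow> real"
  assumes "L2 f" "L2 g"
  shows "integrable lborel (\<lambda>y. f y * g y)"
proof (rule Bochner_Integration.integrable_bound)
  show "integrable lborel (\<lambda>y. (norm (f y))\<^sup>2 + (norm (g y))\<^sup>2)"
    using assms by (auto simp: L2_def)
  show "(\<lambda>y. f y * g y) \<in> borel_measurable lborel"
    using assms by (auto simp: L2_def)
  have "\<bar>f y * g y\<bar> \<le> (f y)\<^sup>2 + (g y)\<^sup>2" for y
  proof -
    have "2 * (\<bar>f y\<bar> * \<bar>g y\<bar>) \<le> \<bar>f y\<bar>\<^sup>2 + \<bar>g y\<bar>\<^sup>2"
      using zero_le_power2[of "\<bar>f y\<bar> - \<bar>g y\<bar>"] by (simp add: power2_eq_square algebra_simps)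
    moreover have "0 \<le> \<bar>f y\<bar> * \<bar>g y\<bar>" by simp
    ultimately show ?thesis unfolding abs_mult power2_abs by linarith
  qed
  then show "AE x in lborel. norm (f x * g x) \<le> norm ((norm (f x))\<^sup>2 + (norm (g x))\<^sup>2)"
    by simp
qed

text \<open>Closed intervals are an intersection-stable generator of the Borel sets, so vanishing
  integrals pass to all Borel sets by a Dynkin-system induction. As \<open>h\<close> is only locally
  integrable, this is done for its restriction to each \<open>[-N, N]\<close>, and the countably
  many null sets are united.\<close>

lemma AE_zero_if_Icc:
  fixes h :: "real \<Rightarrow> real"
  assumes int: "\<And>a b. set_integrable lborel {a..b} h"
    and zero: "\<And>a b. a \<le> b \<Longrightarrow> (LBINT y:{a..b}. h y) = 0"
  shows "AE y in lborel. h y = 0"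
proof -
  have "AE y in lborel. y \<in> {-real N..real N} \<longrightarrow> h y = 0" for N
  proof -
    let ?f = "\<lambda>y. indicator {-real N..real N} y * h y"
    have f: "integrable lborel ?f"
      using int[of "-real N" "real N"] by (simp add: set_integrable_def)
    have fI: "set_integrable lborel A ?f" if "A \<in> sets borel" for A
      using that integrable_mult_indicator[OF _ f, of A] by (simp add: set_integrable_def)
    have I: "Int_stable (range (\<lambda>(a, b). {a..b::real}))"
      by (auto simp: Int_stable_def image_iff Int_atLeastAtMost)
    have g: "sets lborel = sigma_sets UNIV (range (\<lambda>(a, b). {a..b::real}))"
      by (simp add: borel_eq_atLeastAtMost)
    have gp: "range (\<lambda>(a, b). {a..b::real}) \<subseteq> Pow UNIV" by auto
    have "(LBINT y:A. ?f y) = 0" if "A \<in> sets lborel" for A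
      using that unfolding g
    proof (induction rule: sigma_sets_induct_disjoint[OF I gp, consumes 1, case_names basic empty compl union])
      case (basic A)
      then obtain a b where A: "A = {a..b}" by auto
      have "(LBINT y:A. ?f y) = (LBINT y:{max a (-real N)..min b (real N)}. h y)"
        unfolding set_lebesgue_integral_def A
        by (intro Bochner_Integration.integral_cong) (auto simp: indicator_def)
      then show ?case using zero[of "max a (-real N)" "min b (real N)"]
        by (cases "max a (-real N) \<le> min b (real N)") (auto simp: set_lebesgue_integral_def)
    next
      case empty show ?case by (simp add: set_lebesgue_integral_def)
    next
      case (compl A)
      then have A: "A \<in> sets borel" by (simp flip: g)
      have "(LBINT y:UNIV. ?f y) = (LBINT y:A. ?f y) + (LBINT y:UNIV - A. ?f y)"
        using A by (subst set_integral_Un[symmetric]) (auto intro!: fI)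
      moreover have "(LBINT y:UNIV. ?f y) = (LBINT y:{-real N..real N}. h y)"
        by (simp add: set_lebesgue_integral_def)
      ultimately show ?case using compl zero[of "-real N" "real N"] by simp
    next
      case (union A)
      then have A: "range A \<subseteq> sets borel" by (simp flip: g)
      have "(LBINT y:(\<Union>i. A i). ?f y) = (\<Sum>i. (LBINT y:A i. ?f y))"
        using A union by (intro lebesgue_integral_countable_add fI)
          (auto simp: disjoint_family_on_def)
      then show ?case using union by simp
    qed
    then have "AE y in lborel. ?f y = 0"
      using density_unique_real[of lborel ?f "\<lambda>_. 0"] f by (simp add: set_lebesgue_integral_def)
    then show ?thesis by eventually_elim (auto simp: indicator_def)
  qed
  then have "AE y in lborel. \<forall>N. y \<in> {-real N..real N} \<longrightarrow> h y = 0"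
    unfolding AE_all_countable by blast
  then show ?thesis
  proof eventually_elim
    case (elim y)
    obtain N where "\<bar>y\<bar> \<le> real N" using real_arch_simple by blast
    then show ?case using elim by (auto simp: abs_le_iff dest: spec[of _ N])
  qed
qed

text \<open>The primitive of an integrable \<open>g\<close> need not be differentiable everywhere,
  so the product rule is replaced by Fubini's theorem on the triangle
  \<open>a \<le> y \<le> x \<le> b\<close>.\<close>

lemma primitive_by_parts:
  fixes \<phi> \<phi>' g :: "real \<Rightarrow> real"
  assumes ab: "a \<le> b"
    and \<phi>: "\<And>y. (\<phi> has_real_derivative \<phi>' y) (at y)" "continuous_on UNIV \<phi>'" "\<phi> b = 0"
    and g: "set_integrable lborel {a..b} g"
  shows "(LBINT x:{a..b}. \<phi>' x * (LBINT y:{a..x}. g y)) = - (LBINT y:{a..b}. \<phi> y * g y)"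
proof -
  let ?u = "\<lambda>x. indicator {a..b} x * \<phi>' x" and ?v = "\<lambda>y. indicator {a..b} y * g y"
  let ?f = "\<lambda>x y. ?u x * ?v y * indicator {..x} y"
  have u: "integrable lborel ?u" using borel_integrable_atLeastAtMost'[of a b \<phi>'] \<phi>(2)
    by (auto simp: set_integrable_def intro: continuous_on_subset)
  have v: "integrable lborel ?v" using g by (simp add: set_integrable_def)
  have um[measurable]: "\<phi>' \<in> borel_measurable borel" using \<phi>(2) by (simp add: borel_measurable_continuous_onI)
  have vm[measurable]: "?v \<in> borel_measurable borel" using v by auto
  have uv: "integrable (lborel \<Otimes>\<^sub>M lborel) (\<lambda>(x, y). ?u x * ?v y)"
    using u v integrable_abs[OF u]
    by (intro lborel_pair.Fubini_integrable) (auto simp: abs_mult)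
  have i: "integrable (lborel \<Otimes>\<^sub>M lborel) (\<lambda>(x, y). ?f x y)"
  proof (rule Bochner_Integration.integrable_bound[OF uv])
    have "(\<lambda>(x, y). ?f x y) = (\<lambda>p. ?u (fst p) * ?v (snd p) * (if snd p \<le> fst p then 1 else 0))"
      by (auto simp: indicator_def)
    also have "\<dots> \<in> borel_measurable (lborel \<Otimes>\<^sub>M lborel)" by measurable
    finally show "(\<lambda>(x, y). ?f x y) \<in> borel_measurable (lborel \<Otimes>\<^sub>M lborel)" .
  qed (auto simp: indicator_def)
  have "(LBINT y. LBINT x. ?f x y) = (LBINT x. LBINT y. ?f x y)"
    by (rule lborel_pair.Fubini_integral[OF i])
  also have "(\<lambda>x. LBINT y. ?f x y) = (\<lambda>x. indicator {a..b} x * (\<phi>' x * (LBINT y:{a..x}. g y)))"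
  proof
    fix x
    have "(LBINT y. ?f x y) = ?u x * (LBINT y. ?v y * indicator {..x} y)"
      by (simp add: mult.assoc)
    also have "\<dots> = ?u x * (LBINT y:{a..x}. g y)"
    proof (cases "x \<in> {a..b}")
      case True
      then have "(LBINT y. ?v y * indicator {..x} y) = (LBINT y:{a..x}. g y)"
        unfolding set_lebesgue_integral_def
        by (intro Bochner_Integration.integral_cong) (auto simp: indicator_def)
      then show ?thesis by simp
    qed auto
    finally show "(LBINT y. ?f x y) = indicator {a..b} x * (\<phi>' x * (LBINT y:{a..x}. g y))"
      by simp
  qed
  also have "(\<lambda>y. LBINT x. ?f x y) = (\<lambda>y. - (indicator {a..b} y * (\<phi> y * g y)))"
  proof
    fix y
    have "(LBINT x. ?f x y) = ?v y * (LBINT x. ?u x * indicator {..x} y)"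
      by (subst integral_mult_right_zero[symmetric], rule Bochner_Integration.integral_cong) auto
    also have "\<dots> = ?v y * (- \<phi> y)"
    proof (cases "y \<in> {a..b}")
      case True
      then have "(LBINT x. ?u x * indicator {..x} y) = (LBINT x. \<phi>' x * indicator {y..b} x)"
        by (intro Bochner_Integration.integral_cong) (auto simp: indicator_def)
      also have "\<dots> = \<phi> b - \<phi> y"
        using True \<phi> by (intro integral_FTC_Icc_real) (auto simp: continuous_on_eq_continuous_at)
      finally show ?thesis using \<phi> by simp
    qed auto
    finally show "(LBINT x. ?f x y) = - (indicator {a..b} y * (\<phi> y * g y))" by simp
  qed
  finally show ?thesis by (simp add: set_lebesgue_integral_def)
qed

lemma bump_tendsto_indicator:
  fixes a b :: real
  assumes "a \<le> b"
  shows "(\<lambda>n. max 0 (1 - real (Suc n) * (max 0 (a - y) + max 0 (y - b)))) \<longlonglongrightarrow> indicator {a..b} y"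
proof (cases "y \<in> {a..b}")
  case True
  then show ?thesis by simp
next
  case False
  define d where "d = max 0 (a - y) + max 0 (y - b)"
  have d: "d > 0" using False by (auto simp: d_def max_def)
  obtain N where N: "1 / d < real N" using reals_Archimedean2 by blast
  have "max 0 (1 - real (Suc n) * d) = 0" if "n \<ge> N" for n
  proof -
    have "1 / d < real (Suc n)" using N that by linarith
    then have "1 < real (Suc n) * d" using d by (simp add: field_simps)
    then show ?thesis by simp
  qed
  then have "eventually (\<lambda>n. max 0 (1 - real (Suc n) * d) = 0) sequentially"
    using eventually_sequentially by blast
  then show ?thesis using False unfolding d_def
    by (simp add: tendsto_eventually)
qed

text \<open>Subtracting a multiple of one fixed hat function turns any continuous function of
  compact support into one of mean zero, so \<open>h\<close> integrates against all of them as a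
  constant \<open>C\<close> does. Trapezoids shrinking to an interval then show that
  \<open>h - C\<close> has integral zero over every interval.\<close>

lemma du_Bois_Reymond:
  fixes h :: "real \<Rightarrow> real"
  assumes int: "\<And>a b. set_integrable lborel {a..b} h"
    and orth: "\<And>a b \<theta>. a \<le> b \<Longrightarrow> continuous_on UNIV \<theta> \<Longrightarrow> (\<And>y. y \<notin> {a..b} \<Longrightarrow> \<theta> y = 0) \<Longrightarrow>
       (LBINT y:{a..b}. \<theta> y) = 0 \<Longrightarrow> (LBINT y:{a..b}. \<theta> y * h y) = 0"
  shows "\<exists>C. AE y in lborel. h y = C"
proof -
  have intm: "set_integrable lborel {a..b} (\<lambda>y. \<theta> y * h y)" if "continuous_on UNIV \<theta>" for a b and \<theta> :: "real \<Rightarrow> real"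
  proof -
    obtain M where M: "\<And>y. y \<in> {a..b} \<Longrightarrow> norm (\<theta> y) \<le> M"
      using compact_continuous_image[OF continuous_on_subset[OF \<open>continuous_on UNIV \<theta>\<close>], of "{a..b}", THEN compact_imp_bounded]
      by (metis bounded_iff compact_Icc image_eqI subset_UNIV)
    have [measurable]: "\<theta> \<in> borel_measurable borel" using that by (simp add: borel_measurable_continuous_onI)
    have h: "integrable lborel (\<lambda>y. indicator {a..b} y * h y)"
      using int[of a b] by (simp add: set_integrable_def)
    then have [measurable]: "(\<lambda>y. indicator {a..b} y * h y) \<in> borel_measurable borel" by auto
    show ?thesis unfolding set_integrable_def
    proof (rule Bochner_Integration.integrable_bound)
      show "integrable lborel (\<lambda>y. M * (indicator {a..b} y * h y))" using h by simp
      have "(\<lambda>y. indicator {a..b} y *\<^sub>R (\<theta> y * h y)) = (\<lambda>y. \<theta> y * (indicator {a..b} y * h y))" by auto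
      then show "(\<lambda>y. indicator {a..b} y *\<^sub>R (\<theta> y * h y)) \<in> borel_measurable lborel" by simp
      show "AE y in lborel. norm (indicator {a..b} y *\<^sub>R (\<theta> y * h y)) \<le> norm (M * (indicator {a..b} y * h y))"
      proof (intro AE_I2)
        fix y show "norm (indicator {a..b} y *\<^sub>R (\<theta> y * h y)) \<le> norm (M * (indicator {a..b} y * h y))"
          using M[of y] by (auto simp: indicator_def abs_mult intro!: mult_right_mono)
      qed
    qed
  qed
  define \<theta>0 :: "real \<Rightarrow> real" where "\<theta>0 y = max 0 (1 - \<bar>y\<bar>)" for y
  have \<theta>0c: "continuous_on UNIV \<theta>0" unfolding \<theta>0_def by (intro continuous_intros)
  have \<theta>0i: "set_integrable lborel {a..b} \<theta>0" for a b
    using \<theta>0c by (intro borel_integrable_atLeastAtMost') (auto intro: continuous_on_subset)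
  define Z where "Z = (LBINT y:{-1..1}. \<theta>0 y)"
  have Z: "Z > 0"
  proof -
    have "(LBINT y:{-(1/2)..1/2::real}. 1/2) \<le> (LBINT y:{-(1/2)..1/2}. \<theta>0 y)"
    proof (intro set_integral_mono \<theta>0i)
      show "set_integrable lborel {-(1/2)..1/2::real} (\<lambda>y. 1/2::real)"
        by (intro borel_integrable_atLeastAtMost' continuous_intros)
    qed (auto simp: \<theta>0_def)
    also have "\<dots> \<le> Z" unfolding Z_def set_lebesgue_integral_def
    proof (rule integral_mono)
      show "integrable lborel (\<lambda>y. indicat_real {-(1/2)..1/2} y *\<^sub>R \<theta>0 y)" "integrable lborel (\<lambda>y. indicat_real {-1..1} y *\<^sub>R \<theta>0 y)"
        using \<theta>0i by (simp_all only: set_integrable_def)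
    qed (auto simp: \<theta>0_def indicator_def)
    finally show ?thesis by (simp add: set_lebesgue_integral_def)
  qed
  define C where "C = (LBINT y:{-1..1}. \<theta>0 y * h y) / Z"
  have ext: "(LBINT y:{-N..N}. \<theta> y * f y) = (LBINT y:{a..b}. \<theta> y * f y)"
    if "\<And>y. y \<notin> {a..b} \<Longrightarrow> \<theta> y = 0" "-N \<le> a" "b \<le> N" for a b N and \<theta> f :: "real \<Rightarrow> real"
    unfolding set_lebesgue_integral_def using that
    by (intro Bochner_Integration.integral_cong) (force simp: indicator_def)+
  have main: "(LBINT y:{a..b}. \<theta> y * h y) = C * (LBINT y:{a..b}. \<theta> y)"
    if ab: "a \<le> b" and c: "continuous_on UNIV \<theta>" and s: "\<And>y. y \<notin> {a..b} \<Longrightarrow> \<theta> y = 0" for a b \<theta>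
  proof -
    \<comment> \<open>Both \<open>\<theta>\<close> and the hat are supported in
      \<open>[-N, N]\<close>, so \<open>orth\<close> can be applied to their combination on one
      common interval.\<close>
    define N where "N = max 1 (max (-a) b)"
    have N: "-N \<le> a" "b \<le> N" "1 \<le> N" by (auto simp: N_def)
    have ci: "set_integrable lborel {-N..N} \<theta>" using c
      by (intro borel_integrable_atLeastAtMost') (auto intro: continuous_on_subset)
    define s where "s = (LBINT y:{-N..N}. \<theta> y) / Z"
    have t0: "\<And>y. y \<notin> {-1..1} \<Longrightarrow> \<theta>0 y = 0" by (auto simp: \<theta>0_def)
    have z: "(LBINT y:{-N..N}. \<theta>0 y) = Z"
      using ext[of "-1" 1 \<theta>0 N "\<lambda>_. 1"] t0 N by (simp add: Z_def)
    have "(LBINT y:{-N..N}. (\<theta> y - s * \<theta>0 y) * h y) = 0"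
    proof (rule orth)
      show "continuous_on UNIV (\<lambda>y. \<theta> y - s * \<theta>0 y)" using c \<theta>0c by (intro continuous_intros)
      show "\<theta> y - s * \<theta>0 y = 0" if "y \<notin> {-N..N}" for y
        using that s N by (auto simp: \<theta>0_def)
      show "(LBINT y:{-N..N}. \<theta> y - s * \<theta>0 y) = 0"
        using ci \<theta>0i z Z by (subst set_integral_diff(2)) (auto simp: s_def)
    qed (use N in auto)
    moreover have "(LBINT y:{-N..N}. (\<theta> y - s * \<theta>0 y) * h y) = (LBINT y:{-N..N}. \<theta> y * h y) - (LBINT y:{-N..N}. s * (\<theta>0 y * h y))"
      using intm[OF c] intm[OF \<theta>0c] by (subst set_integral_diff(2)[symmetric]) (auto simp: algebra_simps)
    ultimately have "(LBINT y:{-N..N}. \<theta> y * h y) = s * (LBINT y:{-N..N}. \<theta>0 y * h y)" by simp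
    then show ?thesis
      using ext[of a b \<theta> N h] ext[of a b \<theta> N "\<lambda>_. 1"] ext[of "-1" 1 \<theta>0 N h] t0 that(3) N Z
      by (simp add: C_def s_def mult.commute)
  qed
  have "AE y in lborel. h y - C = 0"
  proof (rule AE_zero_if_Icc)
    show "set_integrable lborel {a..b} (\<lambda>y. h y - C)" for a b
      using int[of a b] by (intro set_integral_diff) (auto intro!: borel_integrable_atLeastAtMost')
    show "(LBINT y:{a..b}. h y - C) = 0" if ab: "a \<le> b" for a b
    proof -
      define \<theta> where "\<theta> n y = max 0 (1 - real (Suc n) * (max 0 (a - y) + max 0 (y - b)))" for n y
      have c: "continuous_on UNIV (\<theta> n)" for n unfolding \<theta>_def by (intro continuous_intros)
      have s: "\<theta> n y = 0" if "y \<notin> {a-1..b+1}" for n y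
      proof -
        have "1 \<le> max 0 (a - y) + max 0 (y - b)" using that by (auto simp: max_def)
        then have "1 * 1 \<le> real (Suc n) * (max 0 (a - y) + max 0 (y - b))" by (intro mult_mono) auto
        then show ?thesis by (simp add: \<theta>_def)
      qed
      have b: "0 \<le> \<theta> n y" "\<theta> n y \<le> 1" for n y by (auto simp: \<theta>_def)
      have lim: "(\<lambda>n. LBINT y:{a-1..b+1}. \<theta> n y * f y) \<longlonglongrightarrow> (LBINT y:{a..b}. f y)"
        if fi: "\<And>a b. set_integrable lborel {a..b} f" and f0: "\<And>n. set_integrable lborel {a-1..b+1} (\<lambda>y. \<theta> n y * f y)"
        for f :: "real \<Rightarrow> real"
        unfolding set_lebesgue_integral_def
      proof (rule integral_dominated_convergence[where w="\<lambda>y. norm (indicator {a-1..b+1} y *\<^sub>R f y)"])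
        show "integrable lborel (\<lambda>y. norm (indicat_real {a - 1..b + 1} y *\<^sub>R f y))"
          using fi[of "a-1" "b+1"] unfolding set_integrable_def by (rule integrable_norm)
        show "AE y in lborel. (\<lambda>n. indicator {a-1..b+1} y *\<^sub>R (\<theta> n y * f y)) \<longlonglongrightarrow> indicator {a..b} y *\<^sub>R f y"
        proof (rule AE_I2)
          fix y
          have "(\<lambda>n. indicator {a-1..b+1} y *\<^sub>R (\<theta> n y * f y)) \<longlonglongrightarrow> indicator {a-1..b+1} y *\<^sub>R (indicator {a..b} y * f y)"
            unfolding \<theta>_def by (intro tendsto_intros bump_tendsto_indicator ab)
          also have "indicator {a-1..b+1} y *\<^sub>R (indicator {a..b} y * f y) = indicator {a..b} y *\<^sub>R f y"
            by (auto simp: indicator_def)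
          finally show "(\<lambda>n. indicator {a-1..b+1} y *\<^sub>R (\<theta> n y * f y)) \<longlonglongrightarrow> indicator {a..b} y *\<^sub>R f y" .
        qed
        show "AE y in lborel. norm (indicat_real {a - 1..b + 1} y *\<^sub>R (\<theta> n y * f y)) \<le> norm (indicat_real {a - 1..b + 1} y *\<^sub>R f y)" for n
          using b by (auto simp: indicator_def abs_mult intro!: mult_left_le_one_le)
      qed (use fi f0 in \<open>auto simp: set_integrable_def\<close>)
      have ti: "set_integrable lborel {a-1..b+1} (\<lambda>y. \<theta> n y * 1)" for n
        using c by (intro borel_integrable_atLeastAtMost') (auto intro: continuous_on_subset)
      have "(\<lambda>n. LBINT y:{a-1..b+1}. \<theta> n y * h y) \<longlonglongrightarrow> (LBINT y:{a..b}. h y)"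
        using int intm[OF c] by (intro lim)
      moreover have "(LBINT y:{a-1..b+1}. \<theta> n y * h y) = C * (LBINT y:{a-1..b+1}. \<theta> n y * 1)" for n
        using main[of "a-1" "b+1" "\<theta> n"] ab c s by simp
      moreover have "(\<lambda>n. C * (LBINT y:{a-1..b+1}. \<theta> n y * 1)) \<longlonglongrightarrow> C * (LBINT y:{a..b}. 1)"
        using ti by (intro tendsto_mult_left lim) (auto intro!: borel_integrable_atLeastAtMost')
      ultimately have "(LBINT y:{a..b}. h y) = C * (LBINT y:{a..b}. 1)"
        by (simp add: LIMSEQ_unique)
      also have "\<dots> = (LBINT y:{a..b}. C)" by (simp flip: set_integral_mult_right)
      finally show ?thesis using int
        by (subst set_integral_diff(2)) (auto intro!: borel_integrable_atLeastAtMost')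
    qed
  qed
  then show ?thesis by auto
qed

lemma test_functionD:
  assumes "test_function \<phi>"
  obtains N where "N > 0" "\<And>y. (\<phi> has_real_derivative deriv \<phi> y) (at y)" "continuous_on UNIV (deriv \<phi>)"
    "\<And>y. y \<notin> {-N..N} \<Longrightarrow> \<phi> y = 0" "\<And>y. y \<notin> {-N..N} \<Longrightarrow> deriv \<phi> y = 0"
proof -
  obtain D where D: "\<And>y. (\<phi> has_real_derivative D y) (at y)" "continuous_on UNIV D"
    using assms by (auto simp: test_function_def C1_differentiable_on_def has_real_derivative_iff_has_vector_derivative)
  have "deriv \<phi> = D" using D by (auto intro!: DERIV_imp_deriv)
  with D have d: "\<And>y. (\<phi> has_real_derivative deriv \<phi> y) (at y)" "continuous_on UNIV (deriv \<phi>)" by auto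
  have "bounded (closure {y. \<phi> y \<noteq> 0})" using assms by (auto simp: test_function_def compact_imp_bounded)
  then have "bounded {y. \<phi> y \<noteq> 0}" by (rule bounded_subset) (rule closure_subset)
  then obtain B where B: "\<And>y. \<phi> y \<noteq> 0 \<Longrightarrow> \<bar>y\<bar> \<le> B"
    unfolding bounded_iff by auto
  define N where "N = max 1 B"
  have N: "\<phi> y = 0" if "y \<notin> {-N..N}" for y
  proof (rule ccontr)
    assume "\<phi> y \<noteq> 0" then have "\<bar>y\<bar> \<le> B" by (rule B)
    then show False using that unfolding N_def by auto
  qed
  have "deriv \<phi> y = 0" if "y \<notin> {-N..N}" for y
  proof -
    have "eventually (\<lambda>z. z \<in> - {-N..N}) (nhds y)" using that by (intro eventually_nhds_in_open) auto
    then have "eventually (\<lambda>z. \<phi> z = 0) (nhds y)" by eventually_elim (use N in auto)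
    then have "deriv \<phi> y = deriv (\<lambda>_. 0) y" by (rule deriv_cong_ev) simp
    then show ?thesis by simp
  qed
  with N show thesis by (intro that[of N] d) (auto simp: N_def)
qed

lemma test_functionI:
  assumes "\<And>y. (\<phi> has_real_derivative \<phi>' y) (at y)" "continuous_on UNIV \<phi>'" "\<And>y. y \<notin> {a..b} \<Longrightarrow> \<phi> y = 0"
  shows "test_function \<phi>"
proof -
  have "closure {y. \<phi> y \<noteq> 0} \<subseteq> {a..b}" using assms(3) by (intro closure_minimal closed_atLeastAtMost) blast
  then have "compact (closure {y. \<phi> y \<noteq> 0})"
    using bounded_subset[OF bounded_closed_interval] by (auto simp: compact_eq_bounded_closed)
  with assms show ?thesis
    by (auto simp: test_function_def C1_differentiable_on_def has_real_derivative_iff_has_vector_derivative)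
qed

lemma L2_continuous_compact_support:
  fixes f :: "real \<Rightarrow> 'a::euclidean_space"
  assumes "continuous_on UNIV f" "\<And>y. y \<notin> {a..b} \<Longrightarrow> f y = 0"
  shows "L2 f"
proof -
  have "set_integrable lborel {a..b} (\<lambda>y. (norm (f y))\<^sup>2)"
    by (intro borel_integrable_atLeastAtMost' continuous_intros continuous_on_subset[OF assms(1)]) auto
  moreover have "(\<lambda>y. indicator {a..b} y *\<^sub>R (norm (f y))\<^sup>2) = (\<lambda>y. (norm (f y))\<^sup>2)"
  proof
    show "indicator {a..b} y *\<^sub>R (norm (f y))\<^sup>2 = (norm (f y))\<^sup>2" for y
      using assms(2)[of y] by (cases "y \<in> {a..b}") simp_all
  qed
  ultimately show ?thesis using assms(1)
    by (auto simp: L2_def set_integrable_def borel_measurable_continuous_onI)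
qed

lemma LBINT_compact_support:
  fixes f :: "real \<Rightarrow> 'a::euclidean_space"
  assumes "\<And>y. y \<notin> A \<Longrightarrow> f y = 0"
  shows "(LBINT y:A. f y) = (LBINT y. f y)"
proof -
  have "(\<lambda>y. indicator A y *\<^sub>R f y) = f"
  proof
    show "indicator A y *\<^sub>R f y = f y" for y
      using assms(1)[of y] by (cases "y \<in> A") simp_all
  qed
  then show ?thesis by (simp add: set_lebesgue_integral_def)
qed

text \<open>The primitive \<open>P\<close> of \<open>g\<close> obeys the same integration by parts
  as \<open>f\<close>, so \<open>f - P\<close> annihilates derivatives of test functions. These are
  exactly the continuous mean-zero functions of compact support, since the primitive of such a
  function again has compact support. The du Bois-Reymond lemma makes \<open>f - P\<close>
  constant.\<close>

lemma weak_deriv_primitive: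
  fixes f g :: "real \<Rightarrow> real"
  assumes w: "L2_weak_deriv f g"
  shows "\<exists>F. continuous_on UNIV F \<and> (AE y in lborel. f y = F y) \<and>
    (\<forall>a b. a \<le> b \<longrightarrow> F b - F a = (LBINT y:{a..b}. g y))"
proof -
  have L2: "L2 f" "L2 g" using w by (auto simp: L2_weak_deriv_def)
  note gi = integrable_bdd_interval[OF L2(2)]
  have gI: "g integrable_on {a..b}" for a b using set_borel_integral_eq_integral(1)[OF gi] .
  have gE: "(LBINT y:{a..b}. g y) = integral {a..b} g" for a b using set_borel_integral_eq_integral(2)[OF gi] .
  define P where "P y = (if 0 \<le> y then integral {0..y} g else - integral {y..0} g)" for y
  have P: "P y - P a = integral {a..y} g" if "a \<le> y" for a y
    using that Henstock_Kurzweil_Integration.integral_combine[OF _ _ gI, of a 0 y]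
      Henstock_Kurzweil_Integration.integral_combine[OF _ _ gI, of 0 a y]
      Henstock_Kurzweil_Integration.integral_combine[OF _ _ gI, of a y 0]
    by (auto simp: P_def)
  have Pc: "continuous_on UNIV P"
    unfolding continuous_on_eq_continuous_at[OF open_UNIV]
  proof
    fix x :: real
    have "continuous_on {x-1..x+1} (\<lambda>y. P (x-1) + integral {x-1..y} g)"
      by (intro continuous_intros indefinite_integral_continuous_1 gI)
    also have "?this \<longleftrightarrow> continuous_on {x-1..x+1} P"
    proof (intro continuous_on_cong refl)
      fix y assume "y \<in> {x-1..x+1}"
      then show "P (x-1) + integral {x-1..y} g = P y" using P[of "x-1" y] by simp
    qed
    finally show "isCont P x" by (rule continuous_on_interior) auto
  qed
  have Pi: "set_integrable lborel {a..b} P" for a b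
    using Pc by (intro borel_integrable_atLeastAtMost') (auto intro: continuous_on_subset)
  have "\<exists>C. AE y in lborel. f y - P y = C"
  proof (rule du_Bois_Reymond)
    show "set_integrable lborel {a..b} (\<lambda>y. f y - P y)" for a b
      by (intro set_integral_diff integrable_bdd_interval L2 Pi)
    fix a b :: real and \<theta> :: "real \<Rightarrow> real"
    assume ab: "a \<le> b" and c: "continuous_on UNIV \<theta>" and s: "\<And>y. y \<notin> {a..b} \<Longrightarrow> \<theta> y = 0"
      and z: "(LBINT y:{a..b}. \<theta> y) = 0"
    have ti: "set_integrable lborel {u..v} \<theta>" for u v
      using c by (intro borel_integrable_atLeastAtMost') (auto intro: continuous_on_subset)
    obtain \<phi> where \<phi>: "\<And>y. (\<phi> has_real_derivative \<theta> y) (at y)" "\<phi> a = 0"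
      using ex_primitive[OF c] by blast
    have d: "deriv \<phi> = \<theta>" using \<phi> by (auto intro!: DERIV_imp_deriv)
    have ftc: "(LBINT y:{u..v}. \<theta> y) = \<phi> v - \<phi> u" if "u \<le> v" for u v
      using integral_FTC_Icc_real[of u v \<phi> \<theta>] that \<phi> c
      by (auto simp: set_lebesgue_integral_def continuous_on_eq_continuous_at mult.commute)
    \<comment> \<open>Mean zero of \<open>\<theta>\<close> enters here: it brings the primitive back
      to 0 at \<open>b\<close>. The open interval includes the endpoint \<open>b\<close> among the
      zeros, as \<open>primitive_by_parts\<close> asks.\<close>
    have \<phi>0: "\<phi> y = 0" if "y \<notin> {a<..<b}" for y
    proof (cases "y \<le> a")
      case True
      have "(LBINT x:{y..a}. \<theta> x) = (LBINT x:{a}. \<theta> x)"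
        unfolding set_lebesgue_integral_def using s ab True
        by (intro Bochner_Integration.integral_cong refl) (force simp: indicator_def)
      moreover have "(LBINT x:{a}. \<theta> x) = 0" using ftc[of a a] by simp
      ultimately show ?thesis using ftc[of y a] \<phi> True by simp
    next
      case False
      then have y: "b \<le> y" using that by auto
      have "(LBINT x:{a..y}. \<theta> x) = (LBINT x:{a..b}. \<theta> x)"
        unfolding set_lebesgue_integral_def using s ab y
        by (intro Bochner_Integration.integral_cong refl) (force simp: indicator_def)
      then show ?thesis using ftc[of a y] \<phi> z y ab by simp
    qed
    then have \<phi>1: "\<phi> y = 0" if "y \<notin> {a..b}" for y using that by auto
    have "test_function \<phi>" using \<phi> c \<phi>1 by (intro test_functionI)
    then have "(LBINT y. deriv \<phi> y * f y) = - (LBINT y. \<phi> y * g y)"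
      using w by (simp add: L2_weak_deriv_def)
    then have "(LBINT y. \<theta> y * f y) = - (LBINT y. \<phi> y * g y)"
      unfolding d .
    then have 1: "(LBINT y:{a..b}. \<theta> y * f y) = - (LBINT y:{a..b}. \<phi> y * g y)"
      using LBINT_compact_support[of "{a..b}" "\<lambda>y. \<theta> y * f y"] LBINT_compact_support[of "{a..b}" "\<lambda>y. \<phi> y * g y"] s \<phi>1
      by simp
    have "- (LBINT y:{a..b}. \<phi> y * g y) = (LBINT x:{a..b}. \<theta> x * (LBINT y:{a..x}. g y))"
      using \<phi>0[of b] by (intro primitive_by_parts[symmetric] ab \<phi> c gi) auto
    also have "\<dots> = (LBINT x:{a..b}. \<theta> x * P x - P a * \<theta> x)"
      using P gE by (intro set_lebesgue_integral_cong) (auto simp: algebra_simps)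
    also have "\<dots> = (LBINT x:{a..b}. \<theta> x * P x) - (LBINT x:{a..b}. P a * \<theta> x)"
      using c Pc ti by (intro set_integral_diff borel_integrable_atLeastAtMost' continuous_intros)
        (auto intro: continuous_on_subset)
    finally have 2: "(LBINT y:{a..b}. \<theta> y * f y) = (LBINT x:{a..b}. \<theta> x * P x)"
      using 1 z by simp
    have t2: "L2 \<theta>" using c s by (rule L2_continuous_compact_support)
    have "integrable lborel (\<lambda>y. \<theta> y * f y)" by (rule L2_mult_integrable[OF t2 L2(1)])
    then have fi: "set_integrable lborel {a..b} (\<lambda>y. \<theta> y * f y)"
      unfolding set_integrable_def by (intro integrable_mult_indicator) auto
    have "(LBINT y:{a..b}. \<theta> y * (f y - P y)) = (LBINT y:{a..b}. \<theta> y * f y) - (LBINT y:{a..b}. \<theta> y * P y)"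
      unfolding right_diff_distrib
      using c Pc by (intro set_integral_diff fi borel_integrable_atLeastAtMost' continuous_intros)
        (auto intro: continuous_on_subset)
    then show "(LBINT y:{a..b}. \<theta> y * (f y - P y)) = 0" using 2 by simp
  qed
  then obtain C where C: "AE y in lborel. f y - P y = C" by blast
  have "AE y in lborel. f y = P y + C" using C by eventually_elim auto
  then show ?thesis using Pc P gE
    by (intro exI[of _ "\<lambda>y. P y + C"]) (auto intro!: continuous_intros)
qed

text \<open>Increments of the continuous representative of \<open>f\<close> are integrals of
  \<open>g\<close>, hence of the continuous \<open>g'\<close>, so it is a classical primitive of
  \<open>g'\<close>. Repeated use descends from the highest weak derivative to classical
  ones.\<close>

lemma weak_deriv_C1_representative:
  fixes f g :: "real \<Rightarrow> real"
  assumes w: "L2_weak_deriv f g" and g: "AE y in lborel. g y = g' y" "continuous_on UNIV g'"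
  shows "\<exists>F. (\<forall>y. (F has_real_derivative g' y) (at y)) \<and> (AE y in lborel. f y = F y)"
proof -
  have m: "g \<in> borel_measurable borel" "g' \<in> borel_measurable borel"
    using w g by (auto simp: L2_weak_deriv_def L2_def borel_measurable_continuous_onI)
  obtain F where F: "AE y in lborel. f y = F y"
    "\<forall>a b. a \<le> b \<longrightarrow> F b - F a = (LBINT y:{a..b}. g y)"
    using weak_deriv_primitive[OF w] by blast
  obtain G where G: "\<And>y. (G has_real_derivative g' y) (at y)" "G 0 = 0"
    using ex_primitive[OF g(2)] by blast
  have e: "F b - F a = G b - G a" if "a \<le> b" for a b
  proof -
    have "F b - F a = (LBINT y:{a..b}. g' y)"
      unfolding F(2)[rule_format, OF that] set_lebesgue_integral_def
      using g m by (intro integral_cong_AE) (auto elim!: eventually_mono)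
    also have "\<dots> = G b - G a"
      using integral_FTC_Icc_real[of a b G g'] that G g
      by (auto simp: set_lebesgue_integral_def continuous_on_eq_continuous_at mult.commute)
    finally show ?thesis .
  qed
  have "F y = G y + F 0" for y
  proof (cases "0 \<le> y")
    case True
    show ?thesis using e[OF True] G(2) by linarith
  next
    case False
    then have "y \<le> 0" by simp
    from e[OF this] show ?thesis using G(2) by linarith
  qed
  then have e2: "(\<lambda>y. G y + F 0) = F" by (intro ext) (rule sym)
  have "((\<lambda>y. G y + F 0) has_real_derivative g' y) (at y)" for y
    by (auto intro!: derivative_eq_intros G)
  then show ?thesis unfolding e2 using F(1) by blast
qed

lemma L2_bound:
  fixes f :: "real \<Rightarrow> 'a::euclidean_space" and g :: "real \<Rightarrow> 'b::euclidean_space"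
  assumes "L2 g" "f \<in> borel_measurable borel" "\<And>y. norm (f y) \<le> C * norm (g y)"
  shows "L2 f"
  unfolding L2_def
proof
  show "integrable lborel (\<lambda>y. (norm (f y))\<^sup>2)"
  proof (rule Bochner_Integration.integrable_bound)
    show "integrable lborel (\<lambda>y. C\<^sup>2 * (norm (g y))\<^sup>2)" using assms by (auto simp: L2_def)
    show "(\<lambda>y. (norm (f y))\<^sup>2) \<in> borel_measurable lborel" using assms by simp
    have "(norm (f y))\<^sup>2 \<le> (C * norm (g y))\<^sup>2" for y by (intro power_mono assms) auto
    then show "AE y in lborel. norm ((norm (f y))\<^sup>2) \<le> norm (C\<^sup>2 * (norm (g y))\<^sup>2)"
      by (auto simp: power_mult_distrib)
  qed
qed (use assms in simp)

lemma L2_measurable: "L2 f \<Longrightarrow> f \<in> borel_measurable borel"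
  by (simp add: L2_def)

lemma L2_cong_AE:
  fixes f g :: "real \<Rightarrow> 'a::euclidean_space"
  assumes "L2 f" "AE y in lborel. f y = g y" "g \<in> borel_measurable borel"
  shows "L2 g"
proof -
  have "integrable lborel (\<lambda>y. (norm (f y))\<^sup>2) \<longleftrightarrow> integrable lborel (\<lambda>y. (norm (g y))\<^sup>2)"
    using assms by (intro integrable_cong_AE) (auto simp: L2_def elim!: eventually_mono)
  then show ?thesis using assms by (auto simp: L2_def)
qed

lemma L2_add:
  fixes f g :: "real \<Rightarrow> 'a::euclidean_space"
  assumes "L2 f" "L2 g"
  shows "L2 (\<lambda>y. f y + g y)"
  unfolding L2_def
proof
  show "integrable lborel (\<lambda>y. (norm (f y + g y))\<^sup>2)"
  proof (rule Bochner_Integration.integrable_bound)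
    show "integrable lborel (\<lambda>y. 2 * (norm (f y))\<^sup>2 + 2 * (norm (g y))\<^sup>2)"
      using assms by (auto simp: L2_def)
    have "(norm (f y + g y))\<^sup>2 \<le> 2 * (norm (f y))\<^sup>2 + 2 * (norm (g y))\<^sup>2" for y
    proof -
      have "(norm (f y + g y))\<^sup>2 \<le> (norm (f y) + norm (g y))\<^sup>2"
        by (intro power_mono norm_triangle_ineq) auto
      also have "\<dots> \<le> 2 * (norm (f y))\<^sup>2 + 2 * (norm (g y))\<^sup>2"
        using zero_le_power2[of "norm (f y) - norm (g y)"] by (simp add: power2_eq_square algebra_simps)
      finally show ?thesis .
    qed
    then show "AE y in lborel. norm ((norm (f y + g y))\<^sup>2) \<le> norm (2 * (norm (f y))\<^sup>2 + 2 * (norm (g y))\<^sup>2)"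
      by auto
  qed (use assms in \<open>auto simp: L2_def\<close>)
qed (use assms in \<open>auto simp: L2_def\<close>)

lemma L2_cmult:
  fixes f :: "real \<Rightarrow> complex"
  assumes "L2 f"
  shows "L2 (\<lambda>y. c * f y)"
  by (rule L2_bound[of f _ "cmod c"]) (use assms L2_measurable[OF assms] in \<open>auto simp: norm_mult\<close>)

lemma L2_diff:
  fixes f g :: "real \<Rightarrow> complex"
  assumes "L2 f" "L2 g"
  shows "L2 (\<lambda>y. f y - g y)"
  using L2_add[OF assms(1) L2_cmult[OF assms(2), of "-1"]] by simp

lemma L2_Re: "L2 f \<Longrightarrow> L2 (\<lambda>y. Re (f y))"
  by (rule L2_bound[of f _ 1]) (auto dest: L2_measurable simp: abs_Re_le_cmod)

lemma L2_Im: "L2 f \<Longrightarrow> L2 (\<lambda>y. Im (f y))"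
  by (rule L2_bound[of f _ 1]) (auto dest: L2_measurable simp: abs_Im_le_cmod)

lemma test_function_L2:
  assumes "test_function \<phi>"
  shows "L2 \<phi>" "L2 (deriv \<phi>)"
proof -
  obtain N where N: "N > 0" "\<And>y. (\<phi> has_real_derivative deriv \<phi> y) (at y)" "continuous_on UNIV (deriv \<phi>)"
    "\<And>y. y \<notin> {-N..N} \<Longrightarrow> \<phi> y = 0" "\<And>y. y \<notin> {-N..N} \<Longrightarrow> deriv \<phi> y = 0"
    using test_functionD[OF assms] by metis
  have "continuous_on UNIV \<phi>" using N(2) DERIV_isCont by (auto simp: continuous_on_eq_continuous_at)
  then show "L2 \<phi>" "L2 (deriv \<phi>)" using N by (auto intro: L2_continuous_compact_support[where a="-N" and b=N])
qed

lemma L2_scaleR_integrable: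
  fixes f :: "real \<Rightarrow> complex"
  assumes "L2 \<phi>" "L2 f"
  shows "integrable lborel (\<lambda>y. \<phi> y *\<^sub>R f y)"
proof -
  have "L2 (\<lambda>y. norm (f y))" by (rule L2_bound[of f _ 1]) (use assms L2_measurable[of f] in auto)
  from L2_mult_integrable[OF assms(1) this] show ?thesis
    by (rule Bochner_Integration.integrable_bound) (use assms in \<open>auto simp: L2_def abs_mult\<close>)
qed

lemma weak_deriv_Re_Im:
  assumes "L2_weak_deriv f g"
  shows weak_deriv_Re: "L2_weak_deriv (\<lambda>y. Re (f y)) (\<lambda>y. Re (g y))"
    and weak_deriv_Im: "L2_weak_deriv (\<lambda>y. Im (f y)) (\<lambda>y. Im (g y))"
proof -
  have L: "L2 f" "L2 g" using assms by (auto simp: L2_weak_deriv_def)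
  have "(LBINT y. deriv \<phi> y * Re (f y)) = - (LBINT y. \<phi> y * Re (g y))"
    "(LBINT y. deriv \<phi> y * Im (f y)) = - (LBINT y. \<phi> y * Im (g y))" if t: "test_function \<phi>" for \<phi>
  proof -
    note i = L2_scaleR_integrable[OF test_function_L2(2)[OF t] L(1)] L2_scaleR_integrable[OF test_function_L2(1)[OF t] L(2)]
    have e: "(LBINT y. deriv \<phi> y *\<^sub>R f y) = - (LBINT y. \<phi> y *\<^sub>R g y)"
      using assms t by (simp add: L2_weak_deriv_def)
    show "(LBINT y. deriv \<phi> y * Re (f y)) = - (LBINT y. \<phi> y * Re (g y))"
      using arg_cong[OF e, of Re] integral_Re[OF i(1)] integral_Re[OF i(2)] by simp
    show "(LBINT y. deriv \<phi> y * Im (f y)) = - (LBINT y. \<phi> y * Im (g y))"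
      using arg_cong[OF e, of Im] integral_Im[OF i(1)] integral_Im[OF i(2)] by simp
  qed
  then show "L2_weak_deriv (\<lambda>y. Re (f y)) (\<lambda>y. Re (g y))" "L2_weak_deriv (\<lambda>y. Im (f y)) (\<lambda>y. Im (g y))"
    using L by (auto simp: L2_weak_deriv_def L2_Re L2_Im)
qed

lemma C1_weak_deriv:
  fixes f g :: "real \<Rightarrow> complex"
  assumes d: "\<And>y. (f has_vector_derivative g y) (at y)" and c: "continuous_on UNIV g" and L: "L2 f" "L2 g"
  shows "L2_weak_deriv f g"
  unfolding L2_weak_deriv_def
proof (intro conjI L allI impI)
  fix \<phi> assume t: "test_function \<phi>"
  obtain N where N: "N > 0" "\<And>y. (\<phi> has_real_derivative deriv \<phi> y) (at y)" "continuous_on UNIV (deriv \<phi>)"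
    "\<And>y. y \<notin> {-N..N} \<Longrightarrow> \<phi> y = 0" "\<And>y. y \<notin> {-N..N} \<Longrightarrow> deriv \<phi> y = 0"
    using test_functionD[OF t] by metis
  have fc: "continuous_on UNIV f" using has_vector_derivative_continuous[OF d]
    by (auto simp: continuous_on_eq_continuous_at)
  have \<phi>c: "continuous_on UNIV \<phi>" using N(2) DERIV_isCont by (auto simp: continuous_on_eq_continuous_at)
  note i = L2_scaleR_integrable[OF test_function_L2(2)[OF t] L(1)] L2_scaleR_integrable[OF test_function_L2(1)[OF t] L(2)]
  have "(LBINT y. deriv \<phi> y *\<^sub>R f y) + (LBINT y. \<phi> y *\<^sub>R g y) = (LBINT y. deriv \<phi> y *\<^sub>R f y + \<phi> y *\<^sub>R g y)"
    using i by simp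
  also have "\<dots> = (LBINT y:{-N-1..N+1}. deriv \<phi> y *\<^sub>R f y + \<phi> y *\<^sub>R g y)"
    using N by (intro LBINT_compact_support[symmetric]) auto
  also have "\<dots> = \<phi> (N+1) *\<^sub>R f (N+1) - \<phi> (-N-1) *\<^sub>R f (-N-1)"
    unfolding set_lebesgue_integral_def
  proof (rule integral_FTC_Icc)
    show "((\<lambda>y. \<phi> y *\<^sub>R f y) has_vector_derivative (deriv \<phi> x *\<^sub>R f x + \<phi> x *\<^sub>R g x)) (at x within {-N-1..N+1})" for x
      using has_vector_derivative_scaleR[OF N(2) d, of x] has_vector_derivative_at_within
      by (fastforce simp: add.commute)
    show "continuous_on {-N-1..N+1} (\<lambda>y. deriv \<phi> y *\<^sub>R f y + \<phi> y *\<^sub>R g y)"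
      by (intro continuous_intros continuous_on_subset[OF \<phi>c] continuous_on_subset[OF N(3)]
          continuous_on_subset[OF fc] continuous_on_subset[OF c]) auto
  qed (use N in auto)
  also have "\<dots> = 0" using N by simp
  finally show "(LBINT y. deriv \<phi> y *\<^sub>R f y) = - (LBINT y. \<phi> y *\<^sub>R g y)" by (simp add: eq_neg_iff_add_eq_0)
qed

section \<open>Decay at infinity of functions in \<open>H^1\<close>\<close>

lemma integrable_square_no_limit:
  fixes f :: "real \<Rightarrow> real"
  assumes "integrable lborel f" "\<And>y. 0 \<le> f y" "(f \<longlongrightarrow> l) at_top"
  shows "l \<le> 0"
proof (rule ccontr)
  assume "\<not> l \<le> 0"
  then have "eventually (\<lambda>y. f y > l/2) at_top" using assms(3) by (intro order_tendstoD(1)[of f l]) auto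
  then obtain R where R: "\<And>y. y \<ge> R \<Longrightarrow> f y > l/2" by (auto simp: eventually_at_top_linorder)
  have "real n * (l/2) \<le> (LBINT y. f y)" for n
  proof -
    have "real n * (l/2) = (LBINT y. (l/2) * indicator {R..R + real n} y)"
      by (simp add: mult.commute)
    also have "\<dots> \<le> (LBINT y. f y)"
    proof (rule integral_mono_AE[OF _ assms(1)])
      show "integrable lborel (\<lambda>y. l / 2 * indicat_real {R..R + real n} y)"
        by (intro integrable_mult_right) (simp add: integrable_indicator_iff emeasure_lborel_Icc_eq)
      show "AE y in lborel. l / 2 * indicat_real {R..R + real n} y \<le> f y"
        using R assms(2) by (auto simp: indicator_def intro!: AE_I2 less_imp_le)
    qed
    finally show ?thesis .
  qed
  moreover obtain n where "(LBINT y. f y) / (l/2) < real n" using reals_Archimedean2 by blast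
  ultimately show False using \<open>\<not> l \<le> 0\<close> by (auto simp: field_simps not_le dest!: spec[of _ n] leD)
qed

text \<open>The derivative \<open>2 f f'\<close> of \<open>f\<^sup>2\<close> is integrable, so
  \<open>f\<^sup>2\<close> has a limit; an integrable nonnegative function can only have the limit
  0.\<close>

lemma L2_C1_tendsto_0_at_top:
  fixes f f' :: "real \<Rightarrow> real"
  assumes d: "\<And>y. (f has_real_derivative f' y) (at y)" and c: "continuous_on UNIV f'" and L: "L2 f" "L2 f'"
  shows "(f \<longlongrightarrow> 0) at_top"
proof -
  define h where "h y = 2 * (f y * f' y)" for y
  have hi: "integrable lborel h" unfolding h_def by (intro integrable_mult_right L2_mult_integrable L)
  have fc: "continuous_on UNIV f" using d DERIV_isCont by (auto simp: continuous_on_eq_continuous_at)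
  define I where "I = (LBINT y. indicator {0..} y *\<^sub>R h y)"
  have "((\<lambda>y. LBINT x. indicator {..y} x *\<^sub>R (indicator {0..} x *\<^sub>R h x)) \<longlongrightarrow> I) at_top"
    unfolding I_def by (rule tendsto_integral_at_top) (use integrable_mult_indicator[of "{0..}" lborel h] hi in auto)
  then have "((\<lambda>y. (f 0)\<^sup>2 + (LBINT x. indicator {..y} x *\<^sub>R (indicator {0..} x *\<^sub>R h x))) \<longlongrightarrow> (f 0)\<^sup>2 + I) at_top"
    by (intro tendsto_intros)
  moreover have "eventually (\<lambda>y. (f 0)\<^sup>2 + (LBINT x. indicator {..y} x *\<^sub>R (indicator {0..} x *\<^sub>R h x)) = (f y)\<^sup>2) at_top"
    using eventually_ge_at_top[of 0]
  proof eventually_elim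
    case (elim y)
    have "(LBINT x. indicator {..y} x *\<^sub>R (indicator {0..} x *\<^sub>R h x)) = (LBINT x. h x * indicator {0..y} x)"
      by (intro Bochner_Integration.integral_cong) (auto simp: indicator_def)
    also have "\<dots> = (f y)\<^sup>2 - (f 0)\<^sup>2"
    proof (rule integral_FTC_Icc_real[OF elim])
      show "((\<lambda>y. (f y)\<^sup>2) has_real_derivative h x) (at x)" for x
        by (auto intro!: derivative_eq_intros d simp: h_def)
      have "continuous_on UNIV h" unfolding h_def by (intro continuous_intros fc c)
      then show "isCont h x" for x by (simp add: continuous_on_eq_continuous_at)
    qed
    finally show ?case by simp
  qed
  ultimately have lim: "((\<lambda>y. (f y)\<^sup>2) \<longlongrightarrow> (f 0)\<^sup>2 + I) at_top" by (rule Lim_transform_eventually)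
  have "(f 0)\<^sup>2 + I \<le> 0"
    using L(1) lim by (intro integrable_square_no_limit[of "\<lambda>y. (f y)\<^sup>2"]) (auto simp: L2_def)
  moreover have "(f 0)\<^sup>2 + I \<ge> 0" using lim by (rule tendsto_lowerbound) (auto)
  ultimately have "((\<lambda>y. (f y)\<^sup>2) \<longlongrightarrow> 0) at_top" using lim by simp
  then have "((\<lambda>y. sqrt ((f y)\<^sup>2)) \<longlongrightarrow> sqrt 0) at_top" by (rule tendsto_real_sqrt)
  then show ?thesis by (simp add: tendsto_rabs_zero_iff)
qed

lemma L2_reflect:
  fixes f :: "real \<Rightarrow> 'a::euclidean_space"
  assumes "L2 f"
  shows "L2 (\<lambda>y. f (-y))"
  using assms lborel_integrable_real_affine[of "\<lambda>y. (norm (f y))\<^sup>2" "-1" 0] by (auto simp: L2_def)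

lemma L2_C1_tendsto_0_at_bot:
  fixes f f' :: "real \<Rightarrow> real"
  assumes d: "\<And>y. (f has_real_derivative f' y) (at y)" and c: "continuous_on UNIV f'" and L: "L2 f" "L2 f'"
  shows "(f \<longlongrightarrow> 0) at_bot"
proof -
  have "((\<lambda>y. f (-y)) \<longlongrightarrow> 0) at_top"
  proof (rule L2_C1_tendsto_0_at_top)
    show "((\<lambda>y. f (- y)) has_real_derivative - f' (-y)) (at y)" for y
      using DERIV_mirror[of f "f' (-y)" y] d[of "-y"] by simp
    show "continuous_on UNIV (\<lambda>y. - f' (-y))"
      by (intro continuous_intros continuous_on_compose2[OF c]) auto
    show "L2 (\<lambda>y. - f' (-y))" by (rule L2_bound[OF L2_reflect[OF L(2)], where C=1]) (use L2_measurable[OF L2_reflect[OF L(2)]] in auto)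
  qed (rule L2_reflect[OF L(1)])
  then show ?thesis unfolding filterlim_at_bot_mirror .
qed

lemma continuous_bounded_if_limits:
  fixes f :: "real \<Rightarrow> real"
  assumes c: "continuous_on UNIV f" and t: "(f \<longlongrightarrow> l) at_top" "(f \<longlongrightarrow> l') at_bot"
  obtains M where "M > 0" "\<And>y. \<bar>f y\<bar> \<le> M"
proof -
  have "eventually (\<lambda>y. \<bar>f y\<bar> < \<bar>l\<bar> + 1) at_top" "eventually (\<lambda>y. \<bar>f y\<bar> < \<bar>l'\<bar> + 1) at_bot"
    using t[THEN tendsto_rabs] by (auto intro: order_tendstoD(2))
  then obtain A B where AB: "\<And>y. y \<ge> A \<Longrightarrow> \<bar>f y\<bar> < \<bar>l\<bar> + 1" "\<And>y. y \<le> B \<Longrightarrow> \<bar>f y\<bar> < \<bar>l'\<bar> + 1"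
    by (auto simp: eventually_at_top_linorder eventually_at_bot_linorder)
  have "compact (f ` {B..A})" by (intro compact_continuous_image continuous_on_subset[OF c]) auto
  then obtain K where K: "\<And>y. y \<in> {B..A} \<Longrightarrow> \<bar>f y\<bar> \<le> K"
    using compact_imp_bounded[THEN bounded_iff[THEN iffD1]] by (metis imageI real_norm_def)
  show thesis
  proof (rule that[of "(\<bar>l\<bar> + 1) + (\<bar>l'\<bar> + 1) + \<bar>K\<bar>"])
    fix y show "\<bar>f y\<bar> \<le> (\<bar>l\<bar> + 1) + (\<bar>l'\<bar> + 1) + \<bar>K\<bar>"
      using AB[of y] K[of y] by (cases "y \<ge> A"; cases "y \<le> B") auto
  qed auto
qed

lemma L2_C1_bounded:
  fixes f f' :: "real \<Rightarrow> real"
  assumes d: "\<And>y. (f has_real_derivative f' y) (at y)" and c: "continuous_on UNIV f'" and L: "L2 f" "L2 f'"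
  obtains M where "M > 0" "\<And>y. \<bar>f y\<bar> \<le> M"
proof (rule continuous_bounded_if_limits)
  show "continuous_on UNIV f" using d DERIV_isCont by (auto simp: continuous_on_eq_continuous_at)
  show "(f \<longlongrightarrow> 0) at_top" by (rule L2_C1_tendsto_0_at_top[OF assms])
  show "(f \<longlongrightarrow> 0) at_bot" by (rule L2_C1_tendsto_0_at_bot[OF assms])
qed (use that in blast)

section \<open>Cutoffs and the energy estimate for the Helmholtz equation\<close>

lemma has_real_derivative_pos_part_square:
  "((\<lambda>u::real. (max 0 u)\<^sup>2) has_real_derivative 2 * max 0 u) (at u)"
proof -
  consider "u > 0" | "u < 0" | "u = 0" by linarith
  then show ?thesis
  proof cases
    case 1
    have "((\<lambda>u. u\<^sup>2) has_real_derivative 2 * max 0 u) (at u)"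
      using 1 by (auto intro!: derivative_eq_intros)
    then show ?thesis
      using 1 by (rule_tac DERIV_cong_ev[THEN iffD1, rotated 3, where f1="\<lambda>u. u\<^sup>2" and x1=u])
        (auto intro: eventually_mono[OF eventually_nhds_in_open[of "{0<..}"]])
  next
    case 2
    have "((\<lambda>u. 0) has_real_derivative 2 * max 0 u) (at u)"
      using 2 by (auto intro!: derivative_eq_intros)
    then show ?thesis
      using 2 by (rule_tac DERIV_cong_ev[THEN iffD1, rotated 3, where f1="\<lambda>u. 0" and x1=u])
        (auto intro: eventually_mono[OF eventually_nhds_in_open[of "{..<0}"]])
  next
    case 3
    have "((\<lambda>h. (max 0 h)\<^sup>2 / h) \<longlongrightarrow> (0::real)) (at 0)"
    proof (rule Lim_null_comparison)
      have "norm ((max 0 h)\<^sup>2 / h) \<le> \<bar>h\<bar>" for h :: real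
        by (cases "h > 0") (auto simp: power2_eq_square max_def)
      then show "eventually (\<lambda>h. norm ((max 0 h)\<^sup>2 / h) \<le> \<bar>h\<bar>) (at (0::real))" by simp
      show "((\<lambda>h. \<bar>h\<bar>) \<longlongrightarrow> 0) (at (0::real))"
        by (intro tendsto_rabs_zero tendsto_ident_at)
    qed
    then show ?thesis using 3 by (simp add: DERIV_def)
  qed
qed

text \<open>The square of the positive part of \<open>1 - (y / (n + 1))\<^sup>2\<close> is an
  explicit bump of class \<open>C\<^sup>1\<close>, the smoothness asked of test functions. The
  uniform bound on the derivatives and their pointwise limit 0 let the error of cutting off vanish
  by dominated convergence.\<close>

lemma cutoff_exists:
  obtains \<eta> \<eta>' :: "nat \<Rightarrow> real \<Rightarrow> real" where
    "\<And>n y. (\<eta> n has_real_derivative \<eta>' n y) (at y)" "\<And>n. continuous_on UNIV (\<eta>' n)"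
    "\<And>n y. 0 \<le> \<eta> n y" "\<And>n y. \<eta> n y \<le> 1" "\<And>n y. y \<notin> {-real (Suc n)..real (Suc n)} \<Longrightarrow> \<eta> n y = 0"
    "\<And>n y. \<bar>\<eta>' n y\<bar> \<le> 4" "\<And>y. (\<lambda>n. \<eta> n y) \<longlonglongrightarrow> 1" "\<And>y. (\<lambda>n. \<eta>' n y) \<longlonglongrightarrow> 0"
proof
  define q where "q n y = y / real (Suc n)" for n and y :: real
  define \<eta> where "\<eta> n y = (max 0 (1 - (q n y)\<^sup>2))\<^sup>2" for n y
  define \<eta>' where "\<eta>' n y = 2 * max 0 (1 - (q n y)\<^sup>2) * (- 2 * q n y / real (Suc n))" for n y
  have qd: "(q n has_real_derivative 1 / real (Suc n)) (at y)" for n y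
    unfolding q_def by (auto intro!: derivative_eq_intros)
  show "(\<eta> n has_real_derivative \<eta>' n y) (at y)" for n y
  proof -
    have "((\<lambda>y. 1 - (q n y)\<^sup>2) has_real_derivative (- 2 * q n y / real (Suc n))) (at y)"
      by (auto intro!: derivative_eq_intros qd)
    from DERIV_chain2[OF has_real_derivative_pos_part_square this]
    show ?thesis unfolding \<eta>_def \<eta>'_def .
  qed
  show "continuous_on UNIV (\<eta>' n)" for n unfolding \<eta>'_def q_def by (intro continuous_intros) auto
  show "0 \<le> \<eta> n y" for n y by (simp add: \<eta>_def)
  show "\<eta> n y \<le> 1" for n y unfolding \<eta>_def by (intro power_le_one) auto
  show "\<eta> n y = 0" if "y \<notin> {-real (Suc n)..real (Suc n)}" for n y
  proof -
    have "\<bar>q n y\<bar> \<ge> 1" using that by (auto simp: q_def field_simps abs_if)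
    then have "1 \<le> (q n y)\<^sup>2" using abs_le_square_iff[of 1 "q n y"] by simp
    then show ?thesis by (simp add: \<eta>_def)
  qed
  show "\<bar>\<eta>' n y\<bar> \<le> 4" for n y
  proof (cases "\<bar>q n y\<bar> \<le> 1")
    case True
    have "\<bar>\<eta>' n y\<bar> = 2 * max 0 (1 - (q n y)\<^sup>2) * (2 * (\<bar>q n y\<bar> / real (Suc n)))"
      by (simp add: \<eta>'_def abs_mult)
    also have "\<dots> \<le> 2 * 1 * (2 * (1 / 1))"
      using True by (intro mult_mono frac_le) auto
    finally show ?thesis by simp
  next
    case False
    then have "1 \<le> (q n y)\<^sup>2" using abs_le_square_iff[of 1 "q n y"] by simp
    then show ?thesis by (simp add: \<eta>'_def)
  qed
  have q0: "(\<lambda>n. q n y) \<longlonglongrightarrow> 0" for y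
    unfolding q_def by (intro real_tendsto_divide_at_top[OF tendsto_const]) (use filterlim_Suc filterlim_real_sequentially in \<open>blast intro: filterlim_compose\<close>)
  show "(\<lambda>n. \<eta> n y) \<longlonglongrightarrow> 1" for y
    unfolding \<eta>_def by (rule tendsto_eq_intros q0 refl)+ simp
  show "(\<lambda>n. \<eta>' n y) \<longlonglongrightarrow> 0" for y
  proof -
    have "(\<lambda>n. 2 * max 0 (1 - (q n y)\<^sup>2) * (- 2 * q n y * inverse (real (Suc n)))) \<longlonglongrightarrow> 2 * max 0 (1 - 0\<^sup>2) * (- 2 * 0 * 0)"
      by (intro tendsto_intros q0 LIMSEQ_inverse_real_of_nat)
    then show ?thesis by (simp add: \<eta>'_def divide_inverse)
  qed
qed

text \<open>The weak derivative of \<open>\<psi>1\<close> is tested against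
  \<open>\<eta> n * F\<close>, with \<open>F\<close> the \<open>C\<^sup>1\<close> representative of
  \<open>\<psi>\<close>. The extra term containing \<open>\<eta>' n\<close> is dominated by the
  integrable \<open>4 |F F1|\<close> and disappears in the limit, so no boundary terms
  remain.\<close>

lemma weak_deriv_by_parts:
  fixes \<psi> \<psi>1 \<psi>2 :: "real \<Rightarrow> real"
  assumes w1: "L2_weak_deriv \<psi> \<psi>1" and w2: "L2_weak_deriv \<psi>1 \<psi>2"
  shows "(LBINT y. (\<psi>1 y)\<^sup>2) = - (LBINT y. \<psi> y * \<psi>2 y)"
proof -
  have L: "L2 \<psi>" "L2 \<psi>1" "L2 \<psi>2" using w1 w2 by (auto simp: L2_weak_deriv_def)
  obtain F1 where F1: "continuous_on UNIV F1" "AE y in lborel. \<psi>1 y = F1 y"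
    using weak_deriv_primitive[OF w2] by blast
  obtain F where F: "\<forall>y. (F has_real_derivative F1 y) (at y)" "AE y in lborel. \<psi> y = F y"
    using weak_deriv_C1_representative[OF w1 F1(2,1)] by blast
  have Fc: "continuous_on UNIV F" using F(1) DERIV_isCont by (auto simp: continuous_on_eq_continuous_at)
  have LF: "L2 F" "L2 F1" using L2_cong_AE[OF L(1) F(2)] L2_cong_AE[OF L(2) F1(2)] Fc F1
    by (auto simp: borel_measurable_continuous_onI)
  have [measurable]: "\<psi>1 \<in> borel_measurable borel" "\<psi>2 \<in> borel_measurable borel" "\<psi> \<in> borel_measurable borel"
    "F \<in> borel_measurable borel" "F1 \<in> borel_measurable borel"
    using L LF by (auto simp: L2_def)
  obtain \<eta> \<eta>' :: "nat \<Rightarrow> real \<Rightarrow> real" where \<eta>: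
    "\<And>n y. (\<eta> n has_real_derivative \<eta>' n y) (at y)" "\<And>n. continuous_on UNIV (\<eta>' n)"
    "\<And>n y. 0 \<le> \<eta> n y" "\<And>n y. \<eta> n y \<le> 1" "\<And>n y. y \<notin> {-real (Suc n)..real (Suc n)} \<Longrightarrow> \<eta> n y = 0"
    "\<And>n y. \<bar>\<eta>' n y\<bar> \<le> 4" "\<And>y. (\<lambda>n. \<eta> n y) \<longlonglongrightarrow> 1" "\<And>y. (\<lambda>n. \<eta>' n y) \<longlonglongrightarrow> 0"
    using cutoff_exists by metis
  have \<eta>c: "continuous_on UNIV (\<eta> n)" for n using DERIV_isCont[OF \<eta>(1)] by (auto simp: continuous_on_eq_continuous_at)
  have [measurable]: "\<eta> n \<in> borel_measurable borel" "\<eta>' n \<in> borel_measurable borel" for n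
    using \<eta>(2) \<eta>c by (auto simp: borel_measurable_continuous_onI)
  have eq: "(LBINT y. (\<eta>' n y * F y + \<eta> n y * F1 y) * F1 y) = - (LBINT y. \<eta> n y * F y * \<psi>2 y)" for n
  proof -
    have d: "((\<lambda>y. \<eta> n y * F y) has_real_derivative (\<eta>' n y * F y + \<eta> n y * F1 y)) (at y)" for y
      using DERIV_mult[OF \<eta>(1) F(1)[rule_format], of n y] by (simp add: mult.commute add.commute)
    have "test_function (\<lambda>y. \<eta> n y * F y)"
    proof (rule test_functionI[OF d])
      show "continuous_on UNIV (\<lambda>y. \<eta>' n y * F y + \<eta> n y * F1 y)"
        by (intro continuous_intros \<eta> \<eta>c Fc F1)
      show "\<eta> n y * F y = 0" if "y \<notin> {- real (Suc n)..real (Suc n)}" for y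
        using \<eta>(5)[OF that] by simp
    qed
    moreover have "deriv (\<lambda>y. \<eta> n y * F y) = (\<lambda>y. \<eta>' n y * F y + \<eta> n y * F1 y)"
      using d by (auto intro!: DERIV_imp_deriv)
    ultimately have "(LBINT y. (\<eta>' n y * F y + \<eta> n y * F1 y) * \<psi>1 y) = - (LBINT y. \<eta> n y * F y * \<psi>2 y)"
      using w2 by (auto simp: L2_weak_deriv_def dest!: spec[of _ "\<lambda>y. \<eta> n y * F y"])
    moreover have "(LBINT y. (\<eta>' n y * F y + \<eta> n y * F1 y) * \<psi>1 y) = (LBINT y. (\<eta>' n y * F y + \<eta> n y * F1 y) * F1 y)"
      using F1(2) by (intro integral_cong_AE) (auto elim!: eventually_mono)
    ultimately show ?thesis by simp
  qed
  have "(\<lambda>n. LBINT y. (\<eta>' n y * F y + \<eta> n y * F1 y) * F1 y) \<longlonglongrightarrow> (LBINT y. (0 * F y + 1 * F1 y) * F1 y)"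
  proof (rule integral_dominated_convergence[where w="\<lambda>y. 4 * norm (F y * F1 y) + norm (F1 y * F1 y)"])
    show "integrable lborel (\<lambda>y. 4 * norm (F y * F1 y) + norm (F1 y * F1 y))"
      by (intro Bochner_Integration.integrable_add integrable_mult_right integrable_norm L2_mult_integrable LF)
    show "AE y in lborel. (\<lambda>n. (\<eta>' n y * F y + \<eta> n y * F1 y) * F1 y) \<longlonglongrightarrow> (0 * F y + 1 * F1 y) * F1 y"
      by (intro AE_I2 tendsto_intros \<eta>)
    show "AE y in lborel. norm ((\<eta>' n y * F y + \<eta> n y * F1 y) * F1 y) \<le> 4 * norm (F y * F1 y) + norm (F1 y * F1 y)" for n
    proof (intro AE_I2)
      fix y
      have "(\<eta>' n y * F y + \<eta> n y * F1 y) * F1 y = \<eta>' n y * (F y * F1 y) + \<eta> n y * (F1 y * F1 y)"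
        by (simp add: algebra_simps)
      also have "\<bar>\<dots>\<bar> \<le> \<bar>\<eta>' n y * (F y * F1 y)\<bar> + \<bar>\<eta> n y * (F1 y * F1 y)\<bar>"
        by (rule abs_triangle_ineq)
      also have "\<dots> = \<bar>\<eta>' n y\<bar> * \<bar>F y * F1 y\<bar> + \<bar>\<eta> n y\<bar> * \<bar>F1 y * F1 y\<bar>"
        by (simp only: abs_mult)
      also have "\<dots> \<le> 4 * \<bar>F y * F1 y\<bar> + 1 * \<bar>F1 y * F1 y\<bar>"
        using \<eta>(3,4,6)[of n y] by (intro add_mono mult_right_mono) auto
      finally show "norm ((\<eta>' n y * F y + \<eta> n y * F1 y) * F1 y) \<le> 4 * norm (F y * F1 y) + norm (F1 y * F1 y)"
        by simp
    qed
  qed measurable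
  moreover have "(\<lambda>n. - (LBINT y. \<eta> n y * F y * \<psi>2 y)) \<longlonglongrightarrow> - (LBINT y. 1 * F y * \<psi>2 y)"
  proof (intro tendsto_minus, rule integral_dominated_convergence[where w="\<lambda>y. norm (F y * \<psi>2 y)"])
    show "integrable lborel (\<lambda>y. norm (F y * \<psi>2 y))"
      by (intro integrable_norm L2_mult_integrable LF L)
    show "AE y in lborel. (\<lambda>n. \<eta> n y * F y * \<psi>2 y) \<longlonglongrightarrow> 1 * F y * \<psi>2 y"
      by (intro AE_I2 tendsto_intros \<eta>)
    show "AE y in lborel. norm (\<eta> n y * F y * \<psi>2 y) \<le> norm (F y * \<psi>2 y)" for n
      using \<eta>(3,4) by (auto simp: abs_mult mult.assoc intro!: mult_left_le_one_le)
  qed measurable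
  ultimately have "(LBINT y. (0 * F y + 1 * F1 y) * F1 y) = - (LBINT y. 1 * F y * \<psi>2 y)"
    unfolding eq by (rule LIMSEQ_unique)
  moreover have "(LBINT y. (\<psi>1 y)\<^sup>2) = (LBINT y. F1 y * F1 y)"
    using F1(2) by (intro integral_cong_AE) (auto elim!: eventually_mono simp: power2_eq_square)
  moreover have "(LBINT y. \<psi> y * \<psi>2 y) = (LBINT y. F y * \<psi>2 y)"
    using F(2) by (intro integral_cong_AE) (auto elim!: eventually_mono)
  ultimately show ?thesis by simp
qed

text \<open>Multiplying the equation by \<open>\<psi>\<close> and integrating by parts shows that
  \<open>\<kappa>\<close> times the integral of \<open>\<psi>\<^sup>2\<close> plus the integral of
  \<open>\<psi> \<omega>\<close> is nonpositive. Expanding the square of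
  \<open>\<kappa> \<psi> + \<omega>\<close> and subtracting \<open>2 \<kappa>\<close> times that
  inequality eliminates the mixed integral.\<close>

lemma helmholtz_energy_real:
  fixes \<psi> \<psi>1 \<psi>2 \<omega> :: "real \<Rightarrow> real"
  assumes w1: "L2_weak_deriv \<psi> \<psi>1" and w2: "L2_weak_deriv \<psi>1 \<psi>2" and L\<omega>: "L2 \<omega>"
    and eq: "AE y in lborel. \<psi>2 y - \<kappa> * \<psi> y = \<omega> y" and \<kappa>: "\<kappa> > 0"
  shows "\<kappa>\<^sup>2 * (LBINT y. (\<psi> y)\<^sup>2) \<le> (LBINT y. (\<omega> y)\<^sup>2)"
proof -
  have L: "L2 \<psi>" "L2 \<psi>1" "L2 \<psi>2" using w1 w2 by (auto simp: L2_weak_deriv_def)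
  have m[measurable]: "\<psi> \<in> borel_measurable borel" "\<psi>2 \<in> borel_measurable borel" "\<omega> \<in> borel_measurable borel"
    using L L\<omega> by (auto simp: L2_def)
  have i: "integrable lborel (\<lambda>y. (\<psi> y)\<^sup>2)" "integrable lborel (\<lambda>y. (\<omega> y)\<^sup>2)" "integrable lborel (\<lambda>y. \<psi> y * \<omega> y)"
    using L L\<omega> L2_mult_integrable by (auto simp: L2_def)
  have "(LBINT y. \<psi> y * \<psi>2 y) = (LBINT y. \<psi> y * \<omega> y + \<kappa> * (\<psi> y)\<^sup>2)"
    using eq by (intro integral_cong_AE) (auto elim!: eventually_mono simp: power2_eq_square algebra_simps)
  also have "\<dots> = (LBINT y. \<psi> y * \<omega> y) + \<kappa> * (LBINT y. (\<psi> y)\<^sup>2)" using i by simp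
  finally have "\<kappa> * (LBINT y. (\<psi> y)\<^sup>2) + (LBINT y. \<psi> y * \<omega> y) = - (LBINT y. (\<psi>1 y)\<^sup>2)"
    using weak_deriv_by_parts[OF w1 w2] by simp
  also have "\<dots> \<le> 0" by simp
  finally have 1: "\<kappa> * (LBINT y. (\<psi> y)\<^sup>2) + (LBINT y. \<psi> y * \<omega> y) \<le> 0" .
  have "0 \<le> (LBINT y. (\<kappa> * \<psi> y + \<omega> y)\<^sup>2)" by simp
  also have "\<dots> = (LBINT y. \<kappa>\<^sup>2 * (\<psi> y)\<^sup>2 + (2 * \<kappa>) * (\<psi> y * \<omega> y) + (\<omega> y)\<^sup>2)"
    by (intro Bochner_Integration.integral_cong) (auto simp: power2_eq_square algebra_simps)
  also have "\<dots> = \<kappa>\<^sup>2 * (LBINT y. (\<psi> y)\<^sup>2) + (2 * \<kappa>) * (LBINT y. \<psi> y * \<omega> y) + (LBINT y. (\<omega> y)\<^sup>2)"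
    using i by simp
  finally have "0 \<le> \<kappa>\<^sup>2 * (LBINT y. (\<psi> y)\<^sup>2) + (2 * \<kappa>) * (LBINT y. \<psi> y * \<omega> y) + (LBINT y. (\<omega> y)\<^sup>2)" .
  moreover have "2 * \<kappa> * (\<kappa> * (LBINT y. (\<psi> y)\<^sup>2) + (LBINT y. \<psi> y * \<omega> y)) \<le> 0"
    using 1 \<kappa> by (simp add: mult_nonneg_nonpos)
  ultimately show ?thesis by (simp add: power2_eq_square algebra_simps)
qed

lemma integral_cmod_square:
  fixes f :: "real \<Rightarrow> complex"
  assumes "L2 f"
  shows "(LBINT y. (cmod (f y))\<^sup>2) = (LBINT y. (Re (f y))\<^sup>2) + (LBINT y. (Im (f y))\<^sup>2)"
  unfolding cmod_power2
  using L2_Re[OF assms] L2_Im[OF assms] by (intro Bochner_Integration.integral_add) (auto simp: L2_def)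

lemma helmholtz_energy:
  assumes h: "helmholtz_inverse k \<omega> \<psi>" and L\<omega>: "L2 \<omega>" and k: "k \<noteq> 0"
  shows "(LBINT y. (cmod (\<psi> y))\<^sup>2) \<le> (LBINT y. (cmod (\<omega> y))\<^sup>2)"
proof -
  define \<kappa> where "\<kappa> = (of_int k :: real)\<^sup>2"
  \<comment> \<open>A nonzero integer has square at least 1, so the inverse operator has norm at
    most 1, the form in which the estimate enters the energy method for the evolution.\<close>
  have "1 \<le> k\<^sup>2" using k by (simp add: int_one_le_iff_zero_less)
  then have \<kappa>: "\<kappa> \<ge> 1" unfolding \<kappa>_def by (metis of_int_1_le_iff of_int_power)
  obtain \<psi>1 \<psi>2 where w: "L2_weak_deriv \<psi> \<psi>1" "L2_weak_deriv \<psi>1 \<psi>2"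
    and eq: "AE y in lborel. \<psi>2 y - (of_int k)\<^sup>2 * \<psi> y = \<omega> y"
    using h by (auto simp: helmholtz_inverse_def)
  have L: "L2 \<psi>" using w by (auto simp: L2_weak_deriv_def)
  have kk: "(of_int k :: complex)\<^sup>2 = of_real \<kappa>" by (simp add: \<kappa>_def)
  have "AE y in lborel. Re (\<psi>2 y) - \<kappa> * Re (\<psi> y) = Re (\<omega> y)"
    using eq unfolding kk by eventually_elim (drule arg_cong[where f=Re], simp)
  moreover have "AE y in lborel. Im (\<psi>2 y) - \<kappa> * Im (\<psi> y) = Im (\<omega> y)"
    using eq unfolding kk by eventually_elim (drule arg_cong[where f=Im], simp)
  ultimately have re: "AE y in lborel. Re (\<psi>2 y) - \<kappa> * Re (\<psi> y) = Re (\<omega> y)" "AE y in lborel. Im (\<psi>2 y) - \<kappa> * Im (\<psi> y) = Im (\<omega> y)"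
    by auto
  from helmholtz_energy_real[OF weak_deriv_Re[OF w(1)] weak_deriv_Re[OF w(2)] L2_Re[OF L\<omega>] re(1)]
    helmholtz_energy_real[OF weak_deriv_Im[OF w(1)] weak_deriv_Im[OF w(2)] L2_Im[OF L\<omega>] re(2)] \<kappa>
  have "\<kappa>\<^sup>2 * (LBINT y. (cmod (\<psi> y))\<^sup>2) \<le> (LBINT y. (cmod (\<omega> y))\<^sup>2)"
    by (simp add: integral_cmod_square L L\<omega> algebra_simps)
  moreover have "1 * (LBINT y. (cmod (\<psi> y))\<^sup>2) \<le> \<kappa>\<^sup>2 * (LBINT y. (cmod (\<psi> y))\<^sup>2)"
    using \<kappa> by (intro mult_right_mono) auto
  ultimately show ?thesis by simp
qed

section \<open>Classical derivatives of \<open>b''\<close>\<close>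

text \<open>Every derivative is gauge integrable and integrates back to its primitive, and the gauge
  integral ignores negligible sets. Hence \<open>f\<close> is a primitive of the continuous
  \<open>g\<close>, and almost-everywhere identities for \<open>b''\<close> become pointwise
  ones.\<close>

lemma has_real_derivative_AE_continuous:
  fixes f f' g :: "real \<Rightarrow> real"
  assumes d: "\<And>y. (f has_real_derivative f' y) (at y)" and e: "AE y in lborel. f' y = g y" and c: "continuous_on UNIV g"
  shows "f' = g"
proof
  obtain G where G: "\<And>y. (G has_real_derivative g y) (at y)" "G 0 = 0"
    using ex_primitive[OF c] by blast
  have "negligible {y. f' y \<noteq> g y}"
    using e by (simp add: AE_iff_null_sets null_sets_completion_iff negligible_iff_null_sets eventually_ae_filter)
      (metis (mono_tags, lifting) completion.complete2 mem_Collect_eq null_sets_completionI subsetI)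
  then have *: "f b - f a = G b - G a" if "a \<le> b" for a b
  proof -
    have "(f' has_integral (f b - f a)) {a..b}" "(g has_integral (G b - G a)) {a..b}"
      using that
      by (auto intro!: fundamental_theorem_of_calculus has_vector_derivative_at_within
        d[unfolded has_real_derivative_iff_has_vector_derivative] G(1)[unfolded has_real_derivative_iff_has_vector_derivative])
    moreover have "(f' has_integral (G b - G a)) {a..b}"
      using \<open>negligible _\<close> by (rule has_integral_spike[OF _ _ calculation(2)]) auto
    ultimately show ?thesis by (metis has_integral_unique)
  qed
  have e2: "(\<lambda>y. G y + f 0) = f"
  proof
    fix y show "G y + f 0 = f y"
      using *[of 0 y] *[of y 0] G(2) by (cases "0 \<le> y") force+
  qed
  fix y
  have "((\<lambda>y. G y + f 0) has_real_derivative g y) (at y)"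
    by (auto intro!: derivative_eq_intros G)
  then have "(f has_real_derivative g y) (at y)" unfolding e2 .
  then show "f' y = g y" using d DERIV_unique by blast
qed

text \<open>The one-dimensional embedding of \<open>H^4\<close> into \<open>C^3\<close>, read from
  the top: the third weak derivative is continuous because it has a weak derivative itself, and each
  lower one is a \<open>C^1\<close> primitive of the next. At the bottom \<open>f'\<close> is a
  derivative and so equals its continuous representative everywhere.\<close>

lemma Sobolev_H4_regular:
  fixes f f' :: "real \<Rightarrow> real"
  assumes d: "\<And>y. (f has_real_derivative f' y) (at y)" and S: "Sobolev_H 4 f'"
  obtains d1 d2 d3 where "\<And>y. (f' has_real_derivative d1 y) (at y)" "\<And>y. (d1 has_real_derivative d2 y) (at y)"
    "\<And>y. (d2 has_real_derivative d3 y) (at y)" "continuous_on UNIV d3" "L2 f'" "L2 d1"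
proof -
  obtain f1 f2 f3 f4 where f: "L2_weak_deriv f' f1" "L2_weak_deriv f1 f2" "L2_weak_deriv f2 f3" "L2_weak_deriv f3 f4"
    using S by (auto simp: numeral_eq_Suc)
  obtain d3 where d3: "continuous_on UNIV d3" "AE y in lborel. f3 y = d3 y"
    using weak_deriv_primitive[OF f(4)] by blast
  obtain d2 where d2: "\<forall>y. (d2 has_real_derivative d3 y) (at y)" "AE y in lborel. f2 y = d2 y"
    using weak_deriv_C1_representative[OF f(3) d3(2,1)] by blast
  have c2: "continuous_on UNIV d2" using d2(1) DERIV_isCont by (auto simp: continuous_on_eq_continuous_at)
  obtain d1 where d1: "\<forall>y. (d1 has_real_derivative d2 y) (at y)" "AE y in lborel. f1 y = d1 y"
    using weak_deriv_C1_representative[OF f(2) d2(2) c2] by blast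
  have c1: "continuous_on UNIV d1" using d1(1) DERIV_isCont by (auto simp: continuous_on_eq_continuous_at)
  obtain d0 where d0: "\<forall>y. (d0 has_real_derivative d1 y) (at y)" "AE y in lborel. f' y = d0 y"
    using weak_deriv_C1_representative[OF f(1) d1(2) c1] by blast
  have c0: "continuous_on UNIV d0" using d0(1) DERIV_isCont by (auto simp: continuous_on_eq_continuous_at)
  have e: "f' = d0" by (rule has_real_derivative_AE_continuous[OF d d0(2) c0])
  have "L2 f'" "L2 f1" using f by (auto simp: L2_weak_deriv_def)
  moreover have "L2 d1" by (rule L2_cong_AE[OF \<open>L2 f1\<close> d1(2)]) (simp add: c1 borel_measurable_continuous_onI)
  ultimately show thesis using d0(1) d1(1) d2(1) d3(1) e by (intro that[of d1 d2 d3]) auto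
qed

section \<open>The singular equation for \<open>\<phi>\<^sub>1\<close>\<close>

text \<open>For either sign, \<open>K / l * exp (l * |s - a|)\<close> minus
  \<open>\<plusminus> H\<close> is monotone away from \<open>a\<close>. Keeping the exponential in
  hypothesis and conclusion lets each further integration gain a factor
  \<open>1 / l\<close>.\<close>

lemma exp_comparison:
  fixes H h :: "real \<Rightarrow> real"
  assumes d: "\<And>s. (H has_real_derivative h s) (at s)" and H: "H a = 0" and l: "l > 0"
    and b: "\<And>s. s \<in> closed_segment a y \<Longrightarrow> \<bar>h s\<bar> \<le> K * exp (l * \<bar>s - a\<bar>)"
  shows "\<bar>H y\<bar> \<le> K / l * (exp (l * \<bar>y - a\<bar>) - 1)"
proof -
  have seg: "\<bar>h s\<bar> \<le> K * exp (l * \<bar>s - a\<bar>)" if "a \<le> s \<and> s \<le> y \<or> y \<le> s \<and> s \<le> a" for s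
    using that by (intro b) (auto simp: closed_segment_eq_real_ivl)
  have "\<sigma> * H y \<le> K / l * (exp (l * \<bar>y - a\<bar>) - 1)" if \<sigma>: "\<sigma> = 1 \<or> \<sigma> = -1" for \<sigma> :: real
  proof (cases "a \<le> y")
    case True
    have "K / l * exp (l * (a - a)) - \<sigma> * H a \<le> K / l * exp (l * (y - a)) - \<sigma> * H y"
    proof (rule DERIV_nonneg_imp_nondecreasing[OF True])
      fix s assume s: "a \<le> s" "s \<le> y"
      have "((\<lambda>s. K / l * exp (l * (s - a)) - \<sigma> * H s) has_real_derivative K * exp (l * (s - a)) - \<sigma> * h s) (at s)"
        using l by (auto intro!: derivative_eq_intros d)
      moreover have "0 \<le> K * exp (l * (s - a)) - \<sigma> * h s" using seg[of s] s \<sigma> by auto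
      ultimately show "\<exists>D. ((\<lambda>s. K / l * exp (l * (s - a)) - \<sigma> * H s) has_real_derivative D) (at s) \<and> 0 \<le> D" by blast
    qed
    then show ?thesis using True H by (simp add: algebra_simps)
  next
    case False
    then have le: "y \<le> a" by simp
    have "K / l * exp (l * (a - y)) - \<sigma> * H y \<ge> K / l * exp (l * (a - a)) - \<sigma> * H a"
    proof (rule DERIV_nonpos_imp_nonincreasing[OF le])
      fix s assume s: "y \<le> s" "s \<le> a"
      have "((\<lambda>s. K / l * exp (l * (a - s)) - \<sigma> * H s) has_real_derivative - (K * exp (l * (a - s))) - \<sigma> * h s) (at s)"
        using l by (auto intro!: derivative_eq_intros d)
      moreover have "- (K * exp (l * (a - s))) - \<sigma> * h s \<le> 0" using seg[of s] s \<sigma> by auto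
      ultimately show "\<exists>D. ((\<lambda>s. K / l * exp (l * (a - s)) - \<sigma> * H s) has_real_derivative D) (at s) \<and> D \<le> 0" by blast
    qed
    then show ?thesis using False H by (simp add: algebra_simps)
  qed
  from this[of 1] this[of "-1"] show ?thesis by auto
qed

lemma exp_minus_one_le: "exp t - 1 \<le> t * exp t" for t :: real
  using exp_ge_add_one_self[of "-t"] mult_right_mono[of "1 - t" "exp (-t)" "exp t"]
  by (simp add: exp_minus algebra_simps)

section \<open>Monotone profiles and the Volterra equation at a critical point\<close>

locale shear =
  fixes b b' :: "real \<Rightarrow> real" and m :: real
  assumes m_pos: "0 < m"
    and b_deriv: "\<And>y. (b has_real_derivative b' y) (at y)"
    and b'_lower: "\<And>y. m \<le> b' y" and b'_upper: "\<And>y. b' y \<le> 1 / m"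
begin

lemma b'_pos: "0 < b' y"
  using b'_lower[of y] m_pos by linarith

lemma b_continuous: "continuous_on A b"
  by (intro continuous_at_imp_continuous_on ballI DERIV_isCont[OF b_deriv])

lemma b_diff_bounds:
  assumes "y \<le> z"
  shows "m * (z - y) \<le> b z - b y" "b z - b y \<le> (z - y) / m"
proof -
  have "b z - b y = 0 \<and> z = y \<or> (\<exists>x. b z - b y = (z - y) * b' x)"
    using assms MVT2[of y z b b'] b_deriv by (cases "y = z") (auto simp: le_less)
  then show "m * (z - y) \<le> b z - b y" "b z - b y \<le> (z - y) / m"
    using assms b'_lower b'_upper mult_left_mono[of m _ "z - y"] mult_left_mono[of _ "1/m" "z - y"]
    by (auto simp: mult.commute)
qed

lemma abs_b_diff_bounds: "m * \<bar>z - y\<bar> \<le> \<bar>b z - b y\<bar>" "\<bar>b z - b y\<bar> \<le> \<bar>z - y\<bar> / m"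
  using b_diff_bounds[of y z] b_diff_bounds[of z y] m_pos
    mult_nonneg_nonneg[of m "z - y"] mult_nonneg_nonneg[of m "y - z"]
  by (cases "y \<le> z"; auto simp: abs_if minus_divide_left; linarith)+

lemma b_eq_iff: "b z = b y \<longleftrightarrow> z = y"
  using abs_b_diff_bounds(1)[of z y] m_pos by (auto simp: mult_le_0_iff)

lemma b_less_iff: "b z < b y \<longleftrightarrow> z < y"
proof (cases "z < y")
  case True
  then have "0 < m * (y - z)" using m_pos by simp
  then show ?thesis using b_diff_bounds(1)[of z y] True by linarith
next
  case False
  then have "0 \<le> m * (z - y)" using m_pos by simp
  then show ?thesis using b_diff_bounds(1)[of y z] False by linarith
qed

lemma b_le_iff: "b z \<le> b y \<longleftrightarrow> z \<le> y"
  using b_less_iff[of y z] by auto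

lemma b_inv: "b (inv b c) = c"
proof -
  define R where "R = \<bar>c - b 0\<bar> / m"
  have R: "R \<ge> 0" "m * R = \<bar>c - b 0\<bar>" using m_pos by (auto simp: R_def)
  have "b (-R) \<le> c" "c \<le> b R"
    using b_diff_bounds(1)[of "-R" 0] b_diff_bounds(1)[of 0 R] R by auto
  then have "\<exists>y\<ge>-R. y \<le> R \<and> b y = c"
    using R b_continuous by (intro IVT') auto
  then have "c \<in> range b" by auto
  then show ?thesis by (rule f_inv_into_f)
qed

lemma inv_b: "inv b (b y) = y"
  using b_inv b_eq_iff by blast

end

locale critical_point = shear +
  fixes a :: real and \<kappa> :: real
  assumes \<kappa>_pos: "\<kappa> > 0"
begin

definition w :: "real \<Rightarrow> real" where "w y = (b y - b a)\<^sup>2"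

lemma w_a: "w a = 0" by (simp add: w_def)

lemma w_nonneg: "0 \<le> w y" by (simp add: w_def)

lemma w_pos: "y \<noteq> a \<Longrightarrow> 0 < w y" by (simp add: w_def b_eq_iff)

lemma w_continuous: "continuous_on A w"
  unfolding w_def by (intro continuous_intros b_continuous)

lemma w_mono:
  assumes "s \<in> closed_segment a y"
  shows "w s \<le> w y"
proof -
  have "a \<le> s \<and> s \<le> y \<or> y \<le> s \<and> s \<le> a"
    using assms by (auto simp: closed_segment_eq_real_ivl split: if_splits)
  then have "\<bar>b s - b a\<bar> \<le> \<bar>b y - b a\<bar>"
    using b_le_iff[of a s] b_le_iff[of s y] b_le_iff[of y s] b_le_iff[of s a] by (auto simp: abs_if)
  then show ?thesis unfolding w_def by (simp add: abs_le_square_iff)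
qed

definition is_sol :: "(real \<Rightarrow> real) \<Rightarrow> (real \<Rightarrow> real) \<Rightarrow> bool" where
  "is_sol \<phi> \<phi>' \<longleftrightarrow> (\<forall>y. (\<phi> has_real_derivative \<phi>' y) (at y)) \<and>
     (\<forall>y. ((\<lambda>z. w z * \<phi>' z) has_real_derivative \<kappa> * w y * \<phi> y) (at y))"

text \<open>The rate of the exponential weight. Two integrations of the equation gain
  \<open>\<kappa> / lam\<^sup>2\<close>, and this rate makes the gain exactly one half, the
  contraction constant below.\<close>

definition lam :: real where "lam = sqrt (2 * \<kappa>)"

lemma lam_pos: "lam > 0" and lam_square: "\<kappa> / lam / lam = 1 / 2"
  using \<kappa>_pos by (auto simp: lam_def divide_divide_eq_left)

text \<open>The weight \<open>w\<close> increases away from \<open>a\<close>, so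
  \<open>w s \<le> w y\<close> under the integral and \<open>w y\<close> comes out as a factor. This
  prepares the division by \<open>w\<close>, which vanishes at \<open>a\<close>.\<close>

lemma flux_bound:
  assumes d: "\<And>y. (g has_real_derivative \<kappa> * w y * \<phi> y) (at y)" and g: "g a = 0"
    and b: "\<And>s. s \<in> closed_segment a y \<Longrightarrow> \<bar>\<phi> s\<bar> \<le> M * exp (lam * \<bar>s - a\<bar>)"
  shows "\<bar>g y\<bar> \<le> w y * (\<kappa> * M / lam * (exp (lam * \<bar>y - a\<bar>) - 1))"
proof -
  have "\<bar>g y\<bar> \<le> (\<kappa> * w y * M) / lam * (exp (lam * \<bar>y - a\<bar>) - 1)"
  proof (rule exp_comparison[OF d g lam_pos])
    fix s assume s: "s \<in> closed_segment a y"
    have "\<bar>\<kappa> * w s * \<phi> s\<bar> = \<kappa> * w s * \<bar>\<phi> s\<bar>"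
      using \<kappa>_pos w_nonneg[of s] by (simp add: abs_mult)
    also have "\<dots> \<le> \<kappa> * w y * (M * exp (lam * \<bar>s - a\<bar>))"
      using \<kappa>_pos w_nonneg w_mono[OF s] b[OF s] by (intro mult_mono mult_nonneg_nonneg) auto
    finally show "\<bar>\<kappa> * w s * \<phi> s\<bar> \<le> \<kappa> * w y * M * exp (lam * \<bar>s - a\<bar>)" by simp
  qed
  then show ?thesis by (simp add: mult_ac)
qed

lemma slope_bound:
  assumes d: "\<And>y. ((\<lambda>z. w z * h z) has_real_derivative \<kappa> * w y * \<phi> y) (at y)" and h: "h a = 0"
    and b: "\<And>s. s \<in> closed_segment a y \<Longrightarrow> \<bar>\<phi> s\<bar> \<le> M * exp (lam * \<bar>s - a\<bar>)"
  shows "\<bar>h y\<bar> \<le> \<kappa> * M / lam * (exp (lam * \<bar>y - a\<bar>) - 1)"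
proof (cases "y = a")
  case False
  have "w y * \<bar>h y\<bar> \<le> w y * (\<kappa> * M / lam * (exp (lam * \<bar>y - a\<bar>) - 1))"
    using flux_bound[where y=y and g="\<lambda>z. w z * h z", OF d _ b] h w_nonneg[of y] by (simp add: abs_mult w_a)
  then show ?thesis using w_pos[OF False] by (rule mult_left_le_imp_le)
qed (use h in simp)

text \<open>Integrating the slope bound once more produces the factor
  \<open>\<kappa> / lam / lam = 1 / 2\<close>. In the norm weighted by
  \<open>exp (lam * |y - a|)\<close> the linear Volterra operator taking \<open>\<phi>\<close> to
  \<open>H\<close> is therefore a contraction, from which both uniqueness and existence
  follow.\<close>

lemma volterra_bound:
  assumes d: "\<And>y. ((\<lambda>z. w z * h z) has_real_derivative \<kappa> * w y * \<phi> y) (at y)" and h: "h a = 0"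
    and D: "\<And>y. (H has_real_derivative h y) (at y)" and H: "H a = 0"
    and b: "\<And>s. s \<in> closed_segment a y \<Longrightarrow> \<bar>\<phi> s\<bar> \<le> M * exp (lam * \<bar>s - a\<bar>)"
  shows "\<bar>H y\<bar> \<le> M / 2 * exp (lam * \<bar>y - a\<bar>)"
proof -
  have M: "0 \<le> M" using b[of a] abs_ge_zero[of "\<phi> a"] by (simp del: abs_ge_zero)
  have "\<bar>H y\<bar> \<le> (\<kappa> * M / lam) / lam * (exp (lam * \<bar>y - a\<bar>) - 1)"
  proof (rule exp_comparison[OF D H lam_pos])
    fix s assume s: "s \<in> closed_segment a y"
    have "closed_segment a s \<subseteq> closed_segment a y" using s by (simp add: subset_closed_segment)
    then have "\<bar>h s\<bar> \<le> \<kappa> * M / lam * (exp (lam * \<bar>s - a\<bar>) - 1)"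
      by (intro slope_bound[OF d h] b) auto
    also have "\<dots> \<le> \<kappa> * M / lam * exp (lam * \<bar>s - a\<bar>)"
      using M \<kappa>_pos lam_pos by (intro mult_left_mono) auto
    finally show "\<bar>h s\<bar> \<le> \<kappa> * M / lam * exp (lam * \<bar>s - a\<bar>)" .
  qed
  also have "\<dots> = (\<kappa> / lam / lam) * M * (exp (lam * \<bar>y - a\<bar>) - 1)" by simp
  also have "\<dots> \<le> M / 2 * exp (lam * \<bar>y - a\<bar>)"
    unfolding lam_square using M by (simp add: algebra_simps)
  finally show ?thesis .
qed

lemma is_sol_unique:
  assumes s1: "is_sol \<phi>1 \<phi>1'" and s2: "is_sol \<phi>2 \<phi>2'"
    and a: "\<phi>1 a = \<phi>2 a" "\<phi>1' a = 0" "\<phi>2' a = 0"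
  shows "\<phi>1 = \<phi>2"
proof
  fix y
  define d where "d y = \<phi>1 y - \<phi>2 y" for y
  define d' where "d' y = \<phi>1' y - \<phi>2' y" for y
  have dd: "(d has_real_derivative d' y) (at y)" for y
    using s1 s2 unfolding d_def d'_def is_sol_def by (intro derivative_intros) auto
  have "((\<lambda>z. w z * \<phi>1' z - w z * \<phi>2' z) has_real_derivative \<kappa> * w y * \<phi>1 y - \<kappa> * w y * \<phi>2 y) (at y)" for y
    using s1 s2 unfolding is_sol_def by (intro derivative_intros) auto
  then have wd: "((\<lambda>z. w z * d' z) has_real_derivative \<kappa> * w y * d y) (at y)" for y
    by (simp add: d_def d'_def algebra_simps)
  have "continuous_on (closed_segment a y) d"
    by (intro continuous_at_imp_continuous_on ballI DERIV_isCont[OF dd])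
  then have "bounded (d ` closed_segment a y)"
    by (intro compact_imp_bounded compact_continuous_image) auto
  then obtain M where M: "\<And>s. s \<in> closed_segment a y \<Longrightarrow> \<bar>d s\<bar> \<le> M"
    unfolding bounded_iff by auto
  \<comment> \<open>The difference of two solutions is a fixed point of the linear Volterra
    operator, so its bound can be halved indefinitely.\<close>
  have "\<bar>d s\<bar> \<le> M / 2 ^ n * exp (lam * \<bar>s - a\<bar>)" if "s \<in> closed_segment a y" for s n
    using that
  proof (induction n arbitrary: s)
    case 0
    have "0 \<le> M" using M[of a] abs_ge_zero[of "d a"] by (simp del: abs_ge_zero)
    then have "M * 1 \<le> M * exp (lam * \<bar>s - a\<bar>)" using lam_pos by (intro mult_left_mono) auto
    then show ?case using M[OF 0] by simp
  next
    case (Suc n)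
    have "closed_segment a s \<subseteq> closed_segment a y" using Suc.prems by (simp add: subset_closed_segment)
    then have "\<bar>d s\<bar> \<le> (M / 2 ^ n) / 2 * exp (lam * \<bar>s - a\<bar>)"
      using a Suc.IH by (intro volterra_bound[OF wd _ dd]) (auto simp: d_def d'_def)
    then show ?case by simp
  qed
  then have "\<bar>d y\<bar> \<le> (1 / 2) ^ n * (M * exp (lam * \<bar>y - a\<bar>))" for n
    by (simp add: power_divide)
  moreover have "(\<lambda>n. (1 / 2) ^ n * (M * exp (lam * \<bar>y - a\<bar>))) \<longlonglongrightarrow> 0 * (M * exp (lam * \<bar>y - a\<bar>))"
    by (intro tendsto_intros LIMSEQ_realpow_zero) auto
  ultimately have "\<bar>d y\<bar> \<le> 0 * (M * exp (lam * \<bar>y - a\<bar>))"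
    by (intro LIMSEQ_le_const) auto
  then show "\<phi>1 y = \<phi>2 y" by (simp add: d_def)
qed

definition prim :: "(real \<Rightarrow> real) \<Rightarrow> real \<Rightarrow> real" where
  "prim h = (SOME H. (\<forall>y. (H has_real_derivative h y) (at y)) \<and> H a = 0)"

lemma prim:
  assumes "continuous_on UNIV h"
  shows "(prim h has_real_derivative h y) (at y)" "prim h a = 0"
proof -
  obtain H where "\<And>y. (H has_real_derivative h y) (at y)" "H a = 0"
    using ex_primitive[OF assms] by blast
  then have "\<exists>H. (\<forall>y. (H has_real_derivative h y) (at y)) \<and> H a = 0" by blast
  from someI_ex[OF this] show "(prim h has_real_derivative h y) (at y)" "prim h a = 0"
    unfolding prim_def by auto
qed

text \<open>The slope at \<open>a\<close> is \<open>0 / 0 = 0\<close>, which is the correct value.\<close>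

definition slope :: "(real \<Rightarrow> real) \<Rightarrow> real \<Rightarrow> real" where
  "slope \<phi> y = prim (\<lambda>y. \<kappa> * w y * \<phi> y) y / w y"

lemma slope_a: "slope \<phi> a = 0"
  by (simp add: slope_def w_a)

lemma slope_deriv:
  assumes "continuous_on UNIV \<phi>"
  shows "((\<lambda>z. w z * slope \<phi> z) has_real_derivative \<kappa> * w y * \<phi> y) (at y)"
proof -
  have c: "continuous_on UNIV (\<lambda>y. \<kappa> * w y * \<phi> y)" by (intro continuous_intros w_continuous assms)
  have "w z * slope \<phi> z = prim (\<lambda>y. \<kappa> * w y * \<phi> y) z" for z
    using prim(2)[OF c] w_pos[of z] by (cases "z = a") (auto simp: slope_def w_a)
  then show ?thesis using prim(1)[OF c] by simp
qed

text \<open>Only the point \<open>a\<close> is delicate. There \<open>slope_bound\<close>, fed with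
  a bound of \<open>\<phi>\<close> on a neighbourhood, forces the quotient to 0, the value it has at
  \<open>a\<close> by \<open>slope_a\<close>.\<close>

lemma slope_continuous:
  assumes c: "continuous_on UNIV \<phi>"
  shows "continuous_on UNIV (slope \<phi>)"
  unfolding continuous_on_eq_continuous_at[OF open_UNIV]
proof
  have cw: "continuous_on UNIV (\<lambda>y. \<kappa> * w y * \<phi> y)" by (intro continuous_intros w_continuous c)
  fix y show "isCont (slope \<phi>) y"
  proof (cases "y = a")
    case False
    then show ?thesis unfolding slope_def
      using w_pos[OF False] DERIV_isCont[OF prim(1)[OF cw]] w_continuous[of UNIV]
      by (intro continuous_intros) (auto simp: continuous_on_eq_continuous_at)
  next
    case True
    have "bounded (\<phi> ` {a-1..a+1})"
      by (intro compact_imp_bounded compact_continuous_image continuous_on_subset[OF c]) auto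
    then obtain M where M: "\<And>s. s \<in> {a-1..a+1} \<Longrightarrow> \<bar>\<phi> s\<bar> \<le> M"
      unfolding bounded_iff by (metis imageI real_norm_def)
    have M0: "0 \<le> M" using M[of a] abs_ge_zero[of "\<phi> a"] by (simp del: abs_ge_zero)
    have "\<bar>slope \<phi> s\<bar> \<le> \<kappa> * M / lam * (exp (lam * \<bar>s - a\<bar>) - 1)" if s: "s \<in> {a-1<..<a+1}" for s
    proof (rule slope_bound[OF slope_deriv[OF c] slope_a])
      fix t assume "t \<in> closed_segment a s"
      then have "\<bar>\<phi> t\<bar> \<le> M * 1" using s M[of t] by (auto simp: closed_segment_eq_real_ivl split: if_splits)
      also have "\<dots> \<le> M * exp (lam * \<bar>t - a\<bar>)" using lam_pos M0 by (intro mult_left_mono) auto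
      finally show "\<bar>\<phi> t\<bar> \<le> M * exp (lam * \<bar>t - a\<bar>)" .
    qed
    then have "eventually (\<lambda>s. norm (slope \<phi> s) \<le> \<kappa> * M / lam * (exp (lam * \<bar>s - a\<bar>) - 1)) (at a)"
      unfolding eventually_at_topological by (intro exI[of _ "{a-1<..<a+1}"]) auto
    moreover have "((\<lambda>s. \<kappa> * M / lam * (exp (lam * \<bar>s - a\<bar>) - 1)) \<longlongrightarrow> \<kappa> * M / lam * (exp (lam * \<bar>a - a\<bar>) - 1)) (at a)"
      by (intro tendsto_intros)
    ultimately have "(slope \<phi> \<longlongrightarrow> 0) (at a)"
      by (intro Lim_null_comparison[of "slope \<phi>"]) auto
    then show ?thesis by (simp add: isCont_def True slope_a)
  qed
qed

text \<open>Solutions may grow exponentially, so the unknown is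
  \<open>f = \<phi> / exp (lam * |y - a|)\<close>, sought among bounded continuous functions. The
  map is \<open>\<phi> \<mapsto> 1 + prim (slope \<phi>)\<close> conjugated by the weight, which
  turns the weighted contraction into one in the supremum norm.\<close>

definition volterra :: "(real \<Rightarrow>\<^sub>C real) \<Rightarrow> real \<Rightarrow> real" where
  "volterra f y = (1 + prim (slope (\<lambda>s. exp (lam * \<bar>s - a\<bar>) * f s)) y) / exp (lam * \<bar>y - a\<bar>)"

lemma weighted_continuous: "continuous_on UNIV (\<lambda>s. exp (lam * \<bar>s - a\<bar>) * apply_bcontfun f s)"
  for f :: "real \<Rightarrow>\<^sub>C real"
  by (intro continuous_intros continuous_on_apply_bcontfun)

lemma volterra_bcontfun: "volterra f \<in> bcontfun"
proof (rule bcontfun_normI)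
  let ?\<phi> = "\<lambda>s. exp (lam * \<bar>s - a\<bar>) * f s"
  note c = weighted_continuous[of f]
  note sc = slope_continuous[OF c]
  have "continuous_on UNIV (prim (slope ?\<phi>))"
    using DERIV_isCont[OF prim(1)[OF sc]] by (auto simp: continuous_on_eq_continuous_at)
  then show "continuous_on UNIV (volterra f)"
    unfolding volterra_def by (intro continuous_intros) auto
  fix y
  have "\<bar>prim (slope ?\<phi>) y\<bar> \<le> norm f / 2 * exp (lam * \<bar>y - a\<bar>)"
  proof (rule volterra_bound[OF slope_deriv[OF c] slope_a prim(1)[OF sc] prim(2)[OF sc]])
    show "\<bar>exp (lam * \<bar>s - a\<bar>) * f s\<bar> \<le> norm f * exp (lam * \<bar>s - a\<bar>)" for s
      using norm_bounded[of f s] by (simp add: abs_mult mult.commute)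
  qed
  then have "\<bar>1 + prim (slope ?\<phi>) y\<bar> \<le> 1 + norm f / 2 * exp (lam * \<bar>y - a\<bar>)" by linarith
  also have "\<dots> \<le> (1 + norm f / 2) * exp (lam * \<bar>y - a\<bar>)" using lam_pos by (simp add: algebra_simps)
  finally show "norm (volterra f y) \<le> 1 + norm f / 2"
    by (simp add: volterra_def divide_le_eq)
qed

lemma is_sol_exists: "\<exists>\<phi> \<phi>'. is_sol \<phi> \<phi>' \<and> \<phi> a = 1 \<and> \<phi>' a = 0"
proof -
  have "\<exists>!f. Bcontfun (volterra f) = f"
  proof (rule banach_fix_type[where c="1/2"])
    show "\<forall>f g. dist (Bcontfun (volterra f)) (Bcontfun (volterra g)) \<le> 1/2 * dist f g"
    proof (intro allI)
      fix f g
      let ?\<phi> = "\<lambda>f s. exp (lam * \<bar>s - a\<bar>) * apply_bcontfun f s"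
      let ?P = "\<lambda>f. prim (slope (?\<phi> f))"
      note c = weighted_continuous
      note sc = slope_continuous[OF c]
      show "dist (Bcontfun (volterra f)) (Bcontfun (volterra g)) \<le> 1/2 * dist f g"
      proof (rule dist_bound)
        fix y
        have "\<bar>?P f y - ?P g y\<bar> \<le> dist f g / 2 * exp (lam * \<bar>y - a\<bar>)"
        proof (rule volterra_bound[where h="\<lambda>y. slope (?\<phi> f) y - slope (?\<phi> g) y" and \<phi>="\<lambda>s. ?\<phi> f s - ?\<phi> g s"])
          show "((\<lambda>z. w z * (slope (?\<phi> f) z - slope (?\<phi> g) z)) has_real_derivative \<kappa> * w y * (?\<phi> f y - ?\<phi> g y)) (at y)" for y
            using DERIV_diff[OF slope_deriv[OF c[of f], of y] slope_deriv[OF c[of g], of y]]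
            by (simp add: algebra_simps)
          show "((\<lambda>y. ?P f y - ?P g y) has_real_derivative slope (?\<phi> f) y - slope (?\<phi> g) y) (at y)" for y
            by (intro derivative_intros prim sc)
          show "\<bar>?\<phi> f s - ?\<phi> g s\<bar> \<le> dist f g * exp (lam * \<bar>s - a\<bar>)" for s
            using dist_bounded[of f s g] unfolding right_diff_distrib[symmetric] abs_mult
            by (simp add: dist_real_def mult.commute)
        qed (auto simp: slope_a prim(2)[OF sc])
        moreover have "dist (volterra f y) (volterra g y) = \<bar>?P f y - ?P g y\<bar> / exp (lam * \<bar>y - a\<bar>)"
          by (simp add: volterra_def dist_real_def flip: diff_divide_distrib)
        ultimately show "dist (apply_bcontfun (Bcontfun (volterra f)) y) (apply_bcontfun (Bcontfun (volterra g)) y) \<le> 1/2 * dist f g"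
          by (simp add: Bcontfun_inverse volterra_bcontfun divide_le_eq)
      qed
    qed
  qed auto
  then obtain f where "Bcontfun (volterra f) = f" by blast
  then have f: "apply_bcontfun f = volterra f"
    using Bcontfun_inverse[OF volterra_bcontfun[of f]] by simp
  define \<phi> where "\<phi> s = exp (lam * \<bar>s - a\<bar>) * f s" for s
  have c: "continuous_on UNIV \<phi>" unfolding \<phi>_def by (rule weighted_continuous)
  have e: "\<phi> y = 1 + prim (slope \<phi>) y" for y
  proof -
    have "\<phi> y = exp (lam * \<bar>y - a\<bar>) * volterra f y" unfolding \<phi>_def f ..
    then show ?thesis unfolding volterra_def \<phi>_def[symmetric] by simp
  qed
  note sc = slope_continuous[OF c]
  have "((\<lambda>y. 1 + prim (slope \<phi>) y) has_real_derivative slope \<phi> y) (at y)" for y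
    using DERIV_add[OF DERIV_const[of 1] prim(1)[OF sc, of y]] by simp
  then have "(\<phi> has_real_derivative slope \<phi> y) (at y)" for y
    unfolding e[abs_def, symmetric] .
  then have "is_sol \<phi> (slope \<phi>)" unfolding is_sol_def using slope_deriv[OF c] by blast
  moreover have "\<phi> a = 1" using e[of a] prim(2)[OF sc] by simp
  ultimately show ?thesis using slope_a by blast
qed

end

context critical_point
begin

text \<open>The product \<open>w * \<phi>' * \<phi>\<close> has a nonnegative derivative and
  vanishes at \<open>a\<close>, so \<open>\<phi> * \<phi>'\<close> has the sign of
  \<open>y - a\<close> and \<open>\<phi>\<^sup>2 \<ge> 1\<close>. A value of \<open>\<phi>\<close>
  below 1 would then be at most -1 and force a zero between it and \<open>a\<close>, which is
  impossible.\<close>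

lemma sol_sign:
  assumes s: "is_sol \<phi> \<phi>'" and a: "\<phi> a = 1" "\<phi>' a = 0"
  shows "1 \<le> \<phi> y" "a \<le> y \<Longrightarrow> 0 \<le> \<phi>' y" "y \<le> a \<Longrightarrow> \<phi>' y \<le> 0"
proof -
  have d: "(\<phi> has_real_derivative \<phi>' y) (at y)" for y using s by (simp add: is_sol_def)
  have wd: "((\<lambda>z. w z * \<phi>' z) has_real_derivative \<kappa> * w y * \<phi> y) (at y)" for y using s by (simp add: is_sol_def)
  define P where "P y = w y * \<phi>' y * \<phi> y" for y
  have P: "(P has_real_derivative (\<kappa> * w y * \<phi> y) * \<phi> y + \<phi>' y * (w y * \<phi>' y)) (at y)" for y
    unfolding P_def by (rule DERIV_mult[OF wd d])
  have P0: "0 \<le> (\<kappa> * w y * \<phi> y) * \<phi> y + \<phi>' y * (w y * \<phi>' y)" for y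
  proof -
    have "(\<kappa> * w y * \<phi> y) * \<phi> y + \<phi>' y * (w y * \<phi>' y) = \<kappa> * w y * (\<phi> y)\<^sup>2 + w y * (\<phi>' y)\<^sup>2"
      by (simp add: power2_eq_square)
    then show ?thesis using \<kappa>_pos w_nonneg[of y] by simp
  qed
  have Pm: "P x \<le> P z" if "x \<le> z" for x z
    using DERIV_nonneg_imp_nondecreasing[OF that, of P] P P0 by blast
  have Pa: "P a = 0" by (simp add: P_def a)
  have pos: "0 \<le> \<phi>' y * \<phi> y" if "a \<le> y" for y
    using Pm[OF that] Pa w_pos[of y] a by (cases "y = a") (auto simp: P_def mult.assoc zero_le_mult_iff)
  have neg: "\<phi>' y * \<phi> y \<le> 0" if "y \<le> a" for y
    using Pm[OF that] Pa w_pos[of y] a by (cases "y = a") (auto simp: P_def mult.assoc mult_le_0_iff)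
  have pos2: "0 \<le> 2 * (\<phi>' y * \<phi> y)" if "a \<le> y" for y using pos[OF that] by linarith
  have neg2: "2 * (\<phi>' y * \<phi> y) \<le> 0" if "y \<le> a" for y using neg[OF that] by linarith
  have sqd: "((\<lambda>y. (\<phi> y)\<^sup>2) has_real_derivative 2 * (\<phi>' y * \<phi> y)) (at y)" for y
    by (auto intro!: derivative_eq_intros d)
  have sq: "1 \<le> (\<phi> y)\<^sup>2" for y
  proof (cases "a \<le> y")
    case True
    have "(\<phi> a)\<^sup>2 \<le> (\<phi> y)\<^sup>2"
      by (rule DERIV_nonneg_imp_nondecreasing[OF True]) (rule exI, rule conjI, rule sqd, rule pos2)
    then show ?thesis by (simp add: a)
  next
    case False
    then have "y \<le> a" by simp
    then have "(\<phi> a)\<^sup>2 \<le> (\<phi> y)\<^sup>2"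
      by (rule DERIV_nonpos_imp_nonincreasing) (rule exI, rule conjI, rule sqd, rule neg2)
    then show ?thesis by (simp add: a)
  qed
  have c: "isCont \<phi> x" for x by (rule DERIV_isCont[OF d])
  have ge: "1 \<le> \<phi> y" for y
  proof (rule ccontr)
    assume n: "\<not> 1 \<le> \<phi> y"
    have "\<bar>\<phi> y\<bar> \<ge> 1" using sq[of y] abs_le_square_iff[of 1 "\<phi> y"] by simp
    then have le: "\<phi> y \<le> 0" using n by auto
    have "\<exists>z. \<phi> z = 0"
    proof (cases "a \<le> y")
      case True
      then show ?thesis using IVT2[of \<phi> y 0 a] le a c by auto
    next
      case False
      then show ?thesis using IVT[of \<phi> y 0 a] le a c by auto
    qed
    then obtain z where "\<phi> z = 0" ..
    then show False using sq[of z] by simp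
  qed
  show "1 \<le> \<phi> y" by (rule ge)
  show "0 \<le> \<phi>' y" if "a \<le> y" using pos[OF that] ge[of y] by (auto simp: zero_le_mult_iff)
  show "\<phi>' y \<le> 0" if "y \<le> a" using neg[OF that] ge[of y] by (auto simp: mult_le_0_iff)
qed

text \<open>Quadratic contact of \<open>\<phi>\<close> with 1 at \<open>a\<close> makes the second
  integrand of \<open>J1\<close> bounded there, and the linear bound on \<open>\<phi>'\<close> gives
  the limit of the boundary term in Picone's identity. Both come from \<open>slope_bound\<close>
  through \<open>exp t - 1 \<le> t * exp t\<close>.\<close>

lemma sol_near:
  assumes s: "is_sol \<phi> \<phi>'" and a: "\<phi> a = 1" "\<phi>' a = 0"
  obtains K where "K \<ge> 0" "\<And>y. \<bar>y - a\<bar> \<le> 1 \<Longrightarrow> \<bar>\<phi>' y\<bar> \<le> K * \<bar>y - a\<bar>"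
    "\<And>y. \<bar>y - a\<bar> \<le> 1 \<Longrightarrow> \<bar>\<phi> y - 1\<bar> \<le> K * (y - a)\<^sup>2"
proof -
  have d: "(\<phi> has_real_derivative \<phi>' y) (at y)" for y using s by (simp add: is_sol_def)
  have wd: "((\<lambda>z. w z * \<phi>' z) has_real_derivative \<kappa> * w y * \<phi> y) (at y)" for y using s by (simp add: is_sol_def)
  have "bounded (\<phi> ` {a-1..a+1})"
    by (intro compact_imp_bounded compact_continuous_image continuous_at_imp_continuous_on ballI DERIV_isCont[OF d]) auto
  then obtain M where M: "\<And>s. s \<in> {a-1..a+1} \<Longrightarrow> \<bar>\<phi> s\<bar> \<le> M"
    unfolding bounded_iff by (metis imageI real_norm_def)
  have M0: "0 \<le> M" using M[of a] a by simp
  define K where "K = \<kappa> * M / lam * (lam * exp lam)"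
  have K: "K \<ge> 0" using M0 \<kappa>_pos lam_pos by (simp add: K_def)
  have 1: "\<bar>\<phi>' y\<bar> \<le> K * \<bar>y - a\<bar>" if y: "\<bar>y - a\<bar> \<le> 1" for y
  proof -
    have "\<bar>\<phi>' y\<bar> \<le> \<kappa> * M / lam * (exp (lam * \<bar>y - a\<bar>) - 1)"
    proof (rule slope_bound[OF wd a(2)])
      fix t assume "t \<in> closed_segment a y"
      then have "\<bar>\<phi> t\<bar> \<le> M * 1" using y M[of t] by (auto simp: closed_segment_eq_real_ivl split: if_splits)
      also have "\<dots> \<le> M * exp (lam * \<bar>t - a\<bar>)" using lam_pos M0 by (intro mult_left_mono) auto
      finally show "\<bar>\<phi> t\<bar> \<le> M * exp (lam * \<bar>t - a\<bar>)" .
    qed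
    also have "\<dots> \<le> \<kappa> * M / lam * (lam * exp lam * \<bar>y - a\<bar>)"
    proof (intro mult_left_mono)
      have "exp (lam * \<bar>y - a\<bar>) - 1 \<le> (lam * \<bar>y - a\<bar>) * exp (lam * \<bar>y - a\<bar>)" by (rule exp_minus_one_le)
      also have "\<dots> \<le> (lam * \<bar>y - a\<bar>) * exp lam"
        using lam_pos y by (intro mult_left_mono) (auto simp: mult_left_le)
      finally show "exp (lam * \<bar>y - a\<bar>) - 1 \<le> lam * exp lam * \<bar>y - a\<bar>" by (simp add: mult_ac)
    qed (use M0 \<kappa>_pos lam_pos in simp)
    finally show ?thesis using lam_pos by (simp add: K_def mult_ac)
  qed
  have 2: "\<bar>\<phi> y - 1\<bar> \<le> K * (y - a)\<^sup>2" if y: "\<bar>y - a\<bar> \<le> 1" for y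
  proof -
    have "norm (\<phi> y - \<phi> a) \<le> K * \<bar>y - a\<bar> * norm (y - a)"
    proof (rule field_differentiable_bound[where S="closed_segment a y"])
      show "(\<phi> has_field_derivative \<phi>' z) (at z within closed_segment a y)" for z
        by (rule has_field_derivative_at_within[OF d])
      fix z assume z: "z \<in> closed_segment a y"
      then have zy: "\<bar>z - a\<bar> \<le> \<bar>y - a\<bar>" by (auto simp: closed_segment_eq_real_ivl split: if_splits)
      then have "\<bar>\<phi>' z\<bar> \<le> K * \<bar>z - a\<bar>" using y by (intro 1) auto
      also have "\<dots> \<le> K * \<bar>y - a\<bar>" using zy K by (intro mult_left_mono) auto
      finally show "norm (\<phi>' z) \<le> K * \<bar>y - a\<bar>" by simp
    qed auto
    then show ?thesis using a by (simp add: power2_eq_square mult.assoc abs_mult_self_eq)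
  qed
  show thesis by (rule that[OF K 1 2])
qed

end

section \<open>Principal values as limits of symmetric truncations\<close>

lemma quotient_tendsto:
  fixes f g :: "real \<Rightarrow> real"
  assumes "(f has_real_derivative f') (at a)" "(g has_real_derivative g') (at a)" "g' \<noteq> 0"
  shows "((\<lambda>y. (f y - f a) / (g y - g a)) \<longlongrightarrow> f' / g') (at a)"
proof -
  have "((\<lambda>y. ((f y - f a) / (y - a)) / ((g y - g a) / (y - a))) \<longlongrightarrow> f' / g') (at a)"
    using assms by (intro tendsto_divide) (auto simp: has_field_derivative_iff)
  then show ?thesis
    by (rule Lim_transform_eventually) (auto simp: eventually_at_filter)
qed

lemma integrable_inverse_square_decay:
  fixes f :: "real \<Rightarrow> real"
  assumes m: "f \<in> borel_measurable borel" and b: "\<And>y. \<bar>f y\<bar> \<le> C / (1 + (y - a)\<^sup>2)"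
  shows "integrable lborel f"
proof (rule Bochner_Integration.integrable_bound)
  have "integrable lborel (\<lambda>x::real. inverse (1 + x\<^sup>2))"
    using integrable_inverse_1_plus_square by (simp add: set_integrable_def einterval_def)
  from lborel_integrable_real_affine[OF this, of 1 "-a"]
  have "integrable lborel (\<lambda>y. inverse (1 + (y - a)\<^sup>2))" by (simp add: add.commute)
  then show "integrable lborel (\<lambda>y. C * inverse (1 + (y - a)\<^sup>2))" by simp
  have "\<bar>f y\<bar> \<le> \<bar>C * inverse (1 + (y - a)\<^sup>2)\<bar>" for y
    using b[of y] by (simp add: divide_inverse)
  then show "AE y in lborel. norm (f y) \<le> norm (C * inverse (1 + (y - a)\<^sup>2))" by simp
qed (use m in simp)

definition punctured :: "real \<Rightarrow> real \<Rightarrow> real set" where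
  "punctured a \<epsilon> = {y. \<epsilon> < \<bar>y - a\<bar>}"

lemma punctured_measurable [measurable]: "punctured a \<epsilon> \<in> sets borel"
  unfolding punctured_def by measurable

lemma set_integrable_punctured:
  fixes r :: "real \<Rightarrow> real"
  shows "integrable lborel r \<Longrightarrow> set_integrable lborel (punctured a \<epsilon>) r"
  unfolding set_integrable_def by (intro integrable_mult_indicator) auto

lemma tendsto_integral_punctured:
  fixes r :: "real \<Rightarrow> real"
  assumes r: "integrable lborel r"
  shows "((\<lambda>\<epsilon>. LBINT y:punctured a \<epsilon>. r y) \<longlongrightarrow> (LBINT y. r y)) (at_right 0)"
proof (rule tendsto_at_right_sequentially[of 0 1])
  fix S :: "nat \<Rightarrow> real" assume S: "\<And>n. 0 < S n" "S \<longlonglongrightarrow> 0"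
  show "(\<lambda>n. LBINT y:punctured a (S n). r y) \<longlonglongrightarrow> (LBINT y. r y)"
    unfolding set_lebesgue_integral_def
  proof (rule integral_dominated_convergence[where w="\<lambda>y. norm (r y)"])
    have "AE y in lborel. y \<noteq> a" by (rule AE_lborel_singleton)
    then show "AE y in lborel. (\<lambda>n. indicator (punctured a (S n)) y *\<^sub>R r y) \<longlonglongrightarrow> r y"
    proof eventually_elim
      case (elim y)
      then have "eventually (\<lambda>n. S n < \<bar>y - a\<bar>) sequentially"
        using S(2) by (intro order_tendstoD) auto
      then have "eventually (\<lambda>n. indicator (punctured a (S n)) y *\<^sub>R r y = r y) sequentially"
        by eventually_elim (simp add: punctured_def)
      then show ?case by (rule tendsto_eventually)
    qed
  qed (use r in \<open>auto simp: indicator_def\<close>)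
qed simp

lemma tendsto_integral_at_bot:
  fixes f :: "real \<Rightarrow> real"
  assumes f: "integrable lborel f"
  shows "((\<lambda>v. LBINT x. indicator {v..} x *\<^sub>R f x) \<longlongrightarrow> (LBINT x. f x)) at_bot"
proof -
  have r: "(LBINT x. g x) = (LBINT x. g (- x))" for g :: "real \<Rightarrow> real"
    using lborel_integral_real_affine[of "-1" g 0] by simp
  have "integrable lborel (\<lambda>x. f (- x))"
    using lborel_integrable_real_affine[OF f, of "-1" 0] by simp
  then have "((\<lambda>v. LBINT x. indicator {..v} x *\<^sub>R f (- x)) \<longlongrightarrow> (LBINT x. f (- x))) at_top"
    by (intro tendsto_integral_at_top) auto
  moreover have "(LBINT x. indicator {..v} x *\<^sub>R f (- x)) = (LBINT x. indicator {- v..} x *\<^sub>R f x)" for v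
    unfolding r[of "\<lambda>x. indicator {- v..} x *\<^sub>R f x"]
    by (intro Bochner_Integration.integral_cong) (auto simp: indicator_def)
  ultimately show ?thesis
    unfolding filterlim_at_bot_mirror r[of f, symmetric] by simp
qed

text \<open>The reflection \<open>y \<mapsto> 2 * a - y\<close> preserves the truncated set and
  changes the sign of the integrand.\<close>

lemma odd_integral_zero:
  fixes a \<sigma> \<epsilon> :: real
  shows "(LBINT y. indicator {y. \<epsilon> < \<bar>y - a\<bar> \<and> \<bar>y - a\<bar> \<le> 1} y * (\<sigma> / (y - a))) = 0" (is "integral\<^sup>L lborel ?f = 0")
proof -
  have "integral\<^sup>L lborel ?f = \<bar>-1\<bar> *\<^sub>R (LBINT x. ?f (2 * a + (-1) * x))"
    by (rule lborel_integral_real_affine) simp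
  also have "(\<lambda>x. ?f (2 * a + (-1) * x)) = (\<lambda>x. - ?f x)"
  proof
    fix x
    have "\<sigma> / (a - x) = - (\<sigma> / (x - a))" by (metis minus_diff_eq minus_divide_right)
    then show "?f (2 * a + (-1) * x) = - ?f x"
      by (simp add: indicator_def abs_minus_commute[of a x])
  qed
  finally show ?thesis by simp
qed

text \<open>Subtracting the odd singular part \<open>\<sigma> / (y - a)\<close> near \<open>a\<close> does not change symmetric truncations.\<close>

lemma principal_value_regularize:
  fixes f :: "real \<Rightarrow> real"
  assumes m[measurable]: "f \<in> borel_measurable borel"
    and near: "\<And>y. 0 < \<bar>y - a\<bar> \<Longrightarrow> \<bar>y - a\<bar> \<le> 1 \<Longrightarrow> \<bar>f y - \<sigma> / (y - a)\<bar> \<le> M"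
    and far: "set_integrable lborel (punctured a 1) f"
  shows "\<exists>r. integrable lborel r \<and>
    (LBINT y. \<bar>r y\<bar>) \<le> 2 * M + (LBINT y:punctured a 1. \<bar>f y\<bar>) \<and>
    (\<forall>\<epsilon>. 0 < \<epsilon> \<longrightarrow> \<epsilon> < 1 \<longrightarrow> set_integrable lborel (punctured a \<epsilon>) f \<and>
      (LBINT y:punctured a \<epsilon>. f y) = (LBINT y:punctured a \<epsilon>. r y))"
proof -
  define A where "A = {y. 0 < \<bar>y - a\<bar> \<and> \<bar>y - a\<bar> \<le> 1}"
  have [measurable]: "A \<in> sets borel" unfolding A_def by measurable
  have A_sub: "A \<subseteq> {a-1..a+1}" by (auto simp: A_def)
  have Afin: "integrable lborel (indicator {a-1..a+1} :: real \<Rightarrow> real)"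
    by (simp add: integrable_indicator_iff emeasure_lborel_Icc_eq)
  have M: "0 \<le> M" using near[of "a+1"] abs_ge_zero by (smt (verit) )
  define r1 where "r1 y = indicator A y * (f y - \<sigma> / (y - a))" for y
  define r2 where "r2 y = indicator (punctured a 1) y * f y" for y
  have r1b: "\<bar>r1 y\<bar> \<le> M * indicator {a-1..a+1} y" for y
    using near[of y] A_sub M by (cases "y \<in> A") (auto simp: r1_def A_def indicator_def)
  have r1m: "r1 \<in> borel_measurable borel" unfolding r1_def by measurable
  have r1i: "integrable lborel r1"
    by (rule Bochner_Integration.integrable_bound[OF integrable_mult_right[OF Afin, of M]])
      (use r1b M r1m in \<open>auto simp: abs_mult intro!: AE_I2\<close>)
  have r2i: "integrable lborel r2" using far by (simp add: set_integrable_def r2_def[abs_def])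
  \<comment> \<open>The factor 2 in the result is the length of \<open>[a - 1, a + 1]\<close>.
    Neither the residue \<open>\<sigma>\<close> nor the truncation radius enters, which later gives
    estimates uniform in the singular point.\<close>
  have "(LBINT y. \<bar>r1 y + r2 y\<bar>) \<le> (LBINT y. M * indicator {a-1..a+1} y + \<bar>r2 y\<bar>)"
    using r1i r2i Afin r1b
    by (intro integral_mono) (auto intro!: order_trans[OF abs_triangle_ineq] add_right_mono)
  also have "\<dots> = 2 * M + (LBINT y. \<bar>r2 y\<bar>)"
    using Afin r2i by (simp add: mult.commute)
  also have "(LBINT y. \<bar>r2 y\<bar>) = (LBINT y:punctured a 1. \<bar>f y\<bar>)"
    by (auto simp: set_lebesgue_integral_def r2_def abs_mult)
  finally have n: "(LBINT y. \<bar>r1 y + r2 y\<bar>) \<le> 2 * M + (LBINT y:punctured a 1. \<bar>f y\<bar>)" .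
  have "set_integrable lborel (punctured a \<epsilon>) f \<and>
      (LBINT y:punctured a \<epsilon>. f y) = (LBINT y:punctured a \<epsilon>. r1 y + r2 y)" if e: "0 < \<epsilon>" "\<epsilon> < 1" for \<epsilon>
  proof -
    define od where "od y = indicator {y. \<epsilon> < \<bar>y - a\<bar> \<and> \<bar>y - a\<bar> \<le> 1} y * (\<sigma> / (y - a))" for y
    have [measurable]: "od \<in> borel_measurable borel" unfolding od_def by measurable
    have oi: "integrable lborel od"
    proof (rule Bochner_Integration.integrable_bound[OF integrable_mult_right[OF Afin, of "\<bar>\<sigma>\<bar> / \<epsilon>"]])
      show "AE y in lborel. norm (od y) \<le> norm (\<bar>\<sigma>\<bar> / \<epsilon> * indicator {a-1..a+1} y)"
        using e by (auto simp: od_def indicator_def abs_mult intro!: frac_le)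
    qed simp
    have eq: "indicator (punctured a \<epsilon>) y * f y = indicator (punctured a \<epsilon>) y * (r1 y + r2 y) + od y" for y
      using e by (auto simp: r1_def r2_def od_def A_def punctured_def indicator_def)
    have ri: "integrable lborel (\<lambda>y. indicator (punctured a \<epsilon>) y * (r1 y + r2 y))"
      using set_integrable_punctured[OF Bochner_Integration.integrable_add[OF r1i r2i]] by (simp add: set_integrable_def)
    have oz: "integral\<^sup>L lborel od = 0" unfolding od_def by (rule odd_integral_zero)
    show ?thesis
      unfolding set_integrable_def set_lebesgue_integral_def real_scaleR_def eq
      using ri oi oz by simp
  qed
  then show ?thesis using r1i r2i n by (intro exI[of _ "\<lambda>y. r1 y + r2 y"]) auto
qed

section \<open>The Wronskian as a limit of truncated integrals\<close>

lemma taylor1_bound: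
  fixes f g :: "real \<Rightarrow> real"
  assumes d: "\<And>y. (f has_real_derivative g y) (at y)"
    and b: "\<And>z. z \<in> closed_segment a y \<Longrightarrow> \<bar>g z - g a\<bar> \<le> K * \<bar>y - a\<bar>"
  shows "\<bar>f y - f a - g a * (y - a)\<bar> \<le> K * (y - a)\<^sup>2"
proof -
  have "norm ((f y - g a * y) - (f a - g a * a)) \<le> K * \<bar>y - a\<bar> * norm (y - a)"
  proof (rule field_differentiable_bound[where S="closed_segment a y"])
    show "((\<lambda>y. f y - g a * y) has_field_derivative g z - g a) (at z within closed_segment a y)" for z
      by (rule has_field_derivative_at_within) (auto intro!: derivative_eq_intros d)
  qed (use b in auto)
  then show ?thesis by (simp add: power2_eq_square mult.assoc abs_mult_self_eq algebra_simps)
qed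

lemma closed_segment_abs_le: "z \<in> closed_segment a y \<Longrightarrow> \<bar>z - a\<bar> \<le> \<bar>y - a\<bar>" for a y z :: real
  by (auto simp: closed_segment_eq_real_ivl split: if_splits)

lemma continuous_bounded_near:
  fixes f :: "real \<Rightarrow> real"
  assumes "continuous_on UNIV f"
  obtains M where "M > 0" "\<And>y. \<bar>y - a\<bar> \<le> R \<Longrightarrow> \<bar>f y\<bar> \<le> M"
proof -
  have "bounded (f ` {a-R..a+R})"
    by (intro compact_imp_bounded compact_continuous_image continuous_on_subset[OF assms]) auto
  then obtain M where M: "\<And>s. s \<in> {a-R..a+R} \<Longrightarrow> \<bar>f s\<bar> \<le> M"
    unfolding bounded_iff by (metis imageI real_norm_def)
  show thesis
  proof (rule that[of "\<bar>M\<bar> + 1"])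
    show "\<bar>f y\<bar> \<le> \<bar>M\<bar> + 1" if "\<bar>y - a\<bar> \<le> R" for y
    proof -
      have "y \<in> {a-R..a+R}" using that by (auto simp: abs_le_iff)
      then show ?thesis using M[of y] by linarith
    qed
  qed simp
qed

lemma lipschitz_of_deriv_bound:
  fixes f g :: "real \<Rightarrow> real"
  assumes d: "\<And>y. (f has_real_derivative g y) (at y)" and b: "\<And>z. z \<in> closed_segment a y \<Longrightarrow> \<bar>g z\<bar> \<le> K"
  shows "\<bar>f y - f a\<bar> \<le> K * \<bar>y - a\<bar>"
proof -
  have "norm (f y - f a) \<le> K * norm (y - a)"
    by (rule field_differentiable_bound[where S="closed_segment a y" and f'=g])
      (use b in \<open>auto intro: has_field_derivative_at_within[OF d]\<close>)
  then show ?thesis by simp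
qed

locale smooth_shear = shear +
  fixes b2 b3 :: "real \<Rightarrow> real" and K :: real
  assumes b'_deriv: "\<And>y. (b' has_real_derivative b2 y) (at y)"
    and b2_deriv: "\<And>y. (b2 has_real_derivative b3 y) (at y)"
    and b3_continuous: "continuous_on UNIV b3"
    and b2_bound: "\<And>y. \<bar>b2 y\<bar> \<le> K"
begin

lemma b'_continuous: "continuous_on A b'"
  by (intro continuous_at_imp_continuous_on ballI DERIV_isCont[OF b'_deriv])

lemma b2_continuous: "continuous_on A b2"
  by (intro continuous_at_imp_continuous_on ballI DERIV_isCont[OF b2_deriv])

lemma b_measurable[measurable]: "b \<in> borel_measurable borel" "b' \<in> borel_measurable borel" "b2 \<in> borel_measurable borel"
  by (auto intro!: borel_measurable_continuous_onI b_continuous b'_continuous b2_continuous)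

lemma K_nonneg: "0 \<le> K" using b2_bound[of 0] by linarith

lemma b_taylor: "\<bar>b y - b a - b' a * (y - a)\<bar> \<le> K * (y - a)\<^sup>2"
proof (rule taylor1_bound[OF b_deriv])
  fix z assume z: "z \<in> closed_segment a y"
  have "\<bar>b' z - b' a\<bar> \<le> K * \<bar>z - a\<bar>" by (intro lipschitz_of_deriv_bound[OF b'_deriv] b2_bound)
  also have "\<dots> \<le> K * \<bar>y - a\<bar>" using closed_segment_abs_le[OF z] K_nonneg by (rule mult_left_mono)
  finally show "\<bar>b' z - b' a\<bar> \<le> K * \<bar>y - a\<bar>" .
qed

lemma b_diff_nonzero: "y \<noteq> a \<Longrightarrow> b y - b a \<noteq> 0"
  by (simp add: b_eq_iff)

text \<open>The difference factors as \<open>(B - \<beta> s) (B + \<beta> s) / (\<beta>\<^sup>2 s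
  B\<^sup>2)\<close>. Taylor's formula bounds the first factor by \<open>K s\<^sup>2\<close>, the
  second is at most \<open>2 |s| / m\<close>, and \<open>|B| \<ge> m |s|\<close> with
  \<open>\<beta> \<ge> m\<close> bounds the denominator below by
  \<open>m\<^sup>4 |s|\<^sup>3\<close>.\<close>

lemma inverse_square_diff_bound:
  assumes y: "y \<noteq> a"
  shows "\<bar>1 / ((b' a)\<^sup>2 * (y - a)) - (y - a) / (b y - b a)\<^sup>2\<bar> \<le> 2 * K / m ^ 5"
proof -
  define s where "s = y - a" define B where "B = b y - b a" define \<beta> where "\<beta> = b' a"
  have s: "s \<noteq> 0" using y by (simp add: s_def)
  have B: "m * \<bar>s\<bar> \<le> \<bar>B\<bar>" "\<bar>B\<bar> \<le> \<bar>s\<bar> / m" using abs_b_diff_bounds[where z=y and y=a] by (auto simp: s_def B_def)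
  have B0: "B \<noteq> 0" using b_diff_nonzero[OF y] by (simp add: B_def)
  have \<beta>: "m \<le> \<beta>" "\<beta> \<le> 1/m" "\<beta> > 0" using b'_lower b'_upper b'_pos by (auto simp: \<beta>_def)
  have "1 / (\<beta>\<^sup>2 * s) - s / B\<^sup>2 = (B - \<beta> * s) * (B + \<beta> * s) / (\<beta>\<^sup>2 * s * B\<^sup>2)"
    using s B0 \<beta>(3) by (simp add: field_simps power2_eq_square)
  then have "\<bar>1 / (\<beta>\<^sup>2 * s) - s / B\<^sup>2\<bar> = \<bar>B - \<beta> * s\<bar> * \<bar>B + \<beta> * s\<bar> / (\<beta>\<^sup>2 * \<bar>s\<bar> * B\<^sup>2)"
    by (simp add: abs_mult)
  also have "\<dots> \<le> (K * s\<^sup>2) * (2 * \<bar>s\<bar> / m) / (m\<^sup>2 * \<bar>s\<bar> * (m * \<bar>s\<bar>)\<^sup>2)"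
  proof (rule frac_le)
    have "\<bar>B + \<beta> * s\<bar> \<le> \<bar>B\<bar> + \<beta> * \<bar>s\<bar>" using abs_triangle_ineq[of B "\<beta> * s"] \<beta> by (simp add: abs_mult)
    also have "\<dots> \<le> \<bar>s\<bar> / m + (1/m) * \<bar>s\<bar>" using B \<beta> by (intro add_mono mult_right_mono) auto
    finally have "\<bar>B + \<beta> * s\<bar> \<le> 2 * \<bar>s\<bar> / m" by simp
    moreover have "\<bar>B - \<beta> * s\<bar> \<le> K * s\<^sup>2" using b_taylor[of y a] by (simp add: B_def \<beta>_def s_def)
    ultimately show "\<bar>B - \<beta> * s\<bar> * \<bar>B + \<beta> * s\<bar> \<le> (K * s\<^sup>2) * (2 * \<bar>s\<bar> / m)"
      using K_nonneg by (intro mult_mono) auto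
    have "(m * \<bar>s\<bar>)\<^sup>2 \<le> \<bar>B\<bar>\<^sup>2" using B m_pos by (intro power_mono) auto
    moreover have "m\<^sup>2 \<le> \<beta>\<^sup>2" using \<beta> m_pos by (intro power_mono) auto
    ultimately show "m\<^sup>2 * \<bar>s\<bar> * (m * \<bar>s\<bar>)\<^sup>2 \<le> \<beta>\<^sup>2 * \<bar>s\<bar> * B\<^sup>2"
      by (intro mult_mono) auto
    show "0 < m\<^sup>2 * \<bar>s\<bar> * (m * \<bar>s\<bar>)\<^sup>2" using s m_pos by simp
  qed (use K_nonneg m_pos in simp)
  also have "\<dots> = 2 * K / m ^ 5"
    using s m_pos by (simp add: field_simps power2_eq_square power_numeral_reduce)
  finally show ?thesis by (simp add: s_def B_def \<beta>_def)
qed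

text \<open>To leading order \<open>b' a - b' y\<close> is \<open>- b2 a * (y - a)\<close>, so the
  first integrand of \<open>J1\<close> has an odd pole with residue
  \<open>- b2 a / (b' a)\<^sup>2\<close>. The bounded remainder is the form that
  \<open>principal_value_regularize\<close> asks for.\<close>

lemma slope_difference_near:
  obtains M where "\<And>y. 0 < \<bar>y - a\<bar> \<Longrightarrow> \<bar>y - a\<bar> \<le> 1 \<Longrightarrow>
    \<bar>(b' a - b' y) / (b y - b a)\<^sup>2 - (- b2 a / (b' a)\<^sup>2) / (y - a)\<bar> \<le> M"
proof -
  obtain K3 where K3: "K3 > 0" "\<And>y. \<bar>y - a\<bar> \<le> 1 \<Longrightarrow> \<bar>b3 y\<bar> \<le> K3"
    using continuous_bounded_near[OF b3_continuous] by blast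
  show thesis
  proof (rule that[of "K3 / m\<^sup>2 + K * (2 * K / m ^ 5)"])
    fix y assume y: "0 < \<bar>y - a\<bar>" "\<bar>y - a\<bar> \<le> 1"
    define s where "s = y - a" define B where "B = b y - b a" define \<beta> where "\<beta> = b' a"
    have s: "s \<noteq> 0" using y by (simp add: s_def)
    have B: "m * \<bar>s\<bar> \<le> \<bar>B\<bar>" using abs_b_diff_bounds(1)[where z=y and y=a] by (auto simp: s_def B_def)
    have B0: "B \<noteq> 0" using b_diff_nonzero[of y a] s by (simp add: B_def s_def)
    have t: "\<bar>b' y - b' a - b2 a * s\<bar> \<le> K3 * s\<^sup>2"
      unfolding s_def
    proof (rule taylor1_bound[OF b'_deriv])
      fix z assume z: "z \<in> closed_segment a y"
      have "\<bar>b2 z - b2 a\<bar> \<le> K3 * \<bar>z - a\<bar>"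
      proof (rule lipschitz_of_deriv_bound[OF b2_deriv])
        fix x assume "x \<in> closed_segment a z"
        then show "\<bar>b3 x\<bar> \<le> K3" using closed_segment_abs_le[of x a z] closed_segment_abs_le[OF z] y by (intro K3) auto
      qed
      also have "\<dots> \<le> K3 * \<bar>y - a\<bar>" using closed_segment_abs_le[OF z] K3 by (intro mult_left_mono) auto
      finally show "\<bar>b2 z - b2 a\<bar> \<le> K3 * \<bar>y - a\<bar>" .
    qed
    have e: "(b' a - b' y) / B\<^sup>2 - (- b2 a / \<beta>\<^sup>2) / s
       = - (b' y - b' a - b2 a * s) / B\<^sup>2 + b2 a * (1 / (\<beta>\<^sup>2 * s) - s / B\<^sup>2)"
      by (simp add: diff_divide_distrib add_divide_distrib right_diff_distrib minus_divide_left[symmetric])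
    have "\<bar>(b' a - b' y) / B\<^sup>2 - (- b2 a / \<beta>\<^sup>2) / s\<bar>
      \<le> \<bar>- (b' y - b' a - b2 a * s) / B\<^sup>2\<bar> + \<bar>b2 a * (1 / (\<beta>\<^sup>2 * s) - s / B\<^sup>2)\<bar>"
      unfolding e by (rule abs_triangle_ineq)
    also have "\<bar>- (b' y - b' a - b2 a * s) / B\<^sup>2\<bar> \<le> K3 * s\<^sup>2 / (m * \<bar>s\<bar>)\<^sup>2"
    proof -
      have "(m * \<bar>s\<bar>)\<^sup>2 \<le> \<bar>B\<bar>\<^sup>2" using B m_pos by (intro power_mono) auto
      then have "\<bar>b' y - b' a - b2 a * s\<bar> / B\<^sup>2 \<le> K3 * s\<^sup>2 / (m * \<bar>s\<bar>)\<^sup>2"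
        using t K3 m_pos s by (intro frac_le) auto
      then show ?thesis by (simp only: abs_divide abs_minus_cancel abs_power2)
    qed
    also have "K3 * s\<^sup>2 / (m * \<bar>s\<bar>)\<^sup>2 = K3 / m\<^sup>2" using s by (simp add: power_mult_distrib)
    also have "\<bar>b2 a * (1 / (\<beta>\<^sup>2 * s) - s / B\<^sup>2)\<bar> \<le> K * (2 * K / m ^ 5)"
      unfolding abs_mult using inverse_square_diff_bound[of y a] y b2_bound[of a] K_nonneg
      by (intro mult_mono) (auto simp: s_def B_def \<beta>_def)
    finally show "\<bar>(b' a - b' y) / (b y - b a)\<^sup>2 - (- b2 a / (b' a)\<^sup>2) / (y - a)\<bar> \<le> K3 / m\<^sup>2 + K * (2 * K / m ^ 5)"
      by (simp add: s_def B_def \<beta>_def)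
  qed
qed

lemma inverse_square_punctured:
  assumes e: "0 < \<epsilon>" and y: "y \<in> punctured a \<epsilon>"
  shows "1 / (b y - b a)\<^sup>2 \<le> ((1 + 1 / \<epsilon>\<^sup>2) / m\<^sup>2) / (1 + (y - a)\<^sup>2)"
proof -
  define s where "s = \<bar>y - a\<bar>"
  have s: "\<epsilon> < s" "s > 0" using y e by (auto simp: punctured_def s_def)
  have "(m * s)\<^sup>2 \<le> \<bar>b y - b a\<bar>\<^sup>2"
    using abs_b_diff_bounds(1)[where z=y and y=a] m_pos s by (intro power_mono) (auto simp: s_def)
  then have "1 / (b y - b a)\<^sup>2 \<le> 1 / (m * s)\<^sup>2" using m_pos s by (intro frac_le) auto
  also have "\<dots> \<le> ((1 + 1 / \<epsilon>\<^sup>2) / m\<^sup>2) / (1 + s\<^sup>2)"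
  proof -
    have "1 \<le> s\<^sup>2 / \<epsilon>\<^sup>2" using s e by (simp add: power_mono)
    then have "1 + s\<^sup>2 \<le> (1 + 1 / \<epsilon>\<^sup>2) * s\<^sup>2" by (simp add: algebra_simps)
    moreover have "0 < 1 + s\<^sup>2" by (rule add_pos_nonneg) auto
    ultimately have "1 \<le> (1 + 1 / \<epsilon>\<^sup>2) / (1 + s\<^sup>2) * s\<^sup>2" by (simp add: le_divide_eq_1_pos)
    then have "1 / s\<^sup>2 \<le> (1 + 1 / \<epsilon>\<^sup>2) / (1 + s\<^sup>2)" using s by (subst pos_divide_le_eq) auto
    from divide_right_mono[OF this, of "m\<^sup>2"] show ?thesis by (simp add: power_mult_distrib mult.commute)
  qed
  finally show ?thesis by (simp add: s_def)
qed

lemma slope_difference_far: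
  "set_integrable lborel (punctured a 1) (\<lambda>y. (b' a - b' y) / (b y - b a)\<^sup>2)"
  unfolding set_integrable_def
proof (rule integrable_inverse_square_decay)
  show "\<bar>indicator (punctured a 1) y *\<^sub>R ((b' a - b' y) / (b y - b a)\<^sup>2)\<bar> \<le> ((1 / m) * (2 / m\<^sup>2)) / (1 + (y - a)\<^sup>2)" for y
  proof (cases "y \<in> punctured a 1")
    case True
    have "\<bar>b' a - b' y\<bar> \<le> 1 / m" using b'_upper[of a] b'_upper[of y] b'_pos[of a] b'_pos[of y] by linarith
    then have "\<bar>b' a - b' y\<bar> * (1 / (b y - b a)\<^sup>2) \<le> (1 / m) * ((2 / m\<^sup>2) / (1 + (y - a)\<^sup>2))"
      using inverse_square_punctured[OF _ True] m_pos by (intro mult_mono) auto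
    then show ?thesis using True by (simp add: abs_mult)
  next
    case False
    then show ?thesis using m_pos by (auto intro!: divide_nonneg_pos add_pos_nonneg)
  qed
qed measurable

text \<open>The two integrands of \<open>J1\<close> merged. Their terms
  \<open>1 / (b - b a)\<^sup>2\<close> cancel, which leaves the reciprocal square of the Rayleigh
  solution \<open>(b - b a) * \<phi>\<close>, as produced by Picone's identity, and a total
  derivative.\<close>

definition J_integrand :: "(real \<Rightarrow> real) \<Rightarrow> real \<Rightarrow> real \<Rightarrow> real" where
  "J_integrand \<phi> a y = 1 / ((b y - b a) * \<phi> y)\<^sup>2 - b' y / (b' a * (b y - b a)\<^sup>2)"

text \<open>Uniqueness for the singular equation identifies \<open>phi1\<close> with the solution at
  hand. The principal value converges once its odd pole is removed, the second integral converges
  absolutely, and on each truncation the two combine into \<open>J_integrand\<close>.\<close>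

lemma J1_limit:
  assumes s: "critical_point.is_sol b a \<kappa> \<phi> \<phi>'" and ini: "\<phi> a = 1" "\<phi>' a = 0"
    and \<kappa>: "\<kappa> > 0" "\<kappa> = (of_int k)\<^sup>2"
  shows "((\<lambda>\<epsilon>. LBINT y:punctured a \<epsilon>. J_integrand \<phi> a y) \<longlongrightarrow> J1 b k (b a)) (at_right 0)"
    "\<And>\<epsilon>. 0 < \<epsilon> \<Longrightarrow> \<epsilon> < 1 \<Longrightarrow> set_integrable lborel (punctured a \<epsilon>) (J_integrand \<phi> a)"
proof -
  interpret critical_point b b' m a \<kappa> by unfold_locales (rule \<kappa>)
  have sol: "is_sol \<phi> \<phi>'" by (rule s)
  have ip: "is_phi1 b k (b a) f \<longleftrightarrow> (\<exists>f'. is_sol f f' \<and> f a = 1 \<and> f' a = 0)" for f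
    unfolding is_phi1_def is_sol_def inv_b w_def by (simp add: \<kappa>(2))
  have phi1: "phi1 b k (b a) = \<phi>"
    unfolding phi1_def
  proof (rule the_equality)
    show "is_phi1 b k (b a) \<phi>" using sol ini ip by blast
    show "f = \<phi>" if "is_phi1 b k (b a) f" for f
      using that ip is_sol_unique[OF _ sol] ini by metis
  qed
  have db: "deriv b = b'" by (rule ext) (rule DERIV_imp_deriv[OF b_deriv])
  have d: "(\<phi> has_real_derivative \<phi>' y) (at y)" for y using sol by (simp add: is_sol_def)
  have [measurable]: "\<phi> \<in> borel_measurable borel"
    by (intro borel_measurable_continuous_onI continuous_at_imp_continuous_on ballI DERIV_isCont[OF d])
  have ge1: "1 \<le> \<phi> y" for y using sol_sign(1)[OF sol ini] .
  define f1 where "f1 y = (b' a - b' y) / (b y - b a)\<^sup>2" for y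
  define f2 where "f2 y = 1 / (b y - b a)\<^sup>2 * (1 / (\<phi> y)\<^sup>2 - 1)" for y
  have [measurable]: "f1 \<in> borel_measurable borel" "f2 \<in> borel_measurable borel"
    unfolding f1_def f2_def by measurable
  have f2i: "integrable lborel f2"
  proof -
    obtain C where C: "C \<ge> 0" "\<And>y. \<bar>y - a\<bar> \<le> 1 \<Longrightarrow> \<bar>\<phi> y - 1\<bar> \<le> C * (y - a)\<^sup>2"
      using sol_near[OF sol ini] by metis
    show ?thesis
    proof (rule integrable_inverse_square_decay)
      fix y
      have p: "0 \<le> 1 - 1 / (\<phi> y)\<^sup>2" "1 - 1 / (\<phi> y)\<^sup>2 \<le> 1"
        using ge1[of y] by (auto simp: power_mono)
      have a2: "\<bar>f2 y\<bar> = (1 / (b y - b a)\<^sup>2) * (1 - 1 / (\<phi> y)\<^sup>2)"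
        using p(1) by (simp add: f2_def abs_mult)
      \<comment> \<open>Far from \<open>a\<close> the factor \<open>1 - 1 / \<phi>\<^sup>2\<close>
        is at most 1 and leaves \<open>2 / m\<^sup>2\<close>. Near \<open>a\<close> the quadratic
        contact of \<open>\<phi>\<close> with 1 cancels the double pole and leaves
        \<open>2 * C / m\<^sup>2\<close>, doubled because \<open>1 + (y - a)\<^sup>2 \<le> 2\<close>
        there.\<close>
      show "\<bar>f2 y\<bar> \<le> (4 * C / m\<^sup>2 + 2 / m\<^sup>2) / (1 + (y - a)\<^sup>2)"
      proof (cases "y \<in> punctured a 1")
        case True
        have "\<bar>f2 y\<bar> \<le> ((1 + 1 / 1\<^sup>2) / m\<^sup>2 / (1 + (y - a)\<^sup>2)) * 1"
          unfolding a2 using inverse_square_punctured[OF _ True] p by (intro mult_mono) auto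
        also have "\<dots> = (0 + 2 / m\<^sup>2) / (1 + (y - a)\<^sup>2)" by simp
        also have "\<dots> \<le> (4 * C / m\<^sup>2 + 2 / m\<^sup>2) / (1 + (y - a)\<^sup>2)"
        proof (rule divide_right_mono)
          show "0 + 2 / m\<^sup>2 \<le> 4 * C / m\<^sup>2 + 2 / m\<^sup>2" using C m_pos by simp
        qed (auto intro: add_nonneg_nonneg)
        finally show ?thesis .
      next
        case False
        then have y: "\<bar>y - a\<bar> \<le> 1" by (auto simp: punctured_def)
        have s1: "(y - a)\<^sup>2 \<le> 1" using y abs_le_square_iff[of "y - a" 1] by simp
        show ?thesis
        proof (cases "y = a")
          case True then show ?thesis using C m_pos by (simp add: f2_def)
        next
          case ya: False
          have "1 - 1 / (\<phi> y)\<^sup>2 = (\<phi> y - 1) * ((\<phi> y + 1) / (\<phi> y)\<^sup>2)"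
            using ge1[of y] by (simp add: field_simps power2_eq_square)
          also have "\<dots> \<le> (C * (y - a)\<^sup>2) * 2"
          proof (rule mult_mono)
            show "\<phi> y - 1 \<le> C * (y - a)\<^sup>2" using C(2)[OF y] by simp
            have "\<phi> y * 1 \<le> \<phi> y * \<phi> y" using ge1[of y] by (intro mult_left_mono) auto
            then have "\<phi> y + 1 \<le> 2 * (\<phi> y)\<^sup>2" using ge1[of y] unfolding power2_eq_square by linarith
            then show "(\<phi> y + 1) / (\<phi> y)\<^sup>2 \<le> 2" using ge1[of y] by (simp add: divide_le_eq)
          qed (use C ge1[of y] in auto)
          finally have q: "1 - 1 / (\<phi> y)\<^sup>2 \<le> 2 * C * (y - a)\<^sup>2" by simp
          have "(m * \<bar>y - a\<bar>)\<^sup>2 \<le> \<bar>b y - b a\<bar>\<^sup>2"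
            using abs_b_diff_bounds(1)[where z=y and y=a] m_pos by (intro power_mono) auto
          then have "1 / (b y - b a)\<^sup>2 \<le> 1 / (m\<^sup>2 * (y - a)\<^sup>2)" using m_pos ya by (intro frac_le) (auto simp: power_mult_distrib)
          then have "\<bar>f2 y\<bar> \<le> 1 / (m\<^sup>2 * (y - a)\<^sup>2) * (2 * C * (y - a)\<^sup>2)"
            unfolding a2 using q p by (intro mult_mono) auto
          also have "\<dots> = 2 * C / m\<^sup>2" using ya by simp
          also have "\<dots> = (4 * C / m\<^sup>2) / 2" by simp
          also have "\<dots> \<le> (4 * C / m\<^sup>2 + 2 / m\<^sup>2) / (1 + (y - a)\<^sup>2)"
            using C m_pos s1 by (intro frac_le) (auto intro!: add_pos_nonneg)
          finally show ?thesis .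
        qed
      qed
    qed simp
  qed
  obtain M where M: "\<And>y. 0 < \<bar>y - a\<bar> \<Longrightarrow> \<bar>y - a\<bar> \<le> 1 \<Longrightarrow> \<bar>f1 y - (- b2 a / (b' a)\<^sup>2) / (y - a)\<bar> \<le> M"
    unfolding f1_def using slope_difference_near[of a] by blast
  have far: "set_integrable lborel (punctured a 1) f1"
    using slope_difference_far[of a] by (simp add: f1_def[abs_def])
  obtain r where r: "integrable lborel r"
    "\<And>\<epsilon>. 0 < \<epsilon> \<Longrightarrow> \<epsilon> < 1 \<Longrightarrow> set_integrable lborel (punctured a \<epsilon>) f1"
    "\<And>\<epsilon>. 0 < \<epsilon> \<Longrightarrow> \<epsilon> < 1 \<Longrightarrow> (LBINT y:punctured a \<epsilon>. f1 y) = (LBINT y:punctured a \<epsilon>. r y)"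
    using principal_value_regularize[OF _ M far] by (metis \<open>f1 \<in> borel_measurable borel\<close>)
  have small: "eventually (\<lambda>\<epsilon>::real. 0 < \<epsilon> \<and> \<epsilon> < 1) (at_right 0)"
    using eventually_at_right_real[of 0 1] by (auto elim: eventually_mono)
  have "((\<lambda>\<epsilon>. LBINT y:punctured a \<epsilon>. r y) \<longlongrightarrow> (LBINT y. r y)) (at_right 0)"
    by (rule tendsto_integral_punctured[OF r(1)])
  then have f1t: "((\<lambda>\<epsilon>. LBINT y:punctured a \<epsilon>. f1 y) \<longlongrightarrow> (LBINT y. r y)) (at_right 0)"
    by (rule Lim_transform_eventually) (use small in \<open>auto elim!: eventually_mono simp: r\<close>)
  then have pv: "pv_integral a f1 = (LBINT y. r y)"
    unfolding pv_integral_def punctured_def by (intro tendsto_Lim) auto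
  have J1: "J1 b k (b a) = 1 / b' a * (LBINT y. r y) + (LBINT y. f2 y)"
    unfolding J1_def Let_def inv_b phi1 db pv[symmetric] f1_def f2_def ..
  have split: "J_integrand \<phi> a y = 1 / b' a * f1 y + f2 y" if "y \<noteq> a" for y
  proof -
    define x where "x = b y - b a"
    have "x \<noteq> 0" using b_diff_nonzero[OF that] by (simp add: x_def)
    then show ?thesis unfolding J_integrand_def f1_def f2_def x_def[symmetric]
      using b'_pos[of a] ge1[of y] by (simp add: field_simps power2_eq_square)
  qed
  \<comment> \<open>At \<open>y = a\<close> every quotient over \<open>b y - b a\<close> is a
    division by 0 and has the value 0, so the identity holds without exception.\<close>
  have split': "J_integrand \<phi> a y = 1 / b' a * f1 y + f2 y" for y
    by (cases "y = a") (simp add: J_integrand_def f1_def f2_def, rule split)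
  show si: "set_integrable lborel (punctured a \<epsilon>) (J_integrand \<phi> a)" if "0 < \<epsilon>" "\<epsilon> < 1" for \<epsilon>
    unfolding split'[abs_def] using r(2)[OF that] set_integrable_punctured[OF f2i]
    by (intro set_integral_add set_integrable_mult_right) auto
  have "((\<lambda>\<epsilon>. 1 / b' a * (LBINT y:punctured a \<epsilon>. f1 y) + (LBINT y:punctured a \<epsilon>. f2 y)) \<longlongrightarrow> J1 b k (b a)) (at_right 0)"
    unfolding J1 by (intro tendsto_intros f1t tendsto_integral_punctured f2i)
  then show "((\<lambda>\<epsilon>. LBINT y:punctured a \<epsilon>. J_integrand \<phi> a y) \<longlongrightarrow> J1 b k (b a)) (at_right 0)"
  proof (rule Lim_transform_eventually)
    show "eventually (\<lambda>\<epsilon>. 1 / b' a * (LBINT y:punctured a \<epsilon>. f1 y) + (LBINT y:punctured a \<epsilon>. f2 y) = (LBINT y:punctured a \<epsilon>. J_integrand \<phi> a y)) (at_right 0)"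
      using small
    proof eventually_elim
      case (elim \<epsilon>)
      then show ?case
        unfolding split' using r(2)[of \<epsilon>] set_integrable_punctured[OF f2i]
        by (subst set_integral_add(2)) (auto simp only: set_integral_mult_right set_integrable_mult_right)
    qed
  qed
qed

end

section \<open>The Rayleigh quotient inequality\<close>

text \<open>The potential \<open>r * (b - b ys)\<close> is \<open>b'' / (b - b ys)\<close> with its
  singularity removed, so the stream function \<open>\<psi>\<close> solves a regular linear equation
  across the critical point \<open>ys\<close>.\<close>

locale rayleigh_mode = smooth_shear +
  fixes ys \<kappa> :: real and r \<psi> \<psi>' :: "real \<Rightarrow> real" and R :: real
  assumes \<kappa>_pos: "\<kappa> > 0"
    and b2_factor: "\<And>y. b2 y = r y * (b y - b ys)\<^sup>2"
    and r_continuous: "continuous_on UNIV r"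
    and r_bound: "\<And>y. \<bar>r y\<bar> \<le> R"
    and \<psi>_deriv: "\<And>y. (\<psi> has_real_derivative \<psi>' y) (at y)"
    and \<psi>'_deriv: "\<And>y. (\<psi>' has_real_derivative (\<kappa> + r y * (b y - b ys)) * \<psi> y) (at y)"
    and \<psi>_L2: "L2 \<psi>"
    and \<psi>_lim: "(\<psi> \<longlongrightarrow> 0) at_top" "(\<psi> \<longlongrightarrow> 0) at_bot"
    and \<psi>'_lim: "(\<psi>' \<longlongrightarrow> 0) at_top" "(\<psi>' \<longlongrightarrow> 0) at_bot"
begin

lemma \<psi>_continuous: "continuous_on A \<psi>"
  by (intro continuous_at_imp_continuous_on ballI DERIV_isCont[OF \<psi>_deriv])

lemma \<psi>'_continuous: "continuous_on A \<psi>'"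
  by (intro continuous_at_imp_continuous_on ballI DERIV_isCont[OF \<psi>'_deriv])

lemma mode_measurable[measurable]:
  "\<psi> \<in> borel_measurable borel" "\<psi>' \<in> borel_measurable borel" "r \<in> borel_measurable borel"
  by (auto intro!: borel_measurable_continuous_onI \<psi>_continuous \<psi>'_continuous r_continuous)

lemma R_nonneg: "0 \<le> R" using r_bound[of 0] by linarith

lemma \<psi>_square_integrable: "integrable lborel (\<lambda>y. (\<psi> y)\<^sup>2)"
  using \<psi>_L2 by (simp add: L2_def)

lemma weighted_integrable: "integrable lborel (\<lambda>y. r y * (\<psi> y)\<^sup>2)"
proof (rule Bochner_Integration.integrable_bound[OF integrable_mult_right[OF \<psi>_square_integrable, of R]])
  show "AE y in lborel. norm (r y * (\<psi> y)\<^sup>2) \<le> norm (R * (\<psi> y)\<^sup>2)"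
    using r_bound R_nonneg by (auto simp: abs_mult intro!: AE_I2 mult_right_mono)
qed measurable

lemma b_at_top: "filterlim b at_top at_top"
proof (rule filterlim_at_top_mono)
  show "filterlim (\<lambda>y. b 0 + m * y) at_top at_top"
    by (intro filterlim_tendsto_add_at_top[OF tendsto_const] filterlim_tendsto_pos_mult_at_top[OF tendsto_const m_pos] filterlim_ident)
  show "eventually (\<lambda>y. b 0 + m * y \<le> b y) at_top"
    using eventually_ge_at_top[of 0] by eventually_elim (use b_diff_bounds(1)[of 0] in \<open>simp add: algebra_simps\<close>)
qed

lemma b_at_bot: "filterlim b at_bot at_bot"
proof -
  have "filterlim (\<lambda>y. - b (- y)) at_top at_top"
  proof (rule filterlim_at_top_mono)
  show "filterlim (\<lambda>y. - b 0 + m * y) at_top at_top"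
    by (intro filterlim_tendsto_add_at_top[OF tendsto_const] filterlim_tendsto_pos_mult_at_top[OF tendsto_const m_pos] filterlim_ident)
  show "eventually (\<lambda>y. - b 0 + m * y \<le> - b (- y)) at_top"
    using eventually_ge_at_top[of 0]
  proof eventually_elim
    case (elim y)
    then show ?case using b_diff_bounds(1)[of "-y" 0] by simp
  qed
  qed
  then show ?thesis by (simp add: filterlim_at_bot_mirror filterlim_uminus_at_top)
qed

lemma inverse_b_tendsto_0:
  "((\<lambda>y. 1 / (b y - c)) \<longlongrightarrow> 0) at_top" "((\<lambda>y. 1 / (b y - c)) \<longlongrightarrow> 0) at_bot"
proof -
  have "filterlim (\<lambda>y. b y + (- c)) at_infinity at_top"
    by (intro filterlim_at_top_imp_at_infinity filterlim_tendsto_add_at_top[OF tendsto_const, of "\<lambda>y. b y" at_top "-c", simplified add.commute[of "-c"]] b_at_top)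
  from tendsto_divide_0[OF tendsto_const this, of 1] show "((\<lambda>y. 1 / (b y - c)) \<longlongrightarrow> 0) at_top" by simp
  have "filterlim (\<lambda>y. - b y + c) at_top at_bot"
    using filterlim_tendsto_add_at_top[OF tendsto_const, of "\<lambda>y. - b y" at_bot c] b_at_bot
    by (simp add: filterlim_uminus_at_top add.commute)
  then have "filterlim (\<lambda>y. - b y + c) at_infinity at_bot" by (rule filterlim_at_top_imp_at_infinity)
  from tendsto_divide_0[OF tendsto_const this, of "-1"]
  have "((\<lambda>y. -1 / (c - b y)) \<longlongrightarrow> 0) at_bot" by simp
  moreover have "-1 / (c - b y) = 1 / (b y - c)" for y
    by (metis minus_diff_eq minus_divide_divide minus_minus)
  ultimately show "((\<lambda>y. 1 / (b y - c)) \<longlongrightarrow> 0) at_bot" by simp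
qed

end

text \<open>
  \<open>\<psi>\<close> is used as a trial function in the quadratic form of the Rayleigh equation at speed \<open>b a\<close>. The boundary term
  \<open>B\<close> collects the total derivatives, and \<open>B' + S\<close> is a perfect square by Picone's identity.
\<close>

locale trial = rayleigh_mode +
  fixes a :: real and \<phi> \<phi>' :: "real \<Rightarrow> real"
  assumes sol: "critical_point.is_sol b a \<kappa> \<phi> \<phi>'" and ini: "\<phi> a = 1" "\<phi>' a = 0"
begin

sublocale critical_point b b' m a \<kappa>
  by unfold_locales (rule \<kappa>_pos)

definition \<beta> where "\<beta> = b' a"
definition p where "p = \<psi> a"
text \<open>The solution of the Rayleigh equation
  \<open>\<Phi>'' = (\<kappa> + b'' / (b - b a)) \<Phi>\<close> at speed \<open>b a\<close> that has
  a simple zero at \<open>a\<close>, with slope \<open>\<beta>\<close> there.\<close>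

definition \<Phi> where "\<Phi> y = (b y - b a) * \<phi> y"
definition \<Phi>' where "\<Phi>' y = b' y * \<phi> y + (b y - b a) * \<phi>' y"
definition S where "S y = (b a - b ys) * (r y * (b y - b ys) * (\<psi> y)\<^sup>2 / (b y - b a)) + (\<beta> * p)\<^sup>2 * J_integrand \<phi> a y"
text \<open>The first two terms are Picone's
  \<open>\<psi>\<^sup>2 (\<psi>' / \<psi> - \<Phi>' / \<Phi>)\<close>, written without division by
  \<open>\<psi>\<close>. The Wronskian \<open>\<psi>' \<Phi> - \<psi> \<Phi>'\<close> is
  \<open>- \<beta> p\<close> at \<open>a\<close>; shifting it by \<open>\<beta> p\<close> inside the
  square gives rise to the third term. The last one integrates, up to the factor
  \<open>(\<beta> p)\<^sup>2\<close>, the term that \<open>J_integrand\<close> subtracts from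
  \<open>1 / \<Phi>\<^sup>2\<close>.\<close>

definition B where "B y = \<psi> y * \<psi>' y - (\<psi> y)\<^sup>2 * \<Phi>' y / \<Phi> y + 2 * (\<beta> * p) * \<psi> y / \<Phi> y - (\<beta> * p)\<^sup>2 / (\<beta> * (b y - b a))"

lemma \<phi>_deriv: "(\<phi> has_real_derivative \<phi>' y) (at y)"
  using sol by (simp add: is_sol_def)

lemma \<phi>_ge_1: "1 \<le> \<phi> y" using sol_sign(1)[OF sol ini] .

lemma \<beta>_pos: "\<beta> > 0" by (simp add: \<beta>_def b'_pos)

lemma \<Phi>_nonzero: "y \<noteq> a \<Longrightarrow> \<Phi> y \<noteq> 0"
  using \<phi>_ge_1[of y] b_diff_nonzero[of y a] by (simp add: \<Phi>_def)

lemma \<Phi>_deriv: "(\<Phi> has_real_derivative \<Phi>' y) (at y)"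
  unfolding \<Phi>_def \<Phi>'_def by (auto intro!: derivative_eq_intros b_deriv \<phi>_deriv)

lemma \<phi>'_deriv:
  assumes y: "y \<noteq> a"
  shows "(\<phi>' has_real_derivative \<kappa> * \<phi> y - 2 * b' y * \<phi>' y / (b y - b a)) (at y)"
proof -
  have w: "((\<lambda>z. w z * \<phi>' z) has_real_derivative \<kappa> * w y * \<phi> y) (at y)" using sol by (simp add: is_sol_def)
  have wd: "(w has_real_derivative 2 * (b y - b a) * b' y) (at y)"
    unfolding w_def by (auto intro!: derivative_eq_intros b_deriv)
  define x where "x = b y - b a"
  have n: "x \<noteq> 0" using b_diff_nonzero[OF y] by (simp add: x_def)
  have wn: "w y \<noteq> 0" using w_pos[OF y] by simp
  have "((\<lambda>z. w z * \<phi>' z / w z) has_real_derivative ((\<kappa> * w y * \<phi> y) * w y - (w y * \<phi>' y) * (2 * (b y - b a) * b' y)) / (w y * w y)) (at y)"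
    by (rule DERIV_divide[OF w wd wn])
  also have "((\<kappa> * w y * \<phi> y) * w y - (w y * \<phi>' y) * (2 * (b y - b a) * b' y)) / (w y * w y) = \<kappa> * \<phi> y - 2 * b' y * \<phi>' y / (b y - b a)"
    unfolding w_def x_def[symmetric] using n by (simp add: field_simps power2_eq_square)
  finally have d: "((\<lambda>z. w z * \<phi>' z / w z) has_real_derivative \<kappa> * \<phi> y - 2 * b' y * \<phi>' y / (b y - b a)) (at y)" .
  have "eventually (\<lambda>z. z \<in> - {a}) (nhds y)" using y by (intro eventually_nhds_in_open) auto
  then have "eventually (\<lambda>z. w z * \<phi>' z / w z = \<phi>' z) (nhds y)"
    by eventually_elim (use w_pos in force)
  from DERIV_cong_ev[OF refl this refl] d show ?thesis by simp
qed

lemma \<Phi>'_deriv: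
  assumes y: "y \<noteq> a"
  shows "(\<Phi>' has_real_derivative (\<kappa> + b2 y / (b y - b a)) * \<Phi> y) (at y)"
proof -
  define x where "x = b y - b a"
  have n: "x \<noteq> 0" using b_diff_nonzero[OF y] by (simp add: x_def)
  have "(\<Phi>' has_real_derivative b2 y * \<phi> y + \<phi>' y * b' y + ((b' y - 0) * \<phi>' y + (\<kappa> * \<phi> y - 2 * b' y * \<phi>' y / x) * x)) (at y)"
    unfolding \<Phi>'_def x_def
    by (intro DERIV_add DERIV_mult DERIV_diff DERIV_const b'_deriv \<phi>_deriv b_deriv \<phi>'_deriv[OF y])
  moreover have "b2 y * \<phi> y + \<phi>' y * b' y + ((b' y - 0) * \<phi>' y + (\<kappa> * \<phi> y - 2 * b' y * \<phi>' y / x) * x) = (\<kappa> + b2 y / x) * \<Phi> y"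
    unfolding \<Phi>_def x_def[symmetric] using n by (simp add: field_simps)
  ultimately show ?thesis by (simp add: x_def)
qed

lemma B_deriv:
  assumes y: "y \<noteq> a"
  shows "(B has_real_derivative ((\<psi>' y * \<Phi> y - \<psi> y * \<Phi>' y + \<beta> * p) / \<Phi> y)\<^sup>2 - S y) (at y)"
proof -
  define x where "x = b y - b a"
  have n: "x \<noteq> 0" using b_diff_nonzero[OF y] by (simp add: x_def)
  have \<Phi>n: "\<Phi> y \<noteq> 0" using \<Phi>_nonzero[OF y] .
  define V where "V = \<kappa> + r y * (b y - b ys)"
  define U where "U = \<kappa> + b2 y / x"
  \<comment> \<open>Through \<open>b2_factor\<close> the potentials at the speeds
    \<open>b ys\<close> and \<open>b a\<close> are both expressed by \<open>r\<close>, and their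
    difference acquires the factor \<open>b a - b ys\<close>. This is the origin of the linear term
    in the final inequality.\<close>
  have VU: "V - U = - ((b a - b ys) * (r y * (b y - b ys) / x))"
  proof -
    have "V - U = r y * (b y - b ys) * (x - (b y - b ys)) / x"
      using n by (simp add: V_def U_def b2_factor field_simps power2_eq_square)
    moreover have "x - (b y - b ys) = - (b a - b ys)" by (simp add: x_def)
    moreover have "u * (- d) / x = - (d * (u / x))" for u d by simp
    ultimately show ?thesis by (simp only:)
  qed
  have 1: "((\<lambda>y. \<psi> y * \<psi>' y) has_real_derivative (\<psi>' y)\<^sup>2 + V * (\<psi> y)\<^sup>2) (at y)"
    by (auto intro!: derivative_eq_intros \<psi>_deriv \<psi>'_deriv simp: V_def power2_eq_square algebra_simps)
  have 2: "((\<lambda>y. (\<psi> y)\<^sup>2 * \<Phi>' y / \<Phi> y) has_real_derivative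
      2 * \<psi> y * \<psi>' y * \<Phi>' y / \<Phi> y + U * (\<psi> y)\<^sup>2 - (\<psi> y)\<^sup>2 * (\<Phi>' y)\<^sup>2 / (\<Phi> y)\<^sup>2) (at y)"
    using \<Phi>n
    by (auto intro!: derivative_eq_intros \<psi>_deriv \<Phi>_deriv \<Phi>'_deriv[OF y] simp: U_def x_def)
      (simp add: field_simps power2_eq_square)
  have 3: "((\<lambda>y. 2 * (\<beta> * p) * \<psi> y / \<Phi> y) has_real_derivative 2 * (\<beta> * p) * (\<psi>' y * \<Phi> y - \<psi> y * \<Phi>' y) / (\<Phi> y)\<^sup>2) (at y)"
    using \<Phi>n by (auto intro!: derivative_eq_intros \<psi>_deriv \<Phi>_deriv simp: power2_eq_square algebra_simps)
  have 4: "((\<lambda>y. (\<beta> * p)\<^sup>2 / (\<beta> * (b y - b a))) has_real_derivative - ((\<beta> * p)\<^sup>2 * b' y / (\<beta> * x\<^sup>2))) (at y)"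
    using n \<beta>_pos by (auto intro!: derivative_eq_intros b_deriv simp: x_def power2_eq_square)
  have "(B has_real_derivative ((\<psi>' y)\<^sup>2 + V * (\<psi> y)\<^sup>2) - (2 * \<psi> y * \<psi>' y * \<Phi>' y / \<Phi> y + U * (\<psi> y)\<^sup>2 - (\<psi> y)\<^sup>2 * (\<Phi>' y)\<^sup>2 / (\<Phi> y)\<^sup>2)
      + 2 * (\<beta> * p) * (\<psi>' y * \<Phi> y - \<psi> y * \<Phi>' y) / (\<Phi> y)\<^sup>2 - - ((\<beta> * p)\<^sup>2 * b' y / (\<beta> * x\<^sup>2))) (at y)" (is "(B has_real_derivative ?D) _")
    unfolding B_def by (intro DERIV_add DERIV_diff 1 2 3 4)
  moreover have "?D = ((\<psi>' y * \<Phi> y - \<psi> y * \<Phi>' y + \<beta> * p) / \<Phi> y)\<^sup>2 - S y"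
  proof -
    have sq: "((\<psi>' y * \<Phi> y - \<psi> y * \<Phi>' y + \<beta> * p) / \<Phi> y)\<^sup>2
      = (\<psi>' y)\<^sup>2 - 2 * \<psi> y * \<psi>' y * \<Phi>' y / \<Phi> y + (\<psi> y)\<^sup>2 * (\<Phi>' y)\<^sup>2 / (\<Phi> y)\<^sup>2
        + 2 * (\<beta> * p) * (\<psi>' y * \<Phi> y - \<psi> y * \<Phi>' y) / (\<Phi> y)\<^sup>2 + (\<beta> * p)\<^sup>2 / (\<Phi> y)\<^sup>2"
      using \<Phi>n by (simp add: field_simps power2_eq_square)
    have S: "S y = - ((V - U) * (\<psi> y)\<^sup>2) + (\<beta> * p)\<^sup>2 / (\<Phi> y)\<^sup>2 - (\<beta> * p)\<^sup>2 * b' y / (\<beta> * x\<^sup>2)"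
      unfolding VU S_def J_integrand_def by (simp add: x_def \<beta>_def \<Phi>_def algebra_simps)
    show ?thesis unfolding sq S by (simp add: algebra_simps)
  qed
  ultimately show ?thesis by simp
qed

definition B_lim where "B_lim = p * \<psi>' a - b2 a / \<beta> * p\<^sup>2"

text \<open>The poles at \<open>a\<close> cancel. With \<open>\<phi>\<close> replaced by 1 and
  \<open>b'\<close> by \<open>\<beta>\<close>, the terms over \<open>b - b a\<close> form the
  perfect square \<open>- \<beta> (\<psi> - p)\<^sup>2 / (b - b a)\<close>; the corrections contain
  \<open>\<phi> - 1\<close> or \<open>b' - \<beta>\<close> and are difference quotients as
  well.\<close>

lemma B_eq:
  assumes y: "y \<noteq> a"
  shows "B y = \<psi> y * \<psi>' y - (\<psi> y)\<^sup>2 * \<phi>' y / \<phi> y - (b' y - b' a) / (b y - b a) * (\<psi> y)\<^sup>2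
    - \<beta> * ((\<psi> y - \<psi> a) * ((\<psi> y - \<psi> a) / (b y - b a))) - 2 * \<beta> * p * \<psi> y * ((\<phi> y - \<phi> a) / (b y - b a)) / \<phi> y"
proof -
  define x where "x = b y - b a"
  have n: "x \<noteq> 0" using b_diff_nonzero[OF y] by (simp add: x_def)
  have f: "\<phi> y \<noteq> 0" using \<phi>_ge_1[of y] by simp
  show ?thesis
    unfolding B_def \<Phi>_def \<Phi>'_def x_def[symmetric] \<beta>_def[symmetric] p_def[symmetric] ini
    using n f \<beta>_pos by (simp add: field_simps power2_eq_square)
qed

text \<open>What counts is that the limit is two-sided: it cancels in
  \<open>B (a + \<epsilon>) - B (a - \<epsilon>)\<close>.\<close>

lemma B_tendsto: "(B \<longlongrightarrow> B_lim) (at a)"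
proof -
  have b0: "b' a \<noteq> 0" using b'_pos[of a] by simp
  note q = quotient_tendsto[OF _ b_deriv b0]
  have \<phi>'0: "(\<phi>' \<longlongrightarrow> 0) (at a)"
  proof -
    obtain C where C: "\<And>y. \<bar>y - a\<bar> \<le> 1 \<Longrightarrow> \<bar>\<phi>' y\<bar> \<le> C * \<bar>y - a\<bar>"
      using sol_near[OF sol ini] by metis
    show ?thesis
    proof (rule Lim_null_comparison)
      show "eventually (\<lambda>y. norm (\<phi>' y) \<le> C * \<bar>y - a\<bar>) (at a)"
        unfolding eventually_at_topological using C by (intro exI[of _ "{a-1<..<a+1}"]) auto
      have "((\<lambda>y. C * \<bar>y - a\<bar>) \<longlongrightarrow> C * \<bar>a - a\<bar>) (at a)" by (intro tendsto_intros)
      then show "((\<lambda>y. C * \<bar>y - a\<bar>) \<longlongrightarrow> 0) (at a)" by simp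
    qed
  qed
  have t: "(\<psi> \<longlongrightarrow> \<psi> a) (at a)" "(\<psi>' \<longlongrightarrow> \<psi>' a) (at a)" "(\<phi> \<longlongrightarrow> \<phi> a) (at a)"
    using DERIV_isCont[OF \<psi>_deriv] DERIV_isCont[OF \<psi>'_deriv] DERIV_isCont[OF \<phi>_deriv] by (simp_all add: isCont_def)
  have "((\<lambda>y. \<psi> y * \<psi>' y - (\<psi> y)\<^sup>2 * \<phi>' y / \<phi> y - (b' y - b' a) / (b y - b a) * (\<psi> y)\<^sup>2
    - \<beta> * ((\<psi> y - \<psi> a) * ((\<psi> y - \<psi> a) / (b y - b a))) - 2 * \<beta> * p * \<psi> y * ((\<phi> y - \<phi> a) / (b y - b a)) / \<phi> y)
    \<longlongrightarrow> \<psi> a * \<psi>' a - (\<psi> a)\<^sup>2 * 0 / \<phi> a - b2 a / b' a * (\<psi> a)\<^sup>2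
    - \<beta> * ((\<psi> a - \<psi> a) * (\<psi>' a / b' a)) - 2 * \<beta> * p * \<psi> a * (\<phi>' a / b' a) / \<phi> a) (at a)"
    by (intro tendsto_intros t \<phi>'0 q b'_deriv \<psi>_deriv \<phi>_deriv) (simp_all add: ini)
  moreover have "\<psi> a * \<psi>' a - (\<psi> a)\<^sup>2 * 0 / \<phi> a - b2 a / b' a * (\<psi> a)\<^sup>2
    - \<beta> * ((\<psi> a - \<psi> a) * (\<psi>' a / b' a)) - 2 * \<beta> * p * \<psi> a * (\<phi>' a / b' a) / \<phi> a = B_lim"
    by (simp add: B_lim_def p_def \<beta>_def ini)
  ultimately have "((\<lambda>y. \<psi> y * \<psi>' y - (\<psi> y)\<^sup>2 * \<phi>' y / \<phi> y - (b' y - b' a) / (b y - b a) * (\<psi> y)\<^sup>2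
    - \<beta> * ((\<psi> y - \<psi> a) * ((\<psi> y - \<psi> a) / (b y - b a))) - 2 * \<beta> * p * \<psi> y * ((\<phi> y - \<phi> a) / (b y - b a)) / \<phi> y) \<longlongrightarrow> B_lim) (at a)"
    by simp
  then show ?thesis
    by (rule Lim_transform_eventually) (auto simp: eventually_at_filter B_eq)
qed

end

section \<open>Integration of Picone's identity over symmetric truncations\<close>

context trial
begin

definition S1 where "S1 y = r y * (b y - b ys) * (\<psi> y)\<^sup>2 / (b y - b a)"

text \<open>Writing \<open>b y - b ys = (b y - b a) + (b a - b ys)\<close> isolates the density
  \<open>r \<psi>\<^sup>2\<close> of the solvability integral. The remainder carries another factor
  \<open>b a - b ys\<close>, which together with the one in \<open>S\<close> makes it the quadratic
  error.\<close>

lemma S1_split: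
  assumes "y \<noteq> a"
  shows "S1 y = r y * (\<psi> y)\<^sup>2 + (b a - b ys) * (r y * (\<psi> y)\<^sup>2 / (b y - b a))"
proof -
  define x where "x = b y - b a"
  have "x \<noteq> 0" using b_diff_nonzero[OF assms] by (simp add: x_def)
  moreover have "b y - b ys = x + (b a - b ys)" by (simp add: x_def)
  ultimately show ?thesis unfolding S1_def x_def[symmetric] by (simp add: field_simps)
qed

lemma weighted_punctured_integrable:
  assumes e: "0 < \<epsilon>"
  shows "set_integrable lborel (punctured a \<epsilon>) (\<lambda>y. r y * (\<psi> y)\<^sup>2 / (b y - b a))"
  unfolding set_integrable_def
proof (rule Bochner_Integration.integrable_bound[OF integrable_mult_right[OF weighted_integrable, of "1 / (m * \<epsilon>)"]])
  show "AE y in lborel. norm (indicator (punctured a \<epsilon>) y *\<^sub>R (r y * (\<psi> y)\<^sup>2 / (b y - b a))) \<le> norm (1 / (m * \<epsilon>) * (r y * (\<psi> y)\<^sup>2))"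
  proof (rule AE_I2)
    fix y
    show "norm (indicator (punctured a \<epsilon>) y *\<^sub>R (r y * (\<psi> y)\<^sup>2 / (b y - b a))) \<le> norm (1 / (m * \<epsilon>) * (r y * (\<psi> y)\<^sup>2))"
    proof (cases "y \<in> punctured a \<epsilon>")
      case True
      then have "m * \<epsilon> \<le> m * \<bar>y - a\<bar>" using m_pos by (auto simp: punctured_def)
      also have "\<dots> \<le> \<bar>b y - b a\<bar>" by (rule abs_b_diff_bounds)
      finally have mb: "m * \<epsilon> \<le> \<bar>b y - b a\<bar>" .
      have "\<bar>r y * (\<psi> y)\<^sup>2\<bar> / \<bar>b y - b a\<bar> \<le> \<bar>r y * (\<psi> y)\<^sup>2\<bar> / (m * \<epsilon>)"
      proof (intro divide_left_mono mb)
        have "0 < m * \<epsilon>" using m_pos e by simp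
        moreover have "0 < \<bar>b y - b a\<bar>" using mb calculation by linarith
        ultimately show "0 < \<bar>b y - b a\<bar> * (m * \<epsilon>)" by (rule mult_pos_pos[rotated])
      qed auto
      then show ?thesis using True e m_pos by (simp add: abs_mult)
    qed auto
  qed
qed measurable

lemma S1_punctured_integrable:
  assumes e: "0 < \<epsilon>"
  shows "set_integrable lborel (punctured a \<epsilon>) S1"
    "(LBINT y:punctured a \<epsilon>. S1 y) = (LBINT y:punctured a \<epsilon>. r y * (\<psi> y)\<^sup>2)
      + (b a - b ys) * (LBINT y:punctured a \<epsilon>. r y * (\<psi> y)\<^sup>2 / (b y - b a))"
proof -
  note i = set_integrable_punctured[OF weighted_integrable] set_integrable_mult_right[of "b a - b ys", OF weighted_punctured_integrable[OF e]]
  note s = set_integral_add[OF i(1)[of a \<epsilon>] i(2)]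
  have eq: "S1 y = r y * (\<psi> y)\<^sup>2 + (b a - b ys) * (r y * (\<psi> y)\<^sup>2 / (b y - b a))" if "y \<in> punctured a \<epsilon>" for y
    using that e by (intro S1_split) (auto simp: punctured_def)
  have "set_integrable lborel (punctured a \<epsilon>) S1 \<longleftrightarrow> set_integrable lborel (punctured a \<epsilon>) (\<lambda>y. r y * (\<psi> y)\<^sup>2 + (b a - b ys) * (r y * (\<psi> y)\<^sup>2 / (b y - b a)))"
    by (intro set_integrable_cong refl eq)
  with s(1) show "set_integrable lborel (punctured a \<epsilon>) S1" by blast
  have "(LBINT y:punctured a \<epsilon>. S1 y) = (LBINT y:punctured a \<epsilon>. r y * (\<psi> y)\<^sup>2 + (b a - b ys) * (r y * (\<psi> y)\<^sup>2 / (b y - b a)))"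
    by (intro set_lebesgue_integral_cong allI impI eq) auto
  also have "\<dots> = (LBINT y:punctured a \<epsilon>. r y * (\<psi> y)\<^sup>2) + (LBINT y:punctured a \<epsilon>. (b a - b ys) * (r y * (\<psi> y)\<^sup>2 / (b y - b a)))"
    by (rule s(2))
  finally show "(LBINT y:punctured a \<epsilon>. S1 y) = (LBINT y:punctured a \<epsilon>. r y * (\<psi> y)\<^sup>2)
      + (b a - b ys) * (LBINT y:punctured a \<epsilon>. r y * (\<psi> y)\<^sup>2 / (b y - b a))"
    by (simp only: set_integral_mult_right)
qed

lemma S_eq: "S y = (b a - b ys) * S1 y + (\<beta> * p)\<^sup>2 * J_integrand \<phi> a y"
  by (simp add: S_def S1_def)

lemma S_isCont:
  assumes "y \<noteq> a"
  shows "isCont S y"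
proof -
  have n: "b y - b a \<noteq> 0" "\<phi> y \<noteq> 0" "b' a \<noteq> 0"
    using b_diff_nonzero[OF assms] \<phi>_ge_1[of y] b'_pos[of a] by auto
  have c: "isCont b y" "isCont b' y" "isCont \<phi> y" "isCont \<psi> y" "isCont r y"
    using DERIV_isCont[OF b_deriv] DERIV_isCont[OF b'_deriv] DERIV_isCont[OF \<phi>_deriv] DERIV_isCont[OF \<psi>_deriv] r_continuous
    by (auto simp: continuous_on_eq_continuous_at)
  show ?thesis unfolding S_def J_integrand_def
    by (intro continuous_intros c) (use n in auto)
qed

lemma B_increment:
  assumes uv: "u \<le> v" and a: "a \<notin> {u..v}"
  shows "B u - B v \<le> (LBINT y:{u..v}. S y)"
proof -
  define D where "D y = ((\<psi>' y * \<Phi> y - \<psi> y * \<Phi>' y + \<beta> * p) / \<Phi> y)\<^sup>2" for y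
  have ne: "y \<noteq> a" if "u \<le> y" "y \<le> v" for y using a that by auto
  have c: "isCont D y" if "y \<noteq> a" for y
    unfolding D_def
    by (intro continuous_intros DERIV_isCont[OF \<psi>_deriv] DERIV_isCont[OF \<psi>'_deriv] DERIV_isCont[OF \<Phi>_deriv]
        DERIV_isCont[OF \<Phi>'_deriv[OF that]] \<Phi>_nonzero[OF that])
  have "(LBINT y. (D y - S y) * indicator {u..v} y) = B v - B u"
    by (intro integral_FTC_Icc_real[OF uv] continuous_intros c S_isCont ne)
      (use B_deriv ne in \<open>auto simp: D_def\<close>)
  moreover have "integrable lborel (\<lambda>y. D y * indicator {u..v} y)" "integrable lborel (\<lambda>y. S y * indicator {u..v} y)"
    by (intro borel_integrable_atLeastAtMost c S_isCont ne; assumption)+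
  ultimately have "(LBINT y. D y * indicator {u..v} y) - (LBINT y. S y * indicator {u..v} y) = B v - B u"
    by (simp add: left_diff_distrib)
  moreover have "0 \<le> (LBINT y. D y * indicator {u..v} y)"
    by (intro integral_nonneg_AE AE_I2) (auto simp: D_def)
  ultimately show ?thesis by (simp add: set_lebesgue_integral_def mult.commute)
qed

text \<open>All terms of \<open>B\<close> except \<open>- \<psi>\<^sup>2 \<phi>' / \<phi>\<close>
  tend to 0 by the decay of \<open>\<psi>\<close> and the growth of \<open>b\<close>. The
  exceptional one has the favourable sign at each end, because \<open>\<phi>'\<close> has the sign
  of \<open>y - a\<close>, so a one-sided comparison takes the place of a limit.\<close>

lemma B_at_top: "\<exists>E. (E \<longlongrightarrow> 0) at_top \<and> eventually (\<lambda>y. B y \<le> E y) at_top"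
  and B_at_bot: "\<exists>E. (E \<longlongrightarrow> 0) at_bot \<and> eventually (\<lambda>y. E y \<le> B y) at_bot"
proof -
  let ?i = "\<lambda>y. 1 / (b y - b a)"
  define E where "E y = \<psi> y * \<psi>' y - (\<psi> y)\<^sup>2 * b' y * ?i y + 2 * (\<beta> * p) * \<psi> y * (1 / \<phi> y) * ?i y - (\<beta> * p)\<^sup>2 / \<beta> * ?i y" for y
  have BE: "B y = E y - (\<psi> y)\<^sup>2 * \<phi>' y / \<phi> y" if y: "y \<noteq> a" for y
  proof -
    define x where "x = b y - b a"
    have n: "x \<noteq> 0" using b_diff_nonzero[OF y] by (simp add: x_def)
    have f: "\<phi> y \<noteq> 0" using \<phi>_ge_1[of y] by simp
    show ?thesis
      unfolding B_def E_def \<Phi>_def \<Phi>'_def x_def[symmetric]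
      using n f \<beta>_pos by (simp add: field_simps power2_eq_square)
  qed
  have lim: "(E \<longlongrightarrow> 0) F" if F: "(\<psi> \<longlongrightarrow> 0) F" "(\<psi>' \<longlongrightarrow> 0) F" "(?i \<longlongrightarrow> 0) F" for F
  proof -
    have b1: "Bfun b' F" by (rule BfunI[of _ "1/m"]) (use b'_upper b'_pos in \<open>simp add: less_imp_le\<close>)
    have b2: "Bfun (\<lambda>y. 1 / \<phi> y) F" by (rule BfunI[of _ 1]) (use \<phi>_ge_1 in \<open>auto simp: divide_le_eq order_trans[OF zero_le_one]\<close>)
    have "((\<lambda>y. (\<psi> y)\<^sup>2 * ?i y) \<longlongrightarrow> 0\<^sup>2 * 0) F" by (intro tendsto_intros F)
    then have z1: "((\<lambda>y. ((\<psi> y)\<^sup>2 * ?i y) * b' y) \<longlongrightarrow> 0) F"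
      unfolding tendsto_Zfun_iff mult_zero_right diff_0_right
      by (rule bounded_bilinear.Zfun_prod_Bfun[OF bounded_bilinear_mult _ b1])
    have "((\<lambda>y. 2 * (\<beta> * p) * \<psi> y * ?i y) \<longlongrightarrow> 2 * (\<beta> * p) * 0 * 0) F" by (intro tendsto_intros F)
    then have z2: "((\<lambda>y. (2 * (\<beta> * p) * \<psi> y * ?i y) * (1 / \<phi> y)) \<longlongrightarrow> 0) F"
      unfolding tendsto_Zfun_iff mult_zero_right diff_0_right
      by (rule bounded_bilinear.Zfun_prod_Bfun[OF bounded_bilinear_mult _ b2])
    have "((\<lambda>y. \<psi> y * \<psi>' y - ((\<psi> y)\<^sup>2 * ?i y) * b' y + (2 * (\<beta> * p) * \<psi> y * ?i y) * (1 / \<phi> y) - (\<beta> * p)\<^sup>2 / \<beta> * ?i y) \<longlongrightarrow> 0 * 0 - 0 + 0 - (\<beta> * p)\<^sup>2 / \<beta> * 0) F"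
      by (intro tendsto_intros F z1 z2)
    then show ?thesis unfolding E_def by (simp add: mult_ac)
  qed
  have "eventually (\<lambda>y. B y \<le> E y) at_top"
    using eventually_gt_at_top[of a]
  proof eventually_elim
    case (elim y)
    then have "0 \<le> (\<psi> y)\<^sup>2 * \<phi>' y / \<phi> y"
      using sol_sign(2)[OF sol ini, of y] \<phi>_ge_1[of y] by simp
    then show ?case using BE[of y] elim by simp
  qed
  then show "\<exists>E. (E \<longlongrightarrow> 0) at_top \<and> eventually (\<lambda>y. B y \<le> E y) at_top"
    using lim[OF \<psi>_lim(1) \<psi>'_lim(1) inverse_b_tendsto_0(1)] by blast
  have "eventually (\<lambda>y. E y \<le> B y) at_bot"
    using eventually_gt_at_bot[of a]
  proof eventually_elim
    case (elim y)
    then have "(\<psi> y)\<^sup>2 * \<phi>' y / \<phi> y \<le> 0"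
      using sol_sign(3)[OF sol ini, of y] \<phi>_ge_1[of y] by (simp add: divide_nonpos_pos mult_nonneg_nonpos)
    then show ?case using BE[of y] elim by simp
  qed
  then show "\<exists>E. (E \<longlongrightarrow> 0) at_bot \<and> eventually (\<lambda>y. E y \<le> B y) at_bot"
    using lim[OF \<psi>_lim(2) \<psi>'_lim(2) inverse_b_tendsto_0(2)] by blast
qed

text \<open>Letting the far endpoint in \<open>B_increment\<close> tend to infinity on each side
  leaves only the values of \<open>B\<close> next to \<open>a\<close>. The radius is doubled so that
  the closed half-lines starting at \<open>a \<plusminus> 2 * \<epsilon>\<close> lie inside the open
  set \<open>punctured a \<epsilon>\<close> on which integrability is given.\<close>

lemma truncated_inequality:
  assumes e: "0 < \<epsilon>" and Si: "set_integrable lborel (punctured a \<epsilon>) S"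
  shows "B (a + 2 * \<epsilon>) - B (a - 2 * \<epsilon>) \<le> (LBINT y:punctured a (2 * \<epsilon>). S y)"
proof -
  have right: "B (a + 2 * \<epsilon>) \<le> (LBINT y:{a + 2 * \<epsilon>..}. S y)"
  proof -
    obtain E where E: "(E \<longlongrightarrow> 0) at_top" "eventually (\<lambda>y. B y \<le> E y) at_top" using B_at_top by blast
    have si: "set_integrable lborel {a + 2 * \<epsilon>..} S"
      by (rule set_integrable_subset[OF Si]) (use e in \<open>auto simp: punctured_def\<close>)
    then have "((\<lambda>v. LBINT x. indicator {..v} x *\<^sub>R (indicator {a + 2 * \<epsilon>..} x *\<^sub>R S x)) \<longlongrightarrow> (LBINT y:{a + 2 * \<epsilon>..}. S y)) at_top"
      unfolding set_lebesgue_integral_def set_integrable_def by (intro tendsto_integral_at_top) auto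
    then have "((\<lambda>v. (LBINT x. indicator {..v} x *\<^sub>R (indicator {a + 2 * \<epsilon>..} x *\<^sub>R S x)) + E v) \<longlongrightarrow> (LBINT y:{a + 2 * \<epsilon>..}. S y) + 0) at_top"
      by (intro tendsto_intros E)
    then have "B (a + 2 * \<epsilon>) \<le> (LBINT y:{a + 2 * \<epsilon>..}. S y) + 0"
    proof (rule tendsto_lowerbound)
      show "eventually (\<lambda>v. B (a + 2 * \<epsilon>) \<le> (LBINT x. indicator {..v} x *\<^sub>R (indicator {a + 2 * \<epsilon>..} x *\<^sub>R S x)) + E v) at_top"
        using E(2) eventually_ge_at_top[of "a + 2 * \<epsilon>"]
      proof eventually_elim
        case (elim v)
        have "(LBINT x. indicator {..v} x *\<^sub>R (indicator {a + 2 * \<epsilon>..} x *\<^sub>R S x)) = (LBINT y:{a + 2 * \<epsilon>..v}. S y)"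
          unfolding set_lebesgue_integral_def by (intro Bochner_Integration.integral_cong) (auto simp: indicator_def)
        then show ?case using B_increment[OF elim(2)] elim e by auto
      qed
    qed auto
    then show ?thesis by simp
  qed
  have left: "- B (a - 2 * \<epsilon>) \<le> (LBINT y:{..a - 2 * \<epsilon>}. S y)"
  proof -
    obtain E where E: "(E \<longlongrightarrow> 0) at_bot" "eventually (\<lambda>y. E y \<le> B y) at_bot" using B_at_bot by blast
    have si: "set_integrable lborel {..a - 2 * \<epsilon>} S"
      by (rule set_integrable_subset[OF Si]) (use e in \<open>auto simp: punctured_def\<close>)
    then have "((\<lambda>v. LBINT x. indicator {v..} x *\<^sub>R (indicator {..a - 2 * \<epsilon>} x *\<^sub>R S x)) \<longlongrightarrow> (LBINT y:{..a - 2 * \<epsilon>}. S y)) at_bot"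
      unfolding set_lebesgue_integral_def set_integrable_def by (intro tendsto_integral_at_bot) auto
    then have "((\<lambda>v. (LBINT x. indicator {v..} x *\<^sub>R (indicator {..a - 2 * \<epsilon>} x *\<^sub>R S x)) - E v) \<longlongrightarrow> (LBINT y:{..a - 2 * \<epsilon>}. S y) - 0) at_bot"
      by (intro tendsto_intros E)
    then have "- B (a - 2 * \<epsilon>) \<le> (LBINT y:{..a - 2 * \<epsilon>}. S y) - 0"
    proof (rule tendsto_lowerbound)
      show "eventually (\<lambda>v. - B (a - 2 * \<epsilon>) \<le> (LBINT x. indicator {v..} x *\<^sub>R (indicator {..a - 2 * \<epsilon>} x *\<^sub>R S x)) - E v) at_bot"
        using E(2) eventually_le_at_bot[of "a - 2 * \<epsilon>"]
      proof eventually_elim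
        case (elim v)
        have "(LBINT x. indicator {v..} x *\<^sub>R (indicator {..a - 2 * \<epsilon>} x *\<^sub>R S x)) = (LBINT y:{v..a - 2 * \<epsilon>}. S y)"
          unfolding set_lebesgue_integral_def by (intro Bochner_Integration.integral_cong) (auto simp: indicator_def)
        then show ?case using B_increment[OF elim(2)] elim e by auto
      qed
    qed auto
    then show ?thesis by simp
  qed
  have "(LBINT y:punctured a (2 * \<epsilon>). S y) = (LBINT y:{a + 2 * \<epsilon>..} \<union> {..a - 2 * \<epsilon>}. S y)"
  proof (rule set_integral_cong_set)
    have "AE y in lborel. y \<noteq> a + 2 * \<epsilon> \<and> y \<noteq> a - 2 * \<epsilon>"
      using AE_lborel_singleton[of "a + 2 * \<epsilon>"] AE_lborel_singleton[of "a - 2 * \<epsilon>"] by eventually_elim auto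
    then show "AE x in lborel. x \<in> {a + 2 * \<epsilon>..} \<union> {..a - 2 * \<epsilon>} \<longleftrightarrow> x \<in> punctured a (2 * \<epsilon>)"
      by (rule AE_mp) (use e in \<open>auto simp: punctured_def abs_if intro!: AE_I2\<close>)
    have "set_integrable lborel (punctured a (2 * \<epsilon>)) S" "set_integrable lborel ({a + 2 * \<epsilon>..} \<union> {..a - 2 * \<epsilon>}) S"
      by (rule set_integrable_subset[OF Si]; use e in \<open>auto simp: punctured_def\<close>)+
    then show "set_borel_measurable lborel (punctured a (2 * \<epsilon>)) S" "set_borel_measurable lborel ({a + 2 * \<epsilon>..} \<union> {..a - 2 * \<epsilon>}) S"
      by (auto simp: set_integrable_def set_borel_measurable_def)
  qed
  also have "\<dots> = (LBINT y:{a + 2 * \<epsilon>..}. S y) + (LBINT y:{..a - 2 * \<epsilon>}. S y)"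
    by (intro set_integral_Un set_integrable_subset[OF Si]) (use e in \<open>auto simp: punctured_def\<close>)
  finally show ?thesis using right left by linarith
qed

text \<open>The two boundary values of \<open>B\<close> cancel in the limit. The principal value in
  the remainder enters only through its bound \<open>M\<close>, as its factor
  \<open>(b a - b ys)\<^sup>2\<close> already makes it of second order.\<close>

lemma trial_inequality:
  assumes J: "((\<lambda>\<epsilon>. LBINT y:punctured a \<epsilon>. J_integrand \<phi> a y) \<longlongrightarrow> J) (at_right 0)"
    and Ji: "\<And>\<epsilon>. 0 < \<epsilon> \<Longrightarrow> \<epsilon> < 1 \<Longrightarrow> set_integrable lborel (punctured a \<epsilon>) (J_integrand \<phi> a)"
    and M: "\<And>\<epsilon>. 0 < \<epsilon> \<Longrightarrow> \<epsilon> < 1 \<Longrightarrow> \<bar>LBINT y:punctured a \<epsilon>. r y * (\<psi> y)\<^sup>2 / (b y - b a)\<bar> \<le> M"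
  shows "0 \<le> (b a - b ys) * (LBINT y. r y * (\<psi> y)\<^sup>2) + (b a - b ys)\<^sup>2 * M + (\<beta> * p)\<^sup>2 * J"
proof -
  define L where "L \<epsilon> = (b a - b ys) * (LBINT y:punctured a \<epsilon>. r y * (\<psi> y)\<^sup>2) + (b a - b ys)\<^sup>2 * M
    + (\<beta> * p)\<^sup>2 * (LBINT y:punctured a \<epsilon>. J_integrand \<phi> a y)" for \<epsilon>
  have Lt: "(L \<longlongrightarrow> (b a - b ys) * (LBINT y. r y * (\<psi> y)\<^sup>2) + (b a - b ys)\<^sup>2 * M + (\<beta> * p)\<^sup>2 * J) (at_right 0)"
    unfolding L_def by (intro tendsto_intros tendsto_integral_punctured weighted_integrable J)
  have small: "eventually (\<lambda>\<epsilon>::real. 0 < \<epsilon> \<and> \<epsilon> < 1) (at_right 0)"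
    using eventually_at_right_real[of 0 1] by (auto elim: eventually_mono)
  have ineq: "B (a + \<epsilon>) - B (a - \<epsilon>) \<le> L \<epsilon>" if e: "0 < \<epsilon>" "\<epsilon> < 1" for \<epsilon>
  proof -
    have si: "set_integrable lborel (punctured a \<delta>) S" if "0 < \<delta>" "\<delta> < 1" for \<delta>
      unfolding S_eq[abs_def] using that
      by (intro set_integral_add set_integrable_mult_right S1_punctured_integrable Ji)
    have "B (a + 2 * (\<epsilon> / 2)) - B (a - 2 * (\<epsilon> / 2)) \<le> (LBINT y:punctured a (2 * (\<epsilon> / 2)). S y)"
      using e by (intro truncated_inequality si) auto
    then have "B (a + \<epsilon>) - B (a - \<epsilon>) \<le> (LBINT y:punctured a \<epsilon>. S y)" by simp
    also have "\<dots> = (LBINT y:punctured a \<epsilon>. (b a - b ys) * S1 y) + (LBINT y:punctured a \<epsilon>. (\<beta> * p)\<^sup>2 * J_integrand \<phi> a y)"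
      unfolding S_eq using e
      by (intro set_integral_add set_integrable_mult_right S1_punctured_integrable Ji)
    also have "\<dots> = (b a - b ys) * (LBINT y:punctured a \<epsilon>. r y * (\<psi> y)\<^sup>2)
      + (b a - b ys)\<^sup>2 * (LBINT y:punctured a \<epsilon>. r y * (\<psi> y)\<^sup>2 / (b y - b a))
      + (\<beta> * p)\<^sup>2 * (LBINT y:punctured a \<epsilon>. J_integrand \<phi> a y)"
      unfolding set_integral_mult_right S1_punctured_integrable(2)[OF e(1)] by (simp add: power2_eq_square algebra_simps)
    also have "\<dots> \<le> L \<epsilon>"
      unfolding L_def using M[OF e] by (intro add_mono mult_left_mono order_refl) auto
    finally show ?thesis .
  qed
  have r: "filterlim (\<lambda>\<epsilon>. a + \<epsilon>) (at a) (at_right 0)" "filterlim (\<lambda>\<epsilon>. a - \<epsilon>) (at a) (at_right 0)"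
  proof -
    have "((\<lambda>\<epsilon>. a + \<epsilon>) \<longlongrightarrow> a + 0) (at_right 0)" "((\<lambda>\<epsilon>. a - \<epsilon>) \<longlongrightarrow> a - 0) (at_right 0)"
      by (intro tendsto_intros)+
    then show "filterlim (\<lambda>\<epsilon>. a + \<epsilon>) (at a) (at_right 0)" "filterlim (\<lambda>\<epsilon>. a - \<epsilon>) (at a) (at_right 0)"
      using small by (auto simp: filterlim_at elim!: eventually_mono)
  qed
  have "((\<lambda>\<epsilon>. B (a + \<epsilon>) - B (a - \<epsilon>)) \<longlongrightarrow> B_lim - B_lim) (at_right 0)"
    by (intro tendsto_diff filterlim_compose[OF B_tendsto] r)
  note Bt = this
  have "B_lim - B_lim \<le> (b a - b ys) * (LBINT y. r y * (\<psi> y)\<^sup>2) + (b a - b ys)\<^sup>2 * M + (\<beta> * p)\<^sup>2 * J"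
    by (rule tendsto_le[OF _ Lt Bt]) (use small ineq in \<open>auto elim!: eventually_mono\<close>)
  then show ?thesis by simp
qed

end

section \<open>The solvability condition\<close>

context rayleigh_mode
begin

text \<open>The bound must be uniform in \<open>a\<close>, since \<open>a\<close> will approach
  \<open>ys\<close>. The pole with residue \<open>\<rho> a / b' a\<close> is odd about
  \<open>a\<close> and cancels, and the Lipschitz constant of
  \<open>\<rho> = r \<psi>\<^sup>2\<close> controls what is left. Points within 1 of
  \<open>a\<close> are within 2 of \<open>ys\<close>, hence the radius in
  \<open>lip\<close>.\<close>

lemma pv_bound:
  assumes lip: "\<And>y z. \<bar>y - ys\<bar> \<le> 2 \<Longrightarrow> \<bar>z - ys\<bar> \<le> 2 \<Longrightarrow> \<bar>r y * (\<psi> y)\<^sup>2 - r z * (\<psi> z)\<^sup>2\<bar> \<le> L * \<bar>y - z\<bar>"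
  obtains M where "\<And>a \<epsilon>. \<bar>a - ys\<bar> \<le> 1 \<Longrightarrow> 0 < \<epsilon> \<Longrightarrow> \<epsilon> < 1 \<Longrightarrow>
    \<bar>LBINT y:punctured a \<epsilon>. r y * (\<psi> y)\<^sup>2 / (b y - b a)\<bar> \<le> M"
proof -
  define \<rho> where "\<rho> y = r y * (\<psi> y)\<^sup>2" for y
  have [measurable]: "\<rho> \<in> borel_measurable borel" unfolding \<rho>_def by measurable
  have \<rho>i: "integrable lborel \<rho>" unfolding \<rho>_def by (rule weighted_integrable)
  have "continuous_on UNIV \<rho>" unfolding \<rho>_def by (intro continuous_intros r_continuous \<psi>_continuous)
  then obtain P where P: "P > 0" "\<And>y. \<bar>y - ys\<bar> \<le> 1 \<Longrightarrow> \<bar>\<rho> y\<bar> \<le> P"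
    using continuous_bounded_near by blast
  have L0: "0 \<le> L" using lip[of "ys + 1" ys] by auto
  \<comment> \<open>The first term bounds \<open>(\<rho> y - \<rho> a) / (b y - b a)\<close>, the
    second the error of replacing \<open>b y - b a\<close> by its linearization at
    \<open>a\<close>.\<close>
  define N where "N = L / m + P * (K / m\<^sup>2)"
  show thesis
  proof (rule that)
    fix a \<epsilon> :: real assume a: "\<bar>a - ys\<bar> \<le> 1" and e: "0 < \<epsilon>" "\<epsilon> < 1"
    define f where "f y = \<rho> y / (b y - b a)" for y
    have [measurable]: "f \<in> borel_measurable borel" unfolding f_def by measurable
    have near: "\<bar>f y - (\<rho> a / b' a) / (y - a)\<bar> \<le> N" if y: "0 < \<bar>y - a\<bar>" "\<bar>y - a\<bar> \<le> 1" for y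
    proof -
      define s where "s = y - a" define B where "B = b y - b a" define \<beta> where "\<beta> = b' a"
      have s: "s \<noteq> 0" "\<bar>s\<bar> > 0" using y by (auto simp: s_def)
      have B: "m * \<bar>s\<bar> \<le> \<bar>B\<bar>" using abs_b_diff_bounds(1)[where z=y and y=a] by (auto simp: s_def B_def)
      have B0: "B \<noteq> 0" using b_diff_nonzero[of y a] s by (simp add: B_def s_def)
      have \<beta>: "m \<le> \<beta>" "\<beta> > 0" using b'_lower b'_pos by (auto simp: \<beta>_def)
      have "\<rho> y / B - (\<rho> a / \<beta>) / s = (\<rho> y - \<rho> a) / B + \<rho> a * ((\<beta> * s - B) / (B * (\<beta> * s)))"
        using s B0 \<beta> by (simp add: field_simps)
      also have "\<bar>\<dots>\<bar> \<le> \<bar>(\<rho> y - \<rho> a) / B\<bar> + \<bar>\<rho> a * ((\<beta> * s - B) / (B * (\<beta> * s)))\<bar>" by (rule abs_triangle_ineq)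
      also have "\<bar>(\<rho> y - \<rho> a) / B\<bar> \<le> L * \<bar>s\<bar> / (m * \<bar>s\<bar>)"
        unfolding abs_divide
      proof (rule frac_le)
        show "\<bar>\<rho> y - \<rho> a\<bar> \<le> L * \<bar>s\<bar>" unfolding \<rho>_def s_def using a y by (intro lip) auto
      qed (use L0 B s m_pos in auto)
      also have "L * \<bar>s\<bar> / (m * \<bar>s\<bar>) = L / m" using s by simp
      also have "\<bar>\<rho> a * ((\<beta> * s - B) / (B * (\<beta> * s)))\<bar> \<le> P * (K * s\<^sup>2 / ((m * \<bar>s\<bar>) * (m * \<bar>s\<bar>)))"
        unfolding abs_mult[of "\<rho> a"] abs_divide
      proof (intro mult_mono frac_le)
        show "\<bar>\<rho> a\<bar> \<le> P" by (rule P(2)[OF a])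
        have "\<bar>\<beta> * s - B\<bar> = \<bar>B - \<beta> * s\<bar>" by simp
        then show "\<bar>\<beta> * s - B\<bar> \<le> K * s\<^sup>2" using b_taylor[of y a] by (simp add: B_def \<beta>_def s_def)
        have "m * \<bar>s\<bar> \<le> \<bar>\<beta> * s\<bar>" using \<beta> by (simp add: abs_mult mult_right_mono)
        then show "(m * \<bar>s\<bar>) * (m * \<bar>s\<bar>) \<le> \<bar>B * (\<beta> * s)\<bar>"
          unfolding abs_mult[of B] using B m_pos by (intro mult_mono) auto
        show "0 < (m * \<bar>s\<bar>) * (m * \<bar>s\<bar>)" using m_pos s by simp
      qed (use P K_nonneg in auto)
      also have "K * s\<^sup>2 / ((m * \<bar>s\<bar>) * (m * \<bar>s\<bar>)) = K / m\<^sup>2"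
        using s m_pos by (simp add: field_simps power2_eq_square)
      finally show ?thesis by (simp add: f_def N_def s_def B_def \<beta>_def)
    qed
    have fb: "\<bar>f y\<bar> \<le> \<bar>\<rho> y\<bar> / m" if "y \<in> punctured a 1" for y
    proof -
      have "m * 1 \<le> m * \<bar>y - a\<bar>" using that m_pos by (auto simp: punctured_def)
      also have "\<dots> \<le> \<bar>b y - b a\<bar>" by (rule abs_b_diff_bounds)
      finally show ?thesis unfolding f_def abs_divide using m_pos by (intro divide_left_mono) auto
    qed
    have \<rho>m: "integrable lborel (\<lambda>y. \<bar>\<rho> y\<bar> / m)" using integrable_abs[OF \<rho>i] by simp
    have far: "set_integrable lborel (punctured a 1) f"
      unfolding set_integrable_def
      by (rule Bochner_Integration.integrable_bound[OF \<rho>m])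
        (use fb m_pos in \<open>auto simp: indicator_def intro!: AE_I2\<close>)
    obtain q where q: "integrable lborel q" "(LBINT y. \<bar>q y\<bar>) \<le> 2 * N + (LBINT y:punctured a 1. \<bar>f y\<bar>)"
      "(LBINT y:punctured a \<epsilon>. f y) = (LBINT y:punctured a \<epsilon>. q y)"
      using principal_value_regularize[OF _ near far] e by auto
    have "\<bar>LBINT y:punctured a \<epsilon>. q y\<bar> \<le> (LBINT y. \<bar>q y\<bar>)"
    proof -
      have "\<bar>LBINT y:punctured a \<epsilon>. q y\<bar> \<le> (LBINT y. \<bar>indicator (punctured a \<epsilon>) y *\<^sub>R q y\<bar>)"
        unfolding set_lebesgue_integral_def by (rule integral_abs_bound)
      also have "\<dots> \<le> (LBINT y. \<bar>q y\<bar>)"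
        using set_integrable_punctured[OF q(1)] q(1)
        by (intro integral_mono integrable_abs) (auto simp: set_integrable_def indicator_def)
      finally show ?thesis .
    qed
    also have "\<dots> \<le> 2 * N + (LBINT y:punctured a 1. \<bar>f y\<bar>)" by (rule q(2))
    also have "(LBINT y:punctured a 1. \<bar>f y\<bar>) \<le> (LBINT y. \<bar>\<rho> y\<bar> / m)"
      unfolding set_lebesgue_integral_def
    proof (rule integral_mono_AE)
      show "integrable lborel (\<lambda>y. indicator (punctured a 1) y *\<^sub>R \<bar>f y\<bar>)"
        using integrable_abs[OF far[unfolded set_integrable_def]] by (simp add: abs_mult)
      show "AE y in lborel. indicator (punctured a 1) y *\<^sub>R \<bar>f y\<bar> \<le> \<bar>\<rho> y\<bar> / m"
        using fb m_pos by (auto simp: indicator_def intro!: AE_I2)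
    qed (rule \<rho>m)
    finally have "\<bar>LBINT y:punctured a \<epsilon>. q y\<bar> \<le> 2 * N + (LBINT y. \<bar>\<rho> y\<bar> / m)" by simp
    moreover have "(LBINT y:punctured a \<epsilon>. r y * (\<psi> y)\<^sup>2 / (b y - b a)) = (LBINT y:punctured a \<epsilon>. q y)"
      using q(3) unfolding f_def \<rho>_def .
    ultimately show "\<bar>LBINT y:punctured a \<epsilon>. r y * (\<psi> y)\<^sup>2 / (b y - b a)\<bar> \<le> 2 * N + (LBINT y. \<bar>\<rho> y\<bar> / m)"
      by simp
  qed
qed

text \<open>
  The trial inequality at speed \<open>b a = c\<close> bounds \<open>(c - c\<^sub>*) H\<close> from below by \<open>o(c - c\<^sub>*)\<close> on both sides of \<open>c\<^sub>*\<close>.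
\<close>

lemma solvability_condition:
  assumes \<kappa>: "\<kappa> = (of_int k)\<^sup>2"
    and J: "J1 b k (b ys) = 0" and J': "(J1 b k has_real_derivative 0) (at (b ys))"
    and lip: "\<And>y z. \<bar>y - ys\<bar> \<le> 2 \<Longrightarrow> \<bar>z - ys\<bar> \<le> 2 \<Longrightarrow> \<bar>r y * (\<psi> y)\<^sup>2 - r z * (\<psi> z)\<^sup>2\<bar> \<le> L * \<bar>y - z\<bar>"
  shows "(LBINT y. r y * (\<psi> y)\<^sup>2) = 0"
proof -
  define H where "H = (LBINT y. r y * (\<psi> y)\<^sup>2)"
  obtain M where M: "\<And>a \<epsilon>. \<bar>a - ys\<bar> \<le> 1 \<Longrightarrow> 0 < \<epsilon> \<Longrightarrow> \<epsilon> < 1 \<Longrightarrow>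
    \<bar>LBINT y:punctured a \<epsilon>. r y * (\<psi> y)\<^sup>2 / (b y - b a)\<bar> \<le> M"
    using pv_bound[OF lip] by blast
  obtain P where P: "P > 0" "\<And>y. \<bar>\<psi> y\<bar> \<le> P"
    using continuous_bounded_if_limits[OF \<psi>_continuous \<psi>_lim] by blast
  define c where "c = b ys"
  \<comment> \<open>The restriction \<open>|x| < m\<close> keeps the point \<open>a\<close> with
    \<open>b a = c + x\<close> within distance 1 of \<open>ys\<close>, because \<open>b\<close>
    expands distances by at least the factor \<open>m\<close>.\<close>
  have ineq: "0 \<le> x * H + x\<^sup>2 * M + (b' (inv b (c + x)) * \<psi> (inv b (c + x)))\<^sup>2 * J1 b k (c + x)"
    if x: "\<bar>x\<bar> < m" for x
  proof -
    define a where "a = inv b (c + x)"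
    have ba: "b a = c + x" by (simp add: a_def b_inv)
    have "m * \<bar>a - ys\<bar> \<le> \<bar>x\<bar>" using abs_b_diff_bounds(1)[where z=a and y=ys] by (simp add: ba c_def)
    then have "m * \<bar>a - ys\<bar> \<le> m * 1" using x by simp
    then have a1: "\<bar>a - ys\<bar> \<le> 1" using m_pos by simp
    interpret cp: critical_point b b' m a \<kappa> by unfold_locales (rule \<kappa>_pos)
    obtain \<phi> \<phi>' where s: "cp.is_sol \<phi> \<phi>'" "\<phi> a = 1" "\<phi>' a = 0" using cp.is_sol_exists by blast
    interpret t: trial b b' m b2 b3 K ys \<kappa> r \<psi> \<psi>' R a \<phi> \<phi>' by unfold_locales (use s in auto)
    have "0 \<le> (b a - b ys) * (LBINT y. r y * (\<psi> y)\<^sup>2) + (b a - b ys)\<^sup>2 * M + (t.\<beta> * t.p)\<^sup>2 * J1 b k (b a)"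
      by (intro t.trial_inequality J1_limit[OF s \<kappa>_pos \<kappa>] M a1)
    then show ?thesis unfolding t.\<beta>_def t.p_def ba by (simp add: H_def c_def a_def)
  qed
  define Q where "Q = (1 / m * P)\<^sup>2"
  have Q: "Q > 0" using P m_pos by (simp add: Q_def)
  have JQ: "((\<lambda>x. J1 b k (c + x) / x) \<longlongrightarrow> 0) (at 0)"
    using J' J by (simp add: DERIV_def c_def)
  have key: "0 \<le> \<sigma> * H" if \<sigma>: "\<sigma> = 1 \<or> \<sigma> = -1" for \<sigma> :: real
  proof (rule ccontr)
    assume "\<not> 0 \<le> \<sigma> * H"
    define h where "h = - (\<sigma> * H)"
    have h: "h > 0" using \<open>\<not> 0 \<le> \<sigma> * H\<close> by (simp add: h_def)
    have "eventually (\<lambda>x. \<bar>J1 b k (c + x) / x\<bar> < h / (2 * Q)) (at 0)"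
      using JQ[THEN tendsto_rabs] h Q by (intro order_tendstoD(2)) auto
    then obtain d where d: "d > 0" "\<And>x. x \<noteq> 0 \<Longrightarrow> \<bar>x\<bar> < d \<Longrightarrow> \<bar>J1 b k (c + x) / x\<bar> < h / (2 * Q)"
      by (auto simp: eventually_at dist_real_def)
    \<comment> \<open>The three entries keep \<open>c + x\<close> in the admissible range, make
      \<open>|J1|\<close> at most \<open>h * t / (2 * Q)\<close>, and make the quadratic term at
      most \<open>h * t / 4\<close>. The sum \<open>h * t / 2 + h * t / 4\<close> cannot compensate
      \<open>- h * t\<close>.\<close>
    define t where "t = min (m / 2) (min (d / 2) (h / (4 * (\<bar>M\<bar> + 1))))"
    have t: "t > 0" "t < m" "t < d" "t * (\<bar>M\<bar> + 1) \<le> h / 4"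
    proof -
      show "t > 0" using m_pos d(1) h by (simp add: t_def)
      have "t \<le> m / 2" "t \<le> d / 2" unfolding t_def by (meson min.cobounded1 min.cobounded2 order_trans)+
      then show "t < m" "t < d" using m_pos d(1) by linarith+
      have "t \<le> h / (4 * (\<bar>M\<bar> + 1))" by (simp add: t_def)
      then show "t * (\<bar>M\<bar> + 1) \<le> h / 4" by (simp add: field_simps)
    qed
    define x where "x = \<sigma> * t"
    have x: "x \<noteq> 0" "\<bar>x\<bar> = t" "x\<^sup>2 = t * t" "x * H = - (t * h)"
      using \<sigma> t by (auto simp: x_def h_def power2_eq_square)
    have 1: "x\<^sup>2 * M \<le> t * (h / 4)"
    proof -
      have "t * M \<le> t * (\<bar>M\<bar> + 1)" using t by (intro mult_left_mono) auto
      then have "t * M \<le> h / 4" using t by linarith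
      then have "t * (t * M) \<le> t * (h / 4)" using t by (intro mult_left_mono) auto
      then show ?thesis by (simp add: x(3) mult.assoc)
    qed
    let ?v = "b' (inv b (c + x)) * \<psi> (inv b (c + x))"
    have "\<bar>J1 b k (c + x)\<bar> = \<bar>J1 b k (c + x) / x\<bar> * t" using x by (simp add: abs_divide)
    also have "\<dots> \<le> h / (2 * Q) * t" using d(2)[of x] x t by (intro mult_right_mono) auto
    finally have 2: "\<bar>J1 b k (c + x)\<bar> \<le> h / (2 * Q) * t" .
    have 3: "?v\<^sup>2 \<le> Q"
    proof -
      have "\<bar>?v\<bar> \<le> 1 / m * P" unfolding abs_mult using b'_upper b'_pos P m_pos
        by (intro mult_mono) (auto simp: abs_of_pos)
      then have "\<bar>?v\<bar>\<^sup>2 \<le> (1 / m * P)\<^sup>2" by (intro power_mono) auto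
      then show ?thesis by (simp add: Q_def)
    qed
    have "?v\<^sup>2 * J1 b k (c + x) \<le> ?v\<^sup>2 * \<bar>J1 b k (c + x)\<bar>" by (intro mult_left_mono) auto
    also have "\<dots> \<le> Q * (h / (2 * Q) * t)" using 2 3 Q by (intro mult_mono) auto
    also have "\<dots> = t * (h / 2)" using Q by simp
    finally have "0 \<le> - (t * h) + t * (h / 4) + t * (h / 2)"
      using ineq[of x] x t 1 by linarith
    then have "0 \<le> t * (- h / 4)" by (simp add: algebra_simps)
    moreover have "t * (- h / 4) < 0" using t h by (simp add: mult_pos_neg)
    ultimately show False by linarith
  qed
  from key[of 1] key[of "-1"] show ?thesis by (simp add: H_def)
qed

end

section \<open>The generalized eigenfunction\<close>

lemma DERIV_reflect:
  fixes f :: "real \<Rightarrow> real"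
  assumes "\<And>y. (f has_real_derivative f' y) (at y)"
  shows "((\<lambda>y. f (- y)) has_real_derivative - f' (- y)) (at y)"
  using DERIV_chain2[OF assms DERIV_minus[OF DERIV_ident], of y] by simp

text \<open>Beyond \<open>Y\<close> the function \<open>exp (- l * y) * w y\<close> is
  nondecreasing, so a positive value would persist and contradict the limit 0. Applied to
  combinations of \<open>\<psi>\<close> and \<open>\<psi>'\<close>, this extracts decay
  rates.\<close>

lemma exp_growth_contradiction:
  fixes w w' :: "real \<Rightarrow> real"
  assumes d: "\<And>y. (w has_real_derivative w' y) (at y)" and g: "\<And>y. y \<ge> Y \<Longrightarrow> l * w y \<le> w' y"
    and l: "l > 0" and lim: "(w \<longlongrightarrow> 0) at_top" and y: "y0 \<ge> Y"
  shows "w y0 \<le> 0"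
proof (rule ccontr)
  assume "\<not> w y0 \<le> 0"
  then have pos: "w y0 > 0" by simp
  have "w y0 \<le> w y" if "y \<ge> y0" for y
  proof -
    have "exp (- l * y0) * w y0 \<le> exp (- l * y) * w y"
    proof (rule DERIV_nonneg_imp_nondecreasing[OF that])
      fix x assume x: "y0 \<le> x" "x \<le> y"
      have "((\<lambda>x. exp (- l * x) * w x) has_real_derivative exp (- l * x) * (w' x - l * w x)) (at x)"
        by (auto intro!: derivative_eq_intros d simp: algebra_simps)
      moreover have "0 \<le> exp (- l * x) * (w' x - l * w x)" using g[of x] x y by simp
      ultimately show "\<exists>D. ((\<lambda>x. exp (- l * x) * w x) has_real_derivative D) (at x) \<and> 0 \<le> D" by blast
    qed
    then have "exp (l * y) * (exp (- l * y0) * w y0) \<le> exp (l * y) * (exp (- l * y) * w y)"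
      by (rule mult_left_mono) simp
    then have "exp (l * (y - y0)) * w y0 \<le> w y"
      by (simp add: mult.assoc[symmetric] exp_add[symmetric] exp_diff[symmetric] right_diff_distrib)
    moreover have "1 * w y0 \<le> exp (l * (y - y0)) * w y0"
      using pos l that by (intro mult_right_mono) auto
    ultimately show ?thesis by simp
  qed
  then have "eventually (\<lambda>y. w y0 \<le> w y) at_top" by (auto simp: eventually_at_top_linorder)
  then have "w y0 \<le> 0" by (intro tendsto_lowerbound[OF lim]) auto
  with pos show False by simp
qed

lemma nonincreasing_limit_0:
  fixes f f' :: "real \<Rightarrow> real"
  assumes d: "\<And>y. (f has_real_derivative f' y) (at y)" and n: "\<And>y. y \<ge> Y \<Longrightarrow> f' y \<le> 0"
    and lim: "(f \<longlongrightarrow> 0) at_top" and y: "y \<ge> Y"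
  shows "0 \<le> f y"
proof (rule tendsto_upperbound[OF lim])
  show "eventually (\<lambda>z. f z \<le> f y) at_top"
    using eventually_ge_at_top[of y]
    by eventually_elim (rule DERIV_nonpos_imp_nonincreasing, assumption, use d n y order_trans in blast)
qed auto

section \<open>Absence of zeros of the stream function\<close>

context rayleigh_mode
begin

text \<open>Reversing the line and the sign of \<open>b\<close> keeps the profile increasing and the
  equation in the same form, with \<open>r\<close> changing sign. Statements to the left of
  \<open>ys\<close> thereby reduce to statements to the right.\<close>

lemma reflect:
  "rayleigh_mode (\<lambda>y. - b (- y)) (\<lambda>y. b' (- y)) m (\<lambda>y. - b2 (- y)) (\<lambda>y. b3 (- y)) K (- ys) \<kappa> (\<lambda>y. - r (- y))
    (\<lambda>y. \<psi> (- y)) (\<lambda>y. - \<psi>' (- y)) R"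
proof unfold_locales
  have mir: "continuous_on UNIV (\<lambda>y. f (- y))" if "continuous_on UNIV f" for f :: "real \<Rightarrow> real"
    by (rule continuous_on_compose2[OF that]) (auto intro!: continuous_intros)
  show "((\<lambda>y. - b (- y)) has_real_derivative b' (- y)) (at y)" for y
    using DERIV_minus[OF DERIV_reflect[OF b_deriv]] by simp
  show "((\<lambda>y. b' (- y)) has_real_derivative - b2 (- y)) (at y)" for y
    by (rule DERIV_reflect[OF b'_deriv])
  show "((\<lambda>y. - b2 (- y)) has_real_derivative b3 (- y)) (at y)" for y
    using DERIV_minus[OF DERIV_reflect[OF b2_deriv]] by simp
  show "continuous_on UNIV (\<lambda>y. b3 (- y))" by (rule mir[OF b3_continuous])
  show "- b2 (- y) = - r (- y) * (- b (- y) - - b (- (- ys)))\<^sup>2" for y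
    by (simp add: b2_factor power2_commute)
  show "continuous_on UNIV (\<lambda>y. - r (- y))" by (intro continuous_intros mir r_continuous)
  show "((\<lambda>y. \<psi> (- y)) has_real_derivative - \<psi>' (- y)) (at y)" for y
    by (rule DERIV_reflect[OF \<psi>_deriv])
  show "((\<lambda>y. - \<psi>' (- y)) has_real_derivative (\<kappa> + - r (- y) * (- b (- y) - - b (- (- ys)))) * \<psi> (- y)) (at y)" for y
    using DERIV_minus[OF DERIV_reflect[OF \<psi>'_deriv], of y] by (simp add: algebra_simps)
  show "L2 (\<lambda>y. \<psi> (- y))" by (rule L2_reflect[OF \<psi>_L2])
  show "((\<lambda>y. \<psi> (- y)) \<longlongrightarrow> 0) at_top" "((\<lambda>y. - \<psi>' (- y)) \<longlongrightarrow> 0) at_top"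
    using \<psi>_lim(2) \<psi>'_lim(2) by (auto simp: filterlim_at_bot_mirror intro!: tendsto_eq_intros)
  show "((\<lambda>y. \<psi> (- y)) \<longlongrightarrow> 0) at_bot" "((\<lambda>y. - \<psi>' (- y)) \<longlongrightarrow> 0) at_bot"
    using \<psi>_lim(1) \<psi>'_lim(1) by (auto simp: filterlim_at_bot_mirror intro!: tendsto_eq_intros)
qed (use m_pos b'_lower b'_upper b2_bound r_bound \<kappa>_pos in auto)

text \<open>Picone's identity with comparison function \<open>x = b - b ys\<close>, which solves the
  equation with \<open>\<kappa>\<close> removed and is positive to the right of \<open>ys\<close>.
  The boundary term \<open>V\<close> is nondecreasing beyond \<open>y0\<close> and tends to 0 both
  at \<open>y0\<close> and at infinity, so it is zero there; hence so is its derivative, which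
  dominates \<open>\<kappa> \<psi>\<^sup>2\<close>.\<close>

lemma vanish_right:
  assumes y0: "ys \<le> y0" "\<psi> y0 = 0" and y: "y0 < y"
  shows "\<psi> y = 0"
proof -
  define x where "x y = b y - b ys" for y
  define V where "V y = \<psi> y * \<psi>' y - (\<psi> y)\<^sup>2 * b' y / x y" for y
  define D where "D y = (\<psi>' y - b' y * \<psi> y / x y)\<^sup>2 + \<kappa> * (\<psi> y)\<^sup>2" for y
  have xn: "x y \<noteq> 0" if "y \<noteq> ys" for y using b_diff_nonzero[OF that] by (simp add: x_def)
  have xd: "(x has_real_derivative b' y) (at y)" for y
    unfolding x_def by (auto intro!: derivative_eq_intros b_deriv)
  have Vd: "(V has_real_derivative D y) (at y)" if "y \<noteq> ys" for y
  proof -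
    have 1: "((\<lambda>y. \<psi> y * \<psi>' y) has_real_derivative (\<psi>' y)\<^sup>2 + (\<kappa> + r y * x y) * (\<psi> y)\<^sup>2) (at y)"
      by (auto intro!: derivative_eq_intros \<psi>_deriv \<psi>'_deriv simp: x_def power2_eq_square algebra_simps)
    have 2: "((\<lambda>y. (\<psi> y)\<^sup>2 * b' y) has_real_derivative 2 * \<psi> y * \<psi>' y * b' y + (\<psi> y)\<^sup>2 * (r y * (x y)\<^sup>2)) (at y)"
      by (auto intro!: derivative_eq_intros \<psi>_deriv b'_deriv simp: b2_factor x_def)
    have "(V has_real_derivative (\<psi>' y)\<^sup>2 + (\<kappa> + r y * x y) * (\<psi> y)\<^sup>2
        - ((2 * \<psi> y * \<psi>' y * b' y + (\<psi> y)\<^sup>2 * (r y * (x y)\<^sup>2)) * x y - ((\<psi> y)\<^sup>2 * b' y) * b' y) / (x y * x y)) (at y)"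
      unfolding V_def by (intro DERIV_diff 1 DERIV_divide 2 xd xn that)
    moreover have "(\<psi>' y)\<^sup>2 + (\<kappa> + r y * x y) * (\<psi> y)\<^sup>2
        - ((2 * \<psi> y * \<psi>' y * b' y + (\<psi> y)\<^sup>2 * (r y * (x y)\<^sup>2)) * x y - ((\<psi> y)\<^sup>2 * b' y) * b' y) / (x y * x y) = D y"
      unfolding D_def using xn[OF that] by (simp add: field_simps power2_eq_square)
    ultimately show ?thesis by simp
  qed
  have D0: "0 \<le> D y" for y using \<kappa>_pos by (simp add: D_def)
  have mono: "V u \<le> V v" if "y0 < u" "u \<le> v" for u v
  proof (rule DERIV_nonneg_imp_nondecreasing[OF that(2)])
    fix s assume "u \<le> s" "s \<le> v"
    then have "s \<noteq> ys" using that y0 by auto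
    from Vd[OF this] D0 show "\<exists>D. (V has_real_derivative D) (at s) \<and> 0 \<le> D" by blast
  qed
  have Vtop: "(V \<longlongrightarrow> 0) at_top"
  proof -
    have b1: "Bfun b' at_top" by (rule BfunI[of _ "1/m"]) (use b'_upper b'_pos in \<open>simp add: less_imp_le\<close>)
    have "((\<lambda>y. (\<psi> y)\<^sup>2 * (1 / (b y - b ys))) \<longlongrightarrow> 0\<^sup>2 * 0) at_top"
      by (intro tendsto_intros \<psi>_lim inverse_b_tendsto_0)
    then have "((\<lambda>y. ((\<psi> y)\<^sup>2 * (1 / (b y - b ys))) * b' y) \<longlongrightarrow> 0) at_top"
      unfolding tendsto_Zfun_iff mult_zero_right diff_0_right
      by (rule bounded_bilinear.Zfun_prod_Bfun[OF bounded_bilinear_mult _ b1])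
    then have "((\<lambda>y. \<psi> y * \<psi>' y - ((\<psi> y)\<^sup>2 * (1 / (b y - b ys))) * b' y) \<longlongrightarrow> 0 * 0 - 0) at_top"
      by (intro tendsto_intros \<psi>_lim \<psi>'_lim)
    then show ?thesis by (simp add: V_def[abs_def] x_def)
  qed
  have Vy0: "(V \<longlongrightarrow> 0) (at_right y0)"
  proof -
    have cont: "(\<psi> \<longlongrightarrow> \<psi> y0) (at y0)" "(\<psi>' \<longlongrightarrow> \<psi>' y0) (at y0)" "(b' \<longlongrightarrow> b' y0) (at y0)" "(x \<longlongrightarrow> x y0) (at y0)"
      using DERIV_isCont[OF \<psi>_deriv] DERIV_isCont[OF \<psi>'_deriv] DERIV_isCont[OF b'_deriv] DERIV_isCont[OF xd]
      by (auto simp: isCont_def)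
    have "(V \<longlongrightarrow> 0) (at y0)"
    proof (cases "y0 = ys")
      case False
      have "(V \<longlongrightarrow> \<psi> y0 * \<psi>' y0 - (\<psi> y0)\<^sup>2 * b' y0 / x y0) (at y0)"
        unfolding V_def by (intro tendsto_intros cont xn False)
      then show ?thesis using y0 by simp
    next
      \<comment> \<open>Here \<open>x\<close> vanishes at \<open>y0\<close> as well. One factor of
        \<open>\<psi>\<^sup>2\<close> forms a difference quotient with the denominator, and the
        other still tends to 0.\<close>
      case True
      have b0: "b' y0 \<noteq> 0" using b'_pos[of y0] by simp
      have "((\<lambda>y. \<psi> y * \<psi>' y - \<psi> y * ((\<psi> y - \<psi> y0) / (b y - b y0)) * b' y) \<longlongrightarrow> \<psi> y0 * \<psi>' y0 - \<psi> y0 * (\<psi>' y0 / b' y0) * b' y0) (at y0)"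
        by (intro tendsto_intros cont quotient_tendsto \<psi>_deriv b_deriv b0)
      then show ?thesis using y0(2) b0 unfolding True by (simp add: V_def[abs_def] x_def power2_eq_square)
    qed
    then show ?thesis by (rule filterlim_mono) (simp_all add: at_le)
  qed
  have V0: "V z = 0" if z: "y0 < z" for z
  proof (rule antisym)
    show "V z \<le> 0"
      by (rule tendsto_lowerbound[OF Vtop]) (use mono[OF z] in \<open>auto simp: eventually_at_top_linorder\<close>)
    have "eventually (\<lambda>u. V u \<le> V z) (at_right y0)"
      using eventually_at_right_real[OF z] by eventually_elim (use mono in auto)
    then show "0 \<le> V z" by (intro tendsto_upperbound[OF Vy0]) auto
  qed
  have "eventually (\<lambda>z. z \<in> {y0<..}) (nhds y)" using y by (intro eventually_nhds_in_open) auto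
  then have "eventually (\<lambda>z. V z = 0) (nhds y)" by eventually_elim (use V0 in auto)
  from DERIV_cong_ev[OF refl this refl] Vd[of y] y y0 have "((\<lambda>_. 0) has_real_derivative D y) (at y)" by auto
  then have "D y = 0" using DERIV_unique[OF _ DERIV_const] by blast
  then show ?thesis using \<kappa>_pos by (simp add: D_def add_nonneg_eq_0_iff)
qed

text \<open>On the interval the energy \<open>E = \<psi>\<^sup>2 + \<psi>'\<^sup>2\<close> satisfies
  \<open>|E'| \<le> C E\<close>, so \<open>exp (C * s) * E s\<close> is nondecreasing and its zero
  at the right end spreads to the left. The summand 1 in \<open>q\<close> stems from the derivative
  of \<open>\<psi>\<^sup>2\<close>.\<close>

lemma ode_unique_left:
  assumes z: "\<psi> y1 = 0" "\<psi>' y1 = 0" and y: "y \<le> y1"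
  shows "\<psi> y = 0"
proof -
  define q where "q y = 1 + \<kappa> + r y * (b y - b ys)" for y
  have "continuous_on UNIV q" unfolding q_def by (intro continuous_intros r_continuous b_continuous)
  then obtain C where C: "C > 0" "\<And>s. \<bar>s - y\<bar> \<le> y1 - y \<Longrightarrow> \<bar>q s\<bar> \<le> C"
    using continuous_bounded_near by blast
  define E where "E s = (\<psi> s)\<^sup>2 + (\<psi>' s)\<^sup>2" for s
  have "exp (C * y) * E y \<le> exp (C * y1) * E y1"
  proof (rule DERIV_nonneg_imp_nondecreasing[OF y])
    fix s assume s: "y \<le> s" "s \<le> y1"
    have "((\<lambda>s. exp (C * s) * E s) has_real_derivative exp (C * s) * (C * E s + 2 * q s * (\<psi> s * \<psi>' s))) (at s)"
      unfolding E_def by (auto intro!: derivative_eq_intros \<psi>_deriv \<psi>'_deriv simp: q_def algebra_simps power2_eq_square)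
    moreover have "0 \<le> C * E s + 2 * q s * (\<psi> s * \<psi>' s)"
    proof -
      have "\<bar>2 * (\<psi> s * \<psi>' s)\<bar> \<le> E s"
        using zero_le_power2[of "\<psi> s - \<psi>' s"] zero_le_power2[of "\<psi> s + \<psi>' s"]
        by (auto simp: E_def power2_eq_square algebra_simps abs_if)
      then have "\<bar>q s\<bar> * \<bar>2 * (\<psi> s * \<psi>' s)\<bar> \<le> C * E s" using C s by (intro mult_mono) auto
      then have "\<bar>2 * q s * (\<psi> s * \<psi>' s)\<bar> \<le> C * E s" by (simp add: abs_mult mult_ac)
      then show ?thesis by linarith
    qed
    ultimately show "\<exists>D. ((\<lambda>s. exp (C * s) * E s) has_real_derivative D) (at s) \<and> 0 \<le> D" by (metis exp_ge_zero mult_nonneg_nonneg)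
  qed
  then have "E y \<le> 0" using z by (simp add: E_def mult_le_0_iff)
  then have "(\<psi> y)\<^sup>2 \<le> 0" unfolding E_def using zero_le_power2[of "\<psi>' y"] by linarith
  then show ?thesis by simp
qed

lemma vanish_right_all:
  assumes "ys \<le> y0" "\<psi> y0 = 0"
  shows "\<psi> y = 0"
proof -
  define y1 where "y1 = max (y0 + 1) y"
  have v: "\<psi> z = 0" if "y0 < z" for z using vanish_right[OF assms that] .
  have "eventually (\<lambda>z. z \<in> {y0<..}) (nhds y1)" by (intro eventually_nhds_in_open) (auto simp: y1_def)
  then have "eventually (\<lambda>z. \<psi> z = 0) (nhds y1)" by eventually_elim (use v in auto)
  from DERIV_cong_ev[OF refl this refl] \<psi>_deriv[of y1] have "((\<lambda>_. 0) has_real_derivative \<psi>' y1) (at y1)" by auto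
  then have "\<psi>' y1 = 0" using DERIV_unique[OF _ DERIV_const] by blast
  moreover have "\<psi> y1 = 0" by (rule v) (simp add: y1_def)
  moreover have "y \<le> y1" by (simp add: y1_def)
  ultimately show ?thesis using ode_unique_left by blast
qed

end

text \<open>A zero at or to the right of \<open>ys\<close> makes \<open>\<psi>\<close> vanish beyond
  it, whence Cauchy uniqueness makes it vanish everywhere; a zero to the left is handled by
  reflection.\<close>

lemma (in rayleigh_mode) no_zeros:
  assumes "\<psi> z \<noteq> 0"
  shows "\<psi> y \<noteq> 0"
proof
  assume y: "\<psi> y = 0"
  interpret rfl: rayleigh_mode "\<lambda>y. - b (- y)" "\<lambda>y. b' (- y)" m "\<lambda>y. - b2 (- y)" "\<lambda>y. b3 (- y)" K "- ys" \<kappa> "\<lambda>y. - r (- y)"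
    "\<lambda>y. \<psi> (- y)" "\<lambda>y. - \<psi>' (- y)" R by (rule reflect)
  show False
  proof (cases "ys \<le> y")
    case True
    then show False using vanish_right_all[OF True y, of z] assms by simp
  next
    case False
    then show False using rfl.vanish_right_all[of "- y" "- z"] y assms by simp
  qed
qed

section \<open>Exponential decay and reduction of order\<close>

locale positive_mode = rayleigh_mode +
  assumes \<psi>_pos: "\<And>y. 0 < \<psi> y"
begin

text \<open>The correction \<open>q\<close> tends to 0, being \<open>b'' / (b - b ys)\<close> with
  \<open>b''\<close> bounded. Once \<open>|q| \<le> \<kappa> / 2\<close>, the functions
  \<open>\<psi>' + l \<psi>\<close> and \<open>- \<psi>' - L \<psi>\<close> would grow exponentially
  from any positive value, so both are nonpositive. The rates satisfy \<open>l\<^sup>2 = \<kappa> /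
  2 \<le> \<kappa> + q \<le> 2 \<kappa> = L\<^sup>2\<close>.\<close>

lemma decay_right:
  "\<exists>Y l L. 0 < l \<and> 0 < L \<and> (\<forall>y\<ge>Y. \<psi>' y \<le> - l * \<psi> y \<and> - L * \<psi> y \<le> \<psi>' y \<and>
    \<bar>\<kappa> + r y * (b y - b ys)\<bar> \<le> L * L)"
proof -
  define q where "q y = r y * (b y - b ys)" for y
  have "((\<lambda>y. K * \<bar>1 / (b y - b ys)\<bar>) \<longlongrightarrow> K * \<bar>0\<bar>) at_top"
    by (intro tendsto_intros inverse_b_tendsto_0)
  then have "eventually (\<lambda>y. K * \<bar>1 / (b y - b ys)\<bar> < \<kappa> / 2) at_top"
    using \<kappa>_pos by (intro order_tendstoD(2)) auto
  then obtain Y where Y: "\<And>y. Y \<le> y \<Longrightarrow> K * \<bar>1 / (b y - b ys)\<bar> < \<kappa> / 2"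
    by (auto simp: eventually_at_top_linorder)
  have q: "\<bar>q y\<bar> \<le> \<kappa> / 2" if "Y \<le> y" for y
  proof (cases "y = ys")
    case False
    have "q y = b2 y * (1 / (b y - b ys))"
      unfolding q_def b2_factor using b_diff_nonzero[OF False] by (simp add: power2_eq_square)
    then have "\<bar>q y\<bar> \<le> K * \<bar>1 / (b y - b ys)\<bar>"
      using b2_bound[of y] by (simp only: abs_mult) (intro mult_right_mono, auto)
    then show ?thesis using Y[OF that] by linarith
  qed (use \<kappa>_pos in \<open>simp add: q_def\<close>)
  define l where "l = sqrt (\<kappa> / 2)"
  define L where "L = sqrt (2 * \<kappa>)"
  have l: "l > 0" "l * l = \<kappa> / 2" using \<kappa>_pos by (auto simp: l_def)
  have L: "L > 0" "L * L = 2 * \<kappa>" using \<kappa>_pos by (auto simp: L_def)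
  have A: "\<psi>' y \<le> - l * \<psi> y" if "Y \<le> y" for y
  proof -
    have "\<psi>' y + l * \<psi> y \<le> 0"
    proof (rule exp_growth_contradiction[OF _ _ l(1) _ that])
      show "((\<lambda>y. \<psi>' y + l * \<psi> y) has_real_derivative (\<kappa> + q y) * \<psi> y + l * \<psi>' y) (at y)" for y
        unfolding q_def by (auto intro!: derivative_eq_intros \<psi>_deriv \<psi>'_deriv)
      show "l * (\<psi>' y + l * \<psi> y) \<le> (\<kappa> + q y) * \<psi> y + l * \<psi>' y" if "Y \<le> y" for y
      proof -
        have "(l * l) * \<psi> y \<le> (\<kappa> + q y) * \<psi> y"
          using q[OF that] \<psi>_pos[of y] unfolding l(2) by (intro mult_right_mono) auto
        then show ?thesis by (simp add: distrib_left mult.assoc)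
      qed
      have "((\<lambda>y. \<psi>' y + l * \<psi> y) \<longlongrightarrow> 0 + l * 0) at_top" by (intro tendsto_intros \<psi>_lim \<psi>'_lim)
      then show "((\<lambda>y. \<psi>' y + l * \<psi> y) \<longlongrightarrow> 0) at_top" by simp
    qed
    then show ?thesis by simp
  qed
  have B: "- L * \<psi> y \<le> \<psi>' y" if "Y \<le> y" for y
  proof -
    have "- \<psi>' y - L * \<psi> y \<le> 0"
    proof (rule exp_growth_contradiction[OF _ _ L(1) _ that])
      show "((\<lambda>y. - \<psi>' y - L * \<psi> y) has_real_derivative - ((\<kappa> + q y) * \<psi> y) - L * \<psi>' y) (at y)" for y
        unfolding q_def by (auto intro!: derivative_eq_intros \<psi>_deriv \<psi>'_deriv)
      show "L * (- \<psi>' y - L * \<psi> y) \<le> - ((\<kappa> + q y) * \<psi> y) - L * \<psi>' y" if "Y \<le> y" for y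
      proof -
        have "(\<kappa> + q y) * \<psi> y \<le> (L * L) * \<psi> y"
          using q[OF that] \<kappa>_pos \<psi>_pos[of y] unfolding L(2) by (intro mult_right_mono) auto
        then show ?thesis by (simp add: right_diff_distrib mult.assoc)
      qed
      have "((\<lambda>y. - \<psi>' y - L * \<psi> y) \<longlongrightarrow> - 0 - L * 0) at_top" by (intro tendsto_intros \<psi>_lim \<psi>'_lim)
      then show "((\<lambda>y. - \<psi>' y - L * \<psi> y) \<longlongrightarrow> 0) at_top" by simp
    qed
    then show ?thesis by simp
  qed
  have C: "\<bar>\<kappa> + r y * (b y - b ys)\<bar> \<le> L * L" if "Y \<le> y" for y
    using q[OF that] \<kappa>_pos unfolding L(2) q_def by linarith
  show ?thesis using l(1) L(1) A B C by blast
qed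

text \<open>Since \<open>G\<close> is of order \<open>\<psi>\<^sup>2\<close>, \<open>u'\<close> is
  bounded and \<open>u\<close> grows at most linearly, while \<open>\<psi>\<close> decays
  exponentially. The weight \<open>1 + y\<^sup>2\<close> is a convenient rate that still yields
  boundedness and square integrability.\<close>

lemma corrector_right:
  assumes G: "\<And>y. (G has_real_derivative r y * (\<psi> y)\<^sup>2) (at y)" and G0: "(G \<longlongrightarrow> 0) at_top"
    and u: "\<And>y. (u has_real_derivative G y / (\<psi> y)\<^sup>2) (at y)"
  shows "((\<lambda>y. (1 + y\<^sup>2) * (\<psi> y * u y)) \<longlongrightarrow> 0) at_top"
    "((\<lambda>y. (1 + y\<^sup>2) * (\<psi>' y * u y + G y / \<psi> y)) \<longlongrightarrow> 0) at_top"
    "((\<lambda>y. (1 + y\<^sup>2) * \<psi> y) \<longlongrightarrow> 0) at_top"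
    "((\<lambda>y. (1 + y\<^sup>2) * ((\<kappa> + r y * (b y - b ys)) * (\<psi> y * u y))) \<longlongrightarrow> 0) at_top"
proof -
  obtain Y l L where lL: "0 < l" "0 < L" and all: "\<forall>y\<ge>Y. \<psi>' y \<le> - l * \<psi> y \<and> - L * \<psi> y \<le> \<psi>' y \<and>
    \<bar>\<kappa> + r y * (b y - b ys)\<bar> \<le> L * L"
    using decay_right by blast
  have Y: "0 < l" "0 < L" "\<And>y. Y \<le> y \<Longrightarrow> \<psi>' y \<le> - l * \<psi> y" "\<And>y. Y \<le> y \<Longrightarrow> - L * \<psi> y \<le> \<psi>' y"
    "\<And>y. Y \<le> y \<Longrightarrow> \<bar>\<kappa> + r y * (b y - b ys)\<bar> \<le> L * L"
    using lL all by blast+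
  \<comment> \<open>With this value the derivative of \<open>C \<psi>\<^sup>2\<close> is at most
    \<open>- R \<psi>\<^sup>2\<close> beyond \<open>Y\<close>, which outweighs \<open>G'\<close>.
    Thus \<open>C \<psi>\<^sup>2 \<plusminus> G\<close> is nonincreasing with limit 0, hence
    nonnegative.\<close>
  define C where "C = R / (2 * l)"
  have C0: "0 \<le> C" using R_nonneg Y(1) by (simp add: C_def)
  have GC: "\<sigma> * G y \<le> C * (\<psi> y)\<^sup>2" if \<sigma>: "\<sigma> = 1 \<or> \<sigma> = -1" and y: "Y \<le> y" for \<sigma> y
  proof -
    have "0 \<le> C * (\<psi> y)\<^sup>2 - \<sigma> * G y"
    proof (rule nonincreasing_limit_0[OF _ _ _ y])
      show "((\<lambda>y. C * (\<psi> y)\<^sup>2 - \<sigma> * G y) has_real_derivative 2 * C * (\<psi> y * \<psi>' y) - \<sigma> * (r y * (\<psi> y)\<^sup>2)) (at y)" for y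
        by (auto intro!: derivative_eq_intros \<psi>_deriv G)
      show "2 * C * (\<psi> y * \<psi>' y) - \<sigma> * (r y * (\<psi> y)\<^sup>2) \<le> 0" if "Y \<le> y" for y
      proof -
        have "\<psi> y * \<psi>' y \<le> \<psi> y * (- l * \<psi> y)" using Y(3)[OF that] \<psi>_pos[of y] by (intro mult_left_mono) auto
        then have "2 * C * (\<psi> y * \<psi>' y) \<le> 2 * C * (\<psi> y * (- l * \<psi> y))" by (rule mult_left_mono) (use C0 in simp)
        also have "\<dots> = - R * (\<psi> y)\<^sup>2" using Y(1) by (simp add: C_def power2_eq_square)
        finally have "2 * C * (\<psi> y * \<psi>' y) \<le> - R * (\<psi> y)\<^sup>2" .
        moreover have "- \<sigma> * r y * (\<psi> y)\<^sup>2 \<le> R * (\<psi> y)\<^sup>2"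
          using \<sigma> r_bound[of y] by (intro mult_right_mono) auto
        ultimately show ?thesis by simp
      qed
      have "((\<lambda>y. C * (\<psi> y)\<^sup>2 - \<sigma> * G y) \<longlongrightarrow> C * 0\<^sup>2 - \<sigma> * 0) at_top" by (intro tendsto_intros \<psi>_lim G0)
      then show "((\<lambda>y. C * (\<psi> y)\<^sup>2 - \<sigma> * G y) \<longlongrightarrow> 0) at_top" by simp
    qed
    then show ?thesis by simp
  qed
  have G1: "\<bar>G y\<bar> \<le> C * (\<psi> y)\<^sup>2" if "Y \<le> y" for y
    using GC[of 1, OF _ that] GC[of "-1", OF _ that] by auto
  have u1: "\<bar>u y\<bar> \<le> \<bar>u Y\<bar> + C * (y - Y)" if y: "Y \<le> y" for y
  proof -
    have "\<bar>u y - u Y\<bar> \<le> C * \<bar>y - Y\<bar>"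
    proof (rule lipschitz_of_deriv_bound[OF u])
      fix z assume "z \<in> closed_segment Y y"
      then have "Y \<le> z" using y by (auto simp: closed_segment_eq_real_ivl)
      then show "\<bar>G z / (\<psi> z)\<^sup>2\<bar> \<le> C" using G1[of z] \<psi>_pos[of z] by (simp add: divide_le_eq)
    qed
    then show ?thesis using y by simp
  qed
  have \<psi>1: "\<psi> y \<le> \<psi> Y * exp (- l * (y - Y))" if y: "Y \<le> y" for y
  proof -
    have "exp (l * y) * \<psi> y \<le> exp (l * Y) * \<psi> Y"
    proof (rule DERIV_nonpos_imp_nonincreasing[OF y])
      fix s assume s: "Y \<le> s" "s \<le> y"
      have "((\<lambda>s. exp (l * s) * \<psi> s) has_real_derivative exp (l * s) * (\<psi>' s + l * \<psi> s)) (at s)"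
        by (auto intro!: derivative_eq_intros \<psi>_deriv simp: algebra_simps)
      moreover have "exp (l * s) * (\<psi>' s + l * \<psi> s) \<le> 0"
        using Y(3)[OF s(1)] by (intro mult_nonneg_nonpos) auto
      ultimately show "\<exists>D. ((\<lambda>s. exp (l * s) * \<psi> s) has_real_derivative D) (at s) \<and> D \<le> 0" by blast
    qed
    then have "exp (- l * y) * (exp (l * y) * \<psi> y) \<le> exp (- l * y) * (exp (l * Y) * \<psi> Y)"
      by (rule mult_left_mono) simp
    note A = this
    have B: "exp (- l * y) * (exp (l * y) * \<psi> y) = \<psi> y"
      by (simp add: mult.assoc[symmetric] exp_add[symmetric])
    have C: "exp (- l * (y - Y)) = exp (- l * y) * exp (l * Y)"
      unfolding exp_add[symmetric] by (simp add: right_diff_distrib)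
    show ?thesis using A unfolding B C by (simp only: mult_ac)
  qed
  define A where "A = \<bar>u Y\<bar>"
  define P where "P = (L * L + L + 1) * \<psi> Y"
  have P0: "0 \<le> P" using Y(2) \<psi>_pos[of Y] by (simp add: P_def)
  define D where "D y = (1 + y\<^sup>2) * (P * exp (- l * (y - Y)) * (1 + A + C + C * (y - Y)))" for y
  have Dlim: "(D \<longlongrightarrow> 0) at_top"
    unfolding D_def using Y(1) by real_asymp
  \<comment> \<open>One majorant serves all four limits: \<open>L * L + L + 1\<close> exceeds
    \<open>1\<close>, \<open>L\<close> and \<open>L * L\<close>, the bounds of
    \<open>\<psi>\<close>, \<open>\<psi>'\<close> and
    \<open>(\<kappa> + r * (b - b ys)) * \<psi>\<close> relative to \<open>\<psi>\<close>.\<close>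
  have bound: "(f \<longlongrightarrow> 0) at_top"
    if f: "\<And>y. Y \<le> y \<Longrightarrow> \<bar>f y\<bar> \<le> (1 + y\<^sup>2) * ((L * L + L + 1) * \<psi> y * (1 + C + \<bar>u y\<bar>))" for f
  proof (rule Lim_null_comparison[OF _ Dlim])
    show "eventually (\<lambda>y. norm (f y) \<le> D y) at_top"
      using eventually_ge_at_top[of Y]
    proof eventually_elim
      case (elim y)
      have "norm (f y) \<le> (1 + y\<^sup>2) * ((L * L + L + 1) * \<psi> y * (1 + C + \<bar>u y\<bar>))" using f[OF elim] by simp
      also have "\<dots> \<le> (1 + y\<^sup>2) * ((L * L + L + 1) * (\<psi> Y * exp (- l * (y - Y))) * (1 + A + C + C * (y - Y)))"
        using \<psi>1[OF elim] u1[OF elim] C0 Y(2) \<psi>_pos[of y] \<psi>_pos[of Y]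
        by (intro mult_left_mono mult_mono mult_nonneg_nonneg) (auto simp: A_def)
      finally show ?case by (simp add: D_def P_def mult.assoc)
    qed
  qed
  have L0: "0 \<le> L * L + L" using Y(2) by simp
  show "((\<lambda>y. (1 + y\<^sup>2) * (\<psi> y * u y)) \<longlongrightarrow> 0) at_top"
  proof (rule bound)
    fix y
    have "1 * \<psi> y * \<bar>u y\<bar> \<le> (L * L + L + 1) * \<psi> y * (1 + C + \<bar>u y\<bar>)"
      using \<psi>_pos[of y] C0 L0 by (intro mult_mono) auto
    then show "\<bar>(1 + y\<^sup>2) * (\<psi> y * u y)\<bar> \<le> (1 + y\<^sup>2) * ((L * L + L + 1) * \<psi> y * (1 + C + \<bar>u y\<bar>))"
      using \<psi>_pos[of y] by (simp add: abs_mult mult_left_mono)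
  qed
  show "((\<lambda>y. (1 + y\<^sup>2) * \<psi> y) \<longlongrightarrow> 0) at_top"
  proof (rule bound)
    fix y
    have "1 * \<psi> y * 1 \<le> (L * L + L + 1) * \<psi> y * (1 + C + \<bar>u y\<bar>)"
      using \<psi>_pos[of y] C0 L0 by (intro mult_mono) auto
    then show "\<bar>(1 + y\<^sup>2) * \<psi> y\<bar> \<le> (1 + y\<^sup>2) * ((L * L + L + 1) * \<psi> y * (1 + C + \<bar>u y\<bar>))"
      using \<psi>_pos[of y] by (simp add: abs_mult mult_left_mono)
  qed
  show "((\<lambda>y. (1 + y\<^sup>2) * (\<psi>' y * u y + G y / \<psi> y)) \<longlongrightarrow> 0) at_top"
  proof (rule bound)
    fix y assume y: "Y \<le> y"
    have p: "\<bar>\<psi>' y\<bar> \<le> L * \<psi> y"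
    proof -
      have "- l * \<psi> y \<le> 0" using Y(1) \<psi>_pos[of y] by simp
      then show ?thesis using Y(3)[OF y] Y(4)[OF y] by simp
    qed
    have g: "\<bar>G y / \<psi> y\<bar> \<le> C * \<psi> y"
      using G1[OF y] \<psi>_pos[of y] by (simp add: divide_le_eq power2_eq_square)
    have "\<bar>\<psi>' y * u y + G y / \<psi> y\<bar> \<le> \<bar>\<psi>' y * u y\<bar> + \<bar>G y / \<psi> y\<bar>" by (rule abs_triangle_ineq)
    also have "\<dots> \<le> (L * \<psi> y) * \<bar>u y\<bar> + C * \<psi> y"
      unfolding abs_mult[of "\<psi>' y"] by (intro add_mono mult_right_mono p g) auto
    also have "\<dots> \<le> ((L * L + L + 1) * \<psi> y) * \<bar>u y\<bar> + ((L * L + L + 1) * \<psi> y) * (1 + C)"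
    proof (intro add_mono mult_right_mono)
      show "L \<le> L * L + L + 1" using Y(2) by simp
      have "1 * \<psi> y * C \<le> ((L * L + L + 1) * \<psi> y) * (1 + C)"
        using \<psi>_pos[of y] C0 L0 by (intro mult_mono) auto
      then show "C * \<psi> y \<le> ((L * L + L + 1) * \<psi> y) * (1 + C)" by (simp add: mult.commute)
    qed (use \<psi>_pos[of y] in auto)
    also have "\<dots> = (L * L + L + 1) * \<psi> y * (1 + C + \<bar>u y\<bar>)" by (simp only: distrib_left[symmetric]) (simp add: add.commute)
    finally show "\<bar>(1 + y\<^sup>2) * (\<psi>' y * u y + G y / \<psi> y)\<bar> \<le> (1 + y\<^sup>2) * ((L * L + L + 1) * \<psi> y * (1 + C + \<bar>u y\<bar>))"
      by (simp add: abs_mult mult_left_mono)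
  qed
  show "((\<lambda>y. (1 + y\<^sup>2) * ((\<kappa> + r y * (b y - b ys)) * (\<psi> y * u y))) \<longlongrightarrow> 0) at_top"
  proof (rule bound)
    fix y assume y: "Y \<le> y"
    have "\<bar>\<kappa> + r y * (b y - b ys)\<bar> * (\<psi> y * \<bar>u y\<bar>) \<le> (L * L + L + 1) * (\<psi> y * (1 + C + \<bar>u y\<bar>))"
      using \<psi>_pos[of y] C0 L0 Y(2) Y(5)[OF y] by (intro mult_mono) auto
    then have "\<bar>(\<kappa> + r y * (b y - b ys)) * (\<psi> y * u y)\<bar> \<le> (L * L + L + 1) * \<psi> y * (1 + C + \<bar>u y\<bar>)"
      using \<psi>_pos[of y] by (simp add: abs_mult mult.assoc)
    then show "\<bar>(1 + y\<^sup>2) * ((\<kappa> + r y * (b y - b ys)) * (\<psi> y * u y))\<bar> \<le> (1 + y\<^sup>2) * ((L * L + L + 1) * \<psi> y * (1 + C + \<bar>u y\<bar>))"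
      by (simp add: abs_mult mult_left_mono)
  qed
qed

lemma corrector_left:
  assumes G: "\<And>y. (G has_real_derivative r y * (\<psi> y)\<^sup>2) (at y)" and G0: "(G \<longlongrightarrow> 0) at_bot"
    and u: "\<And>y. (u has_real_derivative G y / (\<psi> y)\<^sup>2) (at y)"
  shows "((\<lambda>y. (1 + y\<^sup>2) * (\<psi> y * u y)) \<longlongrightarrow> 0) at_bot"
    "((\<lambda>y. (1 + y\<^sup>2) * (\<psi>' y * u y + G y / \<psi> y)) \<longlongrightarrow> 0) at_bot"
    "((\<lambda>y. (1 + y\<^sup>2) * \<psi> y) \<longlongrightarrow> 0) at_bot"
    "((\<lambda>y. (1 + y\<^sup>2) * ((\<kappa> + r y * (b y - b ys)) * (\<psi> y * u y))) \<longlongrightarrow> 0) at_bot"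
proof -
  interpret rfl: rayleigh_mode "\<lambda>y. - b (- y)" "\<lambda>y. b' (- y)" m "\<lambda>y. - b2 (- y)" "\<lambda>y. b3 (- y)" K "- ys" \<kappa> "\<lambda>y. - r (- y)"
    "\<lambda>y. \<psi> (- y)" "\<lambda>y. - \<psi>' (- y)" R by (rule reflect)
  interpret rfl: positive_mode "\<lambda>y. - b (- y)" "\<lambda>y. b' (- y)" m "\<lambda>y. - b2 (- y)" "\<lambda>y. b3 (- y)" K "- ys" \<kappa> "\<lambda>y. - r (- y)"
    "\<lambda>y. \<psi> (- y)" "\<lambda>y. - \<psi>' (- y)" R by unfold_locales (rule \<psi>_pos)
  have 1: "((\<lambda>y. G (- y)) has_real_derivative - r (- y) * (\<psi> (- y))\<^sup>2) (at y)" for y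
    using DERIV_reflect[OF G] by simp
  have 2: "((\<lambda>y. G (- y)) \<longlongrightarrow> 0) at_top" using G0 by (simp add: filterlim_at_bot_mirror)
  \<comment> \<open>The reflected \<open>u\<close> needs a minus sign because reflection reverses
    derivatives, whereas the quotient \<open>G / \<psi>\<^sup>2\<close> is merely composed with
    it.\<close>
  have 3: "((\<lambda>y. - u (- y)) has_real_derivative G (- y) / (\<psi> (- y))\<^sup>2) (at y)" for y
    using DERIV_minus[OF DERIV_reflect[OF u]] by simp
  note c = rfl.corrector_right[OF 1 2 3]
  show "((\<lambda>y. (1 + y\<^sup>2) * (\<psi> y * u y)) \<longlongrightarrow> 0) at_bot"
    using tendsto_minus[OF c(1)] by (simp add: filterlim_at_bot_mirror)
  show "((\<lambda>y. (1 + y\<^sup>2) * (\<psi>' y * u y + G y / \<psi> y)) \<longlongrightarrow> 0) at_bot"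
    using c(2) by (simp add: filterlim_at_bot_mirror)
  show "((\<lambda>y. (1 + y\<^sup>2) * \<psi> y) \<longlongrightarrow> 0) at_bot"
    using c(3) by (simp add: filterlim_at_bot_mirror)
  have "(\<kappa> + - r (- y) * (- b (- y) - - b (- (- ys)))) * (\<psi> (- y) * - u (- y))
    = - ((\<kappa> + r (- y) * (b (- y) - b ys)) * (\<psi> (- y) * u (- y)))" for y
    by (simp add: algebra_simps)
  with c(4) have "((\<lambda>y. (1 + y\<^sup>2) * - ((\<kappa> + r (- y) * (b (- y) - b ys)) * (\<psi> (- y) * u (- y)))) \<longlongrightarrow> 0) at_top"
    by (simp only:)
  from tendsto_minus[OF this] show "((\<lambda>y. (1 + y\<^sup>2) * ((\<kappa> + r y * (b y - b ys)) * (\<psi> y * u y))) \<longlongrightarrow> 0) at_bot"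
    by (simp add: filterlim_at_bot_mirror)
qed

end

lemma decay_bound:
  fixes f :: "real \<Rightarrow> real"
  assumes c: "continuous_on UNIV f" and t: "((\<lambda>y. (1 + y\<^sup>2) * f y) \<longlongrightarrow> 0) at_top" "((\<lambda>y. (1 + y\<^sup>2) * f y) \<longlongrightarrow> 0) at_bot"
  obtains E where "E > 0" "\<And>y. \<bar>f y\<bar> \<le> E / (1 + y\<^sup>2)"
proof -
  have "continuous_on UNIV (\<lambda>y. (1 + y\<^sup>2) * f y)" by (intro continuous_intros c)
  then obtain E where E: "E > 0" "\<And>y. \<bar>(1 + y\<^sup>2) * f y\<bar> \<le> E"
    using continuous_bounded_if_limits[OF _ t] by metis
  have "\<bar>f y\<bar> \<le> E / (1 + y\<^sup>2)" for y
  proof -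
    have "0 < 1 + y\<^sup>2" by (rule add_pos_nonneg) auto
    then show ?thesis using E(2)[of y] by (simp add: abs_mult le_divide_eq mult.commute)
  qed
  with E(1) show thesis by (rule that)
qed

text \<open>One condition that gives continuity, boundedness and square integrability together and
  is stable under sums and bounded continuous factors.\<close>

definition rapid :: "(real \<Rightarrow> real) \<Rightarrow> bool" where
  "rapid f \<longleftrightarrow> continuous_on UNIV f \<and> (\<exists>E. \<forall>y. \<bar>f y\<bar> \<le> E / (1 + y\<^sup>2))"

lemma rapidE:
  assumes "rapid f"
  obtains E where "E \<ge> 0" "\<And>y. \<bar>f y\<bar> \<le> E" "\<And>y. \<bar>f y\<bar> \<le> E / (1 + y\<^sup>2)"
proof -
  obtain E where E: "\<And>y. \<bar>f y\<bar> \<le> E / (1 + y\<^sup>2)" using assms by (auto simp: rapid_def)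
  have "E \<ge> 0" using E[of 0] by simp
  moreover have "E / (1 + y\<^sup>2) \<le> E" for y
    using \<open>E \<ge> 0\<close> divide_left_mono[of 1 "1 + y\<^sup>2" E] by (simp add: add_pos_nonneg)
  ultimately show thesis using E order_trans that by metis
qed

lemma rapid_L2:
  assumes "rapid f"
  shows "L2 f"
proof -
  obtain E where E: "E \<ge> 0" "\<And>y. \<bar>f y\<bar> \<le> E" "\<And>y. \<bar>f y\<bar> \<le> E / (1 + y\<^sup>2)" using rapidE[OF assms] by metis
  have [measurable]: "f \<in> borel_measurable borel"
    using assms by (simp add: rapid_def borel_measurable_continuous_onI)
  have "integrable lborel (\<lambda>y. (norm (f y))\<^sup>2)"
  proof (rule integrable_inverse_square_decay[where a=0 and C="E * E"])
    show "\<bar>(norm (f y))\<^sup>2\<bar> \<le> E * E / (1 + (y - 0)\<^sup>2)" for y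
      using mult_mono[OF E(2)[of y] E(3)[of y]] E(1) by (simp add: power2_eq_square)
  qed measurable
  then show ?thesis by (simp add: L2_def)
qed

lemma rapid_mult_bounded:
  assumes f: "rapid f" and g: "continuous_on UNIV g" "\<And>y. \<bar>g y\<bar> \<le> M"
  shows "rapid (\<lambda>y. g y * f y)"
proof -
  obtain E where E: "\<And>y. \<bar>f y\<bar> \<le> E / (1 + y\<^sup>2)" using rapidE[OF f] by metis
  have "\<bar>g y * f y\<bar> \<le> (M * E) / (1 + y\<^sup>2)" for y
    using mult_mono[OF g(2)[of y] E[of y]] g(2)[of y] by (simp add: abs_mult)
  then show ?thesis using f g unfolding rapid_def by (intro conjI continuous_intros exI allI) auto
qed

lemma rapid_add:
  assumes "rapid f" "rapid g"
  shows "rapid (\<lambda>y. f y + g y)"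
proof -
  obtain E F where E: "\<And>y. \<bar>f y\<bar> \<le> E / (1 + y\<^sup>2)" "\<And>y. \<bar>g y\<bar> \<le> F / (1 + y\<^sup>2)"
    using assms unfolding rapid_def by blast
  have "\<bar>f y + g y\<bar> \<le> (E + F) / (1 + y\<^sup>2)" for y
    using E[of y] abs_triangle_ineq[of "f y" "g y"] by (simp add: add_divide_distrib)
  then show ?thesis using assms unfolding rapid_def by (intro conjI continuous_intros exI allI) auto
qed

context positive_mode
begin

text \<open>Reduction of order: for \<open>\<psi>1 = \<psi> u\<close> the equation becomes
  \<open>(\<psi>\<^sup>2 u')' = r \<psi>\<^sup>2\<close>, so \<open>\<psi>\<^sup>2 u'\<close> may be
  taken to be the primitive \<open>G\<close> of \<open>r \<psi>\<^sup>2\<close> that vanishes at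
  minus infinity. It vanishes at plus infinity precisely when the integral is zero, and then
  \<open>\<psi>1\<close> decays on both sides.\<close>

lemma corrector_exists:
  assumes H: "(LBINT y. r y * (\<psi> y)\<^sup>2) = 0"
  shows "\<exists>\<psi>1 \<psi>1'. (\<forall>y. (\<psi>1 has_real_derivative \<psi>1' y) (at y)) \<and>
    (\<forall>y. (\<psi>1' has_real_derivative (\<kappa> + r y * (b y - b ys)) * \<psi>1 y + r y * \<psi> y) (at y)) \<and>
    rapid \<psi>1 \<and> rapid \<psi>1' \<and> rapid (\<lambda>y. (\<kappa> + r y * (b y - b ys)) * \<psi>1 y) \<and> rapid \<psi>"
proof -
  define \<rho> where "\<rho> y = r y * (\<psi> y)\<^sup>2" for y
  have \<rho>i: "integrable lborel \<rho>" unfolding \<rho>_def by (rule weighted_integrable)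
  have \<rho>c: "continuous_on UNIV \<rho>" unfolding \<rho>_def by (intro continuous_intros r_continuous \<psi>_continuous)
  have H0: "(LBINT y. \<rho> y) = 0" using H by (simp add: \<rho>_def)
  define G where "G y = (LBINT x. indicator {..y} x *\<^sub>R \<rho> x)" for y
  have ind: "integrable lborel (\<lambda>x. indicator A x *\<^sub>R \<rho> x)" if "A \<in> sets borel" for A
    using integrable_mult_indicator[of A lborel \<rho>] that \<rho>i by simp
  have Gtop: "(G \<longlongrightarrow> 0) at_top"
    unfolding G_def H0[symmetric] by (rule tendsto_integral_at_top) (auto intro: \<rho>i)
  \<comment> \<open>Vanishing of the total integral turns \<open>G\<close> into minus the integral
    over the right half-line, the form to which \<open>tendsto_integral_at_bot\<close>
    applies.\<close>
  have Gneg: "G y = - (LBINT x. indicator {y..} x *\<^sub>R \<rho> x)" for y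
  proof -
    have "G y + (LBINT x. indicator {y..} x *\<^sub>R \<rho> x) = (LBINT x. indicator {..y} x *\<^sub>R \<rho> x + indicator {y..} x *\<^sub>R \<rho> x)"
      unfolding G_def by (intro Bochner_Integration.integral_add[symmetric] ind) auto
    also have "\<dots> = (LBINT x. \<rho> x)"
    proof (rule integral_cong_AE)
      have "AE x in lborel. x \<noteq> y" by (rule AE_lborel_singleton)
      then show "AE x in lborel. indicator {..y} x *\<^sub>R \<rho> x + indicator {y..} x *\<^sub>R \<rho> x = \<rho> x"
        by eventually_elim (auto simp: indicator_def)
    qed (use \<rho>i in auto)
    finally show ?thesis using H0 by simp
  qed
  have Gbot: "(G \<longlongrightarrow> 0) at_bot"
    using tendsto_minus[OF tendsto_integral_at_bot[OF \<rho>i]] unfolding Gneg[abs_def] H0 by simp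
  obtain G0 where G0: "\<And>y. (G0 has_real_derivative \<rho> y) (at y)" and "G0 0 = 0"
    using ex_primitive[OF \<rho>c, of 0] by blast
  have inc: "G v - G u = G0 v - G0 u" if "u \<le> v" for u v
  proof -
    have "G v - G u = (LBINT x. indicator {..v} x *\<^sub>R \<rho> x - indicator {..u} x *\<^sub>R \<rho> x)"
      unfolding G_def by (intro Bochner_Integration.integral_diff[symmetric] ind) auto
    also have "\<dots> = (LBINT x. \<rho> x * indicator {u..v} x)"
    proof (rule integral_cong_AE)
      have "AE x in lborel. x \<noteq> u" by (rule AE_lborel_singleton)
      then show "AE x in lborel. indicator {..v} x *\<^sub>R \<rho> x - indicator {..u} x *\<^sub>R \<rho> x = \<rho> x * indicator {u..v} x"
        by eventually_elim (use that in \<open>auto simp: indicator_def\<close>)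
    qed (use \<rho>i in auto)
    also have "\<dots> = G0 v - G0 u"
      using \<rho>c by (intro integral_FTC_Icc_real that G0) (auto simp: continuous_on_eq_continuous_at)
    finally show ?thesis .
  qed
  have Ge: "(\<lambda>y. G0 y + (G 0 - G0 0)) = G"
  proof
    fix y show "G0 y + (G 0 - G0 0) = G y" using inc[of 0 y] inc[of y 0] by (cases "0 \<le> y") force+
  qed
  have Gd: "(G has_real_derivative \<rho> y) (at y)" for y
  proof -
    have "((\<lambda>y. G0 y + (G 0 - G0 0)) has_real_derivative \<rho> y) (at y)"
      by (auto intro!: derivative_eq_intros G0)
    then show ?thesis unfolding Ge .
  qed
  have Gd': "(G has_real_derivative r y * (\<psi> y)\<^sup>2) (at y)" for y using Gd by (simp add: \<rho>_def)
  have Gc: "continuous_on UNIV G" by (intro continuous_at_imp_continuous_on ballI DERIV_isCont[OF Gd])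
  have \<psi>n: "\<psi> y \<noteq> 0" for y using \<psi>_pos[of y] by simp
  have uc0: "continuous_on UNIV (\<lambda>y. G y / (\<psi> y)\<^sup>2)" by (intro continuous_intros Gc \<psi>_continuous) (simp add: \<psi>n)
  obtain u where u: "\<And>y. (u has_real_derivative G y / (\<psi> y)\<^sup>2) (at y)" and "u 0 = 0"
    using ex_primitive[OF uc0, of 0] by blast
  have uc: "continuous_on UNIV u" by (intro continuous_at_imp_continuous_on ballI DERIV_isCont[OF u])
  define \<psi>1 where "\<psi>1 y = \<psi> y * u y" for y
  define \<psi>1' where "\<psi>1' y = \<psi>' y * u y + G y / \<psi> y" for y
  have d1: "(\<psi>1 has_real_derivative \<psi>1' y) (at y)" for y
  proof -
    have "(\<psi>1 has_real_derivative \<psi>' y * u y + G y / (\<psi> y)\<^sup>2 * \<psi> y) (at y)"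
      unfolding \<psi>1_def by (rule DERIV_mult[OF \<psi>_deriv u])
    then show ?thesis using \<psi>n[of y] by (simp add: \<psi>1'_def power2_eq_square)
  qed
  have d2: "(\<psi>1' has_real_derivative (\<kappa> + r y * (b y - b ys)) * \<psi>1 y + r y * \<psi> y) (at y)" for y
  proof -
    define V where "V = \<kappa> + r y * (b y - b ys)"
    have "(\<psi>1' has_real_derivative (V * \<psi> y * u y + G y / (\<psi> y)\<^sup>2 * \<psi>' y)
        + (r y * (\<psi> y)\<^sup>2 * \<psi> y - G y * \<psi>' y) / (\<psi> y * \<psi> y)) (at y)"
      unfolding \<psi>1'_def V_def by (intro DERIV_add DERIV_mult DERIV_divide \<psi>'_deriv u Gd' \<psi>_deriv \<psi>n)
    moreover have "(V * \<psi> y * u y + G y / (\<psi> y)\<^sup>2 * \<psi>' y) + (r y * (\<psi> y)\<^sup>2 * \<psi> y - G y * \<psi>' y) / (\<psi> y * \<psi> y)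
      = V * \<psi>1 y + r y * \<psi> y"
      using \<psi>n[of y] by (simp add: \<psi>1_def field_simps power2_eq_square)
    ultimately show ?thesis by (simp add: V_def)
  qed
  note R = corrector_right[OF Gd' Gtop u] and L = corrector_left[OF Gd' Gbot u]
  have rapidI: "rapid f" if "continuous_on UNIV f" "((\<lambda>y. (1 + y\<^sup>2) * f y) \<longlongrightarrow> 0) at_top" "((\<lambda>y. (1 + y\<^sup>2) * f y) \<longlongrightarrow> 0) at_bot" for f
    using that decay_bound[OF that] unfolding rapid_def by metis
  have c1: "continuous_on UNIV \<psi>1" unfolding \<psi>1_def by (intro continuous_intros uc \<psi>_continuous)
  have c1': "continuous_on UNIV \<psi>1'" unfolding \<psi>1'_def
    by (intro continuous_intros uc \<psi>_continuous \<psi>'_continuous Gc) (simp add: \<psi>n)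
  show ?thesis
  proof (rule exI[of _ \<psi>1], rule exI[of _ \<psi>1'], intro conjI allI d1 d2)
    show "rapid \<psi>1" by (rule rapidI[OF c1]) (use R(1) L(1) in \<open>simp_all add: \<psi>1_def\<close>)
    show "rapid \<psi>1'" by (rule rapidI[OF c1']) (use R(2) L(2) in \<open>simp_all add: \<psi>1'_def\<close>)
    show "rapid \<psi>" by (rule rapidI[OF \<psi>_continuous R(3) L(3)])
    have "continuous_on UNIV (\<lambda>y. (\<kappa> + r y * (b y - b ys)) * \<psi>1 y)"
      by (intro continuous_intros r_continuous b_continuous c1)
    then show "rapid (\<lambda>y. (\<kappa> + r y * (b y - b ys)) * \<psi>1 y)"
      by (rule rapidI) (use R(4) L(4) in \<open>simp_all add: \<psi>1_def\<close>)
  qed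
qed

end

section \<open>Dividing \<open>b''\<close> by \<open>(b - c)\<^sup>2\<close>\<close>

locale flat_shear = smooth_shear +
  fixes b4 b5 :: "real \<Rightarrow> real" and ys :: real
  assumes b3_deriv: "\<And>y. (b3 has_real_derivative b4 y) (at y)"
    and b4_deriv: "\<And>y. (b4 has_real_derivative b5 y) (at y)"
    and b5_continuous: "continuous_on UNIV b5"
    and flat: "b2 ys = 0" "b3 ys = 0"
begin

text \<open>The value at \<open>ys\<close> is the limit of the quotient: \<open>b2\<close> behaves
  like \<open>b4 ys / 2 * (y - ys)\<^sup>2\<close> and \<open>b - b ys\<close> like
  \<open>b' ys * (y - ys)\<close>.\<close>

definition quot :: "real \<Rightarrow> real" where
  "quot y = (if y = ys then b4 ys / (2 * (b' ys)\<^sup>2) else b2 y / (b y - b ys)\<^sup>2)"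

lemma quot_factor: "b2 y = quot y * (b y - b ys)\<^sup>2"
  using b_diff_nonzero[of y ys] by (simp add: quot_def flat)

lemma segment_near: "\<bar>y - ys\<bar> \<le> 2 \<Longrightarrow> z \<in> closed_segment ys y \<Longrightarrow> \<bar>z - ys\<bar> \<le> 2"
  using closed_segment_abs_le[of z ys y] by linarith

lemma b3_near:
  obtains M where "M > 0" "\<And>y. \<bar>y - ys\<bar> \<le> 2 \<Longrightarrow> \<bar>b5 y\<bar> \<le> M" "\<And>y. \<bar>y - ys\<bar> \<le> 2 \<Longrightarrow> \<bar>b3 y\<bar> \<le> M"
proof -
  obtain M5 where M5: "M5 > 0" "\<And>y. \<bar>y - ys\<bar> \<le> 2 \<Longrightarrow> \<bar>b5 y\<bar> \<le> M5"
    using continuous_bounded_near[OF b5_continuous] by blast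
  obtain M3 where M3: "M3 > 0" "\<And>y. \<bar>y - ys\<bar> \<le> 2 \<Longrightarrow> \<bar>b3 y\<bar> \<le> M3"
    using continuous_bounded_near[OF b3_continuous] by blast
  show thesis
  proof (rule that[of "M5 + M3"])
    show "M5 + M3 > 0" using M3(1) M5(1) by simp
    show "\<bar>b5 y\<bar> \<le> M5 + M3" if "\<bar>y - ys\<bar> \<le> 2" for y using M5(2)[OF that] M3(1) by simp
    show "\<bar>b3 y\<bar> \<le> M5 + M3" if "\<bar>y - ys\<bar> \<le> 2" for y using M3(2)[OF that] M5(1) by simp
  qed
qed

lemma b2_quotient_tendsto: "((\<lambda>y. b2 y / (y - ys)\<^sup>2) \<longlongrightarrow> b4 ys / 2) (at ys)"
proof -
  obtain M where M: "M > 0" "\<And>y. \<bar>y - ys\<bar> \<le> 2 \<Longrightarrow> \<bar>b5 y\<bar> \<le> M"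
    using b3_near by metis
  have b4l: "\<bar>b4 y - b4 ys\<bar> \<le> M * \<bar>y - ys\<bar>" if y: "\<bar>y - ys\<bar> \<le> 2" for y
    by (rule lipschitz_of_deriv_bound[OF b4_deriv]) (use M segment_near[OF y] in auto)
  have b3t: "\<bar>b3 y - b4 ys * (y - ys)\<bar> \<le> M * (y - ys)\<^sup>2" if y: "\<bar>y - ys\<bar> \<le> 2" for y
  proof -
    have "\<bar>b3 y - b3 ys - b4 ys * (y - ys)\<bar> \<le> M * (y - ys)\<^sup>2"
    proof (rule taylor1_bound[OF b3_deriv])
      fix z assume z: "z \<in> closed_segment ys y"
      have "\<bar>b4 z - b4 ys\<bar> \<le> M * \<bar>z - ys\<bar>" by (rule b4l[OF segment_near[OF y z]])
      also have "\<dots> \<le> M * \<bar>y - ys\<bar>" using closed_segment_abs_le[OF z] M(1) by (intro mult_left_mono) auto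
      finally show "\<bar>b4 z - b4 ys\<bar> \<le> M * \<bar>y - ys\<bar>" .
    qed
    then show ?thesis by (simp add: flat)
  qed
  have b2t: "\<bar>b2 y - b4 ys / 2 * (y - ys)\<^sup>2\<bar> \<le> M * (y - ys)\<^sup>2 * \<bar>y - ys\<bar>" if y: "\<bar>y - ys\<bar> \<le> 2" for y
  proof -
    have "\<bar>(b2 y - b4 ys / 2 * (y - ys)\<^sup>2) - (b2 ys - b4 ys / 2 * (ys - ys)\<^sup>2)\<bar> \<le> M * (y - ys)\<^sup>2 * \<bar>y - ys\<bar>"
    proof (rule lipschitz_of_deriv_bound)
      show "((\<lambda>y. b2 y - b4 ys / 2 * (y - ys)\<^sup>2) has_real_derivative b3 z - b4 ys * (z - ys)) (at z)" for z
        by (auto intro!: derivative_eq_intros b2_deriv)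
      fix z assume z: "z \<in> closed_segment ys y"
      have "\<bar>b3 z - b4 ys * (z - ys)\<bar> \<le> M * (z - ys)\<^sup>2" by (rule b3t[OF segment_near[OF y z]])
      also have "\<dots> \<le> M * (y - ys)\<^sup>2"
        using closed_segment_abs_le[OF z] M(1) by (intro mult_left_mono) (auto simp: abs_le_square_iff)
      finally show "\<bar>b3 z - b4 ys * (z - ys)\<bar> \<le> M * (y - ys)\<^sup>2" .
    qed
    then show ?thesis by (simp add: flat)
  qed
  have "((\<lambda>y. b2 y / (y - ys)\<^sup>2 - b4 ys / 2) \<longlongrightarrow> 0) (at ys)"
  proof (rule Lim_null_comparison)
    have "norm (b2 y / (y - ys)\<^sup>2 - b4 ys / 2) \<le> M * \<bar>y - ys\<bar>" if y: "\<bar>y - ys\<bar> \<le> 2" "y \<noteq> ys" for y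
    proof -
      have "b2 y / (y - ys)\<^sup>2 - b4 ys / 2 = (b2 y - b4 ys / 2 * (y - ys)\<^sup>2) / (y - ys)\<^sup>2"
        using y by (simp add: diff_divide_distrib)
      then have "\<bar>b2 y / (y - ys)\<^sup>2 - b4 ys / 2\<bar> = \<bar>b2 y - b4 ys / 2 * (y - ys)\<^sup>2\<bar> / (y - ys)\<^sup>2"
        by (simp only: abs_divide abs_power2)
      also have "\<dots> \<le> (M * (y - ys)\<^sup>2 * \<bar>y - ys\<bar>) / (y - ys)\<^sup>2"
        by (rule divide_right_mono[OF b2t[OF y(1)]]) simp
      finally show ?thesis using y by simp
    qed
    then show "eventually (\<lambda>y. norm (b2 y / (y - ys)\<^sup>2 - b4 ys / 2) \<le> M * \<bar>y - ys\<bar>) (at ys)"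
      unfolding eventually_at_topological by (intro exI[of _ "{ys-2<..<ys+2}"]) auto
    have "((\<lambda>y. M * \<bar>y - ys\<bar>) \<longlongrightarrow> M * \<bar>ys - ys\<bar>) (at ys)" by (intro tendsto_intros)
    then show "((\<lambda>y. M * \<bar>y - ys\<bar>) \<longlongrightarrow> 0) (at ys)" by simp
  qed
  then show ?thesis by (simp add: LIM_zero_iff)
qed

lemma quot_continuous: "continuous_on UNIV quot"
  unfolding continuous_on_eq_continuous_at[OF open_UNIV]
proof
  fix y show "isCont quot y"
  proof (cases "y = ys")
    case False
    have "isCont (\<lambda>y. b2 y / (b y - b ys)\<^sup>2) y"
      by (intro continuous_intros DERIV_isCont[OF b2_deriv] DERIV_isCont[OF b_deriv])
        (use b_diff_nonzero[OF False] in simp)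
    moreover have "eventually (\<lambda>z. z \<in> - {ys}) (nhds y)" using False by (intro eventually_nhds_in_open) auto
    then have e: "eventually (\<lambda>z. quot z = b2 z / (b z - b ys)\<^sup>2) (nhds y)"
      by eventually_elim (simp add: quot_def)
    ultimately show ?thesis unfolding isCont_cong[OF e] by blast
  next
    case True
    have b0: "b' ys \<noteq> 0" using b'_pos[of ys] by simp
    have "((\<lambda>y. (b2 y / (y - ys)\<^sup>2) * ((y - ys) / (b y - b ys))\<^sup>2) \<longlongrightarrow> b4 ys / 2 * (1 / b' ys)\<^sup>2) (at ys)"
      by (intro tendsto_intros b2_quotient_tendsto quotient_tendsto[OF DERIV_ident b_deriv b0])
    then have "(quot \<longlongrightarrow> b4 ys / 2 * (1 / b' ys)\<^sup>2) (at ys)"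
      by (rule Lim_transform_eventually)
        (auto simp: eventually_at_filter quot_def power_divide)
    then show ?thesis using True by (simp add: isCont_def quot_def power_divide)
  qed
qed

text \<open>The derivative is \<open>N / x\<^sup>3\<close> with \<open>N = b3 x - 2 b' b2\<close>,
  so \<open>N\<close> has to vanish to third order at \<open>ys\<close>. In its second derivative
  the terms \<open>b' b4\<close> cancel and \<open>b5 x - 5 b2 b3\<close> remains, which is of first
  order there; integrating twice from \<open>N ys = N' ys = 0\<close> gives the cubic bound.\<close>

lemma quot_deriv_bound:
  obtains A where "A \<ge> 0" "\<And>y. \<bar>y - ys\<bar> \<le> 2 \<Longrightarrow> y \<noteq> ys \<Longrightarrow> \<exists>D. (quot has_real_derivative D) (at y) \<and> \<bar>D\<bar> \<le> A"
proof -
  obtain M where M: "M > 0" "\<And>y. \<bar>y - ys\<bar> \<le> 2 \<Longrightarrow> \<bar>b5 y\<bar> \<le> M" "\<And>y. \<bar>y - ys\<bar> \<le> 2 \<Longrightarrow> \<bar>b3 y\<bar> \<le> M"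
    using b3_near by metis
  define x where "x y = b y - b ys" for y
  have xd: "(x has_real_derivative b' y) (at y)" for y
    unfolding x_def by (auto intro!: derivative_eq_intros b_deriv)
  define N where "N y = b3 y * x y - 2 * b' y * b2 y" for y
  define N' where "N' y = b4 y * x y - b' y * b3 y - 2 * (b2 y)\<^sup>2" for y
  have Nd: "(N has_real_derivative N' y) (at y)" for y
    unfolding N_def N'_def
    by (auto intro!: derivative_eq_intros b3_deriv xd b'_deriv b2_deriv simp: power2_eq_square algebra_simps)
  have N'd: "(N' has_real_derivative b5 y * x y - 5 * (b2 y * b3 y)) (at y)" for y
    unfolding N'_def
    by (auto intro!: derivative_eq_intros b3_deriv xd b'_deriv b2_deriv b4_deriv simp: power2_eq_square algebra_simps)
  \<comment> \<open>The summands bound \<open>b5 x\<close> and \<open>5 b2 b3\<close> relative to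
    \<open>|y - ys|\<close>, by \<open>|x| \<le> |y - ys| / m\<close> and
    \<open>|b2| \<le> M |y - ys|\<close>.\<close>
  define A where "A = M / m + 5 * (M * M)"
  have A: "A > 0" using M(1) m_pos by (simp add: A_def add_pos_pos)
  have b2l: "\<bar>b2 y\<bar> \<le> M * \<bar>y - ys\<bar>" if y: "\<bar>y - ys\<bar> \<le> 2" for y
  proof -
    have "\<bar>b2 y - b2 ys\<bar> \<le> M * \<bar>y - ys\<bar>"
      by (rule lipschitz_of_deriv_bound[OF b2_deriv]) (use M segment_near[OF y] in auto)
    then show ?thesis by (simp add: flat)
  qed
  have N2: "\<bar>b5 y * x y - 5 * (b2 y * b3 y)\<bar> \<le> A * \<bar>y - ys\<bar>" if y: "\<bar>y - ys\<bar> \<le> 2" for y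
  proof -
    have "\<bar>b5 y * x y\<bar> \<le> M * (\<bar>y - ys\<bar> / m)"
      unfolding abs_mult x_def using M(2)[OF y] M(1) by (intro mult_mono abs_b_diff_bounds) auto
    moreover have "\<bar>b2 y * b3 y\<bar> \<le> (M * \<bar>y - ys\<bar>) * M"
      unfolding abs_mult using b2l[OF y] M(3)[OF y] M(1) by (intro mult_mono) auto
    moreover have "A * \<bar>y - ys\<bar> = M * (\<bar>y - ys\<bar> / m) + 5 * ((M * \<bar>y - ys\<bar>) * M)"
      by (simp add: A_def algebra_simps)
    ultimately show ?thesis by linarith
  qed
  have N1: "\<bar>N' y\<bar> \<le> A * \<bar>y - ys\<bar> * \<bar>y - ys\<bar>" if y: "\<bar>y - ys\<bar> \<le> 2" for y
  proof -
    have "\<bar>N' y - N' ys\<bar> \<le> A * \<bar>y - ys\<bar> * \<bar>y - ys\<bar>"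
    proof (rule lipschitz_of_deriv_bound[OF N'd])
      fix z assume z: "z \<in> closed_segment ys y"
      have "\<bar>b5 z * x z - 5 * (b2 z * b3 z)\<bar> \<le> A * \<bar>z - ys\<bar>" by (rule N2[OF segment_near[OF y z]])
      also have "\<dots> \<le> A * \<bar>y - ys\<bar>" using closed_segment_abs_le[OF z] A by (intro mult_left_mono) auto
      finally show "\<bar>b5 z * x z - 5 * (b2 z * b3 z)\<bar> \<le> A * \<bar>y - ys\<bar>" .
    qed
    then show ?thesis by (simp add: N'_def x_def flat)
  qed
  have N0: "\<bar>N y\<bar> \<le> A * \<bar>y - ys\<bar> ^ 3" if y: "\<bar>y - ys\<bar> \<le> 2" for y
  proof -
    have "\<bar>N y - N ys\<bar> \<le> A * \<bar>y - ys\<bar> * \<bar>y - ys\<bar> * \<bar>y - ys\<bar>"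
    proof (rule lipschitz_of_deriv_bound[OF Nd])
      fix z assume z: "z \<in> closed_segment ys y"
      have "\<bar>N' z\<bar> \<le> A * \<bar>z - ys\<bar> * \<bar>z - ys\<bar>" by (rule N1[OF segment_near[OF y z]])
      also have "\<dots> \<le> A * \<bar>y - ys\<bar> * \<bar>y - ys\<bar>"
        using closed_segment_abs_le[OF z] A by (intro mult_mono) auto
      finally show "\<bar>N' z\<bar> \<le> A * \<bar>y - ys\<bar> * \<bar>y - ys\<bar>" .
    qed
    then show ?thesis by (simp add: N_def x_def flat power3_eq_cube mult.assoc)
  qed
  show thesis
  proof (rule that[of "A / m ^ 3"])
    show "A / m ^ 3 \<ge> 0" using A m_pos by simp
    fix y assume y: "\<bar>y - ys\<bar> \<le> 2" "y \<noteq> ys"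
    have xn: "x y \<noteq> 0" using b_diff_nonzero[OF y(2)] by (simp add: x_def)
    have "((\<lambda>z. b2 z / (x z)\<^sup>2) has_real_derivative N y / (x y) ^ 3) (at y)"
    proof -
      have "((\<lambda>z. b2 z / (x z)\<^sup>2) has_real_derivative (b3 y * (x y)\<^sup>2 - b2 y * (2 * x y * b' y)) / ((x y)\<^sup>2 * (x y)\<^sup>2)) (at y)"
        using xn by (intro DERIV_divide b2_deriv) (auto intro!: derivative_eq_intros xd)
      moreover have "(b3 y * (x y)\<^sup>2 - b2 y * (2 * x y * b' y)) / ((x y)\<^sup>2 * (x y)\<^sup>2) = N y / (x y) ^ 3"
        using xn by (simp add: N_def field_simps power2_eq_square power3_eq_cube)
      ultimately show ?thesis by simp
    qed
    moreover have "eventually (\<lambda>z. z \<in> - {ys}) (nhds y)" using y by (intro eventually_nhds_in_open) auto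
    then have e: "eventually (\<lambda>z. b2 z / (x z)\<^sup>2 = quot z) (nhds y)"
      by eventually_elim (simp add: quot_def x_def)
    ultimately have "(quot has_real_derivative N y / (x y) ^ 3) (at y)"
      unfolding DERIV_cong_ev[OF refl e refl] by blast
    moreover have "\<bar>N y / (x y) ^ 3\<bar> \<le> A * \<bar>y - ys\<bar> ^ 3 / (m * \<bar>y - ys\<bar>) ^ 3"
      unfolding abs_divide power_abs
    proof (rule frac_le)
      show "(m * \<bar>y - ys\<bar>) ^ 3 \<le> \<bar>x y\<bar> ^ 3"
        using abs_b_diff_bounds(1)[of y ys] m_pos by (intro power_mono) (auto simp: x_def)
      show "0 < (m * \<bar>y - ys\<bar>) ^ 3" using y m_pos by simp
    qed (use N0[OF y(1)] A in auto)
    moreover have "A * \<bar>y - ys\<bar> ^ 3 / (m * \<bar>y - ys\<bar>) ^ 3 = A / m ^ 3"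
      using y by (simp add: power_mult_distrib)
    ultimately show "\<exists>D. (quot has_real_derivative D) (at y) \<and> \<bar>D\<bar> \<le> A / m ^ 3" by auto
  qed
qed

text \<open>The derivative bound leaves out \<open>ys\<close>, so the mean value theorem is used on
  intervals without \<open>ys\<close> in their interior, and an interval containing it is cut
  there.\<close>

lemma quot_lipschitz:
  obtains A where "A \<ge> 0" "\<And>y z. \<bar>y - ys\<bar> \<le> 2 \<Longrightarrow> \<bar>z - ys\<bar> \<le> 2 \<Longrightarrow> \<bar>quot y - quot z\<bar> \<le> A * \<bar>y - z\<bar>"
proof -
  obtain A where A: "A \<ge> 0" "\<And>y. \<bar>y - ys\<bar> \<le> 2 \<Longrightarrow> y \<noteq> ys \<Longrightarrow> \<exists>D. (quot has_real_derivative D) (at y) \<and> \<bar>D\<bar> \<le> A"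
    using quot_deriv_bound by metis
  have one: "\<bar>quot z - quot y\<bar> \<le> A * (z - y)" if "\<bar>y - ys\<bar> \<le> 2" "\<bar>z - ys\<bar> \<le> 2" "y < z" "ys \<notin> {y<..<z}" for y z
  proof -
    have der: "\<exists>D. (quot has_real_derivative D) (at s) \<and> \<bar>D\<bar> \<le> A" if "y < s" "s < z" for s
      using that \<open>ys \<notin> {y<..<z}\<close> \<open>\<bar>y - ys\<bar> \<le> 2\<close> \<open>\<bar>z - ys\<bar> \<le> 2\<close> by (intro A(2)) auto
    have "\<exists>l s. y < s \<and> s < z \<and> (quot has_real_derivative l) (at s) \<and> quot z - quot y = (z - y) * l"
      using der by (intro MVT \<open>y < z\<close> continuous_on_subset[OF quot_continuous]) (auto simp: real_differentiable_def)
    then obtain l s where ls: "y < s" "s < z" "(quot has_real_derivative l) (at s)" "quot z - quot y = (z - y) * l" by blast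
    then have "\<bar>l\<bar> \<le> A" using der[of s] DERIV_unique by blast
    then have "(z - y) * \<bar>l\<bar> \<le> (z - y) * A" using \<open>y < z\<close> by (intro mult_left_mono) auto
    then show ?thesis using ls(4) \<open>y < z\<close> by (simp add: abs_mult mult.commute)
  qed
  have lt: "\<bar>quot z - quot y\<bar> \<le> A * (z - y)" if "\<bar>y - ys\<bar> \<le> 2" "\<bar>z - ys\<bar> \<le> 2" "y < z" for y z
  proof (cases "ys \<in> {y<..<z}")
    case False then show ?thesis using one that by blast
  next
    case True
    then have "\<bar>quot z - quot ys\<bar> \<le> A * (z - ys)" "\<bar>quot ys - quot y\<bar> \<le> A * (ys - y)"
      using that by (auto intro!: one)
    moreover have "A * (z - y) = A * (z - ys) + A * (ys - y)" by (simp add: algebra_simps)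
    ultimately show ?thesis by linarith
  qed
  show thesis
  proof (rule that[OF A(1)])
    fix y z assume "\<bar>y - ys\<bar> \<le> 2" "\<bar>z - ys\<bar> \<le> 2"
    then show "\<bar>quot y - quot z\<bar> \<le> A * \<bar>y - z\<bar>"
      using lt[of y z] lt[of z y] by (cases y z rule: linorder_cases) (auto simp: abs_minus_commute)
  qed
qed

lemma quot_bounded: obtains R where "\<And>y. \<bar>quot y\<bar> \<le> R"
proof -
  obtain P where P: "P > 0" "\<And>y. \<bar>y - ys\<bar> \<le> 2 \<Longrightarrow> \<bar>quot y\<bar> \<le> P"
    using continuous_bounded_near[OF quot_continuous] by blast
  show thesis
  proof (rule that[of "P + K / m\<^sup>2"])
    fix y
    show "\<bar>quot y\<bar> \<le> P + K / m\<^sup>2"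
    proof (cases "\<bar>y - ys\<bar> \<le> 2")
      case True
      then show ?thesis using P(2)[of y] K_nonneg m_pos by (simp add: add_increasing2)
    next
      case False
      have "m * 1 \<le> m * \<bar>y - ys\<bar>" using False m_pos by (intro mult_left_mono) auto
      also have "\<dots> \<le> \<bar>b y - b ys\<bar>" by (rule abs_b_diff_bounds)
      finally have "m\<^sup>2 \<le> \<bar>b y - b ys\<bar>\<^sup>2" using m_pos by (intro power_mono) auto
      then have "\<bar>b2 y\<bar> / (b y - b ys)\<^sup>2 \<le> K / m\<^sup>2"
        using b2_bound[of y] m_pos K_nonneg by (intro frac_le) auto
      moreover have "\<bar>quot y\<bar> = \<bar>b2 y\<bar> / (b y - b ys)\<^sup>2" using False by (auto simp: quot_def)
      ultimately show ?thesis using P(1) by simp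
    qed
  qed
qed

end

section \<open>Mild solutions of the evolution equation\<close>

text \<open>The squared norm replaces \<open>L2_norm\<close> because it remains differentiable along
  solutions where it vanishes.\<close>

definition sqn :: "(real \<Rightarrow> complex) \<Rightarrow> real" where
  "sqn f = (LBINT y. (cmod (f y))\<^sup>2)"

lemma L2_norm_sqn: "L2_norm f = sqrt (sqn f)"
  by (simp add: L2_norm_def sqn_def)

lemma sqn_nonneg: "0 \<le> sqn f" by (simp add: sqn_def)

lemma L2_norm_tendsto_0_iff: "((\<lambda>s. L2_norm (f s)) \<longlongrightarrow> 0) F \<longleftrightarrow> ((\<lambda>s. sqn (f s)) \<longlongrightarrow> 0) F"
proof
  assume "((\<lambda>s. L2_norm (f s)) \<longlongrightarrow> 0) F"
  then have "((\<lambda>s. (L2_norm (f s))\<^sup>2) \<longlongrightarrow> 0\<^sup>2) F" by (rule tendsto_power)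
  then show "((\<lambda>s. sqn (f s)) \<longlongrightarrow> 0) F" by (simp add: L2_norm_sqn sqn_nonneg)
next
  assume "((\<lambda>s. sqn (f s)) \<longlongrightarrow> 0) F"
  then have "((\<lambda>s. sqrt (sqn (f s))) \<longlongrightarrow> sqrt 0) F" by (rule tendsto_real_sqrt)
  then show "((\<lambda>s. L2_norm (f s)) \<longlongrightarrow> 0) F" by (simp add: L2_norm_sqn)
qed

lemma sqn_integrable: "L2 f \<Longrightarrow> integrable lborel (\<lambda>y. (cmod (f y))\<^sup>2)"
  by (simp add: L2_def)

lemma sqn_add_le:
  assumes "L2 f" "L2 g"
  shows "sqn (\<lambda>y. f y + g y) \<le> 2 * sqn f + 2 * sqn g"
proof -
  have "sqn (\<lambda>y. f y + g y) \<le> (LBINT y. 2 * (cmod (f y))\<^sup>2 + 2 * (cmod (g y))\<^sup>2)"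
    unfolding sqn_def
  proof (rule integral_mono)
    show "integrable lborel (\<lambda>y. (cmod (f y + g y))\<^sup>2)" using sqn_integrable[OF L2_add[OF assms]] .
    show "integrable lborel (\<lambda>y. 2 * (cmod (f y))\<^sup>2 + 2 * (cmod (g y))\<^sup>2)"
      using assms by (auto simp: sqn_integrable)
    fix y
    have "(cmod (f y + g y))\<^sup>2 \<le> (cmod (f y) + cmod (g y))\<^sup>2" by (intro power_mono norm_triangle_ineq) auto
    also have "\<dots> \<le> 2 * (cmod (f y))\<^sup>2 + 2 * (cmod (g y))\<^sup>2"
      using zero_le_power2[of "cmod (f y) - cmod (g y)"] by (simp add: power2_eq_square algebra_simps)
    finally show "(cmod (f y + g y))\<^sup>2 \<le> 2 * (cmod (f y))\<^sup>2 + 2 * (cmod (g y))\<^sup>2" .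
  qed
  also have "\<dots> = 2 * sqn f + 2 * sqn g"
    using assms by (simp add: sqn_def sqn_integrable)
  finally show ?thesis .
qed

lemma sqn_cmult: "sqn (\<lambda>y. c * f y) = (cmod c)\<^sup>2 * sqn f"
  by (simp add: sqn_def norm_mult power_mult_distrib)

lemma sqn_0_iff:
  assumes "L2 f"
  shows "sqn f = 0 \<longleftrightarrow> (AE y in lborel. f y = 0)"
  unfolding sqn_def using integral_nonneg_eq_0_iff_AE[OF sqn_integrable[OF assms]] by simp

lemma sqn_cong_AE:
  assumes "L2 f" "L2 g" "AE y in lborel. f y = g y"
  shows "sqn f = sqn g"
  unfolding sqn_def using assms by (intro integral_cong_AE) (auto simp: L2_def elim!: eventually_mono)

text \<open>Only the real part of the inner product occurs in the derivative of
  \<open>sqn\<close>.\<close>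

definition ip :: "(real \<Rightarrow> complex) \<Rightarrow> (real \<Rightarrow> complex) \<Rightarrow> real" where
  "ip f g = (LBINT y. Re (cnj (f y) * g y))"

lemma ip_integrable:
  assumes "L2 f" "L2 g"
  shows "integrable lborel (\<lambda>y. Re (cnj (f y) * g y))"
proof -
  have "integrable lborel (\<lambda>y. Re (f y) * Re (g y) + Im (f y) * Im (g y))"
    by (intro Bochner_Integration.integrable_add L2_mult_integrable L2_Re L2_Im assms)
  then show ?thesis by simp
qed

text \<open>Young's inequality, integrated from a pointwise square. The free weight
  \<open>\<delta>\<close> lets it play the part of the Cauchy-Schwarz inequality in limits.\<close>

lemma ip_le:
  assumes "L2 f" "L2 g" "\<delta> > 0"
  shows "2 * \<bar>ip f g\<bar> \<le> \<delta> * sqn f + sqn g / \<delta>"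
proof -
  have "\<bar>ip f g\<bar> \<le> (LBINT y. \<bar>Re (cnj (f y) * g y)\<bar>)"
    unfolding ip_def by (rule integral_abs_bound)
  also have "\<dots> \<le> (LBINT y. \<delta> / 2 * (cmod (f y))\<^sup>2 + 1 / (2 * \<delta>) * (cmod (g y))\<^sup>2)"
  proof (rule integral_mono)
    show "integrable lborel (\<lambda>y. \<bar>Re (cnj (f y) * g y)\<bar>)" by (rule integrable_abs[OF ip_integrable[OF assms(1,2)]])
    show "integrable lborel (\<lambda>y. \<delta> / 2 * (cmod (f y))\<^sup>2 + 1 / (2 * \<delta>) * (cmod (g y))\<^sup>2)"
      by (intro Bochner_Integration.integrable_add integrable_mult_right sqn_integrable assms)
    fix y
    have "\<bar>Re (cnj (f y) * g y)\<bar> \<le> cmod (f y) * cmod (g y)"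
      using abs_Re_le_cmod[of "cnj (f y) * g y"] by (simp add: norm_mult)
    also have "\<dots> \<le> \<delta> / 2 * (cmod (f y))\<^sup>2 + 1 / (2 * \<delta>) * (cmod (g y))\<^sup>2"
    proof -
      have "0 \<le> (\<delta> * cmod (f y) - cmod (g y))\<^sup>2" by simp
      then have "2 * \<delta> * (cmod (f y) * cmod (g y)) \<le> \<delta>\<^sup>2 * (cmod (f y))\<^sup>2 + (cmod (g y))\<^sup>2"
        by (simp add: power2_eq_square algebra_simps)
      then have "2 * \<delta> * (cmod (f y) * cmod (g y)) / (2 * \<delta>) \<le> (\<delta>\<^sup>2 * (cmod (f y))\<^sup>2 + (cmod (g y))\<^sup>2) / (2 * \<delta>)"
        using assms(3) by (intro divide_right_mono) auto
      then show ?thesis using assms(3) by (simp add: add_divide_distrib power2_eq_square)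
    qed
    finally show "\<bar>Re (cnj (f y) * g y)\<bar> \<le> \<delta> / 2 * (cmod (f y))\<^sup>2 + 1 / (2 * \<delta>) * (cmod (g y))\<^sup>2" .
  qed
  also have "\<dots> = \<delta> / 2 * sqn f + 1 / (2 * \<delta>) * sqn g"
    unfolding sqn_def by (subst Bochner_Integration.integral_add) (auto intro!: integrable_mult_right sqn_integrable assms)
  finally show ?thesis by (simp add: field_simps)
qed

lemma ip_tendsto_0:
  assumes L: "L2 f" "\<And>s. L2 (g s)" and t: "((\<lambda>s. sqn (g s)) \<longlongrightarrow> 0) F"
  shows "((\<lambda>s. ip f (g s)) \<longlongrightarrow> 0) F"
proof (rule tendstoI)
  fix e :: real assume e: "e > 0"
  define \<delta> where "\<delta> = e / (sqn f + 1)"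
  have n: "sqn f + 1 > 0" using sqn_nonneg[of f] by linarith
  have d: "\<delta> > 0" using e n by (simp add: \<delta>_def)
  have ds: "\<delta> * sqn f \<le> e"
  proof -
    have "\<delta> * sqn f \<le> \<delta> * (sqn f + 1)" using d by (intro mult_left_mono) auto
    then show ?thesis using n by (simp add: \<delta>_def)
  qed
  have "eventually (\<lambda>s. sqn (g s) < e * \<delta>) F" using t d e by (intro order_tendstoD(2)) auto
  then show "eventually (\<lambda>s. dist (ip f (g s)) 0 < e) F"
  proof eventually_elim
    case (elim s)
    then have "sqn (g s) / \<delta> < e" using d by (simp add: divide_less_eq)
    then show ?case using ip_le[OF L(1) L(2)[of s] d] ds by simp
  qed
qed

lemma L2_weak_deriv_L2: "L2_weak_deriv f g \<Longrightarrow> L2 f" "L2_weak_deriv f g \<Longrightarrow> L2 g"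
  by (auto simp: L2_weak_deriv_def)

lemma L2_weak_deriv_lincomb:
  fixes f g f' g' :: "real \<Rightarrow> complex"
  assumes "L2_weak_deriv f f'" "L2_weak_deriv g g'"
  shows "L2_weak_deriv (\<lambda>y. c * f y + d * g y) (\<lambda>y. c * f' y + d * g' y)"
  unfolding L2_weak_deriv_def
proof (intro conjI allI impI)
  note L = L2_weak_deriv_L2[OF assms(1)] L2_weak_deriv_L2[OF assms(2)]
  show "L2 (\<lambda>y. c * f y + d * g y)" "L2 (\<lambda>y. c * f' y + d * g' y)" by (intro L2_add L2_cmult L)+
  fix \<phi> assume t: "test_function \<phi>"
  note i1 = L2_scaleR_integrable[OF test_function_L2(2)[OF t] L(1)] L2_scaleR_integrable[OF test_function_L2(2)[OF t] L(3)]
  note i2 = L2_scaleR_integrable[OF test_function_L2(1)[OF t] L(2)] L2_scaleR_integrable[OF test_function_L2(1)[OF t] L(4)]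
  have e: "(LBINT y. \<eta> y *\<^sub>R (c * u y + d * v y)) = c * (LBINT y. \<eta> y *\<^sub>R u y) + d * (LBINT y. \<eta> y *\<^sub>R v y)"
    if "integrable lborel (\<lambda>y. \<eta> y *\<^sub>R u y)" "integrable lborel (\<lambda>y. \<eta> y *\<^sub>R v y)" for \<eta> and u v :: "real \<Rightarrow> complex"
  proof -
    have "(\<lambda>y. \<eta> y *\<^sub>R (c * u y + d * v y)) = (\<lambda>y. c * (\<eta> y *\<^sub>R u y) + d * (\<eta> y *\<^sub>R v y))"
      by (simp add: scaleR_right_distrib)
    then show ?thesis using that by (simp del: mult_scaleR_right)
  qed
  show "(LBINT y. deriv \<phi> y *\<^sub>R (c * f y + d * g y)) = - (LBINT y. \<phi> y *\<^sub>R (c * f' y + d * g' y))"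
    unfolding e[OF i1] e[OF i2] using assms t by (simp add: L2_weak_deriv_def)
qed

lemma helmholtz_inverse_iff:
  "helmholtz_inverse k \<omega> \<psi> \<longleftrightarrow> (\<exists>\<psi>1 \<psi>2. L2_weak_deriv \<psi> \<psi>1 \<and> L2_weak_deriv \<psi>1 \<psi>2 \<and>
        (AE y in lborel. \<psi>2 y - (of_int k)\<^sup>2 * \<psi> y = \<omega> y))"
  unfolding helmholtz_inverse_def numeral_2_eq_2 Sobolev_H.simps
  using L2_weak_deriv_L2 by blast

lemma helmholtz_inverse_lincomb:
  assumes "helmholtz_inverse k \<omega> \<psi>" "helmholtz_inverse k \<omega>' \<psi>'"
  shows "helmholtz_inverse k (\<lambda>y. c * \<omega> y + d * \<omega>' y) (\<lambda>y. c * \<psi> y + d * \<psi>' y)"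
proof -
  obtain \<psi>1 \<psi>2 where 1: "L2_weak_deriv \<psi> \<psi>1" "L2_weak_deriv \<psi>1 \<psi>2" "AE y in lborel. \<psi>2 y - (of_int k)\<^sup>2 * \<psi> y = \<omega> y"
    using assms(1) unfolding helmholtz_inverse_iff by blast
  obtain \<phi>1 \<phi>2 where 2: "L2_weak_deriv \<psi>' \<phi>1" "L2_weak_deriv \<phi>1 \<phi>2" "AE y in lborel. \<phi>2 y - (of_int k)\<^sup>2 * \<psi>' y = \<omega>' y"
    using assms(2) unfolding helmholtz_inverse_iff by blast
  have "AE y in lborel. (c * \<psi>2 y + d * \<phi>2 y) - (of_int k)\<^sup>2 * (c * \<psi> y + d * \<psi>' y) = c * \<omega> y + d * \<omega>' y"
    using 1(3) 2(3)
  proof eventually_elim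
    case (elim y)
    show ?case unfolding elim[symmetric] by (simp add: algebra_simps)
  qed
  then show ?thesis unfolding helmholtz_inverse_iff
    using L2_weak_deriv_lincomb[OF 1(1) 2(1)] L2_weak_deriv_lincomb[OF 1(2) 2(2)] by blast
qed

lemma rayleigh_lincomb:
  assumes "rayleigh b k \<omega> \<eta>" "rayleigh b k \<omega>' \<eta>'"
  shows "rayleigh b k (\<lambda>y. c * \<omega> y + d * \<omega>' y) (\<lambda>y. c * \<eta> y + d * \<eta>' y)"
proof -
  obtain \<psi> where 1: "helmholtz_inverse k \<omega> \<psi>" "AE y in lborel. \<eta> y = of_real (b y) * \<omega> y - of_real (deriv (deriv b) y) * \<psi> y"
    using assms(1) by (auto simp: rayleigh_def)
  obtain \<psi>' where 2: "helmholtz_inverse k \<omega>' \<psi>'" "AE y in lborel. \<eta>' y = of_real (b y) * \<omega>' y - of_real (deriv (deriv b) y) * \<psi>' y"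
    using assms(2) by (auto simp: rayleigh_def)
  have "AE y in lborel. c * \<eta> y + d * \<eta>' y = of_real (b y) * (c * \<omega> y + d * \<omega>' y) - of_real (deriv (deriv b) y) * (c * \<psi> y + d * \<psi>' y)"
    using 1(2) 2(2)
  proof eventually_elim
    case (elim y)
    show ?case unfolding elim by (simp add: algebra_simps)
  qed
  with helmholtz_inverse_lincomb[OF 1(1) 2(1)] show ?thesis
    using assms by (auto simp: rayleigh_def intro!: L2_add L2_cmult)
qed

lemma at_within_atLeast_nontrivial: "0 \<le> t \<Longrightarrow> at t within {0..} \<noteq> (bot :: real filter)"
proof
  assume "0 \<le> t" "at t within {0..} = (bot :: real filter)"
  moreover from this have "{t<..} \<subseteq> {0..}" by auto
  ultimately have "at_right t \<le> (bot :: real filter)" using at_le[of "{t<..}" "{0..}" t] by simp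
  then have "at_right t = bot" by (rule le_bot)
  then show False using trivial_limit_at_right_real[of t] by blast
qed

section \<open>The energy method and uniqueness of mild solutions\<close>

lemma gronwall_zero:
  fixes N N' :: "real \<Rightarrow> real"
  assumes d: "\<And>t. 0 \<le> t \<Longrightarrow> (N has_real_derivative N' t) (at t within {0..})"
    and le: "\<And>t. 0 \<le> t \<Longrightarrow> N' t \<le> C * N t" and z: "N 0 = 0" and n: "\<And>t. 0 \<le> N t" and t: "0 \<le> t"
  shows "N t = 0"
proof (cases "t = 0")
  case False
  then have t0: "0 < t" using t by simp
  let ?f = "\<lambda>s. exp (- C * s) * N s"
  have fd: "(?f has_real_derivative exp (- C * s) * (N' s - C * N s)) (at s within {0..t})" if "0 \<le> s" for s
  proof -
    have "(N has_real_derivative N' s) (at s within {0..t})"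
      by (rule DERIV_subset[OF d[OF that]]) auto
    then show ?thesis by (auto intro!: derivative_eq_intros simp: algebra_simps)
  qed
  have "\<exists>x\<in>{0<..<t}. ?f t - ?f 0 = (\<lambda>h. exp (- C * x) * (N' x - C * N x) * h) (t - 0)"
    by (rule mvt_simple[OF t0]) (use fd in \<open>auto simp: has_field_derivative_def\<close>)
  then obtain x where x: "0 < x" "?f t - ?f 0 = exp (- C * x) * (N' x - C * N x) * (t - 0)" by auto
  have "exp (- C * x) * (N' x - C * N x) * (t - 0) \<le> 0"
    using le[of x] x(1) t by (intro mult_nonpos_nonneg mult_nonneg_nonpos) auto
  then have "exp (- C * t) * N t \<le> 0" using x(2) z by simp
  then show ?thesis using n[of t] by (simp add: mult_le_0_iff)
qed (use z in simp)

text \<open>The square of \<open>W t + (s - t) * Q s\<close>, with \<open>Q\<close> the difference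
  quotient, is expanded exactly. In the result only the error \<open>E\<close> and the term with the
  extra factor \<open>s - t\<close> depend on \<open>s\<close>, and both contributions tend to
  0.\<close>

lemma sqn_has_derivative:
  assumes W: "L2_has_time_derivative W u" and t: "0 \<le> t"
  shows "((\<lambda>s. sqn (W s)) has_real_derivative 2 * ip (W t) (u t)) (at t within {0..})"
proof -
  have L: "L2 (W s)" "L2 (u s)" if "0 \<le> s" for s using W that by (auto simp: L2_has_time_derivative_def)
  define Q where "Q s y = (W s y - W t y) / of_real (s - t)" for s y
  \<comment> \<open>Nothing is known about \<open>W s\<close> for negative \<open>s\<close>.
    Extending the error by 0 makes it square integrable for every \<open>s\<close>, as
    \<open>ip_tendsto_0\<close> asks, without changing it on \<open>{0..}\<close>.\<close>
  define E where "E s y = (if 0 \<le> s then Q s y - u t y else 0)" for s y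
  have LQ: "L2 (Q s)" if "0 \<le> s" for s
    using L2_cmult[OF L2_diff[OF L(1)[OF that] L(1)[OF t]], of "1 / of_real (s - t)"] by (simp add: Q_def[abs_def])
  have L0: "L2 (\<lambda>y. 0 :: complex)" by (simp add: L2_def)
  have LE: "L2 (E s)" for s
    unfolding E_def using L2_diff[OF LQ L(2)[OF t], of s] L0 by (cases "0 \<le> s") auto
  have "((\<lambda>s. sqn (\<lambda>y. Q s y - u t y)) \<longlongrightarrow> 0) (at t within {0..})"
    using W t unfolding L2_has_time_derivative_def L2_norm_tendsto_0_iff Q_def by blast
  then have Et: "((\<lambda>s. sqn (E s)) \<longlongrightarrow> 0) (at t within {0..})"
    by (rule Lim_transform_eventually) (auto simp: eventually_at_filter E_def[abs_def])
  have T: "((\<lambda>s. 2 * ip (W t) (u t) + 2 * ip (W t) (E s) + (s - t) * sqn (Q s)) \<longlongrightarrow> 2 * ip (W t) (u t) + 2 * 0 + 0) (at t within {0..})"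
  proof (intro tendsto_add tendsto_mult tendsto_const ip_tendsto_0 L t LE Et)
    show "((\<lambda>s. (s - t) * sqn (Q s)) \<longlongrightarrow> 0) (at t within {0..})"
    proof (rule Lim_null_comparison)
      show "eventually (\<lambda>s. norm ((s - t) * sqn (Q s)) \<le> \<bar>s - t\<bar> * (2 * sqn (E s) + 2 * sqn (u t))) (at t within {0..})"
        unfolding eventually_at_filter
      proof (intro always_eventually allI impI)
        fix s :: real assume "s \<noteq> t" "s \<in> {0..}"
        then have "Q s = (\<lambda>y. E s y + u t y)" by (auto simp: E_def)
        then have "sqn (Q s) \<le> 2 * sqn (E s) + 2 * sqn (u t)" using sqn_add_le[OF LE L(2)[OF t], of s] by simp
        then show "norm ((s - t) * sqn (Q s)) \<le> \<bar>s - t\<bar> * (2 * sqn (E s) + 2 * sqn (u t))"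
          by (simp add: abs_mult sqn_nonneg mult_left_mono)
      qed
      have "((\<lambda>s. \<bar>s - t\<bar> * (2 * sqn (E s) + 2 * sqn (u t))) \<longlongrightarrow> \<bar>t - t\<bar> * (2 * 0 + 2 * sqn (u t))) (at t within {0..})"
        by (intro tendsto_intros Et)
      then show "((\<lambda>s. \<bar>s - t\<bar> * (2 * sqn (E s) + 2 * sqn (u t))) \<longlongrightarrow> 0) (at t within {0..})" by simp
    qed
  qed
  have quot: "(sqn (W s) - sqn (W t)) / (s - t) = 2 * ip (W t) (u t) + 2 * ip (W t) (E s) + (s - t) * sqn (Q s)"
    if s: "s \<noteq> t" "0 \<le> s" for s
  proof -
    have pw: "(cmod (W s y))\<^sup>2 = (cmod (W t y))\<^sup>2 + (s - t) * (2 * Re (cnj (W t y) * u t y) + 2 * Re (cnj (W t y) * E s y) + (s - t) * (cmod (Q s y))\<^sup>2)" for y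
    proof -
      have q: "u t y + E s y = Q s y" using s by (simp add: E_def)
      have w: "W s y = W t y + of_real (s - t) * Q s y" using s by (simp add: Q_def)
      have "Re (cnj (W t y) * u t y) + Re (cnj (W t y) * E s y) = Re (cnj (W t y) * Q s y)"
        unfolding q[symmetric] by (simp add: algebra_simps)
      then have "(s - t) * (2 * Re (cnj (W t y) * u t y) + 2 * Re (cnj (W t y) * E s y) + (s - t) * (cmod (Q s y))\<^sup>2)
        = (s - t) * (2 * Re (cnj (W t y) * Q s y) + (s - t) * (cmod (Q s y))\<^sup>2)" by simp
      then show ?thesis unfolding w cmod_power2 by (simp add: power2_eq_square algebra_simps)
    qed
    have "sqn (W s) = sqn (W t) + (s - t) * (2 * ip (W t) (u t) + 2 * ip (W t) (E s) + (s - t) * sqn (Q s))"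
    proof -
      have gen: "(LBINT y. f1 y + a * (2 * f2 y + 2 * f3 y + a * f4 y))
          = (LBINT y. f1 y) + a * (2 * (LBINT y. f2 y) + 2 * (LBINT y. f3 y) + a * (LBINT y. f4 y))"
        if "integrable lborel f1" "integrable lborel f2" "integrable lborel f3" "integrable lborel f4"
        for a and f1 f2 f3 f4 :: "real \<Rightarrow> real" using that by simp
      show ?thesis unfolding sqn_def[of "W s"] pw
        unfolding sqn_def ip_def
        by (intro gen ip_integrable sqn_integrable L t LE LQ s)
    qed
    then show ?thesis using s by simp
  qed
  have "((\<lambda>s. (sqn (W s) - sqn (W t)) / (s - t)) \<longlongrightarrow> 2 * ip (W t) (u t) + 2 * 0 + 0) (at t within {0..})"
    by (rule Lim_transform_eventually[OF T]) (simp add: eventually_at_filter quot)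
  then show ?thesis by (simp add: has_field_derivative_iff)
qed

text \<open>Multiplication by the real, unbounded \<open>b\<close> contributes only an imaginary
  part to the pairing of \<open>W\<close> with its time derivative. The rest is at most
  \<open>|k| M\<close> times the norms of \<open>W\<close> and its stream function, and the
  Helmholtz estimate bounds the latter by the former, so Gronwall's inequality applies. The argument
  runs on the integrated solution \<open>W\<close>, which is known to lie in the domain of the
  operator.\<close>

lemma homogeneous_solution_zero:
  assumes k: "k \<noteq> 0" and W0: "AE y in lborel. W 0 y = 0" and W: "L2_has_time_derivative W u"
    and eq: "\<And>t. 0 \<le> t \<Longrightarrow> \<exists>\<eta>. rayleigh b k (W t) \<eta> \<and> (AE y in lborel. u t y = - \<i> * of_int k * \<eta> y)"
    and M: "\<And>y. \<bar>deriv (deriv b) y\<bar> \<le> M" and t: "0 \<le> t"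
  shows "AE y in lborel. u t y = 0"
proof -
  have L: "L2 (W s)" "L2 (u s)" if "0 \<le> s" for s using W that by (auto simp: L2_has_time_derivative_def)
  define C where "C = 2 * (\<bar>of_int k\<bar> * M)"
  have M0: "0 \<le> M" using M[of 0] by linarith
  have energy: "2 * ip (W t) (u t) \<le> C * sqn (W t)" if t: "0 \<le> t" for t
  proof -
    obtain \<eta> where \<eta>: "rayleigh b k (W t) \<eta>" "AE y in lborel. u t y = - \<i> * of_int k * \<eta> y" using eq[OF t] by blast
    obtain \<psi> where \<psi>: "helmholtz_inverse k (W t) \<psi>" "AE y in lborel. \<eta> y = of_real (b y) * W t y - of_real (deriv (deriv b) y) * \<psi> y"
      using \<eta>(1) by (auto simp: rayleigh_def)
    have L\<psi>: "L2 \<psi>" using \<psi>(1) L2_weak_deriv_L2 unfolding helmholtz_inverse_iff by blast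
    have "2 * ip (W t) (u t) = (LBINT y. 2 * Re (cnj (W t y) * u t y))"
      unfolding ip_def integral_mult_right_zero ..
    also have "\<dots> \<le> (LBINT y. (\<bar>of_int k\<bar> * M) * ((cmod (W t y))\<^sup>2 + (cmod (\<psi> y))\<^sup>2))"
    proof (rule integral_mono_AE)
      show "integrable lborel (\<lambda>y. 2 * Re (cnj (W t y) * u t y))"
        by (intro integrable_mult_right ip_integrable L t)
      show "integrable lborel (\<lambda>y. (\<bar>of_int k\<bar> * M) * ((cmod (W t y))\<^sup>2 + (cmod (\<psi> y))\<^sup>2))"
        by (intro integrable_mult_right Bochner_Integration.integrable_add sqn_integrable L t L\<psi>)
      show "AE y in lborel. 2 * Re (cnj (W t y) * u t y) \<le> (\<bar>of_int k\<bar> * M) * ((cmod (W t y))\<^sup>2 + (cmod (\<psi> y))\<^sup>2)"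
        using \<eta>(2) \<psi>(2)
      proof eventually_elim
        case (elim y)
        define w where "w = W t y"
        define d where "d = deriv (deriv b) y"
        have "cnj w * u t y = - \<i> * of_real (of_int k * b y) * (cnj w * w) + \<i> * of_real (of_int k * d) * (cnj w * \<psi> y)"
          unfolding elim w_def d_def by (simp add: algebra_simps)
        \<comment> \<open>This makes the first summand purely imaginary, so the unbounded factor
          \<open>b\<close> disappears from the real part.\<close>
        moreover have "cnj w * w = of_real ((cmod w)\<^sup>2)" by (metis complex_norm_square mult.commute)
        ultimately have "Re (cnj w * u t y) = Re (\<i> * of_real (of_int k * d) * (cnj w * \<psi> y))" by simp
        also have "\<dots> \<le> cmod (\<i> * of_real (of_int k * d) * (cnj w * \<psi> y))" by (rule complex_Re_le_cmod)
        also have "\<dots> = \<bar>of_int k\<bar> * \<bar>d\<bar> * (cmod w * cmod (\<psi> y))"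
          by (simp add: norm_mult abs_mult)
        also have "\<dots> \<le> \<bar>of_int k\<bar> * M * (cmod w * cmod (\<psi> y))"
          using M[of y] by (intro mult_right_mono mult_left_mono) (auto simp: d_def)
        finally have "2 * Re (cnj w * u t y) \<le> (\<bar>of_int k\<bar> * M) * (2 * (cmod w * cmod (\<psi> y)))" by simp
        also have "\<dots> \<le> (\<bar>of_int k\<bar> * M) * ((cmod w)\<^sup>2 + (cmod (\<psi> y))\<^sup>2)"
        proof (rule mult_left_mono)
          show "2 * (cmod w * cmod (\<psi> y)) \<le> (cmod w)\<^sup>2 + (cmod (\<psi> y))\<^sup>2"
            using zero_le_power2[of "cmod w - cmod (\<psi> y)"] by (simp add: power2_eq_square algebra_simps)
        qed (use M0 in simp)
        finally show ?case by (simp add: w_def)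
      qed
    qed
    also have "\<dots> = (\<bar>of_int k\<bar> * M) * (sqn (W t) + sqn \<psi>)"
      unfolding sqn_def integral_mult_right_zero
      by (subst Bochner_Integration.integral_add) (auto intro!: sqn_integrable L t L\<psi>)
    also have "\<dots> \<le> (\<bar>of_int k\<bar> * M) * (sqn (W t) + sqn (W t))"
      using helmholtz_energy[OF \<psi>(1) L(1)[OF t] k] M0 unfolding sqn_def by (intro mult_left_mono add_left_mono) auto
    finally show ?thesis by (simp add: C_def)
  qed
  have z: "sqn (W s) = 0" if "0 \<le> s" for s
  proof (rule gronwall_zero[OF sqn_has_derivative[OF W] energy _ sqn_nonneg that])
    show "sqn (W 0) = 0" using sqn_0_iff[OF L(1)] W0 by simp
  qed
  have az: "AE y in lborel. W s y = 0" if "0 \<le> s" for s using z[OF that] sqn_0_iff[OF L(1)[OF that]] by simp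
  have "((\<lambda>s. sqn (\<lambda>y. (W s y - W t y) / of_real (s - t) - u t y)) \<longlongrightarrow> 0) (at t within {0..})"
    using W t unfolding L2_has_time_derivative_def L2_norm_tendsto_0_iff by blast
  then have "((\<lambda>s. sqn (u t)) \<longlongrightarrow> 0) (at t within {0..})"
  proof (rule Lim_transform_eventually)
    have "sqn (\<lambda>y. (W s y - W t y) / of_real (s - t) - u t y) = sqn (u t)" if s: "0 \<le> s" for s
    proof -
      have "AE y in lborel. (W s y - W t y) / of_real (s - t) - u t y = - u t y"
        using az[OF s] az[OF t] by eventually_elim simp
      moreover have "L2 (\<lambda>y. (W s y - W t y) / of_real (s - t) - u t y)"
        using L2_diff[OF L2_cmult[OF L2_diff[OF L(1)[OF s] L(1)[OF t]], of "1 / of_real (s - t)"] L(2)[OF t]] by simp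
      moreover have "L2 (\<lambda>y. - u t y)" using L2_cmult[OF L(2)[OF t], of "-1"] by simp
      ultimately have "sqn (\<lambda>y. (W s y - W t y) / of_real (s - t) - u t y) = sqn (\<lambda>y. - u t y)"
        by (intro sqn_cong_AE)
      then show ?thesis by (simp add: sqn_def)
    qed
    then show "eventually (\<lambda>s. sqn (\<lambda>y. (W s y - W t y) / of_real (s - t) - u t y) = sqn (u t)) (at t within {0..})"
      by (auto simp: eventually_at_filter)
  qed
  then have "sqn (u t) = 0" using at_within_atLeast_nontrivial[OF t] tendsto_const tendsto_unique by metis
  then show ?thesis using sqn_0_iff[OF L(2)[OF t]] by simp
qed

section \<open>The explicit solution on a Jordan chain\<close>

lemma difference_quotient_of_real:
  assumes "(g has_field_derivative g') (at (of_real t :: complex))"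
  shows "((\<lambda>s. (g (of_real s) - g (of_real t)) / of_real (s - t) - g') \<longlongrightarrow> 0) (at t within S)"
proof -
  have f: "filterlim complex_of_real (at (of_real t)) (at t within S)"
    unfolding filterlim_at
    by (intro conjI tendsto_of_real tendsto_ident_at) (auto simp: eventually_at_filter)
  have "((\<lambda>z. (g z - g (of_real t)) / (z - of_real t)) \<longlongrightarrow> g') (at (of_real t))"
    using assms by (simp add: has_field_derivative_iff)
  from filterlim_compose[OF this f]
  have "((\<lambda>s. (g (of_real s) - g (of_real t)) / of_real (s - t)) \<longlongrightarrow> g') (at t within S)" by simp
  then show ?thesis by (simp add: LIM_zero_iff)
qed

text \<open>Coefficients of \<open>W(t) = A(t) \<omega>\<^sub>1 + B(t) \<omega>\<^sub>0\<close> when \<open>(R - c) \<omega>\<^sub>0 = 0\<close> and \<open>(R - c) \<omega>\<^sub>1 = \<omega>\<^sub>0\<close>.\<close>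

lemma propagator_coefficients:
  fixes c :: real and k :: int
  assumes k: "k \<noteq> 0"
  defines "\<alpha> \<equiv> \<lambda>z. exp (- \<i> * of_int k * of_real c * z)"
  shows "\<exists>A B :: complex \<Rightarrow> complex. A 0 = 0 \<and> B 0 = 0 \<and>
    (\<forall>z. (A has_field_derivative \<alpha> z) (at z)) \<and> (\<forall>z. (B has_field_derivative - \<i> * of_int k * z * \<alpha> z) (at z)) \<and>
    (\<forall>z. \<alpha> z = 1 - \<i> * of_int k * of_real c * A z) \<and>
    (\<forall>z. - \<i> * of_int k * z * \<alpha> z = - \<i> * of_int k * (A z + of_real c * B z))"
proof (cases "c = 0")
  \<comment> \<open>For \<open>c = 0\<close> the exponential is constant and the primitives are
    polynomials; the formulas of the other case divide by \<open>c\<close>.\<close>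
  case True
  then show ?thesis
    by (intro exI[of _ "\<lambda>z. z"] exI[of _ "\<lambda>z. - \<i> * of_int k * z\<^sup>2 / 2"])
      (auto simp: \<alpha>_def intro!: derivative_eq_intros)
next
  case False
  define \<mu> where "\<mu> = \<i> * of_int k * of_real c"
  have \<mu>: "\<mu> \<noteq> 0" using k False by (simp add: \<mu>_def)
  have \<alpha>: "\<alpha> z = exp (- \<mu> * z)" for z by (simp add: \<alpha>_def \<mu>_def)
  have \<alpha>d: "(\<alpha> has_field_derivative - \<mu> * \<alpha> z) (at z)" for z
    unfolding \<alpha>[abs_def] by (auto intro!: derivative_eq_intros)
  define A where "A z = (1 - \<alpha> z) / \<mu>" for z
  \<comment> \<open>Found by parts: \<open>(z \<alpha>)' = \<alpha> - \<mu> z \<alpha>\<close>, and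
    since \<open>\<mu> = \<i> k c\<close> the last term is \<open>c\<close> times the required
    derivative.\<close>
  define B where "B z = (z * \<alpha> z - A z) / of_real c" for z
  have Ad: "(A has_field_derivative \<alpha> z) (at z)" for z
    unfolding A_def using \<mu> by (auto intro!: derivative_eq_intros \<alpha>d)
  have "(B has_field_derivative (\<alpha> z + z * (- \<mu> * \<alpha> z) - \<alpha> z) / of_real c) (at z)" for z
    unfolding B_def using False by (auto intro!: derivative_eq_intros \<alpha>d Ad)
  moreover have "(\<alpha> z + z * (- \<mu> * \<alpha> z) - \<alpha> z) / of_real c = - \<i> * of_int k * z * \<alpha> z" for z
    using False by (simp add: \<mu>_def field_simps)
  ultimately have Bd: "(B has_field_derivative - \<i> * of_int k * z * \<alpha> z) (at z)" for z by metis
  have "\<alpha> z = 1 - \<i> * of_int k * of_real c * A z" for z using \<mu> by (simp add: A_def \<mu>_def[symmetric])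
  moreover have "- \<i> * of_int k * z * \<alpha> z = - \<i> * of_int k * (A z + of_real c * B z)" for z
    using False by (simp add: B_def)
  moreover have "A 0 = 0" "B 0 = 0" by (simp_all add: A_def B_def \<alpha>)
  ultimately show ?thesis using Ad Bd by blast
qed

lemma lincomb_tendsto_0:
  fixes f g :: "real \<Rightarrow> complex" and p q :: "'a \<Rightarrow> complex"
  assumes L: "L2 f" "L2 g" and t: "(p \<longlongrightarrow> 0) F" "(q \<longlongrightarrow> 0) F"
  shows "((\<lambda>s. L2_norm (\<lambda>y. p s * f y + q s * g y)) \<longlongrightarrow> 0) F"
  unfolding L2_norm_tendsto_0_iff
proof (rule Lim_null_comparison)
  have "norm (sqn (\<lambda>y. p s * f y + q s * g y)) \<le> 2 * ((cmod (p s))\<^sup>2 * sqn f) + 2 * ((cmod (q s))\<^sup>2 * sqn g)" for s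
    using sqn_add_le[OF L2_cmult[OF L(1), of "p s"] L2_cmult[OF L(2), of "q s"]]
    by (simp add: sqn_cmult sqn_nonneg)
  then show "eventually (\<lambda>s. norm (sqn (\<lambda>y. p s * f y + q s * g y)) \<le> 2 * ((cmod (p s))\<^sup>2 * sqn f) + 2 * ((cmod (q s))\<^sup>2 * sqn g)) F"
    by simp
  have "((\<lambda>s. 2 * ((cmod (p s))\<^sup>2 * sqn f) + 2 * ((cmod (q s))\<^sup>2 * sqn g)) \<longlongrightarrow> 2 * ((cmod 0)\<^sup>2 * sqn f) + 2 * ((cmod 0)\<^sup>2 * sqn g)) F"
    by (intro tendsto_intros t)
  then show "((\<lambda>s. 2 * ((cmod (p s))\<^sup>2 * sqn f) + 2 * ((cmod (q s))\<^sup>2 * sqn g)) \<longlongrightarrow> 0) F" by simp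
qed

text \<open>On the span of \<open>\<omega>0\<close> and \<open>\<omega>1\<close> the operator is a
  Jordan block, so its exponential has coefficients \<open>\<alpha>\<close> and
  \<open>\<beta> = - \<i> k t \<alpha>\<close>. Their primitives \<open>A\<close> and
  \<open>B\<close> define \<open>W\<close>, which stays in this span and hence in the domain, and
  the mild equation reduces to two scalar identities.\<close>

lemma jordan_chain_solution:
  fixes c :: real
  assumes k: "k \<noteq> 0"
    and r0: "rayleigh b k \<omega>0 (\<lambda>y. of_real c * \<omega>0 y)" and r1: "rayleigh b k \<omega>1 (\<lambda>y. of_real c * \<omega>1 y + \<omega>0 y)"
  shows "rayleigh_solution b k \<omega>1
    (\<lambda>t y. exp (- \<i> * of_int k * of_real c * of_real t) * (\<omega>1 y - \<i> * of_int k * of_real t * \<omega>0 y))"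
proof -
  have L: "L2 \<omega>1" "L2 \<omega>0" using r0 r1 by (auto simp: rayleigh_def)
  define \<alpha> where "\<alpha> z = exp (- \<i> * of_int k * of_real c * z)" for z
  define \<beta> where "\<beta> z = - \<i> * of_int k * z * \<alpha> z" for z
  obtain A B :: "complex \<Rightarrow> complex" where AB: "A 0 = 0" "B 0 = 0"
    "\<forall>z. (A has_field_derivative \<alpha> z) (at z)" "\<forall>z. (B has_field_derivative \<beta> z) (at z)"
    "\<forall>z. \<alpha> z = 1 - \<i> * of_int k * of_real c * A z"
    "\<forall>z. \<beta> z = - \<i> * of_int k * (A z + of_real c * B z)"
    using propagator_coefficients[OF k, of c] unfolding \<alpha>_def \<beta>_def by blast
  define \<omega> where "\<omega> t y = \<alpha> (of_real t) * \<omega>1 y + \<beta> (of_real t) * \<omega>0 y" for t :: real and y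
  define W where "W t y = A (of_real t) * \<omega>1 y + B (of_real t) * \<omega>0 y" for t :: real and y
  have \<omega>eq: "(\<lambda>t y. exp (- \<i> * of_int k * of_real c * of_real t) * (\<omega>1 y - \<i> * of_int k * of_real t * \<omega>0 y)) = \<omega>"
    by (intro ext) (simp add: \<omega>_def \<alpha>_def \<beta>_def algebra_simps)
  have L\<omega>: "L2 (\<omega> t)" for t unfolding \<omega>_def by (intro L2_add L2_cmult L)
  have LW: "L2 (W t)" for t unfolding W_def by (intro L2_add L2_cmult L)
  have cont: "((\<lambda>s. f (of_real s) - f (of_real t)) \<longlongrightarrow> 0) (at t within {0..})" if "continuous_on UNIV f" for f :: "complex \<Rightarrow> complex" and t
  proof -
    have "continuous_on UNIV (\<lambda>s. f (complex_of_real s))"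
      by (rule continuous_on_compose2[OF that]) (auto intro!: continuous_intros)
    then have "((\<lambda>s. f (complex_of_real s)) \<longlongrightarrow> f (of_real t)) (at t within {0..})"
      by (auto simp: continuous_on_def intro: tendsto_within_subset)
    then show ?thesis by (simp add: LIM_zero_iff)
  qed
  have \<alpha>c: "continuous_on UNIV \<alpha>" unfolding \<alpha>_def by (intro continuous_intros)
  have \<beta>c: "continuous_on UNIV \<beta>" unfolding \<beta>_def by (intro continuous_intros \<alpha>c)
  have "L2_continuous \<omega>"
    unfolding L2_continuous_def
  proof (intro conjI allI impI L\<omega>)
    fix t :: real
    have "\<omega> s y - \<omega> t y = (\<alpha> (of_real s) - \<alpha> (of_real t)) * \<omega>1 y + (\<beta> (of_real s) - \<beta> (of_real t)) * \<omega>0 y" for s y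
      by (simp add: \<omega>_def algebra_simps)
    then show "((\<lambda>s. L2_norm (\<lambda>y. \<omega> s y - \<omega> t y)) \<longlongrightarrow> 0) (at t within {0..})"
      using lincomb_tendsto_0[OF L cont[OF \<alpha>c] cont[OF \<beta>c]] by simp
  qed
  moreover have "L2_has_time_derivative W \<omega>"
    unfolding L2_has_time_derivative_def
  proof (intro conjI allI impI L\<omega> LW)
    fix t :: real
    let ?p = "\<lambda>s. (A (of_real s) - A (of_real t)) / of_real (s - t) - \<alpha> (of_real t)"
    let ?q = "\<lambda>s. (B (of_real s) - B (of_real t)) / of_real (s - t) - \<beta> (of_real t)"
    have e: "(W s y - W t y) / of_real (s - t) - \<omega> t y = ?p s * \<omega>1 y + ?q s * \<omega>0 y" for s y
      unfolding W_def \<omega>_def by (simp add: diff_divide_distrib add_divide_distrib algebra_simps)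
    show "((\<lambda>s. L2_norm (\<lambda>y. (W s y - W t y) / of_real (s - t) - \<omega> t y)) \<longlongrightarrow> 0) (at t within {0..})"
      unfolding e using AB(3,4) by (intro lincomb_tendsto_0 L difference_quotient_of_real) auto
  qed
  moreover have "\<exists>\<eta>. rayleigh b k (W t) \<eta> \<and> (AE y in lborel. \<omega> t y = \<omega>1 y - \<i> * of_int k * \<eta> y)" for t :: real
  proof (intro exI conjI)
    show "rayleigh b k (W t) (\<lambda>y. A (of_real t) * (of_real c * \<omega>1 y + \<omega>0 y) + B (of_real t) * (of_real c * \<omega>0 y))"
      unfolding W_def by (rule rayleigh_lincomb[OF r1 r0])
    have "\<omega> t y = \<omega>1 y - \<i> * of_int k * (A (of_real t) * (of_real c * \<omega>1 y + \<omega>0 y) + B (of_real t) * (of_real c * \<omega>0 y))" for y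
      unfolding \<omega>_def AB(5)[rule_format, of "of_real t"] AB(6)[rule_format, of "of_real t"]
      by (simp add: algebra_simps)
    then show "AE y in lborel. \<omega> t y = \<omega>1 y - \<i> * of_int k * (A (of_real t) * (of_real c * \<omega>1 y + \<omega>0 y) + B (of_real t) * (of_real c * \<omega>0 y))"
      by simp
  qed
  moreover have "AE y in lborel. W 0 y = 0" by (simp add: W_def AB)
  ultimately show ?thesis unfolding rayleigh_solution_def \<omega>eq by blast
qed

lemma L2_has_time_derivative_diff:
  assumes "L2_has_time_derivative U u" "L2_has_time_derivative V v"
  shows "L2_has_time_derivative (\<lambda>s y. U s y - V s y) (\<lambda>s y. u s y - v s y)"
  unfolding L2_has_time_derivative_def
proof (intro conjI allI impI)
  have L: "L2 (U s)" "L2 (u s)" "L2 (V s)" "L2 (v s)" if "0 \<le> s" for s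
    using assms that by (auto simp: L2_has_time_derivative_def)
  fix t :: real assume t: "0 \<le> t"
  show "L2 (\<lambda>y. U t y - V t y)" "L2 (\<lambda>y. u t y - v t y)" by (intro L2_diff L t)+
  define P where "P s y = (U s y - U t y) / of_real (s - t) - u t y" for s y
  define Q where "Q s y = (V s y - V t y) / of_real (s - t) - v t y" for s y
  have lim: "((\<lambda>s. sqn (P s)) \<longlongrightarrow> 0) (at t within {0..})" "((\<lambda>s. sqn (Q s)) \<longlongrightarrow> 0) (at t within {0..})"
    using assms t unfolding L2_has_time_derivative_def L2_norm_tendsto_0_iff P_def Q_def by blast+
  have e: "(\<lambda>y. (U s y - V s y - (U t y - V t y)) / of_real (s - t) - (u t y - v t y)) = (\<lambda>y. P s y + (-1) * Q s y)" for s
    unfolding P_def Q_def by (simp add: diff_divide_distrib add_divide_distrib algebra_simps)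
  have LP: "L2 (P s)" if "0 \<le> s" for s
    using L2_diff[OF L2_cmult[OF L2_diff[OF L(1)[OF that] L(1)[OF t]], of "1 / of_real (s - t)"] L(2)[OF t]] by (simp add: P_def[abs_def])
  have LQ: "L2 (Q s)" if "0 \<le> s" for s
    using L2_diff[OF L2_cmult[OF L2_diff[OF L(3)[OF that] L(3)[OF t]], of "1 / of_real (s - t)"] L(4)[OF t]] by (simp add: Q_def[abs_def])
  show "((\<lambda>s. L2_norm (\<lambda>y. (U s y - V s y - (U t y - V t y)) / of_real (s - t) - (u t y - v t y))) \<longlongrightarrow> 0) (at t within {0..})"
    unfolding L2_norm_tendsto_0_iff e
  proof (rule Lim_null_comparison)
    show "eventually (\<lambda>s. norm (sqn (\<lambda>y. P s y + (-1) * Q s y)) \<le> 2 * sqn (P s) + 2 * sqn (Q s)) (at t within {0..})"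
      unfolding eventually_at_filter
    proof (intro always_eventually allI impI)
      fix s :: real assume "s \<in> {0..}"
      then have s: "0 \<le> s" by simp
      show "norm (sqn (\<lambda>y. P s y + (-1) * Q s y)) \<le> 2 * sqn (P s) + 2 * sqn (Q s)"
        using sqn_add_le[OF LP[OF s] L2_cmult[OF LQ[OF s], of "-1"]] sqn_cmult[of "-1" "Q s"]
        by (simp add: sqn_nonneg del: mult_minus1)
    qed
    have "((\<lambda>s. 2 * sqn (P s) + 2 * sqn (Q s)) \<longlongrightarrow> 2 * 0 + 2 * 0) (at t within {0..})" by (intro tendsto_intros lim)
    then show "((\<lambda>s. 2 * sqn (P s) + 2 * sqn (Q s)) \<longlongrightarrow> 0) (at t within {0..})" by simp
  qed
qed

lemma rayleigh_solution_unique: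
  assumes k: "k \<noteq> 0" and M: "\<And>y. \<bar>deriv (deriv b) y\<bar> \<le> M"
    and s1: "rayleigh_solution b k \<omega>in \<omega>" and s2: "rayleigh_solution b k \<omega>in \<omega>'" and t: "0 \<le> t"
  shows "AE y in lborel. \<omega> t y = \<omega>' t y"
proof -
  obtain W where W: "AE y in lborel. W 0 y = 0" "L2_has_time_derivative W \<omega>"
    "\<forall>t\<ge>0. \<exists>\<eta>. rayleigh b k (W t) \<eta> \<and> (AE y in lborel. \<omega> t y = \<omega>in y - \<i> * of_int k * \<eta> y)"
    using s1 unfolding rayleigh_solution_def by blast
  obtain V where V: "AE y in lborel. V 0 y = 0" "L2_has_time_derivative V \<omega>'"
    "\<forall>t\<ge>0. \<exists>\<eta>. rayleigh b k (V t) \<eta> \<and> (AE y in lborel. \<omega>' t y = \<omega>in y - \<i> * of_int k * \<eta> y)"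
    using s2 unfolding rayleigh_solution_def by blast
  have "AE y in lborel. \<omega> t y - \<omega>' t y = 0"
  proof (rule homogeneous_solution_zero[OF k _ L2_has_time_derivative_diff[OF W(2) V(2)] _ M t])
    show "AE y in lborel. W 0 y - V 0 y = 0" using W(1) V(1) by eventually_elim simp
    fix t :: real assume t: "0 \<le> t"
    obtain \<eta> where \<eta>: "rayleigh b k (W t) \<eta>" "AE y in lborel. \<omega> t y = \<omega>in y - \<i> * of_int k * \<eta> y"
      using W(3) t by blast
    obtain \<zeta> where \<zeta>: "rayleigh b k (V t) \<zeta>" "AE y in lborel. \<omega>' t y = \<omega>in y - \<i> * of_int k * \<zeta> y"
      using V(3) t by blast
    have "rayleigh b k (\<lambda>y. W t y - V t y) (\<lambda>y. \<eta> y - \<zeta> y)"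
      using rayleigh_lincomb[OF \<eta>(1) \<zeta>(1), of 1 "-1"] by simp
    moreover have "AE y in lborel. \<omega> t y - \<omega>' t y = - \<i> * of_int k * (\<eta> y - \<zeta> y)"
      using \<eta>(2) \<zeta>(2)
    proof eventually_elim
      case (elim y)
      show ?case unfolding elim by (simp add: algebra_simps)
    qed
    ultimately show "\<exists>\<eta>. rayleigh b k (\<lambda>y. W t y - V t y) \<eta> \<and> (AE y in lborel. \<omega> t y - \<omega>' t y = - \<i> * of_int k * \<eta> y)"
      by blast
  qed
  then show ?thesis by eventually_elim simp
qed

text \<open>As \<open>w0\<close> and \<open>w1\<close> are real, the imaginary part of the solution,
  up to the unimodular factor, is \<open>- k t w0\<close>. The modulus is at least its absolute
  value, and \<open>w1\<close> cannot cancel it.\<close>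

lemma linear_growth:
  fixes w0 w1 :: "real \<Rightarrow> real" and \<omega> :: "real \<Rightarrow> real \<Rightarrow> complex" and c :: real
  assumes k: "k \<noteq> 0" and L0: "L2 w0" and n0: "\<not> (AE y in lborel. w0 y = 0)"
    and L\<omega>: "\<And>t. 0 \<le> t \<Longrightarrow> L2 (\<omega> t)"
    and eq: "\<And>t. 0 \<le> t \<Longrightarrow> AE y in lborel. \<omega> t y = exp (- \<i> * of_int k * of_real c * of_real t) *
      (of_real (w1 y) - \<i> * of_int k * of_real t * of_real (w0 y))"
    and d: "\<not> (AE y in lborel. \<bar>w0 y\<bar> \<le> d)" "0 < d" and t: "0 \<le> t"
  shows "ereal (\<bar>of_int k\<bar> * d * t) \<le> Linf_norm (\<omega> t)" "\<bar>of_int k\<bar> * L2_norm (\<lambda>y. complex_of_real (w0 y)) * t \<le> L2_norm (\<omega> t)"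
proof -
  have lower: "AE y in lborel. \<bar>of_int k\<bar> * t * \<bar>w0 y\<bar> \<le> cmod (\<omega> t y)"
    using eq[OF t]
  proof eventually_elim
    case (elim y)
    have e1: "cmod (exp (- \<i> * of_int k * of_real c * of_real t)) = 1"
    proof -
      have "- \<i> * of_int k * of_real c * of_real t = \<i> * complex_of_real (- of_int k * c * t)" by simp
      then show ?thesis by (metis norm_exp_i_times)
    qed
    have "\<bar>Im (of_real (w1 y) - \<i> * of_int k * of_real t * of_real (w0 y))\<bar> \<le> cmod (\<omega> t y)"
      unfolding elim norm_mult e1 mult_1_left by (rule abs_Im_le_cmod)
    then show ?case using t by (simp add: abs_mult)
  qed
  have m: "(\<lambda>y. ereal (norm (\<omega> t y))) \<in> borel_measurable lborel"
    using L2_measurable[OF L\<omega>[OF t]] by simp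
  show "ereal (\<bar>of_int k\<bar> * d * t) \<le> Linf_norm (\<omega> t)"
  proof (rule ccontr)
    assume "\<not> ereal (\<bar>of_int k\<bar> * d * t) \<le> Linf_norm (\<omega> t)"
    then have l: "Linf_norm (\<omega> t) < ereal (\<bar>of_int k\<bar> * d * t)" by simp
    have "AE y in lborel. ereal (norm (\<omega> t y)) \<le> Linf_norm (\<omega> t)"
      unfolding Linf_norm_def by (rule esssup_AE)
    then have "AE y in lborel. \<bar>w0 y\<bar> \<le> d"
      using lower
    proof eventually_elim
      case (elim y)
      then have "ereal (norm (\<omega> t y)) < ereal (\<bar>of_int k\<bar> * d * t)" using l by (rule_tac le_less_trans)
      then have "(\<bar>of_int k\<bar> * t) * \<bar>w0 y\<bar> < (\<bar>of_int k\<bar> * t) * d" using elim(2) by (simp add: mult_ac)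
      then show ?case using mult_left_less_imp_less[of "\<bar>of_int k\<bar> * t" "\<bar>w0 y\<bar>" d] t by simp
    qed
    then show False using d by blast
  qed
  show "\<bar>of_int k\<bar> * L2_norm (\<lambda>y. complex_of_real (w0 y)) * t \<le> L2_norm (\<omega> t)"
  proof -
    have Lc: "L2 (\<lambda>y. complex_of_real (w0 y))" using L0 by (auto simp: L2_def)
    have "(\<bar>of_int k\<bar> * t)\<^sup>2 * sqn (\<lambda>y. complex_of_real (w0 y)) = (LBINT y. (\<bar>of_int k\<bar> * t)\<^sup>2 * (cmod (of_real (w0 y)))\<^sup>2)"
      by (simp add: sqn_def)
    also have "\<dots> \<le> sqn (\<omega> t)"
      unfolding sqn_def
    proof (rule integral_mono_AE)
      show "integrable lborel (\<lambda>y. (\<bar>of_int k\<bar> * t)\<^sup>2 * (cmod (of_real (w0 y)))\<^sup>2)"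
        using sqn_integrable[OF Lc] by simp
      show "integrable lborel (\<lambda>y. (cmod (\<omega> t y))\<^sup>2)" by (rule sqn_integrable[OF L\<omega>[OF t]])
      show "AE y in lborel. (\<bar>of_int k\<bar> * t)\<^sup>2 * (cmod (of_real (w0 y)))\<^sup>2 \<le> (cmod (\<omega> t y))\<^sup>2"
        using lower
      proof eventually_elim
        case (elim y)
        have "(\<bar>of_int k\<bar> * t * \<bar>w0 y\<bar>)\<^sup>2 \<le> (cmod (\<omega> t y))\<^sup>2" using elim t by (intro power_mono) auto
        then show ?case by (simp add: power_mult_distrib)
      qed
    qed
    finally have "sqrt ((\<bar>of_int k\<bar> * t)\<^sup>2 * sqn (\<lambda>y. complex_of_real (w0 y))) \<le> sqrt (sqn (\<omega> t))"
      by (rule real_sqrt_le_mono)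
    then show ?thesis using t by (simp add: L2_norm_sqn real_sqrt_mult mult_ac abs_mult)
  qed
qed

section \<open>Passage between real classical and complex weak solutions\<close>

lemma L2_of_real: "L2 f \<Longrightarrow> L2 (\<lambda>y. complex_of_real (f y))"
  by (auto simp: L2_def)

lemma C1_weak_deriv_of_real:
  fixes f g :: "real \<Rightarrow> real"
  assumes "\<And>y. (f has_real_derivative g y) (at y)" "continuous_on UNIV g" "L2 f" "L2 g"
  shows "L2_weak_deriv (\<lambda>y. complex_of_real (f y)) (\<lambda>y. complex_of_real (g y))"
proof (rule C1_weak_deriv)
  show "((\<lambda>y. complex_of_real (f y)) has_vector_derivative complex_of_real (g y)) (at y)" for y
    by (rule bounded_linear.has_vector_derivative[OF bounded_linear_of_real])
      (use assms(1) in \<open>simp add: has_real_derivative_iff_has_vector_derivative\<close>)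
  show "continuous_on UNIV (\<lambda>y. complex_of_real (g y))" by (intro continuous_intros assms)
qed (intro L2_of_real assms)+

lemma helmholtz_inverse_of_real:
  fixes f f1 f2 :: "real \<Rightarrow> real"
  assumes d: "\<And>y. (f has_real_derivative f1 y) (at y)" "\<And>y. (f1 has_real_derivative f2 y) (at y)"
    and c: "continuous_on UNIV f2" and L: "L2 f" "L2 f1" "L2 f2"
    and eq: "\<And>y. w y = f2 y - (of_int k)\<^sup>2 * f y"
  shows "helmholtz_inverse k (\<lambda>y. complex_of_real (w y)) (\<lambda>y. complex_of_real (f y))"
  unfolding helmholtz_inverse_iff
proof (intro exI conjI)
  have "continuous_on UNIV f1" by (intro continuous_at_imp_continuous_on ballI DERIV_isCont[OF d(2)])
  then show "L2_weak_deriv (\<lambda>y. complex_of_real (f y)) (\<lambda>y. complex_of_real (f1 y))"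
    by (rule C1_weak_deriv_of_real[OF d(1) _ L(1,2)])
  show "L2_weak_deriv (\<lambda>y. complex_of_real (f1 y)) (\<lambda>y. complex_of_real (f2 y))"
    by (rule C1_weak_deriv_of_real[OF d(2) c L(2,3)])
qed (simp add: eq)

text \<open>A continuous representative of \<open>f1\<close> makes \<open>f\<close> agree with a
  \<open>C\<^sup>1\<close> function; the equation then makes \<open>f2\<close> continuous up to a
  null set and gives \<open>f1\<close> a \<open>C\<^sup>1\<close> representative too. The two
  representatives of \<open>f1\<close> are continuous and therefore equal, so the system holds
  classically.\<close>

lemma weak_ode_representative:
  fixes f f1 f2 V :: "real \<Rightarrow> real"
  assumes w: "L2_weak_deriv f f1" "L2_weak_deriv f1 f2" and eq: "AE y in lborel. f2 y = V y * f y"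
    and V: "continuous_on UNIV V"
  shows "\<exists>F G. (\<forall>y. (F has_real_derivative G y) (at y)) \<and> (\<forall>y. (G has_real_derivative V y * F y) (at y)) \<and>
    (AE y in lborel. f y = F y) \<and> L2 F \<and> L2 G \<and> L2 (\<lambda>y. V y * F y)"
proof -
  note L = L2_weak_deriv_L2(1)[OF w(1)] L2_weak_deriv_L2[OF w(2)]
  obtain F1 where F1: "continuous_on UNIV F1" "AE y in lborel. f1 y = F1 y"
    using weak_deriv_primitive[OF w(2)] by blast
  obtain F where F: "\<forall>y. (F has_real_derivative F1 y) (at y)" "AE y in lborel. f y = F y"
    using weak_deriv_C1_representative[OF w(1) F1(2,1)] by blast
  have Fc: "continuous_on UNIV F" by (intro continuous_at_imp_continuous_on ballI DERIV_isCont[OF F(1)[rule_format]])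
  have VF: "continuous_on UNIV (\<lambda>y. V y * F y)" by (intro continuous_intros V Fc)
  have f2: "AE y in lborel. f2 y = V y * F y" using eq F(2) by eventually_elim simp
  obtain G where G: "\<forall>y. (G has_real_derivative V y * F y) (at y)" "AE y in lborel. f1 y = G y"
    using weak_deriv_C1_representative[OF w(2) f2 VF] by blast
  have Gc: "continuous_on UNIV G" by (intro continuous_at_imp_continuous_on ballI DERIV_isCont[OF G(1)[rule_format]])
  have "AE y in lborel. F1 y = G y" using F1(2) G(2) by eventually_elim simp
  then have "F1 = G" by (rule has_real_derivative_AE_continuous[OF F(1)[rule_format] _ Gc])
  moreover have "L2 F" "L2 G" "L2 (\<lambda>y. V y * F y)"
    using L2_cong_AE[OF L(1) F(2)] L2_cong_AE[OF L(2) G(2)] L2_cong_AE[OF L(3) f2] Fc Gc VF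
    by (simp_all add: borel_measurable_continuous_onI)
  ultimately show ?thesis using F G by blast
qed

text \<open>Composing \<open>J2 b\<close> with \<open>b\<close> removes the inverse function, so the
  chain rule carries the double zero over to \<open>b2 / b' ^ 3\<close>. Once
  \<open>b2 ys = 0\<close>, only the term with \<open>d\<close> survives in the quotient
  rule.\<close>

lemma flat_of_J2:
  assumes b: "\<And>y. (b has_real_derivative b' y) (at y)" "\<And>y. (b' has_real_derivative b2 y) (at y)"
    "(b2 has_real_derivative d) (at ys)" and inv: "\<And>y. inv b (b y) = y" and pos: "0 < b' ys"
    and J: "J2 b (b ys) = 0" "(J2 b has_real_derivative 0) (at (b ys))"
  shows "b2 ys = 0" "d = 0"
proof -
  have db: "deriv b = b'" "deriv b' = b2" using b by (auto intro!: DERIV_imp_deriv)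
  have J2: "J2 b (b y) = pi * b2 y / b' y ^ 3" for y by (simp add: J2_def inv db)
  show b20: "b2 ys = 0" using J(1) pos by (simp add: J2)
  have "((\<lambda>y. J2 b (b y)) has_real_derivative 0 * b' ys) (at ys)"
    by (rule DERIV_chain2[OF J(2) b(1)])
  moreover have "((\<lambda>y. pi * b2 y / b' y ^ 3) has_real_derivative pi * d / b' ys ^ 3) (at ys)"
  proof -
    have "((\<lambda>y. b' y ^ 3) has_real_derivative 3 * b' ys ^ 2 * b2 ys) (at ys)"
      by (auto intro!: derivative_eq_intros b)
    then have "((\<lambda>y. pi * b2 y / b' y ^ 3) has_real_derivative
        (pi * d * b' ys ^ 3 - pi * b2 ys * (3 * b' ys ^ 2 * b2 ys)) / (b' ys ^ 3 * b' ys ^ 3)) (at ys)"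
      using pos by (intro DERIV_divide DERIV_cmult b(3)) auto
    moreover have gen: "(pi * d * c - pi * 0 * e) / (c * c) = pi * d / c" if "c \<noteq> 0" for c e :: real
      using that by simp
    have "(pi * d * b' ys ^ 3 - pi * b2 ys * (3 * b' ys ^ 2 * b2 ys)) / (b' ys ^ 3 * b' ys ^ 3) = pi * d / b' ys ^ 3"
      unfolding b20 by (rule gen) (use pos in simp)
    ultimately show ?thesis by (simp only:)
  qed
  ultimately have "pi * d / b' ys ^ 3 = 0" unfolding J2 using DERIV_unique by fastforce
  then show "d = 0" using pos by simp
qed

section \<open>Construction of the growing solution\<close>

theorem theorem1p3:
  fixes b :: "real \<Rightarrow> real" and k :: int and cm cs :: real
  assumes k: "k \<noteq> 0"
    and cm: "0 < cm" "cm < 1"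
    and b_diff: "\<forall>y. b differentiable (at y)"
    and b_bounds: "\<forall>y. cm \<le> deriv b y \<and> deriv b y \<le> 1 / cm"
    and b'_diff: "\<forall>y. deriv b differentiable (at y)"
    and b''_H4: "Sobolev_H 4 (deriv (deriv b))"
    and single: "{c. rayleigh_eigenvalue b k c} = {complex_of_real cs}"
    and multiple: "multiple_embedded_eigenvalue b k cs"
  shows "\<exists>\<omega>in C. Linf \<omega>in \<and> L2 \<omega>in \<and> 0 < C \<and>
    (\<exists>\<omega>. rayleigh_solution b k \<omega>in \<omega>) \<and>
    (\<forall>\<omega>. rayleigh_solution b k \<omega>in \<omega> \<longrightarrow>
       (\<forall>t\<ge>0. ereal (C * t) \<le> Linf_norm (\<omega> t) \<and> C * t \<le> L2_norm (\<omega> t)))"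
proof -
  define b2 where "b2 = deriv (deriv b)"
  have bd: "(b has_real_derivative deriv b y) (at y)" for y
    using b_diff DERIV_deriv_iff_real_differentiable by blast
  have b'd: "(deriv b has_real_derivative b2 y) (at y)" for y
    unfolding b2_def using b'_diff DERIV_deriv_iff_real_differentiable by blast
  obtain b3 b4 b5 where b3: "\<And>y. (b2 has_real_derivative b3 y) (at y)" "\<And>y. (b3 has_real_derivative b4 y) (at y)"
    "\<And>y. (b4 has_real_derivative b5 y) (at y)" "continuous_on UNIV b5" "L2 b2" "L2 b3"
    using Sobolev_H4_regular[OF b'd b''_H4[folded b2_def]] by metis
  have b3c: "continuous_on UNIV b3" by (intro continuous_at_imp_continuous_on ballI DERIV_isCont[OF b3(2)])
  obtain K where K: "K > 0" "\<And>y. \<bar>b2 y\<bar> \<le> K" using L2_C1_bounded[OF b3(1) b3c b3(5,6)] by metis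
  interpret smooth_shear b "deriv b" cm b2 b3 K
    by unfold_locales (use cm bd b_bounds b'd b3 b3c K in auto)
  define ys where "ys = inv b cs"
  have bys: "b ys = cs" by (simp add: ys_def b_inv)
  have J: "J1 b k (b ys) = 0" "(J1 b k has_real_derivative 0) (at (b ys))"
    "J2 b (b ys) = 0" "(J2 b has_real_derivative 0) (at (b ys))" "rayleigh_eigenvalue b k (of_real (b ys))"
    using multiple by (simp_all add: multiple_embedded_eigenvalue_def bys)
  note flat = flat_of_J2[OF bd b'd b3(1) inv_b b'_pos J(3,4)]
  interpret flat_shear b "deriv b" cm b2 b3 K b4 b5 ys
    by unfold_locales (use b3 flat in auto)
  obtain R where R: "\<And>y. \<bar>quot y\<bar> \<le> R" using quot_bounded by blast
  define \<kappa> :: real where "\<kappa> = (of_int k)\<^sup>2"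
  have \<kappa>: "\<kappa> > 0" using k by (simp add: \<kappa>_def)
  \<comment> \<open>This is \<open>b'' / (b - b ys)\<close> continued across \<open>ys\<close>. It
    is both the correction to \<open>\<kappa>\<close> in the stream-function equation and the ratio
    of the eigenfunction to its stream function.\<close>
  define q where "q y = quot y * (b y - b ys)" for y
  define V where "V y = \<kappa> + q y" for y
  have Vc: "continuous_on UNIV V" unfolding V_def q_def
    by (intro continuous_intros quot_continuous b_continuous)
  have b2q: "b2 y = q y * (b y - b ys)" for y
    using quot_factor[of y] by (simp add: q_def power2_eq_square)

  obtain \<Omega> \<Psi> where \<Omega>: "L2 \<Omega>" "\<not> (AE y in lborel. \<Omega> y = 0)" "helmholtz_inverse k \<Omega> \<Psi>"
    "AE y in lborel. of_real (b ys) * \<Omega> y = of_real (b y) * \<Omega> y - of_real (b2 y) * \<Psi> y"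
    using J(5) by (auto simp: rayleigh_eigenvalue_def rayleigh_def b2_def)
  have \<Omega>q: "AE y in lborel. \<Omega> y = of_real (q y) * \<Psi> y"
    using \<Omega>(4) AE_lborel_singleton[of ys]
  proof eventually_elim
    case (elim y)
    have "of_real (b y - b ys) * \<Omega> y = of_real (b y - b ys) * (of_real (q y) * \<Psi> y)"
      using elim(1) by (simp add: b2q algebra_simps)
    then show ?case using b_diff_nonzero[OF elim(2)] by (simp del: of_real_diff)
  qed
  obtain \<Psi>1 \<Psi>2 where \<Psi>: "L2_weak_deriv \<Psi> \<Psi>1" "L2_weak_deriv \<Psi>1 \<Psi>2"
    "AE y in lborel. \<Psi>2 y - (of_int k)\<^sup>2 * \<Psi> y = \<Omega> y"
    using \<Omega>(3) unfolding helmholtz_inverse_iff by blast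
  have \<Psi>2: "AE y in lborel. \<Psi>2 y = of_real (V y) * \<Psi> y"
    using \<Psi>(3) \<Omega>q by eventually_elim (simp add: V_def \<kappa>_def algebra_simps)
  \<comment> \<open>The coefficients are real, so the real and imaginary parts of the stream
    function solve the same equation. Nontriviality is demanded of the vorticity \<open>q f\<close>,
    as this is the profile whose growth is measured.\<close>
  have "\<exists>f f1 f2 :: real \<Rightarrow> real. L2_weak_deriv f f1 \<and> L2_weak_deriv f1 f2 \<and> (AE y in lborel. f2 y = V y * f y) \<and>
    \<not> (AE y in lborel. q y * f y = 0)"
  proof (rule ccontr)
    assume no: "\<nexists>f f1 f2 :: real \<Rightarrow> real. L2_weak_deriv f f1 \<and> L2_weak_deriv f1 f2 \<and> (AE y in lborel. f2 y = V y * f y) \<and>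
      \<not> (AE y in lborel. q y * f y = 0)"
    have "AE y in lborel. Re (\<Psi>2 y) = V y * Re (\<Psi> y)" using \<Psi>2 by eventually_elim simp
    then have re: "AE y in lborel. q y * Re (\<Psi> y) = 0"
      using no weak_deriv_Re[OF \<Psi>(1)] weak_deriv_Re[OF \<Psi>(2)] by blast
    have "AE y in lborel. Im (\<Psi>2 y) = V y * Im (\<Psi> y)" using \<Psi>2 by eventually_elim simp
    then have im: "AE y in lborel. q y * Im (\<Psi> y) = 0"
      using no weak_deriv_Im[OF \<Psi>(1)] weak_deriv_Im[OF \<Psi>(2)] by blast
    have "AE y in lborel. \<Omega> y = 0" using \<Omega>q re im by eventually_elim (simp add: complex_eq_iff)
    then show False using \<Omega>(2) by blast
  qed
  then obtain f f1 f2 :: "real \<Rightarrow> real" where f: "L2_weak_deriv f f1" "L2_weak_deriv f1 f2"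
    "AE y in lborel. f2 y = V y * f y" "\<not> (AE y in lborel. q y * f y = 0)" by blast
  obtain F G where FG: "\<forall>y. (F has_real_derivative G y) (at y)" "\<forall>y. (G has_real_derivative V y * F y) (at y)"
    "AE y in lborel. f y = F y" "L2 F" "L2 G" "L2 (\<lambda>y. V y * F y)"
    using weak_ode_representative[OF f(1-3) Vc] by blast
  note F = FG(1)[rule_format] FG(2)[rule_format] FG(3-6)
  have Fc: "continuous_on UNIV F" by (intro continuous_at_imp_continuous_on ballI DERIV_isCont[OF F(1)])
  have Gc: "continuous_on UNIV G" by (intro continuous_at_imp_continuous_on ballI DERIV_isCont[OF F(2)])
  have VFc: "continuous_on UNIV (\<lambda>y. V y * F y)" by (intro continuous_intros Vc Fc)
  note lims = L2_C1_tendsto_0_at_top[OF F(1) Gc F(4,5)] L2_C1_tendsto_0_at_bot[OF F(1) Gc F(4,5)]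
    L2_C1_tendsto_0_at_top[OF F(2) VFc F(5,6)] L2_C1_tendsto_0_at_bot[OF F(2) VFc F(5,6)]
  \<comment> \<open>The factor \<open>\<sigma>\<close> is left free so that these facts serve twice:
    with the value 1 to exclude zeros, and with the sign of \<open>F\<close> to obtain a positive
    mode.\<close>
  have mode: "rayleigh_mode b (deriv b) cm b2 b3 K ys \<kappa> quot (\<lambda>y. \<sigma> * F y) (\<lambda>y. \<sigma> * G y) R" for \<sigma>
  proof unfold_locales
    show "((\<lambda>y. \<sigma> * F y) has_real_derivative \<sigma> * G y) (at y)" for y by (rule DERIV_cmult[OF F(1)])
    show "((\<lambda>y. \<sigma> * G y) has_real_derivative (\<kappa> + quot y * (b y - b ys)) * (\<sigma> * F y)) (at y)" for y
      using DERIV_cmult[OF F(2), of \<sigma> y] by (simp add: V_def q_def mult_ac)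
    show "L2 (\<lambda>y. \<sigma> * F y)"
      by (rule L2_bound[OF F(4), where C="\<bar>\<sigma>\<bar>"]) (use L2_measurable[OF F(4)] in \<open>auto simp: abs_mult\<close>)
    show "((\<lambda>y. \<sigma> * F y) \<longlongrightarrow> 0) at_top" "((\<lambda>y. \<sigma> * F y) \<longlongrightarrow> 0) at_bot"
      "((\<lambda>y. \<sigma> * G y) \<longlongrightarrow> 0) at_top" "((\<lambda>y. \<sigma> * G y) \<longlongrightarrow> 0) at_bot"
      using lims[THEN tendsto_mult_left, of \<sigma>] by simp_all
  qed (use \<kappa> quot_factor quot_continuous R in auto)
  have "\<exists>z. F z \<noteq> 0"
  proof (rule ccontr)
    assume "\<nexists>z. F z \<noteq> 0"
    then have "AE y in lborel. q y * f y = 0" using F(3) by (auto elim!: eventually_mono)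
    then show False using f(4) by blast
  qed
  then obtain z where "F z \<noteq> 0" ..
  then have F0: "F y \<noteq> 0" for y using rayleigh_mode.no_zeros[OF mode[of 1], of z y] by simp
  define \<sigma> where "\<sigma> = sgn (F 0)"
  have \<sigma>: "\<sigma> = 1 \<or> \<sigma> = -1" using F0[of 0] by (auto simp: \<sigma>_def sgn_if)
  have pos: "0 < \<sigma> * F y" for y
  proof (rule ccontr)
    assume "\<not> 0 < \<sigma> * F y"
    moreover have "0 < \<sigma> * F 0" using F0[of 0] by (simp add: \<sigma>_def sgn_if)
    ultimately have "\<exists>x. \<sigma> * F x = 0"
    proof (cases "0 \<le> y")
      case True
      then show ?thesis using IVT2'[of "\<lambda>x. \<sigma> * F x" y 0 0] \<open>\<not> 0 < \<sigma> * F y\<close> \<open>0 < \<sigma> * F 0\<close> Fc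
        by (force intro!: continuous_intros intro: continuous_on_subset)
    next
      case False
      then show ?thesis using IVT'[of "\<lambda>x. \<sigma> * F x" y 0 0] \<open>\<not> 0 < \<sigma> * F y\<close> \<open>0 < \<sigma> * F 0\<close> Fc
        by (force intro!: continuous_intros intro: continuous_on_subset)
    qed
    then show False using F0 \<sigma> by auto
  qed
  define g where "g y = \<sigma> * F y" for y
  define g' where "g' y = \<sigma> * G y" for y
  interpret positive_mode b "deriv b" cm b2 b3 K ys \<kappa> quot g g' R
    unfolding g_def g'_def by (intro positive_mode.intro mode positive_mode_axioms.intro pos)

  \<comment> \<open>This is the hypothesis \<open>lip\<close> of \<open>pv_bound\<close>. Inserting
    \<open>quot z * (g y)\<^sup>2\<close> reduces it to the Lipschitz bound for \<open>quot\<close>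
    and a derivative bound for \<open>g\<^sup>2\<close>.\<close>
  have "\<exists>L. \<forall>y z. \<bar>y - ys\<bar> \<le> 2 \<longrightarrow> \<bar>z - ys\<bar> \<le> 2 \<longrightarrow> \<bar>quot y * (g y)\<^sup>2 - quot z * (g z)\<^sup>2\<bar> \<le> L * \<bar>y - z\<bar>"
  proof -
    obtain A where A: "A \<ge> 0" "\<And>y z. \<bar>y - ys\<bar> \<le> 2 \<Longrightarrow> \<bar>z - ys\<bar> \<le> 2 \<Longrightarrow> \<bar>quot y - quot z\<bar> \<le> A * \<bar>y - z\<bar>"
      using quot_lipschitz by metis
    have "continuous_on UNIV (\<lambda>y. (g y)\<^sup>2)" by (intro continuous_intros \<psi>_continuous)
    then obtain P where P: "P > 0" "\<And>y. \<bar>y - ys\<bar> \<le> 2 \<Longrightarrow> \<bar>(g y)\<^sup>2\<bar> \<le> P"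
      using continuous_bounded_near by blast
    have "continuous_on UNIV (\<lambda>y. 2 * g y * g' y)" by (intro continuous_intros \<psi>_continuous \<psi>'_continuous)
    then obtain Q where Q: "Q > 0" "\<And>y. \<bar>y - ys\<bar> \<le> 2 \<Longrightarrow> \<bar>2 * g y * g' y\<bar> \<le> Q"
      using continuous_bounded_near by blast
    have sq: "\<bar>(g y)\<^sup>2 - (g z)\<^sup>2\<bar> \<le> Q * \<bar>y - z\<bar>" if "\<bar>y - ys\<bar> \<le> 2" "\<bar>z - ys\<bar> \<le> 2" for y z
    proof (rule lipschitz_of_deriv_bound)
      show "((\<lambda>y. (g y)\<^sup>2) has_real_derivative 2 * g x * g' x) (at x)" for x
        by (auto intro!: derivative_eq_intros \<psi>_deriv)
      fix x assume "x \<in> closed_segment z y"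
      then show "\<bar>2 * g x * g' x\<bar> \<le> Q"
        using that by (intro Q) (auto simp: closed_segment_eq_real_ivl split: if_splits)
    qed
    have "\<bar>quot y * (g y)\<^sup>2 - quot z * (g z)\<^sup>2\<bar> \<le> (A * P + R * Q) * \<bar>y - z\<bar>"
      if yz: "\<bar>y - ys\<bar> \<le> 2" "\<bar>z - ys\<bar> \<le> 2" for y z
    proof -
      have e: "quot y * (g y)\<^sup>2 - quot z * (g z)\<^sup>2 = (quot y - quot z) * (g y)\<^sup>2 + quot z * ((g y)\<^sup>2 - (g z)\<^sup>2)"
        by (simp add: algebra_simps)
      have "\<bar>quot y * (g y)\<^sup>2 - quot z * (g z)\<^sup>2\<bar>
          \<le> \<bar>quot y - quot z\<bar> * \<bar>(g y)\<^sup>2\<bar> + \<bar>quot z\<bar> * \<bar>(g y)\<^sup>2 - (g z)\<^sup>2\<bar>"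
        unfolding e abs_mult[symmetric] by (rule abs_triangle_ineq)
      also have "\<dots> \<le> (A * \<bar>y - z\<bar>) * P + R * (Q * \<bar>y - z\<bar>)"
        by (intro add_mono mult_mono A(2)[OF yz] P(2)[OF yz(1)] R sq[OF yz] mult_nonneg_nonneg A(1) R_nonneg abs_ge_zero)
      finally show ?thesis by (simp add: algebra_simps)
    qed
    then show ?thesis by blast
  qed
  then obtain L where L: "\<And>y z. \<bar>y - ys\<bar> \<le> 2 \<Longrightarrow> \<bar>z - ys\<bar> \<le> 2 \<Longrightarrow> \<bar>quot y * (g y)\<^sup>2 - quot z * (g z)\<^sup>2\<bar> \<le> L * \<bar>y - z\<bar>"
    by blast
  have H: "(LBINT y. quot y * (g y)\<^sup>2) = 0"
    by (rule solvability_condition[OF \<kappa>_def J(1,2) L])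
  obtain \<psi>1 \<psi>1' where *: "\<forall>y. (\<psi>1 has_real_derivative \<psi>1' y) (at y)"
    "\<forall>y. (\<psi>1' has_real_derivative V y * \<psi>1 y + quot y * g y) (at y)"
    "rapid \<psi>1" "rapid \<psi>1'" "rapid (\<lambda>y. V y * \<psi>1 y)" "rapid g"
    using corrector_exists[OF H] unfolding V_def q_def by blast
  note \<psi>1 = *(1)[rule_format] *(2)[rule_format] *(3-6)
  define w0 where "w0 y = q y * g y" for y
  \<comment> \<open>This is \<open>\<psi>1'' - \<kappa> \<psi>1\<close>, the vorticity of the
    corrector. Its product with \<open>b - b ys\<close> exceeds \<open>b'' \<psi>1\<close> by
    \<open>q g = w0\<close>, which is the Jordan chain relation.\<close>
  define w1 where "w1 y = q y * \<psi>1 y + quot y * g y" for y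
  have rg: "rapid (\<lambda>y. quot y * g y)" by (rule rapid_mult_bounded[OF \<psi>1(6) quot_continuous R])
  have V\<psi>: "rapid (\<lambda>y. V y * \<psi>1 y + quot y * g y)" by (rule rapid_add[OF \<psi>1(5) rg])
  have w1: "rapid w1"
  proof -
    \<comment> \<open>The decay of \<open>w1\<close> is read off from that of
      \<open>V \<psi>1\<close> and \<open>\<psi>1\<close>, which the corrector provides, through
      \<open>q = V - \<kappa>\<close>.\<close>
    have "rapid (\<lambda>y. (V y * \<psi>1 y + quot y * g y) + (- \<kappa>) * \<psi>1 y)"
      by (intro rapid_add V\<psi> rapid_mult_bounded[OF \<psi>1(3), of "\<lambda>_. - \<kappa>" \<kappa>]) (use \<kappa> in auto)
    then show ?thesis by (simp add: w1_def[abs_def] V_def algebra_simps)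
  qed
  have Vg: "L2 (\<lambda>y. V y * g y)"
    by (rule L2_bound[OF F(6), where C=1]) (use \<sigma> L2_measurable[OF F(6)] in \<open>auto simp: g_def[abs_def] abs_mult mult_ac\<close>)
  have g'L: "L2 g'"
    by (rule L2_bound[OF F(5), where C=1]) (use \<sigma> L2_measurable[OF F(5)] in \<open>auto simp: g'_def[abs_def] abs_mult\<close>)
  have w0L: "L2 w0"
  proof -
    have "L2 (\<lambda>y. - \<kappa> * g y)"
      by (rule L2_bound[OF \<psi>_L2, where C=\<kappa>]) (use \<kappa> in \<open>auto simp: abs_mult\<close>)
    from L2_add[OF Vg this] show ?thesis by (simp add: w0_def[abs_def] V_def algebra_simps)
  qed
  let ?w0 = "\<lambda>y. complex_of_real (w0 y)" and ?w1 = "\<lambda>y. complex_of_real (w1 y)"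
  have h0: "helmholtz_inverse k ?w0 (\<lambda>y. complex_of_real (g y))"
  proof -
    have d: "(g' has_real_derivative V y * g y) (at y)" for y using \<psi>'_deriv[of y] by (simp add: V_def q_def)
    have c: "continuous_on UNIV (\<lambda>y. V y * g y)" by (intro continuous_intros Vc \<psi>_continuous)
    have e: "w0 y = V y * g y - (of_int k)\<^sup>2 * g y" for y by (simp add: w0_def V_def \<kappa>_def algebra_simps)
    show ?thesis by (rule helmholtz_inverse_of_real[OF \<psi>_deriv d c \<psi>_L2 g'L Vg e])
  qed
  have h1: "helmholtz_inverse k ?w1 (\<lambda>y. complex_of_real (\<psi>1 y))"
    by (rule helmholtz_inverse_of_real[OF \<psi>1(1,2)])
      (use V\<psi> rapid_L2[OF \<psi>1(3)] rapid_L2[OF \<psi>1(4)] rapid_L2[OF V\<psi>] in \<open>auto simp: rapid_def w1_def V_def \<kappa>_def algebra_simps\<close>)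
  have r0: "rayleigh b k ?w0 (\<lambda>y. of_real cs * ?w0 y)"
    unfolding rayleigh_def
  proof (intro conjI exI[of _ "\<lambda>y. complex_of_real (g y)"] h0)
    have e: "cs * w0 y = b y * w0 y - b2 y * g y" for y
      unfolding b2q w0_def bys by (simp add: algebra_simps)
    have "of_real cs * ?w0 y = of_real (b y) * ?w0 y - of_real (b2 y) * of_real (g y)" for y
      using arg_cong[OF e[of y], of complex_of_real] by (simp only: of_real_diff of_real_mult)
    then show "AE y in lborel. of_real cs * ?w0 y = of_real (b y) * ?w0 y - of_real (deriv (deriv b) y) * of_real (g y)"
      by (simp add: b2_def)
  qed (intro L2_cmult L2_of_real w0L)+
  have r1: "rayleigh b k ?w1 (\<lambda>y. of_real cs * ?w1 y + ?w0 y)"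
    unfolding rayleigh_def
  proof (intro conjI exI[of _ "\<lambda>y. complex_of_real (\<psi>1 y)"] h1)
    have gen: "c * (Q * X + u * G) + Q * G = x * (Q * X + u * G) - Q * (x - c) * X"
      if "Q = u * (x - c)" for c Q X u G x :: real
      unfolding that by (simp only: algebra_simps)
    have e: "cs * w1 y + w0 y = b y * w1 y - b2 y * \<psi>1 y" for y
    proof -
      have "q y = quot y * (b y - cs)" by (simp only: q_def bys)
      from gen[OF this, of "\<psi>1 y" "g y"] show ?thesis
        unfolding w0_def w1_def using b2q[of y] bys by metis
    qed
    have "of_real cs * ?w1 y + ?w0 y = of_real (b y) * ?w1 y - of_real (b2 y) * of_real (\<psi>1 y)" for y
      using arg_cong[OF e[of y], of complex_of_real] by (simp only: of_real_diff of_real_mult of_real_add)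
    then show "AE y in lborel. of_real cs * ?w1 y + ?w0 y = of_real (b y) * ?w1 y - of_real (deriv (deriv b) y) * of_real (\<psi>1 y)"
      by (simp add: b2_def)
  qed (intro L2_add L2_cmult L2_of_real w0L rapid_L2[OF w1])+
  note sol = jordan_chain_solution[OF k r0 r1]

  have n0: "\<not> (AE y in lborel. w0 y = 0)"
  proof
    assume "AE y in lborel. w0 y = 0"
    then have "AE y in lborel. q y * f y = 0"
      using F(3) by eventually_elim (use \<sigma> in \<open>auto simp: w0_def g_def\<close>)
    then show False using f(4) by blast
  qed
  \<comment> \<open>A positive level exceeded by \<open>|w0|\<close> on a set of positive measure
    supplies the constant for the essential supremum. Were there none, all levels
    \<open>1 / (n + 1)\<close> would bound \<open>|w0|\<close> and it would vanish almost
    everywhere.\<close>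
  have "\<exists>d>0. \<not> (AE y in lborel. \<bar>w0 y\<bar> \<le> d)"
  proof (rule ccontr)
    assume "\<not> (\<exists>d>0. \<not> (AE y in lborel. \<bar>w0 y\<bar> \<le> d))"
    then have "AE y in lborel. \<bar>w0 y\<bar> \<le> inverse (real (Suc n))" for n by auto
    then have "AE y in lborel. \<forall>n. \<bar>w0 y\<bar> \<le> inverse (real (Suc n))" unfolding AE_all_countable by blast
    then have "AE y in lborel. w0 y = 0"
    proof eventually_elim
      case (elim y)
      have "\<bar>w0 y\<bar> \<le> 0" by (rule LIMSEQ_le_const[OF LIMSEQ_inverse_real_of_nat]) (use elim in auto)
      then show ?case by simp
    qed
    then show False using n0 by blast
  qed
  then obtain d where d: "0 < d" "\<not> (AE y in lborel. \<bar>w0 y\<bar> \<le> d)" by blast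
  define C where "C = min (\<bar>of_int k\<bar> * d) (\<bar>of_int k\<bar> * L2_norm ?w0)"
  have "0 < L2_norm ?w0"
  proof -
    have "sqn ?w0 \<noteq> 0" using sqn_0_iff[OF L2_of_real[OF w0L]] n0 by simp
    then show ?thesis using sqn_nonneg[of ?w0] by (simp add: L2_norm_sqn)
  qed
  then have C: "0 < C" using k d by (simp add: C_def)
  have Linf: "Linf ?w1"
  proof -
    obtain E where E: "\<And>y. \<bar>w1 y\<bar> \<le> E" using rapidE[OF w1] by metis
    have m: "w1 \<in> borel_measurable borel" using w1 by (simp add: rapid_def borel_measurable_continuous_onI)
    have "Linf_norm ?w1 \<le> ereal E" unfolding Linf_norm_def
      by (rule esssup_I) (use E m in auto)
    then have "Linf_norm ?w1 < \<infinity>" by (rule le_less_trans) simp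
    then show ?thesis using m by (simp add: Linf_def)
  qed
  have "ereal (C * t) \<le> Linf_norm (\<omega> t) \<and> C * t \<le> L2_norm (\<omega> t)"
    if s: "rayleigh_solution b k ?w1 \<omega>" and t: "0 \<le> t" for \<omega> t
  proof -
    have L\<omega>: "L2 (\<omega> t)" if "0 \<le> t" for t
      using s that by (auto simp: rayleigh_solution_def L2_continuous_def)
    \<comment> \<open>Uniqueness transfers the explicit formula to an arbitrary mild solution with
      the same data.\<close>
    have u: "AE y in lborel. \<omega> t y = exp (- \<i> * of_int k * of_real cs * of_real t) * (?w1 y - \<i> * of_int k * of_real t * ?w0 y)"
      if "0 \<le> t" for t
      using rayleigh_solution_unique[OF k _ s sol that] K(2) unfolding b2_def by blast
    note lg = linear_growth[OF k w0L n0 L\<omega> u d(2,1) t]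
    have "C * t \<le> \<bar>of_int k\<bar> * d * t" "C * t \<le> \<bar>of_int k\<bar> * L2_norm ?w0 * t"
      using t by (auto simp: C_def intro!: mult_right_mono)
    then show ?thesis using lg by (meson ereal_less_eq(3) order_trans)
  qed
  then show ?thesis using Linf C sol L2_of_real[OF rapid_L2[OF w1]] by blast
qed

end
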